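(* Let $k$ be a field of characteristic zero, $n=5$, $k[X]=k[x_0,\ldots,x_5]$, and let $d$ be the Weitzenböck derivation with kernel $k[X]^d$. Put $t=x_0$ and $d_1=\tau_2(t)$, $d_2=\tau_4(t)$, $tr_1=\tau_4(d_1)$, $tr_2=\tau_3(d_1)$, $tr_3=\tau_1(d_1)$, $c_1=\tau_5(tr_2)$, $c_2=\tau_5(tr_3)$, $c_3=\tau_4(tr_3)$, $p_1=\tau_4(d_2^2)$, $p_2=\tau_3(d_2^2)$, $p_3=\tau_2(c_3)$, $s_1=\tau_4(d_2\,tr_1)$, $s_2=\tau_1(p_1)$, $si_1=\tau_5(d_2^3)$, $si_2=\tau_1(s_1)$, $v_1=\tau_5(d_2\,p_2)$, $v_2=\tau_5(d_2^2\,tr_1)$, $dev=\tau_2(v_2)$, $od=\tau_5(s_1\,d_2^2)$, $dv=\tau_5(d_2^2\,si_1)$, $trn=\tau_5(v_2\,d_2^2)$, $vis=\tau_5(p_1\,p_2\,si_1)$. Then these 23 polynomials $t,d_1,d_2,tr_1,tr_2,tr_3,c_1,c_2,c_3,p_1,p_2,p_3,s_1,s_2,si_1,si_2,v_1,v_2,dev,od,dv,trn,vis$ form a minimal generating set of the $k$-algebra $k[X]^d$.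
   Context: The Weitzenböck derivation $d$ of $k[x_0,\ldots,x_n]$ is the $k$-linear derivation with $d(x_0)=0$, $d(x_i)=x_{i-1}$ for $1\le i\le n$; here $n=5$. $\hat d$ is the $k$-linear derivation with $\hat d(x_i)=(i+1)(n-i)x_{i+1}$ for $0\le i<n$, $\hat d(x_n)=0$. The weight of a monomial $x_0^{\alpha_0}\cdots x_n^{\alpha_n}$ is $n\sum_i\alpha_i-2(\alpha_1+2\alpha_2+\cdots+n\alpha_n)$; a nonzero homogeneous polynomial is isobaric if all its monomials have equal weight, and this common value is its weight $\omega(z)$. The order $\mathrm{ord}(z)$ of a nonzero $z$ is the natural number $s\ge0$ with $\hat d^{\,s}(z)\ne0$, $\hat d^{\,s+1}(z)=0$. For a nonzero homogeneous isobaric $z\in k[X]^d$ and $0\le i\le\min(\mathrm{ord}(z),n)$, $$\tau_i(z)=\sum_{j=0}^{i}(-1)^{j}x_{i-j}\,\frac{(\omega(z)-j)!}{j!\,\omega(z)!}\,\hat d^{\,j}(z)\in k[X]^d.$$ The multi-letter symbols ($tr_i$, $si_i$, $dev$, $od$, $dv$, $trn$, $vis$) are names of single polynomials. *)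

theory Defs
  imports Complex_Main "HOL-Library.Poly_Mapping"
begin

text \<open>
  Polynomials over \<open>'k\<close> in the variables \<open>x\<^sub>0, x\<^sub>1, x\<^sub>2, \<dots>\<close>: an element of \<open>nat \<Rightarrow>\<^sub>0 nat\<close> is a
  monomial (variable index to exponent), and the ring structure is the convolution product of
  \<^theory>\<open>HOL-Library.Poly_Mapping\<close>. The ring \<open>k[x\<^sub>0, \<dots>, x\<^sub>n]\<close> is the subset \<open>polys_upto n\<close>.
\<close>

type_synonym 'k mpoly = "(nat \<Rightarrow>\<^sub>0 nat) \<Rightarrow>\<^sub>0 'k"

definition Const :: "'k::comm_ring_1 \<Rightarrow> 'k mpoly"
  where "Const c = Poly_Mapping.single 0 c"

definition Var :: "nat \<Rightarrow> 'k::comm_ring_1 mpoly"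
  where "Var i = Poly_Mapping.single (Poly_Mapping.single i 1) 1"

definition polys_upto :: "nat \<Rightarrow> 'k::comm_ring_1 mpoly set"
  where "polys_upto n = {p. \<forall>m \<in> Poly_Mapping.keys p. Poly_Mapping.keys m \<subseteq> {..n}}"


subsection \<open>Derivations\<close>

text \<open>
  \<open>derivation_from f\<close> is the \<open>k\<close>-linear derivation \<open>\<Sum>\<^sub>i f\<^sub>i \<partial>/\<partial>x\<^sub>i\<close>, i.e. the one sending
  \<open>x\<^sub>i\<close> to \<open>f i\<close>; see \<open>is_derivation_derivation_from\<close>, \<open>derivation_from_Var\<close> and
  \<open>derivation_unique\<close> below.
\<close>

definition derivation_from :: "(nat \<Rightarrow> 'k mpoly) \<Rightarrow> 'k mpoly \<Rightarrow> 'k::comm_ring_1 mpoly"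
  where "derivation_from f p =
    (\<Sum>m \<in> Poly_Mapping.keys p. \<Sum>i \<in> Poly_Mapping.keys m.
       Poly_Mapping.single (m - Poly_Mapping.single i 1)
         (Poly_Mapping.lookup p m * of_nat (Poly_Mapping.lookup m i)) * f i)"

definition is_derivation :: "('k::comm_ring_1 mpoly \<Rightarrow> 'k mpoly) \<Rightarrow> bool"
  where "is_derivation D \<longleftrightarrow>
    (\<forall>p q. D (p + q) = D p + D q) \<and>
    (\<forall>c p. D (Const c * p) = Const c * D p) \<and>
    (\<forall>p q. D (p * q) = D p * q + p * D q)"

text \<open>The Weitzenboeck derivation \<open>d\<close>.\<close>

definition weitzenboeck :: "'k::comm_ring_1 mpoly \<Rightarrow> 'k mpoly"
  where "weitzenboeck = derivation_from (\<lambda>i. if i = 0 then 0 else Var (i - 1))"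

text \<open>The derivation \<open>d\<close> with a hat; the coefficient is \<open>0\<close> at \<open>i = n\<close>.\<close>

definition dhat :: "nat \<Rightarrow> 'k::comm_ring_1 mpoly \<Rightarrow> 'k mpoly"
  where "dhat n = derivation_from (\<lambda>i. of_nat ((i + 1) * (n - i)) * Var (i + 1))"

definition weitzenboeck_kernel :: "nat \<Rightarrow> 'k::comm_ring_1 mpoly set"
  where "weitzenboeck_kernel n = {p \<in> polys_upto n. weitzenboeck p = 0}"


subsection \<open>Weights and the maps \<open>\<tau>\<^sub>i\<close>\<close>

definition monomial_weight :: "nat \<Rightarrow> (nat \<Rightarrow>\<^sub>0 nat) \<Rightarrow> int"
  where "monomial_weight n m =
    int n * (\<Sum>i\<le>n. int (Poly_Mapping.lookup m i))
      - 2 * (\<Sum>i\<le>n. int i * int (Poly_Mapping.lookup m i))"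

text \<open>Only meaningful for nonzero isobaric \<open>z\<close>, i.e. if all monomials of \<open>z\<close> have equal weight.\<close>

definition weight :: "nat \<Rightarrow> 'k::comm_ring_1 mpoly \<Rightarrow> int"
  where "weight n z = (THE w. \<forall>m \<in> Poly_Mapping.keys z. monomial_weight n m = w)"

text \<open>
  \<open>tau n i z\<close> is \<open>\<tau>\<^sub>i(z)\<close>. The formula is meant for nonzero homogeneous isobaric \<open>z\<close> in the kernel
  of \<open>d\<close> on \<open>k[x\<^sub>0, \<dots>, x\<^sub>n]\<close> and \<open>i \<le> min (ord z) n\<close>. For such \<open>z\<close> the weight
  equals the order of \<open>z\<close>, so \<open>j \<le> i\<close> gives \<open>0 \<le> weight n z - j\<close> and the
  conversion \<open>nat\<close> does not truncate.
\<close>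

definition tau :: "nat \<Rightarrow> nat \<Rightarrow> 'k::field_char_0 mpoly \<Rightarrow> 'k mpoly"
  where "tau n i z =
    (\<Sum>j = 0..i. (- 1) ^ j * Var (i - j) *
       Const (fact (nat (weight n z - int j)) / (fact j * fact (nat (weight n z)))) *
       (dhat n ^^ j) z)"


subsection \<open>Generating sets of subalgebras\<close>

definition is_subalgebra :: "'k::comm_ring_1 mpoly set \<Rightarrow> bool"
  where "is_subalgebra A \<longleftrightarrow>
    (\<forall>c. Const c \<in> A) \<and> (\<forall>p\<in>A. \<forall>q\<in>A. p + q \<in> A) \<and> (\<forall>p\<in>A. \<forall>q\<in>A. p * q \<in> A)"

definition minimal_generating_set :: "'k::comm_ring_1 mpoly set \<Rightarrow> 'k mpoly set \<Rightarrow> bool"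
  where "minimal_generating_set S A \<longleftrightarrow>
    is_subalgebra hull S = A \<and> (\<forall>T. T \<subset> S \<longrightarrow> is_subalgebra hull T \<noteq> A)"


subsection \<open>The derivations are the intended ones\<close>

lemma derivation_from_superset:
  assumes "finite M" "Poly_Mapping.keys p \<subseteq> M"
  shows "derivation_from f p =
    (\<Sum>m \<in> M. \<Sum>i \<in> Poly_Mapping.keys m.
       Poly_Mapping.single (m - Poly_Mapping.single i 1)
         (Poly_Mapping.lookup p m * of_nat (Poly_Mapping.lookup m i)) * f i)"
  unfolding derivation_from_def
  by (rule sum.mono_neutral_left) (use assms in \<open>auto simp: in_keys_iff\<close>)

lemma derivation_from_add: "derivation_from f (p + q) = derivation_from f p + derivation_from f q"
proof -
  let ?M = "Poly_Mapping.keys p \<union> Poly_Mapping.keys q"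
  have "Poly_Mapping.keys (p + q) \<subseteq> ?M" by (rule keys_add)
  then show ?thesis
    by (subst (1 2 3) derivation_from_superset[of ?M])
      (auto simp: lookup_add distrib_right single_add sum.distrib)
qed

lemma derivation_from_zero [simp]: "derivation_from f 0 = 0"
  by (simp add: derivation_from_def)

lemma derivation_from_sum:
  "derivation_from f (\<Sum>a\<in>A. g a) = (\<Sum>a\<in>A. derivation_from f (g a))"
  by (induction A rule: infinite_finite_induct) (auto simp: derivation_from_add)

lemma derivation_from_single:
  assumes "finite I" "Poly_Mapping.keys m \<subseteq> I"
  shows "derivation_from f (Poly_Mapping.single m c) =
    (\<Sum>i \<in> I. Poly_Mapping.single (m - Poly_Mapping.single i 1)
         (c * of_nat (Poly_Mapping.lookup m i)) * f i)"
proof -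
  have "derivation_from f (Poly_Mapping.single m c) =
    (\<Sum>i \<in> Poly_Mapping.keys m. Poly_Mapping.single (m - Poly_Mapping.single i 1)
         (c * of_nat (Poly_Mapping.lookup m i)) * f i)"
    by (subst derivation_from_superset[of "{m}"]) auto
  also have "\<dots> = (\<Sum>i \<in> I. Poly_Mapping.single (m - Poly_Mapping.single i 1)
         (c * of_nat (Poly_Mapping.lookup m i)) * f i)"
    by (rule sum.mono_neutral_left) (use assms in \<open>auto simp: in_keys_iff\<close>)
  finally show ?thesis .
qed

lemma poly_mapping_sum_single:
  fixes p :: "'a \<Rightarrow>\<^sub>0 'b::comm_monoid_add"
  shows "p = (\<Sum>m \<in> Poly_Mapping.keys p. Poly_Mapping.single m (Poly_Mapping.lookup p m))"
proof (rule poly_mapping_eqI)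
  fix k
  have "(\<Sum>m \<in> Poly_Mapping.keys p. Poly_Mapping.lookup (Poly_Mapping.single m (Poly_Mapping.lookup p m)) k)
      = (\<Sum>m \<in> Poly_Mapping.keys p. if m = k then Poly_Mapping.lookup p m else 0)"
    by (rule sum.cong) (auto simp: lookup_single when_def)
  also have "\<dots> = Poly_Mapping.lookup p k"
    by (simp add: in_keys_iff)
  finally show "Poly_Mapping.lookup p k = Poly_Mapping.lookup
      (\<Sum>m \<in> Poly_Mapping.keys p. Poly_Mapping.single m (Poly_Mapping.lookup p m)) k"
    by (simp add: Poly_Mapping.lookup_sum)
qed

lemma monomial_diff_add:
  fixes m l :: "nat \<Rightarrow>\<^sub>0 nat"
  assumes "Poly_Mapping.lookup m i \<noteq> 0"
  shows "m + l - Poly_Mapping.single i 1 = (m - Poly_Mapping.single i 1) + l"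
  by (rule poly_mapping_eqI)
    (use assms in \<open>auto simp: lookup_add lookup_minus lookup_single when_def\<close>)

lemma derivation_from_mult_single:
  "derivation_from f (Poly_Mapping.single m a * Poly_Mapping.single l b) =
     derivation_from f (Poly_Mapping.single m a) * Poly_Mapping.single l b +
     Poly_Mapping.single m a * derivation_from f (Poly_Mapping.single l b)"
proof -
  let ?I = "Poly_Mapping.keys m \<union> Poly_Mapping.keys l"
  let ?D = "\<lambda>m i. Poly_Mapping.single (m - Poly_Mapping.single i (1::nat))"
  let ?e = "\<lambda>m i. of_nat (Poly_Mapping.lookup m i)"
  have k: "Poly_Mapping.keys (m + l) \<subseteq> ?I" by (rule keys_add)
  have 1: "?D (m + l) i (a * b * ?e m i) = ?D m i (a * ?e m i) * Poly_Mapping.single l b" for i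
    by (cases "Poly_Mapping.lookup m i = 0") (simp_all add: monomial_diff_add[of m i l, unfolded One_nat_def] mult_single mult_ac add.commute[of l])
  have 2: "?D (m + l) i (a * b * ?e l i) = Poly_Mapping.single m a * ?D l i (b * ?e l i)" for i
    by (cases "Poly_Mapping.lookup l i = 0")
      (simp_all add: monomial_diff_add[of l i m, unfolded One_nat_def] mult_single mult_ac add.commute[of m])
  have "derivation_from f (Poly_Mapping.single m a * Poly_Mapping.single l b) =
      (\<Sum>i\<in>?I. ?D (m + l) i (a * b * ?e (m + l) i) * f i)"
    by (simp only: mult_single) (rule derivation_from_single; use k in auto)
  also have "\<dots> = (\<Sum>i\<in>?I. (?D m i (a * ?e m i) * f i) * Poly_Mapping.single l b
      + Poly_Mapping.single m a * (?D l i (b * ?e l i) * f i))"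
  proof (rule sum.cong)
    fix i
    have "?D (m + l) i (a * b * ?e (m + l) i)
        = ?D (m + l) i (a * b * ?e m i) + ?D (m + l) i (a * b * ?e l i)"
      by (simp add: lookup_add distrib_left single_add)
    then show "?D (m + l) i (a * b * ?e (m + l) i) * f i =
        (?D m i (a * ?e m i) * f i) * Poly_Mapping.single l b
          + Poly_Mapping.single m a * (?D l i (b * ?e l i) * f i)"
      by (simp only: 1 2) (simp only: algebra_simps)
  qed simp
  also have "\<dots> = derivation_from f (Poly_Mapping.single m a) * Poly_Mapping.single l b +
     Poly_Mapping.single m a * derivation_from f (Poly_Mapping.single l b)"
    by (simp add: derivation_from_single[of ?I] sum.distrib sum_distrib_left sum_distrib_right)
  finally show ?thesis .
qed

lemma derivation_from_mult:
  "derivation_from f (p * q) = derivation_from f p * q + p * derivation_from f q"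
proof -
  let ?s = "\<lambda>p m. Poly_Mapping.single m (Poly_Mapping.lookup p m)"
  define A B where "A = Poly_Mapping.keys p" and "B = Poly_Mapping.keys q"
  have p: "p = (\<Sum>m\<in>A. ?s p m)" and q: "q = (\<Sum>l\<in>B. ?s q l)"
    unfolding A_def B_def by (rule poly_mapping_sum_single)+
  have "derivation_from f (p * q) =
      derivation_from f (\<Sum>m\<in>A. \<Sum>l\<in>B. ?s p m * ?s q l)"
    by (subst p, subst q) (simp only: sum_product)
  also have "\<dots> = (\<Sum>m\<in>A. \<Sum>l\<in>B. derivation_from f (?s p m) * ?s q l)
      + (\<Sum>m\<in>A. \<Sum>l\<in>B. ?s p m * derivation_from f (?s q l))"
    by (simp only: derivation_from_sum derivation_from_mult_single sum.distrib)
  also have "\<dots> = derivation_from f (\<Sum>m\<in>A. ?s p m) * (\<Sum>l\<in>B. ?s q l)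
      + (\<Sum>m\<in>A. ?s p m) * derivation_from f (\<Sum>l\<in>B. ?s q l)"
    by (simp only: sum_product derivation_from_sum)
  finally show ?thesis
    by (simp only: p[symmetric] q[symmetric])
qed

lemma derivation_from_Const [simp]: "derivation_from f (Const c) = 0"
  by (simp add: Const_def derivation_from_single[of "{}"])

lemma is_derivation_derivation_from: "is_derivation (derivation_from f)"
  unfolding is_derivation_def by (simp add: derivation_from_add derivation_from_mult)

lemma derivation_from_Var: "derivation_from f (Var i) = f i"
  by (simp add: Var_def derivation_from_single[of "{i}"])

lemma derivation_unique:
  assumes "is_derivation D" "is_derivation E" "\<And>i. D (Var i) = E (Var i)"
  shows "D = E"
proof
  have Const: "F (Const c) = 0" if "is_derivation F" for F :: "'a mpoly \<Rightarrow> 'a mpoly" and c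
  proof -
    have one: "Const 1 = (1 :: 'a mpoly)" by (simp add: Const_def)
    have "F (1 * 1) = F 1 * 1 + 1 * F 1"
      using that unfolding is_derivation_def by blast
    then have "F 1 = 0" by simp
    moreover have "F (Const c * 1) = Const c * F 1"
      using that unfolding is_derivation_def by blast
    ultimately show ?thesis by simp
  qed
  have add: "F (p + q) = F p + F q" and mult: "F (p * q) = F p * q + p * F q"
    if "is_derivation F" for F :: "'a mpoly \<Rightarrow> 'a mpoly" and p q
    using that unfolding is_derivation_def by blast+
  have power: "D (Var i ^ e) = E (Var i ^ e)" for i e
  proof (induction e)
    case 0
    then show ?case using Const[OF assms(1), of 1] Const[OF assms(2), of 1] by (simp add: Const_def)
  next
    case (Suc e)
    then show ?case by (simp add: mult[OF assms(1)] mult[OF assms(2)] assms(3))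
  qed
  have Var_power: "Var i ^ e = Poly_Mapping.single (Poly_Mapping.single i e) (1 :: 'a)" for i e
    by (induction e) (simp_all add: Var_def mult_single single_add[symmetric])
  have mono_power: "D (Poly_Mapping.single (\<Sum>i\<in>A. Poly_Mapping.single i (g i)) 1)
      = E (Poly_Mapping.single (\<Sum>i\<in>A. Poly_Mapping.single i (g i)) 1)" for A and g :: "nat \<Rightarrow> nat"
  proof (induction A rule: infinite_finite_induct)
    case (insert i A)
    have eq: "Poly_Mapping.single (\<Sum>i\<in>insert i A. Poly_Mapping.single i (g i)) (1 :: 'a)
        = Var i ^ g i * Poly_Mapping.single (\<Sum>i\<in>A. Poly_Mapping.single i (g i)) 1"
      using insert.hyps by (simp add: Var_power mult_single)
    show ?case
      unfolding eq mult[OF assms(1)] mult[OF assms(2)] power insert.IH ..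
  qed (use Const[OF assms(1), of 1] Const[OF assms(2), of 1] in \<open>simp_all add: Const_def\<close>)
  have mono: "D (Poly_Mapping.single m c) = E (Poly_Mapping.single m c)" for m c
  proof -
    have eq: "Poly_Mapping.single m c = Const c * Poly_Mapping.single m 1"
      by (simp add: Const_def mult_single)
    have "D (Poly_Mapping.single m 1) = E (Poly_Mapping.single m 1)"
      using mono_power[of "Poly_Mapping.lookup m" "Poly_Mapping.keys m"]
      by (simp only: poly_mapping_sum_single[symmetric])
    then show ?thesis
      unfolding eq by (simp only: mult[OF assms(1)] mult[OF assms(2)] Const[OF assms(1)] Const[OF assms(2)])
  qed
  fix p
  have zero: "D 0 = 0" "E 0 = 0"
    using add[OF assms(1), of 0 0] add[OF assms(2), of 0 0] by simp_all
  have "D (\<Sum>m\<in>A. Poly_Mapping.single m (g m)) = E (\<Sum>m\<in>A. Poly_Mapping.single m (g m))" for A g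
    by (induction A rule: infinite_finite_induct)
      (simp_all add: zero add[OF assms(1)] add[OF assms(2)] mono)
  then show "D p = E p"
    by (metis poly_mapping_sum_single)
qed

end

theory Submission
  imports Defs "HOL-Computational_Algebra.Polynomial" "HOL-Computational_Algebra.Formal_Power_Series"
begin

text \<open>
  The polynomial ring carries an action of \<open>sl\<^sub>2\<close>: \<open>d\<close> raises the weight by 2, \<open>dhat\<close> lowers it by
  2, and their commutator multiplies by the weight (\<open>commutator\<close>). So the kernel of \<open>d\<close> is spanned
  by highest weight vectors, and since \<open>d\<close> is onto in positive weights (\<open>weitzenboeck_surj\<close>),
  those of degree \<open>m\<close> and weight \<open>w \<ge> 0\<close> form a space whose dimension is the number of monomials
  of weight \<open>w\<close> minus the number of monomials of weight \<open>w + 2\<close>. By the classical correspondence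
  this space consists of the leading coefficients of the covariants of degree \<open>m\<close> and order \<open>w\<close> of
  a binary form of degree \<open>n\<close>, here of the binary quintic.

  Generation is proved by Gordan's method. Euler's formula shows that every highest weight vector
  of degree \<open>m + 1\<close> is a combination of elements \<open>\<tau>\<^sub>i(z)\<close> with \<open>z\<close> of degree \<open>m\<close>
  (\<open>hwv_Suc_subset_tau_span\<close>). If \<open>z = g h\<close> and \<open>g\<close> has order at least \<open>i\<close>, then \<open>\<tau>\<^sub>i(z)\<close> equals
  \<open>h \<tau>\<^sub>i(g)\<close> up to terms with smaller index (\<open>tau_mult_split\<close>), and one of two factors does have
  large enough order if the result has order at least \<open>n - 1\<close>. By induction on the degree
  (\<open>hwv_subset_gen_span\<close>) it remains to treat the highest weight vectors of order less than
  \<open>n - 1 = 4\<close> in all degrees, and \<open>\<tau>\<^sub>i(g)\<close> for the 23 generators \<open>g\<close>.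

  For a fixed order the highest weight vectors form a module over the invariants. A partial
  fraction decomposition computes its Hilbert series (\<open>D_dim_series\<close>); for orders 0 to 4 the
  result is that of a free module over a polynomial ring in invariants of degrees 4, 8 and 12
  (\<open>D_dim_series_low\<close>). That certain products of generators are independent over these invariants,
  and hence a basis (\<open>hwv_subset_gen_span_free\<close>), is checked on quintics that are sums of three
  fifth powers. On such a quintic every generator becomes an explicit polynomial in one variable
  \<open>y\<close>, with \<open>dhat\<close> acting as differentiation by \<open>y\<close> (\<open>syl_dhat\<close>), and independence becomes the
  nonvanishing of a few determinants.

  The elements \<open>\<tau>\<^sub>i(g)\<close> of order at least 5 lie in 21 bidegrees. In each of them, products of
  generators in the number given by the Hilbert series are independent, because suitable
  combinations of point evaluations form a dual basis (\<open>hwv_subset_gen_span_dual_basis\<close>).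

  For minimality, a generator that lies in the algebra generated by the others is a linear
  combination of products of others of the same degree and order. There are at most two such
  products, and a combination of point evaluations vanishes on them but not on the generator
  (\<open>cov_notin_alg_span_others\<close>). The same fact shows that the 23 generators are distinct.
\<close>

section \<open>Constants, bihomogeneous polynomials and linear algebra\<close>

lemma Const_0 [simp]: "Const 0 = 0"
  by (simp add: Const_def)

lemma Const_1 [simp]: "Const 1 = 1"
  by (simp add: Const_def)

lemma Const_eq_0_iff [simp]: "Const c = 0 \<longleftrightarrow> c = 0"
  unfolding Const_def by (metis lookup_single_eq lookup_zero single_zero)

lemma Const_add: "Const (a + b) = Const a + Const b"
  by (simp add: Const_def single_add)

lemma Const_mult: "Const (a * b) = Const a * Const b"
  by (simp add: Const_def mult_single)

lemma Const_uminus: "Const (- a) = - Const a"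
  by (simp add: Const_def single_uminus)

lemma Const_diff: "Const (a - b) = Const a - Const b"
  by (simp add: Const_def single_diff)

lemma of_nat_eq_Const: "of_nat k = Const (of_nat k)"
  by (simp add: Const_def)

lemma Const_power: "Const (a ^ k) = Const a ^ k"
  by (induction k) (simp_all add: Const_mult)

lemma Const_mult_mult: "Const a * (Const b * p) = Const (a * b) * p"
  by (simp add: Const_mult mult.assoc)

lemma lookup_Const_mult: "Poly_Mapping.lookup (Const c * p) k = c * Poly_Mapping.lookup p k"
proof -
  have "Const c * p = Poly_Mapping.map ((*) c) p"
    by (simp add: mult_map_scale_conv_mult Const_def)
  then show ?thesis
    by (simp add: Poly_Mapping.map.rep_eq when_def)
qed

lemma keys_Const_mult_subset: "Poly_Mapping.keys (Const c * p) \<subseteq> Poly_Mapping.keys p"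
  by (auto simp: in_keys_iff lookup_Const_mult)

interpretation vs: vector_space "\<lambda>(c :: 'k::field_char_0) (p :: 'k mpoly). Const c * p"
  by unfold_locales (simp_all add: algebra_simps Const_add Const_mult)

text \<open>
  Everything below is graded by degree and weight. \<open>bihom n m w\<close> is the space of all polynomials
  in \<open>x\<^sub>0, \<dots>, x\<^sub>n\<close> that are homogeneous of degree \<open>m\<close> and isobaric of weight \<open>w\<close>, zero included; \<open>d\<close>
  raises the weight by 2 and \<open>dhat\<close> lowers it by 2.
\<close>

definition mon_degree :: "nat \<Rightarrow> (nat \<Rightarrow>\<^sub>0 nat) \<Rightarrow> nat"
  where "mon_degree n k = (\<Sum>i\<le>n. Poly_Mapping.lookup k i)"

definition bimons :: "nat \<Rightarrow> nat \<Rightarrow> int \<Rightarrow> (nat \<Rightarrow>\<^sub>0 nat) set"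
  where "bimons n m w = {k. Poly_Mapping.keys k \<subseteq> {..n} \<and> mon_degree n k = m \<and> monomial_weight n k = w}"

definition bihom :: "nat \<Rightarrow> nat \<Rightarrow> int \<Rightarrow> 'k::comm_ring_1 mpoly set"
  where "bihom n m w = {p. Poly_Mapping.keys p \<subseteq> bimons n m w}"

lemma mon_degree_add: "mon_degree n (k + l) = mon_degree n k + mon_degree n l"
  by (simp add: mon_degree_def lookup_add sum.distrib)

lemma monomial_weight_add:
  "monomial_weight n (k + l) = monomial_weight n k + monomial_weight n l"
  by (simp add: monomial_weight_def lookup_add sum.distrib algebra_simps)

lemma bimons_add: "k \<in> bimons n m w \<Longrightarrow> l \<in> bimons n m' w' \<Longrightarrow> k + l \<in> bimons n (m + m') (w + w')"
  unfolding bimons_def using keys_add[of k l] by (auto simp: mon_degree_add monomial_weight_add)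

lemma single_in_bimons: "i \<le> n \<Longrightarrow> Poly_Mapping.single i 1 \<in> bimons n 1 (int n - 2 * int i)"
  by (auto simp: bimons_def mon_degree_def monomial_weight_def lookup_single when_def
      if_distrib[of int] if_distrib[of "(*) _"] split: if_splits cong: if_cong)

lemma finite_bimons [simp]: "finite (bimons n m w)"
proof -
  have "bimons n m w \<subseteq> (\<lambda>f. Abs_poly_mapping (\<lambda>i. if i \<le> n then f i else 0)) ` (PiE {..n} (\<lambda>_. {..m}))"
  proof
    fix k assume k: "k \<in> bimons n m w"
    have le: "Poly_Mapping.lookup k i \<le> m" if "i \<le> n" for i
      using k that member_le_sum[of i "{..n}" "Poly_Mapping.lookup k"]
      by (auto simp: bimons_def mon_degree_def)
    have "k = Abs_poly_mapping (\<lambda>i. if i \<le> n then restrict (Poly_Mapping.lookup k) {..n} i else 0)"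
    proof (rule poly_mapping_eqI)
      fix i
      have "finite {i. (if i \<le> n then restrict (Poly_Mapping.lookup k) {..n} i else 0) \<noteq> 0}"
        by (rule finite_subset[of _ "{..n}"]) auto
      then have "Poly_Mapping.lookup (Abs_poly_mapping (\<lambda>i. if i \<le> n then restrict
          (Poly_Mapping.lookup k) {..n} i else 0)) i
          = (if i \<le> n then restrict (Poly_Mapping.lookup k) {..n} i else 0)"
        by (simp add: lookup_Abs_poly_mapping)
      then show "Poly_Mapping.lookup k i =
          Poly_Mapping.lookup (Abs_poly_mapping (\<lambda>i. if i \<le> n then restrict (Poly_Mapping.lookup k)
          {..n} i else 0)) i"
        using k by (auto simp: bimons_def subset_iff in_keys_iff)
    qed
    moreover have "restrict (Poly_Mapping.lookup k) {..n} \<in> PiE {..n} (\<lambda>_. {..m})"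
      using le by auto
    ultimately show "k \<in> (\<lambda>f. Abs_poly_mapping (\<lambda>i. if i \<le> n then f i else 0)) ` (PiE {..n} (\<lambda>_. {..m}))"
      by blast
  qed
  then show ?thesis
    by (rule finite_subset) (intro finite_imageI finite_PiE; simp)
qed

lemma bihom_0 [simp]: "0 \<in> bihom n m w"
  by (simp add: bihom_def)

lemma bihom_add: "p \<in> bihom n m w \<Longrightarrow> q \<in> bihom n m w \<Longrightarrow> p + q \<in> bihom n m w"
  unfolding bihom_def using keys_add[of p q] by auto

lemma bihom_Const_mult: "p \<in> bihom n m w \<Longrightarrow> Const c * p \<in> bihom n m w"
  unfolding bihom_def using keys_Const_mult_subset[of c p] by auto

lemma bihom_uminus: "p \<in> bihom n m w \<Longrightarrow> - p \<in> bihom n m w"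
  by (simp add: bihom_def)

lemma bihom_diff: "p \<in> bihom n m w \<Longrightarrow> q \<in> bihom n m w \<Longrightarrow> p - q \<in> bihom n m w"
  using bihom_add[of p n m w "- q"] bihom_uminus[of q n m w] by simp

lemma bihom_sum: "(\<And>i. i \<in> I \<Longrightarrow> f i \<in> bihom n m w) \<Longrightarrow> (\<Sum>i\<in>I. f i) \<in> bihom n m w"
  by (induction I rule: infinite_finite_induct) (auto intro: bihom_add)

lemma bihom_single: "k \<in> bimons n m w \<Longrightarrow> Poly_Mapping.single k c \<in> bihom n m w"
  by (simp add: bihom_def)

lemma bihom_mult:
  assumes "p \<in> bihom n m w" "q \<in> bihom n m' w'"
  shows "p * q \<in> bihom n (m + m') (w + w')"
  unfolding bihom_def using keys_mult[of p q] assms by (auto simp: bihom_def intro!: bimons_add)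

lemma bihom_Var: "i \<le> n \<Longrightarrow> Var i \<in> bihom n 1 (int n - 2 * int i)"
  unfolding Var_def by (intro bihom_single single_in_bimons)

lemma bihom_Var_mult:
  "i \<le> n \<Longrightarrow> p \<in> bihom n m w \<Longrightarrow> Var i * p \<in> bihom n (Suc m) (w + int n - 2 * int i)"
  using bihom_mult[OF bihom_Var, of i n p m w] by (simp add: algebra_simps)

lemma bihom_1: "1 \<in> bihom n 0 0"
  by (auto simp: bihom_def bimons_def mon_degree_def monomial_weight_def)

lemma bihom_subset_polys_upto: "p \<in> bihom n m w \<Longrightarrow> p \<in> polys_upto n"
  by (auto simp: bihom_def bimons_def polys_upto_def)

lemma weight_bihom:
  assumes "p \<in> bihom n m w" "p \<noteq> 0"
  shows "weight n p = w"
proof -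
  obtain k where "k \<in> Poly_Mapping.keys p" using assms(2) by (auto simp flip: keys_eq_empty)
  then show ?thesis
    unfolding weight_def using assms(1) by (intro the_equality) (auto simp: bihom_def bimons_def)
qed

lemma weight_bound:
  assumes "k \<in> bimons n m w"
  shows "\<bar>w\<bar> \<le> int n * int m"
proof -
  have w: "w = (\<Sum>i\<le>n. (int n - 2 * int i) * int (Poly_Mapping.lookup k i))"
    using assms by (simp add: bimons_def monomial_weight_def algebra_simps sum_subtractf sum_distrib_left)
  have "\<bar>w\<bar> \<le> (\<Sum>i\<le>n. \<bar>(int n - 2 * int i) * int (Poly_Mapping.lookup k i)\<bar>)"
    unfolding w by (rule sum_abs)
  also have "\<dots> \<le> (\<Sum>i\<le>n. int n * int (Poly_Mapping.lookup k i))"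
    by (intro sum_mono) (auto simp: abs_mult intro!: mult_right_mono)
  also have "\<dots> = int n * int m"
    using assms by (auto simp: bimons_def mon_degree_def simp flip: sum_distrib_left of_nat_sum)
  finally show ?thesis .
qed

lemma bihom_eq_0: "p \<in> bihom n m w \<Longrightarrow> \<bar>w\<bar> > int n * int m \<Longrightarrow> p = 0"
  using weight_bound[of _ n m w] by (force simp: bihom_def simp flip: keys_eq_empty)

lemma derivation_from_bihom:
  assumes f: "\<And>i. i \<le> n \<Longrightarrow> f i \<in> bihom n a (int n - 2 * int i + e)"
    and p: "p \<in> bihom n m w"
  shows "derivation_from f p \<in> bihom n (m - 1 + a) (w + e)"
  unfolding derivation_from_def
proof (intro bihom_sum)
  fix k i assume k: "k \<in> Poly_Mapping.keys p" and i: "i \<in> Poly_Mapping.keys k"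
  let ?k = "k - Poly_Mapping.single i 1"
  have kb: "k \<in> bimons n m w" using k p by (auto simp: bihom_def)
  then have "i \<le> n" using i by (auto simp: bimons_def)
  have eq: "?k + Poly_Mapping.single i 1 = k"
    by (rule poly_mapping_eqI) (use i in \<open>auto simp: lookup_add lookup_minus lookup_single when_def
        in_keys_iff\<close>)
  have s: "mon_degree n (Poly_Mapping.single i 1) = 1"
      "monomial_weight n (Poly_Mapping.single i 1) = int n - 2 * int i"
    using single_in_bimons[OF \<open>i \<le> n\<close>] by (auto simp: bimons_def)
  have "Poly_Mapping.keys ?k \<subseteq> Poly_Mapping.keys k"
    by (auto simp: in_keys_iff lookup_minus)
  then have kb': "?k \<in> bimons n (m - 1) (w - (int n - 2 * int i))" and m: "m \<ge> 1"
    using kb mon_degree_add[of n ?k "Poly_Mapping.single i 1"]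
      monomial_weight_add[of n ?k "Poly_Mapping.single i 1"]
    unfolding eq s by (auto simp: bimons_def)
  have "Poly_Mapping.single ?k (Poly_Mapping.lookup p k * of_nat (Poly_Mapping.lookup k i)) * f i
      \<in> bihom n (m - 1 + a) (w - (int n - 2 * int i) + (int n - 2 * int i + e))"
    by (intro bihom_mult bihom_single kb' f \<open>i \<le> n\<close>)
  then show "Poly_Mapping.single ?k (Poly_Mapping.lookup p k * of_nat (Poly_Mapping.lookup k i)) * f i
      \<in> bihom n (m - 1 + a) (w + e)"
    by simp
qed

lemma derivation_from_bihom_linear:
  assumes "\<And>i. i \<le> n \<Longrightarrow> f i \<in> bihom n 1 (int n - 2 * int i + e)"
    and p: "p \<in> bihom n m w"
  shows "derivation_from f p \<in> bihom n m (w + e)"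
proof (cases m)
  case 0
  have "Poly_Mapping.keys k = {}" if "k \<in> Poly_Mapping.keys p" for k
  proof -
    have "Poly_Mapping.keys k \<subseteq> {..n}" "\<forall>i\<le>n. Poly_Mapping.lookup k i = 0"
      using that p 0 by (auto simp: bihom_def bimons_def mon_degree_def)
    then show ?thesis by (meson atMost_iff in_keys_iff subsetD equals0I)
  qed
  then have "derivation_from f p = 0"
    unfolding derivation_from_def by (intro sum.neutral ballI) (metis empty_iff)
  then show ?thesis by simp
qed (use derivation_from_bihom[OF assms] in simp)

lemma weitzenboeck_bihom: "p \<in> bihom n m w \<Longrightarrow> weitzenboeck p \<in> bihom n m (w + 2)"
proof -
  assume p: "p \<in> bihom n m w"
  have "(if i = 0 then 0 else Var (i - 1)) \<in> bihom n 1 (int n - 2 * int i + 2)" if "i \<le> n" for i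
    using that bihom_Var[of "i - 1" n] by (cases i) (auto simp: algebra_simps)
  then show ?thesis unfolding weitzenboeck_def by (intro derivation_from_bihom_linear p)
qed

lemma dhat_bihom: "p \<in> bihom n m w \<Longrightarrow> dhat n p \<in> bihom n m (w - 2)"
proof -
  assume p: "p \<in> bihom n m w"
  have "of_nat ((i + 1) * (n - i)) * Var (i + 1) \<in> bihom n 1 (int n - 2 * int i + - 2)" if "i \<le> n" for i
  proof (cases "i = n")
    case False
    then have "Const (of_nat ((i + 1) * (n - i))) * Var (i + 1) \<in> bihom n 1 (int n - 2 * int (i + 1))"
      using that by (intro bihom_Const_mult bihom_Var) auto
    then show ?thesis unfolding of_nat_eq_Const by (simp add: algebra_simps)
  qed auto
  then show ?thesis using derivation_from_bihom_linear[OF _ p] unfolding dhat_def by fastforce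
qed

lemma weitzenboeck_pow_bihom: "p \<in> bihom n m w \<Longrightarrow> (weitzenboeck ^^ j) p \<in> bihom n m (w + 2 * int j)"
  by (induction j) (auto dest: weitzenboeck_bihom simp: algebra_simps)

lemma dhat_pow_bihom: "p \<in> bihom n m w \<Longrightarrow> (dhat n ^^ j) p \<in> bihom n m (w - 2 * int j)"
  by (induction j) (auto dest: dhat_bihom simp: algebra_simps)

lemma weitzenboeck_add: "weitzenboeck (p + q) = weitzenboeck p + weitzenboeck q"
  and weitzenboeck_mult: "weitzenboeck (p * q) = weitzenboeck p * q + p * weitzenboeck q"
  and weitzenboeck_0 [simp]: "weitzenboeck 0 = 0"
  and weitzenboeck_Const [simp]: "weitzenboeck (Const c) = 0"
  and weitzenboeck_Var: "weitzenboeck (Var i) = (if i = 0 then 0 else Var (i - 1))"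
  and weitzenboeck_sum: "weitzenboeck (\<Sum>i\<in>I. g i) = (\<Sum>i\<in>I. weitzenboeck (g i))"
  by (simp_all add: weitzenboeck_def derivation_from_add derivation_from_mult derivation_from_Var
      derivation_from_sum)

lemma dhat_add: "dhat n (p + q) = dhat n p + dhat n q"
  and dhat_mult: "dhat n (p * q) = dhat n p * q + p * dhat n q"
  and dhat_0 [simp]: "dhat n 0 = 0"
  and dhat_Const [simp]: "dhat n (Const c) = 0"
  and dhat_Var: "dhat n (Var i) = of_nat ((i + 1) * (n - i)) * Var (i + 1)"
  by (simp_all only: dhat_def derivation_from_add derivation_from_mult derivation_from_Var
      derivation_from_zero derivation_from_Const)

lemma weitzenboeck_Const_mult: "weitzenboeck (Const c * p) = Const c * weitzenboeck p"
  by (simp add: weitzenboeck_mult)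

lemma dhat_Const_mult: "dhat n (Const c * p) = Const c * dhat n p"
  by (simp add: dhat_mult)

lemma weitzenboeck_diff: "weitzenboeck (p - q) = weitzenboeck p - weitzenboeck q"
  using weitzenboeck_add[of "p - q" q] by (simp add: algebra_simps)

lemma dhat_pow_add: "(dhat n ^^ j) (p + q) = (dhat n ^^ j) p + (dhat n ^^ j) q"
  by (induction j) (auto simp: dhat_add)

lemma dhat_pow_Const_mult: "(dhat n ^^ j) (Const c * p) = Const c * (dhat n ^^ j) p"
  by (induction j) (auto simp: dhat_Const_mult)

lemma dhat_pow_0: "(dhat n ^^ j) 0 = 0"
  by (induction j) auto

lemma single_sum: "Poly_Mapping.single k (\<Sum>i\<in>I. g i) = (\<Sum>i\<in>I. Poly_Mapping.single k (g i))"
  by (induction I rule: infinite_finite_induct) (simp_all add: single_add)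

section \<open>The action of the Lie algebra sl2\<close>

lemma commutator_eq_derivation_from:
  "weitzenboeck (dhat n p) - dhat n (weitzenboeck p) =
     derivation_from (\<lambda>i. if i \<le> n then Const (of_int (int n - 2 * int i)) * Var i else 0) p"
proof -
  let ?E = "\<lambda>p :: 'a mpoly. weitzenboeck (dhat n p) - dhat n (weitzenboeck p)"
  let ?D = "derivation_from (\<lambda>i. if i \<le> n then Const (of_int (int n -
      2 * int i)) * Var i else 0) :: 'a mpoly \<Rightarrow> _"
  have "?E = ?D"
  proof (rule derivation_unique)
    show "is_derivation ?E"
      unfolding is_derivation_def
      by (simp add: weitzenboeck_add weitzenboeck_mult dhat_add dhat_mult algebra_simps)
    show "is_derivation ?D" by (rule is_derivation_derivation_from)
    fix i
    have "(of_nat ((i + 1) * (n - i)) :: 'a) - of_nat (i * (n - (i - 1))) = of_int (int n - 2 * int i)"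
      if "i \<le> n"
    proof -
      obtain r where r: "n = i + r" using \<open>i \<le> n\<close> le_Suc_ex by blast
      show ?thesis unfolding r by (cases i) (auto simp: algebra_simps)
    qed
    then have *: "Const (of_nat ((i + 1) * (n - i))) - Const (of_nat (i * (n - (i - 1))))
        = (Const (of_int (int n - 2 * int i)) :: 'a mpoly)" if "i \<le> n"
      using that by (simp only: Const_diff[symmetric])
    have "?E (Var i) = (Const (of_nat ((i + 1) * (n - i))) - Const (of_nat (i * (n - (i - 1))))) * Var i"
    proof (cases i)
      case 0
      then show ?thesis
        by (simp add: dhat_Var weitzenboeck_Var weitzenboeck_mult of_nat_eq_Const del: of_nat_mult)
    next
      case (Suc j)
      then show ?thesis
        by (simp add: dhat_Var weitzenboeck_Var weitzenboeck_mult of_nat_eq_Const algebra_simps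
            del: of_nat_mult of_nat_add of_nat_Suc)
    qed
    note E = this
    show "?E (Var i) = ?D (Var i)"
    proof (cases "i \<le> n")
      case True
      show ?thesis unfolding E *[OF True] using True by (simp add: derivation_from_Var)
    next
      case False
      then have z: "n - i = 0" "n - (i - 1) = 0" by auto
      show ?thesis unfolding E z using False by (simp add: derivation_from_Var)
    qed
  qed
  then show ?thesis by metis
qed

lemma derivation_from_diagonal:
  fixes p :: "'k::comm_ring_1 mpoly"
  assumes "\<And>k. k \<in> Poly_Mapping.keys p \<Longrightarrow> Poly_Mapping.keys k \<subseteq> {..n} \<and>
      (\<Sum>i\<le>n. of_nat (Poly_Mapping.lookup k i) * c i) = \<mu>"
  shows "derivation_from (\<lambda>i. if i \<le> n then Const (c i) * Var i else 0) p = Const \<mu> * p"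
proof -
  let ?f = "\<lambda>i. if i \<le> n then Const (c i) * Var i else (0 :: 'k mpoly)"
  let ?l = Poly_Mapping.lookup
  have "derivation_from ?f p = (\<Sum>k \<in> Poly_Mapping.keys p. Const \<mu> * Poly_Mapping.single k (?l p k))"
    unfolding derivation_from_def
  proof (rule sum.cong)
    fix k assume "k \<in> Poly_Mapping.keys p"
    then have k: "Poly_Mapping.keys k \<subseteq> {..n}" "(\<Sum>i\<le>n. of_nat (?l k i) * c i) = \<mu>"
      using assms by auto
    have "(\<Sum>i\<in>Poly_Mapping.keys k. Poly_Mapping.single (k -
        Poly_Mapping.single i 1) (?l p k * of_nat (?l k i)) * ?f i)
        = (\<Sum>i\<in>Poly_Mapping.keys k. Poly_Mapping.single k (?l p k * (of_nat (?l k i) * c i)))"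
    proof (rule sum.cong)
      fix i assume i: "i \<in> Poly_Mapping.keys k"
      have eq: "k - Poly_Mapping.single i 1 + Poly_Mapping.single i 1 = k"
        by (rule poly_mapping_eqI) (use i in \<open>auto simp: lookup_add lookup_minus lookup_single
            when_def in_keys_iff\<close>)
      have "i \<le> n" using i k by auto
      then show "Poly_Mapping.single (k - Poly_Mapping.single i 1) (?l p k * of_nat (?l k i)) * ?f i
          = Poly_Mapping.single k (?l p k * (of_nat (?l k i) * c i))"
        using eq by (simp add: Const_def Var_def mult_single mult.assoc)
    qed simp
    also have "\<dots> = Poly_Mapping.single k (?l p k * (\<Sum>i\<in>Poly_Mapping.keys k. of_nat (?l k i) * c i))"
      by (simp only: single_sum sum_distrib_left)
    also have "(\<Sum>i\<in>Poly_Mapping.keys k. of_nat (?l k i) * c i) = (\<Sum>i\<le>n. of_nat (?l k i) * c i)"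
      using k(1) by (intro sum.mono_neutral_left) (auto simp: in_keys_iff)
    finally show "(\<Sum>i\<in>Poly_Mapping.keys k. Poly_Mapping.single (k -
        Poly_Mapping.single i 1) (?l p k * of_nat (?l k i)) * ?f i)
        = Const \<mu> * Poly_Mapping.single k (?l p k)"
      unfolding k(2) by (simp only: Const_def mult_single add_0_left mult.commute)
  qed simp
  also have "\<dots> = Const \<mu> * p"
    by (simp only: sum_distrib_left[symmetric] poly_mapping_sum_single[symmetric])
  finally show ?thesis .
qed

lemma commutator:
  fixes p :: "'k::comm_ring_1 mpoly"
  assumes "p \<in> bihom n m w"
  shows "weitzenboeck (dhat n p) = dhat n (weitzenboeck p) + Const (of_int w) * p"
proof -
  have "(\<Sum>i\<le>n. of_nat (Poly_Mapping.lookup k i) * of_int (int n - 2 * int i)) = (of_int w :: 'k)"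
    if "k \<in> Poly_Mapping.keys p" for k
  proof -
    have "(\<Sum>i\<le>n. int (Poly_Mapping.lookup k i) * (int n - 2 * int i)) = w"
      using that assms by (auto simp: bihom_def bimons_def monomial_weight_def algebra_simps
          sum_subtractf sum_distrib_left)
    then have "(of_int (\<Sum>i\<le>n. int (Poly_Mapping.lookup k i) * (int n - 2 * int i)) :: 'k) = of_int w"
      by simp
    then show ?thesis by simp
  qed
  then have "derivation_from (\<lambda>i. if i \<le> n then Const (of_int (int n - 2 * int i)) * Var i else 0) p
      = Const (of_int w) * p"
    by (intro derivation_from_diagonal) (use assms in \<open>auto simp: bihom_def bimons_def\<close>)
  then show ?thesis
    using commutator_eq_derivation_from[of n p] by (simp add: algebra_simps)
qed

lemma weitzenboeck_pow_Const_mult: "(weitzenboeck ^^ j) (Const c * p) = Const c * (weitzenboeck ^^ j) p"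
  by (induction j) (auto simp: weitzenboeck_Const_mult)

lemma weitzenboeck_pow_diff: "(weitzenboeck ^^ j) (p - q) = (weitzenboeck ^^ j) p - (weitzenboeck ^^ j) q"
  by (induction j) (auto simp: weitzenboeck_diff)

lemma weitzenboeck_pow_0: "(weitzenboeck ^^ j) 0 = 0"
  by (induction j) auto

lemma weitzenboeck_dhat_pow:
  assumes "p \<in> bihom n m w"
  shows "weitzenboeck ((dhat n ^^ Suc j) p) =
    (dhat n ^^ Suc j) (weitzenboeck p) + Const (of_int ((int j + 1) * (w - int j))) * (dhat n ^^ j) p"
proof (induction j)
  case 0
  then show ?case using commutator[OF assms] by simp
next
  case (Suc j)
  have "weitzenboeck ((dhat n ^^ Suc (Suc j)) p) = dhat n (weitzenboeck ((dhat n ^^ Suc j) p))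
      + Const (of_int (w - 2 * int (Suc j))) * (dhat n ^^ Suc j) p"
    using commutator[OF dhat_pow_bihom[OF assms, of "Suc j"]] by simp
  also have "\<dots> = (dhat n ^^ Suc (Suc j)) (weitzenboeck p)
      + (Const (of_int ((int j + 1) * (w - int j))) + Const (of_int (w -
          2 * int (Suc j)))) * (dhat n ^^ Suc j) p"
    unfolding Suc.IH dhat_add dhat_Const_mult
        by (simp add: distrib_right add.assoc del: of_int_mult of_int_add of_int_diff)
  also have "Const (of_int ((int j + 1) * (w - int j))) + Const (of_int (w - 2 * int (Suc j)))
      = Const (of_int ((int (Suc j) + 1) * (w - int (Suc j))))"
    unfolding Const_add[symmetric] of_int_add[symmetric] by (simp add: algebra_simps)
  finally show ?case .
qed

lemma weitzenboeck_pow_dhat: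
  assumes "p \<in> bihom n m w"
  shows "(weitzenboeck ^^ Suc j) (dhat n p) =
    dhat n ((weitzenboeck ^^ Suc j) p) + Const (of_int ((int j + 1) * (w + int j))) * (weitzenboeck ^^ j) p"
proof (induction j)
  case 0
  then show ?case using commutator[OF assms] by simp
next
  case (Suc j)
  have "(weitzenboeck ^^ Suc (Suc j)) (dhat n p) = weitzenboeck (dhat n ((weitzenboeck ^^ Suc j) p))
      + Const (of_int ((int j + 1) * (w + int j))) * (weitzenboeck ^^ Suc j) p"
    using Suc.IH by (simp add: weitzenboeck_add weitzenboeck_Const_mult)
  also have "weitzenboeck (dhat n ((weitzenboeck ^^ Suc j) p)) = dhat n ((weitzenboeck ^^ Suc (Suc j)) p)
      + Const (of_int (w + 2 * int (Suc j))) * (weitzenboeck ^^ Suc j) p"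
    using commutator[OF weitzenboeck_pow_bihom[OF assms, of "Suc j"]] by simp
  also have "dhat n ((weitzenboeck ^^ Suc (Suc j)) p)
      + Const (of_int (w + 2 * int (Suc j))) * (weitzenboeck ^^ Suc j) p
      + Const (of_int ((int j + 1) * (w + int j))) * (weitzenboeck ^^ Suc j) p
      = dhat n ((weitzenboeck ^^ Suc (Suc j)) p)
      + (Const (of_int (w + 2 * int (Suc j))) + Const (of_int ((int j + 1) * (w +
          int j)))) * (weitzenboeck ^^ Suc j) p"
    by (simp add: algebra_simps)
  also have "Const (of_int (w + 2 * int (Suc j))) + Const (of_int ((int j + 1) * (w + int j)))
      = Const (of_int ((int (Suc j) + 1) * (w + int (Suc j))))"
    unfolding Const_add[symmetric] of_int_add[symmetric] by (simp add: algebra_simps)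
  finally show ?case .
qed

lemma dhat_pow_eq_0_imp:
  fixes p :: "'k::field_char_0 mpoly"
  assumes p: "p \<in> bihom n m w"
    and e: "\<And>j. weitzenboeck ((dhat n ^^ Suc j) p) = Const (e j) * (dhat n ^^ j) p" "\<And>j. e j \<noteq> 0"
  shows "p = 0"
proof -
  have "(dhat n ^^ j) p = 0 \<Longrightarrow> p = 0" for j
  proof (induction j)
    case (Suc j)
    then have "Const (e j) * (dhat n ^^ j) p = 0" using e(1)[of j] by simp
    then show ?case using Suc e(2) by simp
  qed simp
  moreover have "(dhat n ^^ nat (n * m + \<bar>w\<bar> + 1)) p = 0"
    using bihom_eq_0[OF dhat_pow_bihom[OF p]] by simp
  ultimately show ?thesis by blast
qed

text \<open>
  This stands in for complete reducibility of \<open>sl\<^sub>2\<close>-modules. If \<open>d\<^sup>N\<^sup>+\<^sup>1 p = 0\<close>, then \<open>d\<^sup>N\<close> kills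
  \<open>d (dhat p) - c p\<close> for a negative \<open>c\<close>, so by induction \<open>p\<close> is an eigenvector of \<open>d dhat\<close>. Then
  no \<open>dhat\<^sup>j p\<close> vanishes unless \<open>p = 0\<close>, although the weights of a fixed degree are bounded.
\<close>

lemma weitzenboeck_pow_inj:
  fixes p :: "'k::field_char_0 mpoly"
  assumes "p \<in> bihom n m w" "int N \<le> - w" "(weitzenboeck ^^ N) p = 0"
  shows "p = 0"
  using assms
proof (induction N arbitrary: p)
  case (Suc N)
  define c where "c = (int N + 1) * (w + int N)"
  have c: "c < 0" unfolding c_def using Suc.prems(2) by (intro mult_pos_neg) auto
  let ?q = "weitzenboeck (dhat n p) - Const (of_int c) * p"
  have "(weitzenboeck ^^ N) ?q = (weitzenboeck ^^ Suc N) (dhat n p) -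
      Const (of_int c) * (weitzenboeck ^^ N) p"
    by (simp only: weitzenboeck_pow_diff weitzenboeck_pow_Const_mult funpow_Suc_right o_apply)
  also have "\<dots> = 0"
    unfolding weitzenboeck_pow_dhat[OF Suc.prems(1)] Suc.prems(3) c_def by simp
  finally have "(weitzenboeck ^^ N) ?q = 0" .
  moreover have "?q \<in> bihom n m w"
    using weitzenboeck_bihom[OF dhat_bihom[OF Suc.prems(1)]] bihom_Const_mult[OF Suc.prems(1)]
    by (simp add: bihom_diff)
  ultimately have "?q = 0" using Suc.IH[of ?q] Suc.prems(2) by simp
  then have eig: "weitzenboeck (dhat n p) = Const (of_int c) * p" by simp
  define e where "e j = c + int j * w - int j * (int j + 1)" for j
  have "weitzenboeck ((dhat n ^^ Suc j) p) = Const (of_int (e j)) * (dhat n ^^ j) p" for j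
  proof (induction j)
    case 0
    then show ?case using eig by (simp add: e_def)
  next
    case (Suc j)
    have "weitzenboeck ((dhat n ^^ Suc (Suc j)) p) = dhat n (weitzenboeck ((dhat n ^^ Suc j) p))
        + Const (of_int (w - 2 * int (Suc j))) * (dhat n ^^ Suc j) p"
      using commutator[OF dhat_pow_bihom[OF \<open>p \<in> bihom n m w\<close>, of "Suc j"]] by simp
    also have "\<dots> = (Const (of_int (e j)) + Const (of_int (w - 2 * int (Suc j)))) * (dhat n ^^ Suc j) p"
      unfolding Suc by (simp add: dhat_Const_mult algebra_simps)
    also have "Const (of_int (e j)) + Const (of_int (w - 2 * int (Suc j))) = Const (of_int (e (Suc j)))"
      unfolding Const_add[symmetric] of_int_add[symmetric] e_def by (simp add: algebra_simps)
    finally show ?case .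
  qed
  moreover have "of_int (e j) \<noteq> (0 :: 'k)" for j
  proof -
    have "int j * w \<le> 0" using Suc.prems(2) by (intro mult_nonneg_nonpos) auto
    moreover have "0 \<le> int j * (int j + 1)" by simp
    ultimately have "e j < 0" unfolding e_def using c by linarith
    then show ?thesis by (metis of_int_eq_0_iff order_less_irrefl)
  qed
  ultimately show ?case using dhat_pow_eq_0_imp[OF Suc.prems(1), of "\<lambda>j. of_int (e j)"] by blast
qed simp

text \<open>
  Surjectivity on positive weights: powers of \<open>d\<close> kill \<open>y\<close> because weights are bounded, and
  subtracting \<open>d (dhat y) / c\<close> from \<open>y\<close> lowers the power that is needed.
\<close>

lemma weitzenboeck_surj:
  fixes y :: "'k::field_char_0 mpoly"
  assumes y: "y \<in> bihom n m w" and w: "w > 0"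
  shows "\<exists>z \<in> bihom n m (w - 2). weitzenboeck z = y"
proof -
  have "(weitzenboeck ^^ N) y = 0 \<Longrightarrow> \<exists>z \<in> bihom n m (w - 2). weitzenboeck z = y" for N
    using y
  proof (induction N arbitrary: y)
    case 0
    then show ?case by (auto intro!: bexI[of _ 0])
  next
    case (Suc N)
    define c where "c = (of_int ((int N + 1) * (w + int N)) :: 'k)"
    have c: "c \<noteq> 0" unfolding c_def using w by (simp only: of_int_eq_0_iff) simp
    define q where "q = Const (1 / c) * dhat n y"
    have q: "q \<in> bihom n m (w - 2)"
      unfolding q_def by (intro bihom_Const_mult dhat_bihom Suc.prems)
    have "(weitzenboeck ^^ N) (y - weitzenboeck q)
        = (weitzenboeck ^^ N) y - Const (1 / c) * (weitzenboeck ^^ Suc N) (dhat n y)"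
      unfolding q_def
      by (simp only: weitzenboeck_pow_diff weitzenboeck_pow_Const_mult weitzenboeck_Const_mult
          funpow_Suc_right o_apply)
    also have "\<dots> = 0"
      unfolding weitzenboeck_pow_dhat[OF Suc.prems(2)] Suc.prems(1) c_def[symmetric]
      using c by (simp add: Const_mult_mult)
    finally have "(weitzenboeck ^^ N) (y - weitzenboeck q) = 0" .
    moreover have "y - weitzenboeck q \<in> bihom n m w"
      using weitzenboeck_bihom[OF q] Suc.prems(2) by (simp add: bihom_diff)
    ultimately obtain z where "z \<in> bihom n m (w - 2)" "weitzenboeck z = y - weitzenboeck q"
      using Suc.IH by blast
    then show ?case
      using q by (intro bexI[of _ "z + q"]) (auto simp: weitzenboeck_add bihom_add)
  qed
  moreover have "(weitzenboeck ^^ nat (n * m + \<bar>w\<bar> + 1)) y = 0"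
    using bihom_eq_0[OF weitzenboeck_pow_bihom[OF y]] by simp
  ultimately show ?thesis by blast
qed

text \<open>
  The highest weight vectors of degree \<open>m\<close> and weight \<open>w\<close>: the bihomogeneous parts of the kernel
  of \<open>d\<close>. For them weight and order agree.
\<close>

definition hwv :: "nat \<Rightarrow> nat \<Rightarrow> int \<Rightarrow> 'k::comm_ring_1 mpoly set"
  where "hwv n m w = {p \<in> bihom n m w. weitzenboeck p = 0}"

lemma hwv_add: "p \<in> hwv n m w \<Longrightarrow> q \<in> hwv n m w \<Longrightarrow> p + q \<in> hwv n m w"
  by (simp add: hwv_def bihom_add weitzenboeck_add)

lemma hwv_Const_mult: "p \<in> hwv n m w \<Longrightarrow> Const c * p \<in> hwv n m w"
  by (simp add: hwv_def bihom_Const_mult weitzenboeck_Const_mult)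

lemma hwv_mult: "p \<in> hwv n m w \<Longrightarrow> q \<in> hwv n m' w' \<Longrightarrow> p * q \<in> hwv n (m + m') (w + w')"
  by (simp add: hwv_def bihom_mult weitzenboeck_mult)

lemma hwv_0 [simp]: "0 \<in> hwv n m w"
  by (simp add: hwv_def)

lemma hwv_negative:
  fixes p :: "'k::field_char_0 mpoly"
  assumes "p \<in> hwv n m w" "w < 0" shows "p = 0"
  using assms weitzenboeck_pow_inj[of p n m w 1] by (simp add: hwv_def)

lemma subspace_hwv: "vs.subspace (hwv n m w)"
  unfolding vs.subspace_def by (auto simp: hwv_add hwv_Const_mult)

section \<open>The operators tau\<close>

definition tau_coeff :: "int \<Rightarrow> nat \<Rightarrow> 'k::field_char_0"
  where "tau_coeff w j = (- 1) ^ j * (fact (nat (w - int j)) / (fact j * fact (nat w)))"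

lemma tau_bihom:
  fixes z :: "'k::field_char_0 mpoly"
  assumes "z \<in> bihom n m w"
  shows "tau n i z = (\<Sum>k\<le>i. Var k * (Const (tau_coeff w (i - k)) * (dhat n ^^ (i - k)) z))"
proof -
  have "tau n i z = (\<Sum>j = 0..i. Var (i - j) * (Const (tau_coeff w j) * (dhat n ^^ j) z))"
  proof (cases "z = 0")
    case False
    have "(- 1) ^ j * Var (i - j) * Const (fact (nat (w -
        int j)) / (fact j * fact (nat w))) * (dhat n ^^ j) z
        = Var (i - j) * (Const (tau_coeff w j) * (dhat n ^^ j) z)" for j
    proof -
      have "(- 1 :: 'k mpoly) ^ j = Const ((- 1) ^ j)" by (simp add: Const_power Const_uminus)
      then show ?thesis
        by (simp only: tau_coeff_def Const_mult mult_ac)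
    qed
    then show ?thesis
      unfolding tau_def weight_bihom[OF assms False] by (simp only:)
  qed (simp add: tau_def dhat_pow_0)
  also have "\<dots> = (\<Sum>j\<le>i. Var (i - j) * (Const (tau_coeff w j) * (dhat n ^^ j) z))"
    by (simp add: atLeast0AtMost)
  also have "\<dots> = (\<Sum>k\<le>i. Var k * (Const (tau_coeff w (i - k)) * (dhat n ^^ (i - k)) z))"
    by (rule sum.reindex_bij_witness[of _ "\<lambda>j. i - j" "\<lambda>j. i - j"]) auto
  finally show ?thesis .
qed

lemma tau_0_right [simp]: "tau n i 0 = 0"
  by (simp add: tau_def dhat_pow_0)

lemma tau_add:
  fixes p :: "'k::field_char_0 mpoly"
  assumes "p \<in> bihom n m w" "q \<in> bihom n m w"
  shows "tau n i (p + q) = tau n i p + tau n i q"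
  unfolding tau_bihom[OF assms(1)] tau_bihom[OF assms(2)] tau_bihom[OF bihom_add[OF assms]]
  by (simp add: dhat_pow_add algebra_simps sum.distrib)

lemma tau_Const_mult:
  fixes p :: "'k::field_char_0 mpoly"
  assumes "p \<in> bihom n m w"
  shows "tau n i (Const c * p) = Const c * tau n i p"
  unfolding tau_bihom[OF assms] tau_bihom[OF bihom_Const_mult[OF assms]] dhat_pow_Const_mult
      sum_distrib_left
  by (simp only: mult_ac)

lemma tau_0:
  fixes p :: "'k::field_char_0 mpoly"
  assumes "p \<in> bihom n m w"
  shows "tau n 0 p = Var 0 * p"
  unfolding tau_bihom[OF assms] by (simp add: tau_coeff_def)

text \<open>
  A chain of length \<open>s\<close> is a family \<open>u\<^sub>0, \<dots>, u\<^sub>s\<close> for which \<open>\<Sum>\<^sub>k x\<^sub>k u\<^sub>k\<close> is killed by \<open>d\<close> for the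
  formal reason that \<open>d u\<^sub>k = - u\<^sub>k\<^sub>+\<^sub>1\<close>. Both \<open>\<tau>\<^sub>s\<close> and the Euler formula produce such sums, and
  comparing two chains by their top entries is what replaces the Clebsch-Gordan theory.
\<close>

definition chain :: "nat \<Rightarrow> nat \<Rightarrow> int \<Rightarrow> nat \<Rightarrow> (nat \<Rightarrow> 'k::comm_ring_1 mpoly) \<Rightarrow> bool"
  where "chain n m W s u \<longleftrightarrow> (\<forall>k\<le>s. u k \<in> bihom n m (W - int n + 2 * int k)) \<and>
    (\<forall>k<s. weitzenboeck (u k) = - u (Suc k)) \<and> weitzenboeck (u s) = 0"

lemma chain_sum_hwv:
  fixes u :: "nat \<Rightarrow> 'k::field_char_0 mpoly"
  assumes u: "chain n m W s u" and s: "s \<le> n"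
  shows "(\<Sum>k\<le>s. Var k * u k) \<in> hwv n (Suc m) W"
proof -
  have "Var k * u k \<in> bihom n (Suc m) W" if "k \<le> s" for k
    using bihom_Var_mult[of k n "u k" m "W - int n + 2 * int k"] u s that by (auto simp: chain_def)
  moreover have "weitzenboeck (\<Sum>k\<le>r. Var k * u k) = Var r * weitzenboeck (u r)" if "r \<le> s" for r
    using that
  proof (induction r)
    case 0
    then show ?case by (simp add: weitzenboeck_mult weitzenboeck_Var)
  next
    case (Suc r)
    then have "weitzenboeck (u r) = - u (Suc r)" using u by (auto simp: chain_def)
    then show ?case using Suc by (simp add: weitzenboeck_add weitzenboeck_mult weitzenboeck_Var)
  qed
  ultimately show ?thesis
    using u by (auto simp: hwv_def chain_def intro!: bihom_sum)
qed

lemma tau_coeff_step: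
  assumes "int (Suc j) \<le> w"
  shows "tau_coeff w (Suc j) * (of_int ((int j + 1) * (w - int j)) :: 'k::field_char_0) = - tau_coeff w j"
proof -
  obtain r where r: "w = int (Suc j + r)" using zle_iff_zadd[of "int (Suc j)" w] assms by auto
  have 1: "nat (w - int (Suc j)) = r" "nat (w - int j) = Suc r" using r by auto
  have "fact (Suc r) = (of_int (w - int j) * fact r :: 'k)" using r by simp
  moreover have "of_int ((int j + 1) * (w - int j)) = (of_nat (Suc j) * of_int (w - int j) :: 'k)"
    by simp
  moreover have "fact (Suc j) = (of_nat (Suc j) * fact j :: 'k)" by simp
  moreover have "(- 1) ^ Suc j * (f / (a * g * h)) * (a * b) = - ((- 1) ^ j * (b * f / (g * h)))"
    if "a \<noteq> 0" "g \<noteq> 0" "h \<noteq> 0" for a b f g h :: 'k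
    using that by (simp add: field_simps)
  ultimately show ?thesis
    unfolding tau_coeff_def 1 using of_nat_neq_0[of j, where 'a = 'k]
    by (simp only: fact_nonzero not_False_eq_True)
qed

lemma chain_tau:
  fixes z :: "'k::field_char_0 mpoly"
  assumes z: "z \<in> hwv n m (W - int n + 2 * int s)" and s: "int s \<le> W - int n + 2 * int s \<or> z = 0"
  shows "chain n m W s (\<lambda>k. Const (tau_coeff (W - int n + 2 * int s) (s - k)) * (dhat n ^^ (s - k)) z)"
proof -
  let ?w = "W - int n + 2 * int s"
  have zb: "z \<in> bihom n m ?w" and dz: "weitzenboeck z = 0" using z by (auto simp: hwv_def)
  show ?thesis
    unfolding chain_def
  proof (intro conjI allI impI)
    fix k assume "k \<le> s"
    then show "Const (tau_coeff ?w (s - k)) * (dhat n ^^ (s - k)) z \<in> bihom n m (W - int n + 2 * int k)"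
      using dhat_pow_bihom[OF zb, of "s - k"]
          by (intro bihom_Const_mult) (simp add: of_nat_diff algebra_simps)
  next
    fix k assume k: "k < s"
    define j where "j = s - Suc k"
    have j: "s - k = Suc j" "s - Suc k = j" "Suc j \<le> s" using k by (auto simp: j_def)
    have "weitzenboeck (Const (tau_coeff ?w (s - k)) * (dhat n ^^ (s - k)) z)
        = Const (tau_coeff ?w (Suc j)) * (Const (of_int ((int j + 1) * (?w - int j))) * (dhat n ^^ j) z)"
      unfolding j weitzenboeck_Const_mult weitzenboeck_dhat_pow[OF zb] dz by (simp add: dhat_pow_0)
    also have "\<dots> = - (Const (tau_coeff ?w j) * (dhat n ^^ j) z)"
    proof (cases "z = 0")
      case False
      then have "tau_coeff ?w (Suc j) * of_int ((int j + 1) * (?w - int j)) = - (tau_coeff ?w j :: 'k)"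
        using s j by (intro tau_coeff_step) auto
      then show ?thesis unfolding Const_mult_mult by (simp add: Const_uminus)
    qed (simp add: dhat_pow_0)
    finally show "weitzenboeck (Const (tau_coeff ?w (s - k)) * (dhat n ^^ (s - k)) z)
        = - (Const (tau_coeff ?w (s - Suc k)) * (dhat n ^^ (s - Suc k)) z)"
      unfolding j .
  qed (use dz in \<open>simp add: weitzenboeck_Const_mult\<close>)
qed

lemma tau_hwv:
  fixes z :: "'k::field_char_0 mpoly"
  assumes "z \<in> hwv n m w" "int s \<le> w" "s \<le> n"
  shows "tau n s z \<in> hwv n (Suc m) (w + int n - 2 * int s)"
proof -
  have eq: "w + int n - 2 * int s - int n + 2 * int s = w" by simp
  have "chain n m (w + int n - 2 * int s) s (\<lambda>k. Const (tau_coeff w (s - k)) * (dhat n ^^ (s - k)) z)"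
    using chain_tau[of z n m "w + int n - 2 * int s" s] assms unfolding eq by auto
  from chain_sum_hwv[OF this assms(3)] show ?thesis
    using assms(1) by (subst tau_bihom[of z n m w]) (auto simp: hwv_def)
qed

text \<open>
  The span of all \<open>\<tau>\<^sub>i\<close> with \<open>i < s\<close> that land in degree \<open>m + 1\<close> and weight \<open>W\<close>. The filtration by
  \<open>s\<close> makes it possible to neglect lower terms.
\<close>

definition tau_span :: "nat \<Rightarrow> nat \<Rightarrow> int \<Rightarrow> nat \<Rightarrow> 'k::field_char_0 mpoly set"
  where "tau_span n m W s = vs.span {tau n i z |i z. i < s \<and> i \<le> n \<and>
      z \<in> hwv n m (W - int n + 2 * int i) \<and> int i \<le> W - int n + 2 * int i}"

lemma tau_span_mono: "s \<le> s' \<Longrightarrow> tau_span n m W s \<subseteq> tau_span n m W s'"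
  unfolding tau_span_def by (intro vs.span_mono) force

text \<open>
  In a finite-dimensional representation of \<open>sl\<^sub>2\<close> a nonzero highest weight vector of weight \<open>w\<close> is
  not in the image of \<open>d\<^sup>w\<^sup>+\<^sup>1\<close>; hence the top entry of a long chain vanishes.
\<close>

lemma chain_top:
  fixes u :: "nat \<Rightarrow> 'k::field_char_0 mpoly"
  assumes u: "chain n m W s u"
  shows "int s \<le> W - int n + 2 * int s \<or> u s = 0"
proof -
  have "u s = 0" if less: "\<not> int s \<le> W - int n + 2 * int s"
  proof -
    define w where "w = W - int n + 2 * int s"
    define k where "k = nat (w + 1)"
    have k: "k \<le> s" using less by (auto simp: k_def w_def)
    have "(weitzenboeck ^^ i) (u (s - k)) = (- 1) ^ i * u (s - k + i)" if "s - k + i \<le> s" for i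
      using that
    proof (induction i)
      case (Suc i)
      have "(- 1 :: 'k mpoly) = Const (- 1)" by (simp add: Const_uminus)
      then have m: "(- 1 :: 'k mpoly) ^ i = Const ((- 1) ^ i)" by (simp only: Const_power)
      have "weitzenboeck (u (s - k + i)) = - u (Suc (s - k + i))" using u Suc.prems
          by (auto simp: chain_def)
      then show ?case using Suc by (simp add: m weitzenboeck_Const_mult)
    qed simp
    from this[of k] have pow: "(weitzenboeck ^^ k) (u (s - k)) = (- 1) ^ k * u s" using k by simp
    have "(- 1 :: 'k mpoly) = Const (- 1)" by (simp add: Const_uminus)
    then have m: "(- 1 :: 'k mpoly) ^ k = Const ((- 1) ^ k)" by (simp only: Const_power)
    have "(weitzenboeck ^^ Suc k) (u (s - k)) = 0"
      using pow u by (simp add: m weitzenboeck_Const_mult chain_def)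
    moreover have "u (s - k) \<in> bihom n m (W - int n + 2 * int (s - k))"
      using u by (auto simp: chain_def)
    moreover have "W - int n + 2 * int (s - k) = w - 2 * int k"
      using k by (simp add: w_def of_nat_diff)
    moreover have "int (Suc k) \<le> - (w - 2 * int k)"
      using k by (auto simp: k_def)
    ultimately have "u (s - k) = 0" by (metis weitzenboeck_pow_inj)
    then have "(- 1) ^ k * u s = 0" using pow by (simp add: weitzenboeck_pow_0)
    then show "u s = 0" by (simp add: m)
  qed
  then show ?thesis by blast
qed

text \<open>
  Subtracting from a chain the chain of \<open>\<tau>\<^sub>s\<close> of its top entry leaves a shorter chain, and the
  induction continues with that one.
\<close>

lemma chain_sum_minus_tau:
  fixes u :: "nat \<Rightarrow> 'k::field_char_0 mpoly"
  assumes "chain n m W s u" "s \<le> n"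
  shows "(\<Sum>k\<le>s. Var k * u k) - tau n s (u s) \<in> tau_span n m W s"
  using assms
proof (induction s arbitrary: u)
  case 0
  then have "u 0 \<in> bihom n m (W - int n)" by (auto simp: chain_def)
  then show ?case by (simp add: tau_0 tau_span_def vs.span_zero)
next
  case (Suc s)
  let ?w = "W - int n + 2 * int (Suc s)"
  define z where "z = u (Suc s)"
  define v where "v k = Const (tau_coeff ?w (Suc s - k)) * (dhat n ^^ (Suc s - k)) z" for k
  have z: "z \<in> hwv n m ?w" using Suc.prems by (auto simp: z_def hwv_def chain_def)
  have v: "chain n m W (Suc s) v"
    unfolding v_def[abs_def] using chain_top[OF Suc.prems(1)] by (intro chain_tau z) (auto simp: z_def)
  have tau: "tau n (Suc s) z = (\<Sum>k\<le>Suc s. Var k * v k)"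
    unfolding v_def using z by (intro tau_bihom[of z n m]) (auto simp: hwv_def)
  have top: "v (Suc s) = u (Suc s)" by (simp add: v_def tau_coeff_def z_def)
  have c: "chain n m W s (\<lambda>k. u k - v k)"
    using v Suc.prems top by (auto simp: chain_def weitzenboeck_diff intro!: bihom_diff)
  have "tau n s (u s - v s) \<in> tau_span n m W (Suc s)"
  proof (cases "int s \<le> W - int n + 2 * int s")
    case True
    have "u s - v s \<in> hwv n m (W - int n + 2 * int s)" using c by (auto simp: chain_def hwv_def)
    then show ?thesis unfolding tau_span_def using True Suc.prems(2)
      by (intro vs.span_base CollectI exI[of _ s] exI[of _ "u s - v s"]) auto
  next
    case False
    then have "u s - v s = 0" using chain_top[OF c] by auto
    then show ?thesis by (simp add: tau_span_def vs.span_zero)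
  qed
  moreover have "(\<Sum>k\<le>s. Var k * (u k - v k)) - tau n s (u s - v s) \<in> tau_span n m W (Suc s)"
    using Suc.IH[OF c] Suc.prems(2) tau_span_mono[of s "Suc s" n m W] by auto
  ultimately have "(\<Sum>k\<le>s. Var k * (u k - v k)) \<in> tau_span n m W (Suc s)"
    unfolding tau_span_def using vs.span_add by fastforce
  moreover have "(\<Sum>k\<le>Suc s. Var k * u k) - tau n (Suc s) (u (Suc s)) = (\<Sum>k\<le>s. Var k * (u k - v k))"
    unfolding z_def[symmetric] tau using top by (simp add: z_def sum_subtractf algebra_simps)
  ultimately show ?case by simp
qed

text \<open>
  Multiplying the chain of \<open>\<tau>\<^sub>s(g)\<close> by \<open>h\<close> gives a chain with top entry \<open>h g\<close>. So a factor \<open>g\<close> of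
  order at least \<open>s\<close> absorbs the whole operator, up to terms with smaller \<open>s\<close>; these terms are the
  higher transvectants of \<open>g\<close> and \<open>h\<close> in Gordan's method.
\<close>

lemma tau_mult_split:
  fixes g :: "'k::field_char_0 mpoly"
  assumes g: "g \<in> hwv n p a" and h: "h \<in> hwv n q b" and s: "int s \<le> a" "s \<le> n"
  shows "h * tau n s g - tau n s (h * g) \<in> tau_span n (q + p) (b + a + int n - 2 * int s) s"
proof -
  define v where "v k = Const (tau_coeff a (s - k)) * (dhat n ^^ (s - k)) g" for k
  define u where "u k = h * v k" for k
  have eq: "a + int n - 2 * int s - int n + 2 * int s = a" by simp
  have v: "chain n p (a + int n - 2 * int s) s v"
    unfolding v_def[abs_def] using chain_tau[of g n p "a + int n - 2 * int s" s] assms unfolding eq by auto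
  have "chain n (q + p) (b + a + int n - 2 * int s) s u"
    unfolding chain_def
  proof (intro conjI allI impI)
    fix k assume "k \<le> s"
    then show "u k \<in> bihom n (q + p) (b + a + int n - 2 * int s - int n + 2 * int k)"
      using bihom_mult[of h n q b "v k" p "a + int n - 2 * int s - int n + 2 * int k"] v h
      by (auto simp: u_def chain_def hwv_def algebra_simps)
  qed (use v h in \<open>auto simp: u_def weitzenboeck_mult hwv_def chain_def\<close>)
  from chain_sum_minus_tau[OF this s(2)] show ?thesis
    using tau_bihom[of g n p a s] g
    by (auto simp: u_def v_def tau_coeff_def hwv_def sum_distrib_left mult.left_commute)
qed

section \<open>Every seminvariant comes from lower degree\<close>

definition pdiff :: "nat \<Rightarrow> 'k::comm_ring_1 mpoly \<Rightarrow> 'k mpoly"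
  where "pdiff k = derivation_from (\<lambda>i. if i = k then 1 else 0)"

lemma pdiff_add: "pdiff k (p + q) = pdiff k p + pdiff k q"
  and pdiff_mult: "pdiff k (p * q) = pdiff k p * q + p * pdiff k q"
  and pdiff_Const [simp]: "pdiff k (Const c) = 0"
  and pdiff_0 [simp]: "pdiff k 0 = 0"
  and pdiff_Var: "pdiff k (Var i) = (if i = k then 1 else 0)"
  by (simp_all add: pdiff_def derivation_from_add derivation_from_mult derivation_from_Var)

lemma pdiff_bihom:
  assumes "p \<in> bihom n (Suc m) w" "k \<le> n"
  shows "pdiff k p \<in> bihom n m (w - int n + 2 * int k)"
proof -
  have "pdiff k p \<in> bihom n (Suc m - 1 + 0) (w + (2 * int k - int n))"
    unfolding pdiff_def by (rule derivation_from_bihom[OF _ assms(1)]) (auto simp: bihom_1)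
  then show ?thesis by (simp add: algebra_simps)
qed

text \<open>
  The partial derivatives of an element of the kernel form a chain, and by Euler's formula the sum
  of this chain is a multiple of the element itself.
\<close>

lemma weitzenboeck_pdiff: "weitzenboeck (pdiff k p) = pdiff k (weitzenboeck p) - pdiff (Suc k) p"
proof -
  have d1: "weitzenboeck 1 = 0" using weitzenboeck_Const[of 1] by simp
  have "(\<lambda>p. weitzenboeck (pdiff k p) - pdiff k (weitzenboeck p)) = (\<lambda>p. - pdiff (Suc k) p)"
  proof (rule derivation_unique)
    show "is_derivation (\<lambda>p. weitzenboeck (pdiff k p) - pdiff k (weitzenboeck p))"
      unfolding is_derivation_def
      by (simp add: weitzenboeck_add weitzenboeck_mult pdiff_add pdiff_mult algebra_simps)
    show "is_derivation (\<lambda>p. - pdiff (Suc k) p)"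
      unfolding is_derivation_def by (simp add: pdiff_add pdiff_mult algebra_simps)
    show "weitzenboeck (pdiff k (Var i)) - pdiff k (weitzenboeck (Var i)) = - pdiff (Suc k) (Var i)" for i
      by (cases i) (auto simp: pdiff_Var weitzenboeck_Var d1)
  qed
  then have "weitzenboeck (pdiff k p) - pdiff k (weitzenboeck p) = - pdiff (Suc k) p" by metis
  then show ?thesis by (simp add: algebra_simps)
qed

lemma pdiff_eq_0:
  assumes "p \<in> bihom n m w" "k > n"
  shows "pdiff k p = 0"
proof -
  have "i \<noteq> k" if "l \<in> Poly_Mapping.keys p" "i \<in> Poly_Mapping.keys l" for l i
    using that assms by (force simp: bihom_def bimons_def)
  then show ?thesis
    unfolding pdiff_def derivation_from_def by (intro sum.neutral ballI) auto
qed

lemma Euler: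
  fixes p :: "'k::comm_ring_1 mpoly"
  assumes "p \<in> bihom n m w"
  shows "(\<Sum>k\<le>n. Var k * pdiff k p) = Const (of_nat m) * p"
proof -
  have "(\<lambda>p. \<Sum>k\<le>n. Var k * pdiff k p) =
      (derivation_from (\<lambda>i. if i \<le> n then Const 1 * Var i else 0) :: 'k mpoly \<Rightarrow> _)"
  proof (rule derivation_unique)
    show "is_derivation (\<lambda>p. \<Sum>k\<le>n. Var k * pdiff k p :: 'k mpoly)"
      using is_derivation_derivation_from unfolding is_derivation_def pdiff_def
      by (simp add: derivation_from_add derivation_from_mult sum.distrib sum_distrib_left
          sum_distrib_right algebra_simps)
    fix i
    have "(\<Sum>k\<le>n. Var k * pdiff k (Var i)) = (\<Sum>k\<le>n. if k = i then Var i else (0 :: 'k mpoly))"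
      by (intro sum.cong) (auto simp: pdiff_def derivation_from_Var)
    then show "(\<Sum>k\<le>n. Var k * pdiff k (Var i)) =
        (derivation_from (\<lambda>i. if i \<le> n then Const 1 * Var i else 0) (Var i) :: 'k mpoly)"
      by (simp add: derivation_from_Var)
  qed (rule is_derivation_derivation_from)
  then have "(\<Sum>k\<le>n. Var k * pdiff k p) = derivation_from (\<lambda>i. if i \<le> n then Const 1 * Var i else 0) p"
    by (rule fun_cong)
  also have "\<dots> = Const (of_nat m) * p"
  proof (rule derivation_from_diagonal)
    fix k assume "k \<in> Poly_Mapping.keys p"
    then have "k \<in> bimons n m w" using assms by (auto simp: bihom_def)
    then show "Poly_Mapping.keys k \<subseteq> {..n} \<and> (\<Sum>i\<le>n. of_nat (Poly_Mapping.lookup k i) * 1) =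
        (of_nat m :: 'k)"
      by (auto simp: bimons_def mon_degree_def)
  qed
  finally show ?thesis .
qed

text \<open>
  Every element of the kernel of positive degree is therefore a combination of values \<open>\<tau>\<^sub>i(z)\<close> with
  \<open>z\<close> of one degree less.
\<close>

lemma hwv_Suc_subset_tau_span:
  fixes p :: "'k::field_char_0 mpoly"
  assumes "p \<in> hwv n (Suc m) W"
  shows "p \<in> tau_span n m W (Suc n)"
proof -
  have p: "p \<in> bihom n (Suc m) W" "weitzenboeck p = 0" using assms by (auto simp: hwv_def)
  have c: "chain n m W n (\<lambda>k. pdiff k p)"
    unfolding chain_def using p pdiff_eq_0[OF p(1), of "Suc n"]
    by (auto simp: weitzenboeck_pdiff intro: pdiff_bihom)
  have "tau n n (pdiff n p) \<in> tau_span n m W (Suc n)"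
  proof (cases "int n \<le> W - int n + 2 * int n")
    case True
    have "pdiff n p \<in> hwv n m (W - int n + 2 * int n)" using c by (auto simp: chain_def hwv_def)
    then show ?thesis unfolding tau_span_def using True
      by (intro vs.span_base CollectI exI[of _ n] exI[of _ "pdiff n p"]) auto
  next
    case False
    then have "pdiff n p = 0" using chain_top[OF c] by auto
    then show ?thesis by (simp add: tau_span_def vs.span_zero)
  qed
  moreover have "(\<Sum>k\<le>n. Var k * pdiff k p) - tau n n (pdiff n p) \<in> tau_span n m W (Suc n)"
    using chain_sum_minus_tau[OF c] tau_span_mono[of n "Suc n" n m W] by auto
  ultimately have "(\<Sum>k\<le>n. Var k * pdiff k p) \<in> tau_span n m W (Suc n)"
    unfolding tau_span_def using vs.span_add by fastforce
  then have "Const (of_nat (Suc m)) * p \<in> tau_span n m W (Suc n)" unfolding Euler[OF p(1)] .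
  then have "Const (1 / of_nat (Suc m)) * (Const (of_nat (Suc m)) * p) \<in> tau_span n m W (Suc n)"
    unfolding tau_span_def by (rule vs.span_scale)
  moreover have "(1 / of_nat (Suc m)) * of_nat (Suc m) = (1 :: 'k)"
    using of_nat_neq_0[of m, where 'a = 'k] by (simp del: of_nat_Suc)
  ultimately show ?thesis by (simp only: Const_mult_mult Const_1 mult_1_left)
qed

section \<open>Dimension count\<close>

lemma bihom_eq_sum:
  assumes "p \<in> bihom n m w"
  shows "p = (\<Sum>k\<in>bimons n m w. Const (Poly_Mapping.lookup p k) * Poly_Mapping.single k 1)"
proof -
  have "p = (\<Sum>k\<in>Poly_Mapping.keys p. Poly_Mapping.single k (Poly_Mapping.lookup p k))"
    by (rule poly_mapping_sum_single)
  also have "\<dots> = (\<Sum>k\<in>bimons n m w. Poly_Mapping.single k (Poly_Mapping.lookup p k))"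
    using assms by (intro sum.mono_neutral_left) (auto simp: bihom_def in_keys_iff)
  finally show ?thesis by (simp add: Const_def mult_single)
qed

text \<open>
  An independent family in the kernel stays independent when preimages under \<open>d\<close> of the monomials
  of weight \<open>w + 2\<close> are added. The resulting bound shows that an independent family with as many
  elements as the difference of the two numbers of monomials is a basis.
\<close>

lemma independent_hwv_card_le:
  fixes S :: "'k::field_char_0 mpoly set"
  assumes S: "S \<subseteq> hwv n m w" "finite S" "vs.independent S" and w: "w \<ge> 0"
  shows "card S + card (bimons n m (w + 2)) \<le> card (bimons n m w)"
proof -
  let ?B = "bimons n m (w + 2)"
  have "\<exists>z\<in>bihom n m w. weitzenboeck z = (Poly_Mapping.single k 1 :: 'k mpoly)" if "k \<in> ?B" for k
    using weitzenboeck_surj[OF bihom_single[OF that]] w by auto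
  then obtain z where z: "\<And>k. k \<in> ?B \<Longrightarrow> z k \<in> bihom n m w"
      "\<And>k. k \<in> ?B \<Longrightarrow> weitzenboeck (z k) = (Poly_Mapping.single k 1 :: 'k mpoly)"
    by metis
  have inj: "inj_on z ?B"
    by (rule inj_onI) (metis z(2) keys_single one_neq_zero singleton_inject)
  have disj: "S \<inter> z ` ?B = {}"
  proof -
    have "weitzenboeck (z k) \<noteq> 0" if "k \<in> ?B" for k
      using z(2)[OF that] by (metis keys_single keys_zero insert_not_empty one_neq_zero)
    then show ?thesis using S(1) by (auto simp: hwv_def)
  qed
  have "vs.independent (S \<union> z ` ?B)"
  proof
    assume "vs.dependent (S \<union> z ` ?B)"
    then obtain u where u: "\<exists>v\<in>S \<union> z ` ?B. u v \<noteq> 0" "(\<Sum>v\<in>S \<union> z ` ?B. Const (u v) * v) = 0"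
      using vs.dependent_finite[of "S \<union> z ` ?B"] S(2) by auto
    have split: "(\<Sum>v\<in>S. Const (u v) * v) + (\<Sum>k\<in>?B. Const (u (z k)) * z k) = 0"
      using u(2) S(2) disj by (subst (asm) sum.union_disjoint) (auto simp: sum.reindex[OF inj])
    have "0 = weitzenboeck ((\<Sum>v\<in>S. Const (u v) * v) + (\<Sum>k\<in>?B. Const (u (z k)) * z k))"
      unfolding split by simp
    also have "\<dots> = (\<Sum>v\<in>S. Const (u v) * weitzenboeck v) + (\<Sum>k\<in>?B. Const (u (z k)) * weitzenboeck (z k))"
      by (simp only: weitzenboeck_add weitzenboeck_sum weitzenboeck_Const_mult)
    also have "(\<Sum>v\<in>S. Const (u v) * weitzenboeck v) = 0"
      using S(1) by (intro sum.neutral) (auto simp: hwv_def)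
    also have "(\<Sum>k\<in>?B. Const (u (z k)) * weitzenboeck (z k)) = (\<Sum>k\<in>?B. Poly_Mapping.single k (u (z k)))"
      using z(2) by (intro sum.cong) (auto simp: Const_def mult_single)
    finally have sum0: "(\<Sum>k\<in>?B. Poly_Mapping.single k (u (z k))) = 0" by simp
    have uz: "u (z l) = 0" if "l \<in> ?B" for l
    proof -
      have "0 = Poly_Mapping.lookup (\<Sum>k\<in>?B. Poly_Mapping.single k (u (z k))) l"
        unfolding sum0 by simp
      also have "\<dots> = (\<Sum>k\<in>?B. if k = l then u (z k) else 0)"
        unfolding Poly_Mapping.lookup_sum by (intro sum.cong) (auto simp: lookup_single when_def)
      also have "\<dots> = u (z l)" using that by simp
      finally show ?thesis by simp
    qed
    then have "(\<Sum>v\<in>S. Const (u v) * v) = 0" using split by simp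
    moreover have "\<exists>v\<in>S. u v \<noteq> 0" using u(1) uz by auto
    ultimately have "vs.dependent S" using vs.dependent_finite[OF S(2)] by blast
    then show False using S(3) by simp
  qed
  moreover have "S \<union> z ` ?B \<subseteq> vs.span ((\<lambda>k. Poly_Mapping.single k 1) ` bimons n m w)"
  proof
    fix p assume "p \<in> S \<union> z ` ?B"
    then have "p \<in> bihom n m w" using S(1) z(1) by (auto simp: hwv_def)
    then have eq: "p = (\<Sum>k\<in>bimons n m w. Const (Poly_Mapping.lookup p k) * Poly_Mapping.single k 1)"
      by (rule bihom_eq_sum)
    show "p \<in> vs.span ((\<lambda>k. Poly_Mapping.single k 1) ` bimons n m w)"
      by (rule ssubst[OF eq]) (intro vs.span_sum vs.span_scale vs.span_base imageI)
  qed
  ultimately have "card (S \<union> z ` ?B) \<le> card ((\<lambda>k. Poly_Mapping.single k (1 :: 'k)) ` bimons n m w)"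
    by (intro conjunct2[OF vs.independent_span_bound]) auto
  also have "\<dots> \<le> card (bimons n m w)" by (rule card_image_le) simp
  also have "card (S \<union> z ` ?B) = card S + card ?B"
    using S(2) disj by (subst card_Un_disjoint) (auto simp: card_image[OF inj])
  finally show ?thesis .
qed

lemma hwv_subset_span_family:
  fixes f :: "'i \<Rightarrow> 'k::field_char_0 mpoly"
  assumes J: "finite J" "\<And>j. j \<in> J \<Longrightarrow> f j \<in> hwv n m w" and w: "w \<ge> 0"
    and ind: "\<And>c. (\<Sum>j\<in>J. Const (c j) * f j) = 0 \<Longrightarrow> \<forall>j\<in>J. c j = 0"
    and card: "card (bimons n m w) \<le> card J + card (bimons n m (w + 2))"
  shows "hwv n m w \<subseteq> vs.span (f ` J)"
proof (rule ccontr)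
  have inj: "inj_on f J"
  proof (rule inj_onI, rule ccontr)
    fix i j assume ij: "i \<in> J" "j \<in> J" "f i = f j" "i \<noteq> j"
    define c where "c l = (if l = i then 1 else if l = j then - 1 else (0 :: 'k))" for l
    have "(\<Sum>l\<in>J. Const (c l) * f l) = (\<Sum>l\<in>{i, j}. Const (c l) * f l)"
      using ij J(1) by (intro sum.mono_neutral_right) (auto simp: c_def)
    also have "\<dots> = 0" using ij by (simp add: c_def Const_uminus)
    finally show False using ind[of c] ij(1) by (auto simp: c_def)
  qed
  have indep: "vs.independent (f ` J)"
  proof
    assume "vs.dependent (f ` J)"
    then obtain u where u: "\<exists>v\<in>f ` J. u v \<noteq> 0" "(\<Sum>v\<in>f ` J. Const (u v) * v) = 0"
      using vs.dependent_finite[of "f ` J"] J(1) by auto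
    then show False using ind[of "\<lambda>j. u (f j)"] by (auto simp: sum.reindex[OF inj])
  qed
  assume "\<not> hwv n m w \<subseteq> vs.span (f ` J)"
  then obtain p where p: "p \<in> hwv n m w" "p \<notin> vs.span (f ` J)" by blast
  then have "p \<notin> f ` J" using vs.span_base by blast
  have "vs.independent (insert p (f ` J))" using indep p(2) by (simp add: vs.independent_insert)
  then have "card (insert p (f ` J)) + card (bimons n m (w + 2)) \<le> card (bimons n m w)"
    using J p(1) w by (intro independent_hwv_card_le) auto
  then show False using card \<open>p \<notin> f ` J\<close> J(1) by (simp add: card_image[OF inj])
qed

section \<open>Products of generators\<close>

text \<open>
  An entry \<open>(g, a, b)\<close> of \<open>G\<close> is a generator together with its degree and its order.
\<close>

inductive gen_product :: "('k::field_char_0 mpoly \<times> nat \<times> nat) set \<Rightarrow> nat \<Rightarrow> int \<Rightarrow> 'k mpoly \<Rightarrow> bool"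
  for G where
  one: "gen_product G 0 0 1"
| mult: "(g, a, b) \<in> G \<Longrightarrow> gen_product G m w z \<Longrightarrow> gen_product G (a + m) (int b + w) (g * z)"

definition gen_span :: "('k::field_char_0 mpoly \<times> nat \<times> nat) set \<Rightarrow> nat \<Rightarrow> int \<Rightarrow> 'k mpoly set"
  where "gen_span G m w = vs.span {z. gen_product G m w z}"

lemma gen_product_mult:
  "gen_product G m w z \<Longrightarrow> gen_product G m' w' z' \<Longrightarrow> gen_product G (m + m') (w + w') (z * z')"
proof (induction rule: gen_product.induct)
  case one
  then show ?case by simp
next
  case (mult g a b m w z)
  then show ?case using gen_product.mult[of g a b G "m + m'" "w + w'" "z * z'"]
      by (simp add: add.assoc mult.assoc)
qed

lemma gen_product_gen: "(g, a, b) \<in> G \<Longrightarrow> gen_product G a (int b) g"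
  using gen_product.mult[OF _ gen_product.one, of g a b G] by simp

lemma gen_span_mult:
  assumes "p \<in> gen_span G m w" "q \<in> gen_span G m' w'"
  shows "p * q \<in> gen_span G (m + m') (w + w')"
proof -
  have 1: "z * q \<in> gen_span G (m + m') (w + w')" if z: "gen_product G m w z" for z
    using assms(2) unfolding gen_span_def
  proof (induction rule: vs.span_induct_alt)
    case base
    then show ?case by (simp add: vs.span_zero)
  next
    case (step c x y)
    have "z * x \<in> vs.span {z. gen_product G (m + m') (w + w') z}"
      using gen_product_mult[OF z, of m' w' x] step by (intro vs.span_base) auto
    then have "Const c * (z * x) + z * y \<in> vs.span {z. gen_product G (m + m') (w + w') z}"
      using step by (intro vs.span_add vs.span_scale) auto
    then show ?case by (simp add: algebra_simps)
  qed
  show ?thesis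
    using assms(1) unfolding gen_span_def
  proof (induction rule: vs.span_induct_alt)
    case base
    then show ?case by (simp add: vs.span_zero)
  next
    case (step c x y)
    have "Const c * (x * q) + y * q \<in> vs.span {z. gen_product G (m + m') (w + w') z}"
      using step 1[of x] by (intro vs.span_add vs.span_scale) (auto simp: gen_span_def)
    then show ?case by (simp add: algebra_simps)
  qed
qed

lemma gen_span_gen: "(g, a, b) \<in> G \<Longrightarrow> g \<in> gen_span G a (int b)"
  unfolding gen_span_def by (intro vs.span_base) (simp add: gen_product_gen)

lemma gen_span_1: "1 \<in> gen_span G 0 0"
  unfolding gen_span_def by (intro vs.span_base) (simp add: gen_product.one)

lemma gen_span_power: "p \<in> gen_span G m w \<Longrightarrow> p ^ j \<in> gen_span G (j * m) (int j * w)"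
proof (induction j)
  case (Suc j)
  then show ?case using gen_span_mult[of p G m w "p ^ j" "j * m" "int j * w"] by (simp add: algebra_simps)
qed (simp add: gen_span_1)

lemma gen_product_hwv:
  assumes "\<And>g a b. (g, a, b) \<in> G \<Longrightarrow> g \<in> hwv n a (int b)"
  shows "gen_product G m w z \<Longrightarrow> z \<in> hwv n m w"
proof (induction rule: gen_product.induct)
  case one
  show ?case using weitzenboeck_Const[of 1] by (simp add: hwv_def bihom_1)
qed (simp add: assms hwv_mult)

lemma gen_span_hwv:
  assumes "\<And>g a b. (g, a, b) \<in> G \<Longrightarrow> g \<in> hwv n a (int b)"
  shows "gen_span G m w \<subseteq> hwv n m w"
  unfolding gen_span_def using gen_product_hwv[OF assms]
  by (intro vs.span_minimal subspace_hwv) auto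

lemma hwv_degree_0: "(hwv n 0 w :: 'k::field_char_0 mpoly set) \<subseteq> gen_span G 0 w"
proof
  fix p :: "'k mpoly" assume "p \<in> hwv n 0 w"
  then have p: "p \<in> bihom n 0 w" by (simp add: hwv_def)
  have bi: "k = 0 \<and> w = 0" if "k \<in> bimons n 0 w" for k
  proof -
    have "Poly_Mapping.keys k \<subseteq> {..n}" "\<forall>i\<le>n. Poly_Mapping.lookup k i = 0"
      using that by (auto simp: bimons_def mon_degree_def)
    then have "Poly_Mapping.keys k = {}" by (meson atMost_iff in_keys_iff subsetD equals0I)
    then show ?thesis using that by (auto simp: bimons_def monomial_weight_def)
  qed
  show "p \<in> gen_span G 0 w"
  proof (cases "p = 0")
    case False
    then obtain x where x: "x \<in> Poly_Mapping.keys p" by (metis keys_eq_empty equals0I)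
    have sub: "Poly_Mapping.keys p \<subseteq> bimons n 0 w" using p by (simp add: bihom_def)
    then have "w = 0" "x = 0" "Poly_Mapping.keys p \<subseteq> {0}" using bi x by blast+
    then have "w = 0" "Poly_Mapping.keys p = {0}" using x by blast+
    then have "p = Const (Poly_Mapping.lookup p 0) * 1"
      using poly_mapping_sum_single[of p] by (simp add: Const_def)
    then show ?thesis
      using \<open>w = 0\<close> vs.span_scale[OF gen_span_1[unfolded gen_span_def], of "Poly_Mapping.lookup p 0" G]
      unfolding gen_span_def by metis
  qed (simp add: gen_span_def vs.span_zero)
qed

text \<open>
  By \<open>hwv_Suc_subset_tau_span\<close> it suffices to bound \<open>\<tau>\<^sub>s(z)\<close> for products \<open>z\<close> of generators. If \<open>z\<close>
  has two factors and the target weight is at least \<open>n - 1\<close>, then one of the factors has order at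
  least \<open>s\<close>, and \<open>tau_mult_split\<close> reduces the claim to lower degree and smaller \<open>s\<close>.
\<close>

theorem hwv_subset_gen_span:
  fixes G :: "('k::field_char_0 mpoly \<times> nat \<times> nat) set"
  assumes G: "\<And>g a b. (g, a, b) \<in> G \<Longrightarrow> g \<in> hwv n a (int b) \<and> a > 0"
    and x0: "(Var 0, 1, n) \<in> G"
    and low: "\<And>m w. w < int n - 1 \<Longrightarrow> hwv n m w \<subseteq> gen_span G m w"
    and single: "\<And>g a b s. (g, a, b) \<in> G \<Longrightarrow> 1 \<le> s \<Longrightarrow> s \<le> n \<Longrightarrow> s \<le> b \<Longrightarrow> b + 1 \<ge> 2 * s
      \<Longrightarrow> tau n s g \<in> gen_span G (Suc a) (int b + int n - 2 * int s)"
  shows "hwv n m w \<subseteq> gen_span G m w"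
proof (induction m arbitrary: w rule: less_induct)
  case (less m)
  show ?case
  proof (cases m)
    case 0
    then show ?thesis using hwv_degree_0 by blast
  next
    case (Suc d)
    show ?thesis
    proof (cases "w < int n - 1")
      case True
      then show ?thesis by (rule low)
    next
      case False
      have Gh: "g \<in> hwv n a (int b)" if "(g, a, b) \<in> G" for g a b using G that by blast
      have "tau_span n d w s \<subseteq> gen_span G (Suc d) w" for s
      proof (induction s)
        case 0
        then show ?case by (simp add: tau_span_def gen_span_def vs.span_zero)
      next
        case (Suc s)
        let ?v = "w - int n + 2 * int s"
        have tau: "tau n s z \<in> gen_span G (Suc d) w"
          if z: "gen_product G d ?v z" and s: "s \<le> n" "int s \<le> ?v" for z
          using z
        proof cases
          case one
          then have "s = 0" "w = int n" using s by auto
          then show ?thesis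
            using one gen_span_gen[OF x0] by (simp add: tau_0[OF bihom_1])
        next
          case (mult g a b m' w' z')
          note gG = \<open>(g, a, b) \<in> G\<close> and z' = \<open>gen_product G m' w' z'\<close>
          note eqs = \<open>d = a + m'\<close> \<open>?v = int b + w'\<close> \<open>z = g * z'\<close>
          have gz': "g \<in> hwv n a (int b)" "z' \<in> hwv n m' w'" "a > 0"
            using G gG gen_product_hwv[OF Gh z'] by blast+
          have gs: "g \<in> gen_span G a (int b)" "z' \<in> gen_span G m' w'"
            using gen_span_gen[OF gG] z' by (auto simp: gen_span_def intro: vs.span_base)
          have sums: "a + m' = d" "m' + a = d" "a + Suc m' = Suc d" "m' + Suc a = Suc d"
            "int b + w' + int n - 2 * int s = w" "w' + int b + int n - 2 * int s = w"
            "int b + (w' + int n - 2 * int s) = w" "w' + (int b + int n - 2 * int s) = w"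
            using eqs(1,2) by linarith+
          consider "s = 0" | "s \<ge> 1" "m' = 0" | "s \<ge> 1" "m' > 0" "int s \<le> w'" | "s \<ge> 1" "m' > 0" "s \<le> b"
            using False eqs(2) by linarith
          then show ?thesis
          proof cases
            case 1
            have "z \<in> bihom n d ?v" using gen_product_hwv[OF Gh z] by (simp add: hwv_def)
            then have "tau n s z = Var 0 * z" using 1 tau_0 by blast
            moreover have "gen_product G (1 + d) (int n + ?v) (Var 0 * z)"
              using gen_product.mult[OF x0 z] .
            ultimately show ?thesis using 1 by (auto simp: gen_span_def intro: vs.span_base)
          next
            case 2
            have z1: "z' = 1" "w' = 0" using z' 2(2) by (cases; use G in force)+
            then have w: "int b + int n - 2 * int s = w" using eqs by linarith
            then have "tau n s g \<in> gen_span G (Suc a) (int b + int n - 2 * int s)"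
              using single[OF gG 2(1) s(1)] s(2) False eqs(2) z1 by simp
            then show ?thesis unfolding w eqs z1 using 2 by simp
          next
            case 3
            have "tau n s z' \<in> gen_span G (Suc m') (w' + int n - 2 * int s)"
              using tau_hwv[OF gz'(2) 3(3) s(1)] less[of "Suc m'"] \<open>m = Suc d\<close> eqs(1) gz'(3) by auto
            from gen_span_mult[OF gs(1) this] have "g * tau n s z' \<in> gen_span G (Suc d) w"
              unfolding sums .
            moreover have "g * tau n s z' - tau n s z \<in> gen_span G (Suc d) w"
              using tau_mult_split[OF gz'(2,1) 3(3) s(1)] Suc.IH unfolding sums eqs(3) by blast
            ultimately have "g * tau n s z' - (g * tau n s z' - tau n s z) \<in> gen_span G (Suc d) w"
              unfolding gen_span_def by (rule vs.span_diff)
            then show ?thesis by simp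
          next
            case 4
            have "tau n s g \<in> gen_span G (Suc a) (int b + int n - 2 * int s)"
              using tau_hwv[OF gz'(1) _ s(1)] less[of "Suc a"] \<open>m = Suc d\<close> eqs(1) 4 by auto
            from gen_span_mult[OF gs(2) this] have "z' * tau n s g \<in> gen_span G (Suc d) w"
              unfolding sums .
            moreover have "z' * tau n s g - tau n s z \<in> gen_span G (Suc d) w"
              using tau_mult_split[OF gz'(1,2) _ s(1)] 4(3) Suc.IH
              unfolding sums eqs(3) mult.commute[of g] by auto
            ultimately have "z' * tau n s g - (z' * tau n s g - tau n s z) \<in> gen_span G (Suc d) w"
              unfolding gen_span_def by (rule vs.span_diff)
            then show ?thesis by simp
          qed
        qed
        have "tau n s z \<in> gen_span G (Suc d) w"
          if z: "z \<in> hwv n d ?v" and s: "s \<le> n" "int s \<le> ?v" for z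
        proof -
          have "z \<in> vs.span {z. gen_product G d ?v z}"
            using less[of d] \<open>m = Suc d\<close> z by (auto simp: gen_span_def)
          then have "z \<in> bihom n d ?v \<and> tau n s z \<in> gen_span G (Suc d) w"
          proof (induction rule: vs.span_induct_alt)
            case base
            then show ?case by (simp add: gen_span_def vs.span_zero)
          next
            case (step c x y)
            have x: "x \<in> bihom n d ?v" using gen_product_hwv[OF Gh] step(1) by (auto simp: hwv_def)
            have "tau n s (Const c * x + y) = Const c * tau n s x + tau n s y"
              using tau_add[OF bihom_Const_mult[OF x]] tau_Const_mult[OF x] step by simp
            then show ?case
              using tau[of x] step s x
              by (auto simp: gen_span_def intro!: bihom_add bihom_Const_mult vs.span_add vs.span_scale)
          qed
          then show ?thesis by blast
        qed
        then have "{tau n i z |i z. i < Suc s \<and> i \<le> n \<and> z \<in> hwv n d (w - int n + 2 * int i) \<and>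
            int i \<le> w - int n + 2 * int i} \<subseteq> gen_span G (Suc d) w"
          using Suc.IH by (fastforce simp: less_Suc_eq tau_span_def intro: vs.span_base)
        then show ?case
          unfolding tau_span_def[of n d w "Suc s"] gen_span_def
          by (intro vs.span_minimal) (auto intro: vs.subspace_span)
      qed
      then show ?thesis using hwv_Suc_subset_tau_span \<open>m = Suc d\<close> by blast
    qed
  qed
qed

section \<open>The dimensions of the bihomogeneous parts for the quintic\<close>

definition var_mons :: "nat set \<Rightarrow> nat \<Rightarrow> (nat \<Rightarrow>\<^sub>0 nat) set"
  where "var_mons I m = {k. Poly_Mapping.keys k \<subseteq> I \<and> (\<Sum>i\<in>I. Poly_Mapping.lookup k i) = m}"

lemma var_mons_0: "finite I \<Longrightarrow> var_mons I 0 = {0}"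
  by (auto simp: var_mons_def) (metis in_keys_iff keys_eq_empty subset_iff equals0I)

lemma var_mons_empty_Suc: "var_mons {} (Suc m) = {}"
  by (auto simp: var_mons_def)

lemma var_mons_insert_Suc:
  assumes "finite I" "r \<notin> I"
  shows "var_mons (insert r I) (Suc m) =
    var_mons I (Suc m) \<union> (\<lambda>k. k + Poly_Mapping.single r 1) ` var_mons (insert r I) m"
proof (intro set_eqI iffI)
  fix k assume k: "k \<in> var_mons (insert r I) (Suc m)"
  show "k \<in> var_mons I (Suc m) \<union> (\<lambda>k. k + Poly_Mapping.single r 1) ` var_mons (insert r I) m"
  proof (cases "Poly_Mapping.lookup k r = 0")
    case True
    then have "Poly_Mapping.keys k \<subseteq> I" using k by (auto simp: var_mons_def in_keys_iff)
    then have "k \<in> var_mons I (Suc m)" using k assms True by (simp add: var_mons_def)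
    then show ?thesis ..
  next
    case False
    let ?k = "k - Poly_Mapping.single r 1"
    have eq: "k = ?k + Poly_Mapping.single r 1"
      by (rule poly_mapping_eqI) (use False in \<open>auto simp: lookup_add lookup_minus lookup_single when_def\<close>)
    have "Poly_Mapping.keys ?k \<subseteq> insert r I" using k
        by (auto simp: var_mons_def in_keys_iff lookup_minus subset_iff)
    moreover have "Suc m = (\<Sum>i\<in>insert r I. Poly_Mapping.lookup (?k + Poly_Mapping.single r 1) i)"
      using k eq by (simp add: var_mons_def)
    then have "(\<Sum>i\<in>insert r I. Poly_Mapping.lookup ?k i) = m"
      using assms by (simp add: lookup_add lookup_single when_def sum.distrib)
    ultimately have "?k \<in> var_mons (insert r I) m" by (simp add: var_mons_def)
    then show ?thesis using eq by blast
  qed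
next
  fix k assume "k \<in> var_mons I (Suc m) \<union> (\<lambda>k. k + Poly_Mapping.single r 1) ` var_mons (insert r I) m"
  then show "k \<in> var_mons (insert r I) (Suc m)"
  proof
    assume "k \<in> var_mons I (Suc m)"
    then show ?thesis using assms by (auto simp: var_mons_def in_keys_iff subset_iff)
  next
    assume "k \<in> (\<lambda>k. k + Poly_Mapping.single r 1) ` var_mons (insert r I) m"
    then obtain l where l: "k = l + Poly_Mapping.single r 1" "l \<in> var_mons (insert r I) m" by blast
    have "Poly_Mapping.keys k \<subseteq> insert r I"
      using l keys_add[of l "Poly_Mapping.single r 1"] by (auto simp: var_mons_def)
    moreover have "(\<Sum>i\<in>insert r I. Poly_Mapping.lookup k i)
        = (\<Sum>i\<in>insert r I. Poly_Mapping.lookup l i) + (\<Sum>i\<in>insert r I. if i = r then 1 else 0)"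
      unfolding l(1) lookup_add sum.distrib
          by (intro arg_cong2[of _ _ _ _ "(+)"] sum.cong) (auto simp: lookup_single when_def)
    ultimately show ?thesis using l(2) assms(1) by (simp add: var_mons_def)
  qed
qed

lemma finite_var_mons [simp]: "finite I \<Longrightarrow> finite (var_mons I m)"
proof (induction I arbitrary: m rule: finite_induct)
  case empty
  show ?case by (cases m) (simp_all add: var_mons_0 var_mons_empty_Suc)
next
  case (insert r I)
  show ?case by (induction m) (use insert in \<open>simp_all add: var_mons_0 var_mons_insert_Suc\<close>)
qed

definition wt :: "(nat \<Rightarrow>\<^sub>0 nat) \<Rightarrow> int"
  where "wt k = (\<Sum>i\<in>Poly_Mapping.keys k. (5 - 2 * int i) * int (Poly_Mapping.lookup k i))"

lemma wt_superset: "finite I \<Longrightarrow> Poly_Mapping.keys k \<subseteq> I \<Longrightarrow>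
    wt k = (\<Sum>i\<in>I. (5 - 2 * int i) * int (Poly_Mapping.lookup k i))"
  unfolding wt_def by (intro sum.mono_neutral_left) (auto simp: in_keys_iff)

lemma wt_add: "wt (k + l) = wt k + wt l"
proof -
  let ?I = "Poly_Mapping.keys k \<union> Poly_Mapping.keys l"
  have "Poly_Mapping.keys (k + l) \<subseteq> ?I" by (rule keys_add)
  then show ?thesis
    by (subst (1 2 3) wt_superset[of ?I]) (auto simp: lookup_add distrib_left sum.distrib)
qed

lemma wt_single: "wt (Poly_Mapping.single i 1) = 5 - 2 * int i"
  by (simp add: wt_def)

lemma bimons_eq: "bimons 5 m w = {k \<in> var_mons {..5} m. wt k = w}"
proof -
  have "monomial_weight 5 k = wt k" if "Poly_Mapping.keys k \<subseteq> {..5}" for k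
    using that by (subst wt_superset[of "{..5}"])
      (auto simp: monomial_weight_def algebra_simps sum_subtractf sum_distrib_left)
  then show ?thesis by (auto simp: bimons_def var_mons_def mon_degree_def)
qed

text \<open>
  Coefficients are Laurent polynomials in \<open>t\<close>, encoded as finitely supported functions on the
  exponents; \<open>T j\<close> is \<open>t\<^sup>j\<close>, and the power series variable records the degree.
\<close>

type_synonym laurent = "int \<Rightarrow>\<^sub>0 int"

abbreviation T :: "int \<Rightarrow> laurent fps" where "T j \<equiv> fps_const (Poly_Mapping.single j 1)"

definition mon_series :: "nat set \<Rightarrow> laurent fps"
  where "mon_series I = Abs_fps (\<lambda>m. \<Sum>k\<in>var_mons I m. Poly_Mapping.single (wt k) 1)"

lemma mon_series_empty: "mon_series {} = 1"
proof (rule fps_ext)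
  show "fps_nth (mon_series {}) m = fps_nth 1 m" for m
    by (cases m) (simp_all add: mon_series_def var_mons_0 var_mons_empty_Suc wt_def)
qed

lemma mon_series_insert:
  assumes "finite I" "r \<notin> I"
  shows "mon_series (insert r I) * (1 - T (5 - 2 * int r) * fps_X) = mon_series I"
proof (rule fps_ext)
  fix m
  let ?s = "\<lambda>k. Poly_Mapping.single (wt k) (1 :: int)"
  have nth: "fps_nth (mon_series (insert r I) * (1 - T (5 - 2 * int r) * fps_X)) m
      = fps_nth (mon_series (insert r I)) m
        - (if m = 0 then 0 else Poly_Mapping.single (5 -
            2 * int r) 1 * fps_nth (mon_series (insert r I)) (m - 1))"
    by (simp add: algebra_simps flip: mult.assoc)
  show "fps_nth (mon_series (insert r I) * (1 - T (5 - 2 * int r) * fps_X)) m = fps_nth (mon_series I) m"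
  proof (cases m)
    case 0
    then show ?thesis unfolding nth using assms by (simp add: mon_series_def var_mons_0)
  next
    case (Suc l)
    have disj: "var_mons I (Suc l) \<inter> (\<lambda>k. k + Poly_Mapping.single r 1) ` var_mons (insert r I) l = {}"
    proof -
      have "r \<in> Poly_Mapping.keys (k + Poly_Mapping.single r 1)" for k :: "nat \<Rightarrow>\<^sub>0 nat"
        by (simp add: in_keys_iff lookup_add)
      then show ?thesis using assms(2) by (fastforce simp: var_mons_def)
    qed
    have "fps_nth (mon_series (insert r I)) (Suc l) = (\<Sum>k\<in>var_mons I (Suc l). ?s k)
        + (\<Sum>k\<in>(\<lambda>k. k + Poly_Mapping.single r 1) ` var_mons (insert r I) l. ?s k)"
      unfolding mon_series_def fps_nth_Abs_fps var_mons_insert_Suc[OF assms]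
      using assms disj by (intro sum.union_disjoint) auto
    also have "(\<Sum>k\<in>(\<lambda>k. k + Poly_Mapping.single r 1) ` var_mons (insert r I) l. ?s k)
        = (\<Sum>k\<in>var_mons (insert r I) l. Poly_Mapping.single (5 - 2 * int r) 1 * ?s k)"
      by (subst sum.reindex) (auto simp: inj_on_def wt_add wt_single mult_single add.commute simp
          del: One_nat_def intro!: sum.cong)
    finally show ?thesis
      unfolding nth using Suc by (simp add: mon_series_def sum_distrib_left)
  qed
qed

lemma lookup_mon_series:
  assumes "finite I"
  shows "Poly_Mapping.lookup (fps_nth (mon_series I) m) w = int (card {k \<in> var_mons I m. wt k = w})"
proof -
  have "Poly_Mapping.lookup (fps_nth (mon_series I) m) w = (\<Sum>k\<in>var_mons I m. if wt k = w then 1 else 0)"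
    unfolding mon_series_def fps_nth_Abs_fps Poly_Mapping.lookup_sum
    by (intro sum.cong) (auto simp: lookup_single when_def)
  also have "\<dots> = int (card {k \<in> var_mons I m. wt k = w})"
    using assms by (simp add: sum.If_cases Int_def)
  finally show ?thesis .
qed

definition tcoeff :: "int \<Rightarrow> laurent fps \<Rightarrow> int fps"
  where "tcoeff w F = Abs_fps (\<lambda>m. Poly_Mapping.lookup (fps_nth F m) w)"

lemma tcoeff_add: "tcoeff w (F + G) = tcoeff w F + tcoeff w G"
  and tcoeff_diff: "tcoeff w (F - G) = tcoeff w F - tcoeff w G"
  and tcoeff_uminus: "tcoeff w (- F) = - tcoeff w F"
  by (auto simp: tcoeff_def fps_eq_iff lookup_add lookup_minus)

lemma lookup_T_mult: "Poly_Mapping.lookup (Poly_Mapping.single j 1 * (p :: laurent)) w =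
    Poly_Mapping.lookup p (w - j)"
proof -
  have "Poly_Mapping.single j 1 * p = (\<Sum>i\<in>Poly_Mapping.keys p. Poly_Mapping.single (j +
      i) (Poly_Mapping.lookup p i))"
    by (subst poly_mapping_sum_single[of p]) (simp add: sum_distrib_left mult_single)
  then have "Poly_Mapping.lookup (Poly_Mapping.single j 1 * p) w
      = (\<Sum>i\<in>Poly_Mapping.keys p. if i = w - j then Poly_Mapping.lookup p i else 0)"
    unfolding \<open>Poly_Mapping.single j 1 * p = _\<close> Poly_Mapping.lookup_sum
    by (intro sum.cong refl) (auto simp: lookup_single when_def)
  also have "\<dots> = Poly_Mapping.lookup p (w - j)" by (subst sum.delta) (auto simp: in_keys_iff)
  finally show ?thesis .
qed

lemma tcoeff_T: "tcoeff w (T j * F) = tcoeff (w - j) F"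
  by (simp add: tcoeff_def lookup_T_mult)

lemma tcoeff_X: "tcoeff w (fps_X ^ k * F) = fps_X ^ k * tcoeff w F"
  by (simp add: tcoeff_def fps_eq_iff fps_X_power_mult_nth)

lemma mon_series_weights:
  assumes "finite I" "tcoeff w (mon_series I) \<noteq> 0"
  shows "\<exists>m k. k \<in> var_mons I m \<and> wt k = w"
proof (rule ccontr)
  assume "\<not> ?thesis"
  then have "Poly_Mapping.lookup (fps_nth (mon_series I) m) w = 0" for m
    unfolding lookup_mon_series[OF assms(1)] by (auto simp: card_eq_0_iff)
  then have "tcoeff w (mon_series I) = 0" by (simp add: tcoeff_def fps_eq_iff)
  then show False using assms(2) by simp
qed

lemma tcoeff_mon_series_positive: "w < 0 \<Longrightarrow> tcoeff w (mon_series {0,1,2}) = 0"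
proof (rule ccontr)
  assume "w < 0" "tcoeff w (mon_series {0,1,2}) \<noteq> 0"
  then obtain m k where k: "k \<in> var_mons {0,1,2} m" "wt k < 0"
    using mon_series_weights[of "{0,1,2}" w] by auto
  have "wt k = (\<Sum>i\<in>{0,1,2}. (5 - 2 * int i) * int (Poly_Mapping.lookup k i))"
    using k by (intro wt_superset) (auto simp: var_mons_def)
  then show False using k(2) by simp
qed

lemma tcoeff_mon_series_negative: "w > 0 \<Longrightarrow> tcoeff w (mon_series {3,4,5}) = 0"
proof (rule ccontr)
  assume "w > 0" "tcoeff w (mon_series {3,4,5}) \<noteq> 0"
  then obtain m k where k: "k \<in> var_mons {3,4,5} m" "wt k > 0"
    using mon_series_weights[of "{3,4,5}" w] by auto
  have "wt k = (\<Sum>i\<in>{3,4,5}. (5 - 2 * int i) * int (Poly_Mapping.lookup k i))"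
    using k by (intro wt_superset) (auto simp: var_mons_def)
  then show False using k(2) by simp
qed

lemma mon_series_012: "mon_series {0,1,2} * ((1 - T 5 * fps_X) * (1 - T 3 * fps_X) * (1 - T 1 * fps_X)) = 1"
  and mon_series_345: "mon_series {3,4,5} * ((1 - T (-1) * fps_X) * (1 - T (-3) * fps_X) * (1 -
      T (-5) * fps_X)) = 1"
  and mon_series_split: "mon_series {..5} = mon_series {0,1,2} * mon_series {3,4,5}"
proof -
  note ins = mon_series_insert[of "{}" 2] mon_series_insert[of "{2}" 1] mon_series_insert[of "{1,2}" 0]
    mon_series_insert[of "{}" 5] mon_series_insert[of "{5}" 4] mon_series_insert[of "{4,5}" 3]
    mon_series_insert[of "{3,4,5}" 2] mon_series_insert[of "{2,3,4,5}" 1] mon_series_insert[of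
        "{1,2,3,4,5}" 0]
  show 1: "mon_series {0,1,2} * ((1 - T 5 * fps_X) * (1 - T 3 * fps_X) * (1 - T 1 * fps_X)) = 1"
    using ins(1-3) by (simp add: mon_series_empty mult.assoc[symmetric])
  show "mon_series {3,4,5} * ((1 - T (-1) * fps_X) * (1 - T (-3) * fps_X) * (1 - T (-5) * fps_X)) = 1"
    using ins(4-6) by (simp add: mon_series_empty mult.assoc[symmetric])
  have set: "{..5::nat} = {0,1,2,3,4,5}" by auto
  have "mon_series {..5} * ((1 - T 5 * fps_X) * (1 - T 3 * fps_X) * (1 - T 1 * fps_X)) = mon_series {3,4,5}"
    using ins(7-9) unfolding set by (simp add: mult.assoc[symmetric])
  then have "mon_series {..5} * ((1 - T 5 * fps_X) * (1 - T 3 * fps_X) * (1 -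
      T 1 * fps_X)) * mon_series {0,1,2}
      = mon_series {3,4,5} * mon_series {0,1,2}" by simp
  then have "mon_series {..5} * (mon_series {0,1,2} * ((1 - T 5 * fps_X) * (1 - T 3 * fps_X) * (1 -
      T 1 * fps_X)))
      = mon_series {0,1,2} * mon_series {3,4,5}" by (simp add: mult_ac)
  then show "mon_series {..5} = mon_series {0,1,2} * mon_series {3,4,5}"
    unfolding 1 by simp
qed

text \<open>
  The numerators of the partial fraction decomposition of \<open>(1 - t\<^sup>-\<^sup>2) / \<Prod>\<^sub>i (1 - z t\<^sup>5\<^sup>-\<^sup>2\<^sup>i)\<close> into a
  part with nonnegative and a part with negative powers of \<open>t\<close>.
\<close>

definition num :: "nat \<Rightarrow> 'a::comm_ring_1 \<Rightarrow> 'a"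
  where "num j z = [1 + z^18, - z + z^5 + z^7 + z^11 + z^13 - z^19, z^2 + z^10 - z^14 + z^16,
    - z + z^5 + z^9 + z^15 - z^17 - z^19, z^2 + z^4 - z^6 - z^12 - z^16 + z^20,
    - (z^5) + z^7 - z^11 - z^19, z^2 - z^8 - z^10 - z^14 - z^16 + z^20, - (z^3) - z^21] ! j"

text \<open>
  That decomposition with the denominators cleared and \<open>t\<^sup>9\<close> multiplied in; the proof compares the
  coefficients of \<open>t\<^sup>0, \<dots>, t\<^sup>1\<^sup>6\<close>.
\<close>

lemma partial_fraction_identity_cleared:
  fixes z t :: "'a::idom"
  shows "(\<Sum>j<8. num j z * t^j)
      * (t^9 - z * t^8 - z * t^6 - z * t^4 + z^2 * t^5 + z^2 * t^3 + z^2 * t - z^3)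
    - (\<Sum>j<8. num j z * t^(7 - j)) * ((1 - t^5 * z) * (1 - t^3 * z) * (1 - t * z))
    = (t^9 - t^7) * ((1 - z^4) * (1 - z^8) * (1 - z^12))"
proof -
  define n0 n1 n2 n3 n4 n5 n6 n7 where n: "n0 = num 0 z" "n1 = num 1 z" "n2 = num 2 z" "n3 = num 3 z"
    "n4 = num 4 z" "n5 = num 5 z" "n6 = num 6 z" "n7 = num 7 z"
  have S1: "(\<Sum>j<8. num j z * t^j)
      = n0 + n1 * t + n2 * t^2 + n3 * t^3 + n4 * t^4 + n5 * t^5 + n6 * t^6 + n7 * t^7"
    by (simp add: n eval_nat_numeral lessThan_Suc algebra_simps)
  have S2: "(\<Sum>j<8. num j z * t^(7 - j))
      = n0 * t^7 + n1 * t^6 + n2 * t^5 + n3 * t^4 + n4 * t^3 + n5 * t^2 + n6 * t + n7"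
    by (simp add: n eval_nat_numeral lessThan_Suc algebra_simps)
  define D where "D = (1 - z^4) * (1 - z^8) * (1 - z^12)"
  have c:
    "0 - z^3 * n0 - n7 = 0"
    "z^2 * n0 - z^3 * n1 - n6 + z * n7 = 0"
    "z^2 * n1 - z^3 * n2 - n5 + z * n6 = 0"
    "z^2 * n0 + z^2 * n2 - z^3 * n3 - n4 + z * n5 + z * n7 = 0"
    "0 - z * n0 + z^2 * n1 + z^2 * n3 - n3 - z^3 * n4 + z * n4 + z * n6 - z^2 * n7 = 0"
    "z^2 * n0 - z * n1 + z^2 * n2 - n2 + z * n3 + z^2 * n4 - z^3 * n5 + z * n5 - z^2 * n6 + z * n7 = 0"
    "0 - z * n0 + z^2 * n1 - n1 - z * n2 + z * n2 + z^2 * n3 + z * n4 + z^2 * n5 - z^2 * n5 -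
        z^3 * n6 + z * n6 - z^2 * n7 = 0"
    "0 - n0 - z * n1 + z * n1 + z^2 * n2 - z * n3 + z * n3 + z^2 * n4 - z^2 * n4 + z * n5 +
        z^2 * n6 - z^2 * n6 - z^3 * n7 = - D"
    "0 - z * n0 + z * n0 - z * n2 + z * n2 + z^2 * n3 - z^2 * n3 - z * n4 + z * n4 + z^2 * n5 -
        z^2 * n5 + z^2 * n7 - z^2 * n7 = 0"
    "n0 - z * n1 + z * n1 - z^2 * n2 - z * n3 + z * n3 + z^2 * n4 - z^2 * n4 - z * n5 + z^2 * n6 -
        z^2 * n6 + z^3 * n7 = D"
    "z * n0 + n1 - z^2 * n1 - z * n2 + z * n2 - z^2 * n3 - z * n4 + z^2 * n5 - z^2 * n5 - z * n6 +
        z^3 * n6 + z^2 * n7 = 0"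
    "0 - z^2 * n0 + z * n1 + n2 - z^2 * n2 - z * n3 - z^2 * n4 - z * n5 + z^3 * n5 + z^2 * n6 - z * n7 = 0"
    "z * n0 - z^2 * n1 + n3 - z^2 * n3 - z * n4 + z^3 * n4 - z * n6 + z^2 * n7 = 0"
    "0 - z^2 * n0 - z^2 * n2 + z^3 * n3 + n4 - z * n5 - z * n7 = 0"
    "0 - z^2 * n1 + z^3 * n2 + n5 - z * n6 = 0"
    "0 - z^2 * n0 + z^3 * n1 + n6 - z * n7 = 0"
    "z^3 * n0 + n7 = 0"
    unfolding n D_def num_def by (simp_all, algebra+)
  have "(n0 + n1 * t + n2 * t^2 + n3 * t^3 + n4 * t^4 + n5 * t^5 + n6 * t^6 + n7 * t^7)
      * (t^9 - z * t^8 - z * t^6 - z * t^4 + z^2 * t^5 + z^2 * t^3 + z^2 * t - z^3)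
    - (n0 * t^7 + n1 * t^6 + n2 * t^5 + n3 * t^4 + n4 * t^3 + n5 * t^2 + n6 * t + n7)
      * ((1 - t^5 * z) * (1 - t^3 * z) * (1 - t * z))
    = (0 - z^3 * n0 - n7) * t^0
      + (z^2 * n0 - z^3 * n1 - n6 + z * n7) * t^1
      + (z^2 * n1 - z^3 * n2 - n5 + z * n6) * t^2
      + (z^2 * n0 + z^2 * n2 - z^3 * n3 - n4 + z * n5 + z * n7) * t^3
      + (0 - z * n0 + z^2 * n1 + z^2 * n3 - n3 - z^3 * n4 + z * n4 + z * n6 - z^2 * n7) * t^4
      + (z^2 * n0 - z * n1 + z^2 * n2 - n2 + z * n3 + z^2 * n4 - z^3 * n5 + z * n5 - z^2 * n6 +
          z * n7) * t^5
      + (0 - z * n0 + z^2 * n1 - n1 - z * n2 + z * n2 + z^2 * n3 + z * n4 + z^2 * n5 - z^2 * n5 -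
          z^3 * n6 + z * n6 - z^2 * n7) * t^6
      + (0 - n0 - z * n1 + z * n1 + z^2 * n2 - z * n3 + z * n3 + z^2 * n4 - z^2 * n4 + z * n5 +
          z^2 * n6 - z^2 * n6 - z^3 * n7) * t^7
      + (0 - z * n0 + z * n0 - z * n2 + z * n2 + z^2 * n3 - z^2 * n3 - z * n4 + z * n4 + z^2 * n5 -
          z^2 * n5 + z^2 * n7 - z^2 * n7) * t^8
      + (n0 - z * n1 + z * n1 - z^2 * n2 - z * n3 + z * n3 + z^2 * n4 - z^2 * n4 - z * n5 +
          z^2 * n6 - z^2 * n6 + z^3 * n7) * t^9
      + (z * n0 + n1 - z^2 * n1 - z * n2 + z * n2 - z^2 * n3 - z * n4 + z^2 * n5 - z^2 * n5 -
          z * n6 + z^3 * n6 + z^2 * n7) * t^10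
      + (0 - z^2 * n0 + z * n1 + n2 - z^2 * n2 - z * n3 - z^2 * n4 - z * n5 + z^3 * n5 + z^2 * n6 -
          z * n7) * t^11
      + (z * n0 - z^2 * n1 + n3 - z^2 * n3 - z * n4 + z^3 * n4 - z * n6 + z^2 * n7) * t^12
      + (0 - z^2 * n0 - z^2 * n2 + z^3 * n3 + n4 - z * n5 - z * n7) * t^13
      + (0 - z^2 * n1 + z^3 * n2 + n5 - z * n6) * t^14
      + (0 - z^2 * n0 + z^3 * n1 + n6 - z * n7) * t^15
      + (z^3 * n0 + n7) * t^16"
    by algebra
  also have "\<dots> = (t^9 - t^7) * D"
    unfolding c by (simp add: algebra_simps)
  finally show ?thesis unfolding S1 S2 D_def .
qed

lemma partial_fraction_identity:
  fixes z t u :: "'a::idom"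
  assumes "t * u = 1"
  shows "(\<Sum>j<8. num j z * t^j) * ((1 - u * z) * (1 - u^3 * z) * (1 - u^5 * z))
      - u^2 * (\<Sum>j<8. num j z * u^j) * ((1 - t^5 * z) * (1 - t^3 * z) * (1 - t * z))
    = (1 - u^2) * ((1 - z^4) * (1 - z^8) * (1 - z^12))" (is "?L = ?R")
proof -
  have cancel: "t ^ p * u ^ q = t ^ (p - q)" if "q \<le> p" for p q
  proof -
    have "t ^ p = t ^ (p - q) * t ^ q" using that by (simp flip: power_add)
    then show ?thesis using assms by (simp add: mult.assoc flip: power_mult_distrib)
  qed
  have A: "t^9 * ((1 - u * z) * (1 - u^3 * z) * (1 - u^5 * z))
      = t^9 - z * t^8 - z * t^6 - z * t^4 + z^2 * t^5 + z^2 * t^3 + z^2 * t - z^3"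
  proof -
    have "t^9 * ((1 - u * z) * (1 - u^3 * z) * (1 - u^5 * z))
      = t^9 - z * (t^9 * u^1) - z * (t^9 * u^3) - z * (t^9 * u^5) + z^2 * (t^9 * u^4) + z^2 * (t^9 * u^6)
        + z^2 * (t^9 * u^8) - z^3 * (t^9 * u^9)" by algebra
    then show ?thesis by (simp only: cancel) simp
  qed
  have B: "t^9 * (u^2 * (\<Sum>j<8. num j z * u^j)) = (\<Sum>j<8. num j z * t^(7 - j))"
    unfolding sum_distrib_left
  proof (intro sum.cong refl)
    fix j :: nat assume "j \<in> {..<8}"
    then have "t^9 * u^(j + 2) = t^(9 - (j + 2))" by (intro cancel) auto
    moreover have "9 - (j + 2) = 7 - j" by simp
    ultimately have "t^9 * u^(j + 2) = t^(7 - j)" by (simp only:)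
    moreover have "t^9 * (u^2 * (num j z * u^j)) = num j z * (t^9 * u^(j + 2))"
      by (simp only: power_add mult_ac)
    ultimately show "t^9 * (u^2 * (num j z * u^j)) = num j z * t^(7 - j)" by (simp only:)
  qed
  have C: "t^9 * (1 - u^2) = t^9 - t^7" using cancel[of 2 9] by (simp add: right_diff_distrib)
  have "t^9 * ?L = t^9 * ?R"
  proof -
    have "t^9 * (a * q - u^2 * b * p) = a * (t^9 * q) - (t^9 * (u^2 * b)) * p" for a b p q
      by algebra
    then show ?thesis
      using partial_fraction_identity_cleared[of z t] unfolding A[symmetric] B[symmetric] C[symmetric]
      by (simp only: mult.assoc)
  qed
  then have "u^9 * t^9 * ?L = u^9 * t^9 * ?R" by (simp only: mult.assoc)
  moreover have "u^9 * t^9 = 1" using assms by (simp add: mult.commute flip: power_mult_distrib)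
  ultimately show ?thesis by simp
qed

text \<open>
  \<open>dim_series w\<close> turns out to be the Hilbert series of the covariants of order \<open>w\<close>, \<open>D_series\<close> is
  the denominator that belongs to invariants of degrees 4, 8 and 12, and \<open>u_series w\<close> counts the
  monomials of weight \<open>w\<close> in the variables of positive weight \<open>x\<^sub>0, x\<^sub>1, x\<^sub>2\<close> by their degree.
\<close>

definition dim_series :: "int \<Rightarrow> int fps"
  where "dim_series w = Abs_fps (\<lambda>m. int (card (bimons 5 m w)) - int (card (bimons 5 m (w + 2))))"

definition D_series :: "int fps"
  where "D_series = (1 - fps_X^4) * (1 - fps_X^8) * (1 - fps_X^12)"

definition u_series :: "int \<Rightarrow> int fps"
  where "u_series w = tcoeff w (mon_series {0,1,2})"

lemma T_add: "T i * T j = T (i + j)"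
  by (simp add: mult_single)

lemma T_power: "T i ^ k = T (int k * i)"
  by (induction k) (simp_all add: mult_single algebra_simps)

lemma tcoeff_X1: "tcoeff w (fps_X * F) = fps_X * tcoeff w F"
  using tcoeff_X[of w 1 F] by simp

lemma tcoeff_X_poly:
  "tcoeff w ((1 - fps_X^4) * F) = (1 - fps_X^4) * tcoeff w F"
  "tcoeff w ((1 - fps_X^8) * F) = (1 - fps_X^8) * tcoeff w F"
  "tcoeff w ((1 - fps_X^12) * F) = (1 - fps_X^12) * tcoeff w F"
  by (simp_all add: left_diff_distrib tcoeff_diff tcoeff_X)

lemma tcoeff_num: "tcoeff w (num j fps_X * F) = num j fps_X * tcoeff w F" if "j < 8"
proof -
  have "j = 0 \<or> j = 1 \<or> j = 2 \<or> j = 3 \<or> j = 4 \<or> j = 5 \<or> j = 6 \<or> j = 7" using that by auto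
  then show ?thesis
    by (elim disjE) (simp_all add: num_def distrib_right left_diff_distrib tcoeff_add tcoeff_diff
        tcoeff_uminus tcoeff_X tcoeff_X1)
qed

lemma tcoeff_sum: "tcoeff w (\<Sum>i\<in>I. F i) = (\<Sum>i\<in>I. tcoeff w (F i))"
  by (simp add: tcoeff_def fps_eq_iff fps_sum_nth Poly_Mapping.lookup_sum)

lemma dim_series_eq: "dim_series w = tcoeff w ((1 - T (-2)) * mon_series {..5})"
proof -
  have "tcoeff w ((1 - T (-2)) * mon_series {..5}) = tcoeff w (mon_series {..5}) - tcoeff (w +
      2) (mon_series {..5})"
    by (simp add: left_diff_distrib tcoeff_diff tcoeff_T)
  then show ?thesis
    by (simp add: fps_eq_iff dim_series_def tcoeff_def lookup_mon_series bimons_eq)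
qed

text \<open>
  The generating function of \<open>dim_series\<close> is \<open>(1 - t\<^sup>-\<^sup>2) / \<Prod>\<^sub>i (1 - z t\<^sup>5\<^sup>-\<^sup>2\<^sup>i)\<close>. In its partial
  fraction decomposition the part with denominators \<open>1 - z t\<^sup>-\<^sup>1, 1 - z t\<^sup>-\<^sup>3, 1 - z t\<^sup>-\<^sup>5\<close> contains
  negative powers of \<open>t\<close> only, so the coefficient of \<open>t\<^sup>w\<close> can be read off from the other part.
\<close>

theorem D_dim_series:
  assumes "w \<ge> 0"
  shows "D_series * dim_series w = (\<Sum>j<8. num j fps_X * u_series (w - int j))"
proof -
  let ?U = "mon_series {0,1,2}" and ?V = "mon_series {3,4,5}"
  define P where "P = (1 - T 5 * fps_X) * (1 - T 3 * fps_X) * (1 - T 1 * fps_X)"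
  define Q where "Q = (1 - T (-1) * fps_X) * (1 - T (-3) * fps_X) * (1 - T (-5) * fps_X)"
  define N where "N = (\<Sum>j<8. num j fps_X * T 1 ^ j)"
  define N' where "N' = (\<Sum>j<8. num j fps_X * T (-1) ^ j)"
  define D :: "laurent fps" where "D = (1 - fps_X^4) * (1 - fps_X^8) * (1 - fps_X^12)"
  have "T 1 * T (-1) = 1" by (simp add: T_add del: fps_const_mult)
  from partial_fraction_identity[OF this, of fps_X]
  have key: "N * Q - T (-2) * N' * P = (1 - T (-2)) * D"
    unfolding N_def N'_def P_def Q_def D_def T_power by simp
  have UP: "?U * P = 1" and VQ: "?V * Q = 1" and UV: "mon_series {..5} = ?U * ?V"
    using mon_series_012 mon_series_345 mon_series_split by (simp_all add: P_def Q_def)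
  have "D * ((1 - T (-2)) * mon_series {..5}) = (N * Q - T (-2) * N' * P) * (?U * ?V)"
    unfolding key UV by (simp only: mult_ac)
  also have "\<dots> = N * ?U * (?V * Q) - T (-2) * N' * ?V * (?U * P)"
    by (simp only: left_diff_distrib right_diff_distrib mult_ac)
  also have "\<dots> = N * ?U - T (-2) * N' * ?V" unfolding UP VQ by simp
  finally have "tcoeff w (D * ((1 - T (-2)) * mon_series {..5})) = tcoeff w (N * ?U) -
      tcoeff w (T (-2) * N' * ?V)"
    by (simp only: tcoeff_diff)
  moreover have "tcoeff w (D * F) = D_series * tcoeff w F" for F
    unfolding D_def D_series_def by (simp only: mult.assoc tcoeff_X_poly)
  moreover have "tcoeff w (N * ?U) = (\<Sum>j<8. num j fps_X * u_series (w - int j))"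
    unfolding N_def sum_distrib_right tcoeff_sum
  proof (intro sum.cong refl)
    fix j :: nat assume "j \<in> {..<8}"
    then show "tcoeff w (num j fps_X * T 1 ^ j * ?U) = num j fps_X * u_series (w - int j)"
      by (simp only: mult.assoc tcoeff_num T_power tcoeff_T u_series_def lessThan_iff mult_1_right)
  qed
  moreover have "tcoeff w (T (-2) * N' * ?V) = 0"
    unfolding N'_def sum_distrib_right sum_distrib_left tcoeff_sum
  proof (intro sum.neutral ballI)
    fix j :: nat assume j: "j \<in> {..<8}"
    have "tcoeff w (T (-2) * (num j fps_X * T (-1) ^ j) * ?V) = num j fps_X * tcoeff (w + 2 + int j) ?V"
      using j by (simp only: mult.assoc tcoeff_T tcoeff_num T_power lessThan_iff) (simp add: algebra_simps)
    then show "tcoeff w (T (-2) * (num j fps_X * T (-1) ^ j) * ?V) = 0"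
      using tcoeff_mon_series_negative[of "w + 2 + int j"] assms by simp
  qed
  ultimately show ?thesis unfolding dim_series_eq by simp
qed

lemma u_series_negative: "w < 0 \<Longrightarrow> u_series w = 0"
  unfolding u_series_def by (rule tcoeff_mon_series_positive)

lemma u_series_rec:
  "u_series w = (if w = 0 then 1 else 0) + fps_X * (u_series (w - 1) + u_series (w - 3) + u_series (w - 5))
    - fps_X^2 * (u_series (w - 4) + u_series (w - 6) + u_series (w - 8)) + fps_X^3 * u_series (w - 9)"
proof -
  let ?U = "mon_series {0,1,2}"
  have "(1 - T 5 * fps_X) * (1 - T 3 * fps_X) * (1 - T 1 * fps_X)
      = 1 - fps_X * (T 1 + T 3 + T 5) + fps_X^2 * (T 1 * T 3 + T 1 * T 5 + T 3 * T 5) -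
          fps_X^3 * (T 1 * (T 3 * T 5))"
    by algebra
  also have "\<dots> = 1 - fps_X * (T 1 + T 3 + T 5) + fps_X^2 * (T 4 + T 6 + T 8) - fps_X^3 * T 9"
    by (simp add: T_add del: fps_const_mult)
  finally have "?U * (1 - fps_X * (T 1 + T 3 + T 5) + fps_X^2 * (T 4 + T 6 + T 8) - fps_X^3 * T 9) = 1"
    using mon_series_012 by simp
  then have "?U = 1 + fps_X * (T 1 * ?U + T 3 * ?U + T 5 * ?U) - fps_X^2 * (T 4 * ?U + T 6 * ?U + T 8 * ?U)
      + fps_X^3 * (T 9 * ?U)"
    by algebra
  then have "tcoeff w ?U = tcoeff w (1 + fps_X * (T 1 * ?U + T 3 * ?U + T 5 * ?U)
      - fps_X^2 * (T 4 * ?U + T 6 * ?U + T 8 * ?U) + fps_X^3 * (T 9 * ?U))" by (rule arg_cong)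
  moreover have "tcoeff w 1 = (if w = 0 then 1 else 0)"
    by (auto simp: tcoeff_def fps_eq_iff lookup_one when_def)
  ultimately show ?thesis
    unfolding u_series_def by (simp only: tcoeff_add tcoeff_diff tcoeff_X tcoeff_X1 tcoeff_T)
qed

lemma u_series_simps:
  "u_series 0 = 1" "u_series 1 = fps_X" "u_series 2 = fps_X^2" "u_series 3 = fps_X^3 + fps_X"
  "u_series 4 = fps_X^4 + fps_X^2" "u_series 5 = fps_X^5 + fps_X^3 + fps_X"
  "u_series 6 = fps_X^6 + fps_X^4 + 2 * fps_X^2" "u_series 7 = fps_X^7 + fps_X^5 + 2 * fps_X^3"
  "u_series 8 = fps_X^8 + fps_X^6 + 2 * fps_X^4 + fps_X^2"
proof -
  note [simp] = u_series_negative power2_eq_square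
  show u0: "u_series 0 = 1" by (subst u_series_rec) simp
  show u1: "u_series 1 = fps_X" by (subst u_series_rec) (simp add: u0)
  show u2: "u_series 2 = fps_X^2" by (subst u_series_rec) (simp add: u0 u1)
  show u3: "u_series 3 = fps_X^3 + fps_X" by (subst u_series_rec) (simp add: u0 u1 u2, algebra)
  show u4: "u_series 4 = fps_X^4 + fps_X^2" by (subst u_series_rec) (simp add: u0 u1 u2 u3, algebra)
  show u5: "u_series 5 = fps_X^5 + fps_X^3 + fps_X"
      by (subst u_series_rec) (simp add: u0 u1 u2 u3 u4, algebra)
  show u6: "u_series 6 = fps_X^6 + fps_X^4 + 2 * fps_X^2"
    by (subst u_series_rec) (simp add: u0 u1 u2 u3 u4 u5, algebra)
  show u7: "u_series 7 = fps_X^7 + fps_X^5 + 2 * fps_X^3"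
    by (subst u_series_rec) (simp add: u0 u1 u2 u3 u4 u5 u6, algebra)
  show "u_series 8 = fps_X^8 + fps_X^6 + 2 * fps_X^4 + fps_X^2"
    by (subst u_series_rec) (simp add: u0 u1 u2 u3 u4 u5 u6 u7, algebra)
qed

text \<open>
  The right-hand sides record the degrees of a basis over three invariants: for these orders the
  covariants form a free module, as the bases found below show.
\<close>

lemma D_dim_series_low:
  "D_series * dim_series 0 = 1 + fps_X^18"
  "D_series * dim_series 1 = fps_X^5 + fps_X^7 + fps_X^11 + fps_X^13"
  "D_series * dim_series 2 = fps_X^2 + fps_X^6 + fps_X^8 + fps_X^10 + fps_X^12 + fps_X^16"
  "D_series * dim_series 3 = fps_X^3 + fps_X^5 + fps_X^7 + 2 * fps_X^9 + fps_X^11 + fps_X^13 + fps_X^15"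
  "D_series * dim_series 4 = 2 * fps_X^4 + fps_X^6 + 2 * fps_X^8 + 2 * fps_X^10 + fps_X^12 + 2 * fps_X^14"
proof -
  have S: "(\<Sum>j<8. f j) = f 0 + f 1 + f 2 + f 3 + f 4 + f 5 + f 6 + f 7" for f :: "nat \<Rightarrow> int fps"
    by (simp add: eval_nat_numeral lessThan_Suc algebra_simps)
  note [simp] = D_dim_series S u_series_negative u_series_simps num_def
  show "D_series * dim_series 0 = 1 + fps_X^18" by simp
  show "D_series * dim_series 1 = fps_X^5 + fps_X^7 + fps_X^11 + fps_X^13" by (simp, algebra)
  show "D_series * dim_series 2 = fps_X^2 + fps_X^6 + fps_X^8 + fps_X^10 + fps_X^12 + fps_X^16"
      by (simp, algebra)
  show "D_series * dim_series 3 = fps_X^3 + fps_X^5 + fps_X^7 + 2 * fps_X^9 + fps_X^11 + fps_X^13 +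
      fps_X^15"
    by (simp, algebra)
  show "D_series * dim_series 4 = 2 * fps_X^4 + fps_X^6 + 2 * fps_X^8 + 2 * fps_X^10 + fps_X^12 +
      2 * fps_X^14"
    by (simp, algebra)
qed

section \<open>Evaluation at sums of three fifth powers\<close>

definition ev :: "(nat \<Rightarrow> 'k poly) \<Rightarrow> 'k::field_char_0 mpoly \<Rightarrow> 'k poly"
  where "ev x p = (\<Sum>k\<in>Poly_Mapping.keys p.
    smult (Poly_Mapping.lookup p k) (\<Prod>i\<in>Poly_Mapping.keys k. x i ^ Poly_Mapping.lookup k i))"

lemma ev_superset: "finite M \<Longrightarrow> Poly_Mapping.keys p \<subseteq> M \<Longrightarrow> ev x p = (\<Sum>k\<in>M.
    smult (Poly_Mapping.lookup p k) (\<Prod>i\<in>Poly_Mapping.keys k. x i ^ Poly_Mapping.lookup k i))"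
  unfolding ev_def by (rule sum.mono_neutral_left) (auto simp: in_keys_iff)

lemma ev_add: "ev x (p + q) = ev x p + ev x q"
proof -
  let ?M = "Poly_Mapping.keys p \<union> Poly_Mapping.keys q"
  have "Poly_Mapping.keys (p + q) \<subseteq> ?M" by (rule keys_add)
  then show ?thesis
    by (subst (1 2 3) ev_superset[of ?M]) (auto simp: lookup_add smult_add_left sum.distrib)
qed

lemma ev_0 [simp]: "ev x 0 = 0"
  by (simp add: ev_def)

lemma ev_sum: "ev x (\<Sum>i\<in>I. f i) = (\<Sum>i\<in>I. ev x (f i))"
  by (induction I rule: infinite_finite_induct) (auto simp: ev_add)

lemma ev_single:
  assumes "finite I" "Poly_Mapping.keys k \<subseteq> I"
  shows "ev x (Poly_Mapping.single k c) = smult c (\<Prod>i\<in>I. x i ^ Poly_Mapping.lookup k i)"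
proof -
  have "(\<Prod>i\<in>Poly_Mapping.keys k. x i ^ Poly_Mapping.lookup k i) = (\<Prod>i\<in>I. x i ^ Poly_Mapping.lookup k i)"
    using assms by (intro prod.mono_neutral_left) (auto simp: in_keys_iff)
  then show ?thesis
    by (subst ev_superset[of "{k}"]) auto
qed

lemma ev_Const [simp]: "ev x (Const c) = [:c:]"
  unfolding Const_def by (subst ev_single[of "{}"]) auto

lemma ev_Var: "ev x (Var i) = x i"
  unfolding Var_def by (subst ev_single[of "{i}"]) auto

lemma ev_mult: "ev x (p * q) = ev x p * ev x q"
proof -
  let ?s = "\<lambda>p k. Poly_Mapping.single k (Poly_Mapping.lookup p k)"
  have single: "ev x (Poly_Mapping.single k a * Poly_Mapping.single l b)
      = ev x (Poly_Mapping.single k a) * ev x (Poly_Mapping.single l b)" for k l a b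
  proof -
    let ?I = "Poly_Mapping.keys k \<union> Poly_Mapping.keys l"
    have "Poly_Mapping.keys (k + l) \<subseteq> ?I" by (rule keys_add)
    then show ?thesis
      unfolding mult_single
      by (subst (1 2 3) ev_single[of ?I]) (auto simp: lookup_add power_add prod.distrib mult_ac)
  qed
  have "p * q = (\<Sum>k\<in>Poly_Mapping.keys p. \<Sum>l\<in>Poly_Mapping.keys q. ?s p k * ?s q l)"
    unfolding sum_product[symmetric] by (simp only: poly_mapping_sum_single[symmetric])
  then have "ev x (p * q) = (\<Sum>k\<in>Poly_Mapping.keys p. \<Sum>l\<in>Poly_Mapping.keys q. ev x (?s p k) * ev x (?s q l))"
    by (simp only: ev_sum single)
  also have "\<dots> = ev x (\<Sum>k\<in>Poly_Mapping.keys p. ?s p k) * ev x (\<Sum>l\<in>Poly_Mapping.keys q. ?s q l)"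
    unfolding ev_sum sum_product ..
  finally show ?thesis by (simp only: poly_mapping_sum_single[symmetric])
qed

lemma ev_1 [simp]: "ev x 1 = 1"
  using ev_Const[of x 1] by (simp add: pCons_one)

lemma ev_power: "ev x (p ^ j) = ev x p ^ j"
  by (induction j) (simp_all add: ev_mult)

lemma ev_Const_mult: "ev x (Const c * p) = smult c (ev x p)"
  by (simp add: ev_mult)

lemma mpoly_induct [case_names Const Var add mult]:
  assumes "\<And>c. P (Const c)" "\<And>i. P (Var i)"
    and add: "\<And>p q. P p \<Longrightarrow> P q \<Longrightarrow> P (p + q)" and mult: "\<And>p q. P p \<Longrightarrow> P q \<Longrightarrow> P (p * q)"
  shows "P (p :: 'k::comm_ring_1 mpoly)"
proof -
  have P01: "P 0" "P 1" using assms(1)[of 0] assms(1)[of 1] by simp_all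
  have pow: "P (Poly_Mapping.single (Poly_Mapping.single i e) 1)" for i and e :: nat
  proof (induction e)
    case (Suc e)
    have "Poly_Mapping.single (Poly_Mapping.single i (Suc e)) (1 :: 'k)
        = Var i * Poly_Mapping.single (Poly_Mapping.single i e) 1"
      by (simp add: Var_def mult_single single_add[symmetric])
    then show ?case using mult[OF assms(2) Suc] by simp
  qed (use P01 in simp)
  have "P (Poly_Mapping.single (\<Sum>i\<in>A. Poly_Mapping.single i (g i)) 1)" for A and g :: "nat \<Rightarrow> nat"
  proof (induction A rule: infinite_finite_induct)
    case (insert i A)
    have "Poly_Mapping.single (\<Sum>i\<in>insert i A. Poly_Mapping.single i (g i)) (1 :: 'k)
        = Poly_Mapping.single (Poly_Mapping.single i (g i)) 1 * Poly_Mapping.single (\<Sum>i\<in>A.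
            Poly_Mapping.single i (g i)) 1"
      using insert.hyps by (simp add: mult_single)
    then show ?case using mult[OF pow insert.IH] by simp
  qed (use P01 in simp_all)
  then have mono: "P (Poly_Mapping.single k 1)" for k
    by (metis poly_mapping_sum_single)
  have "P (Poly_Mapping.single k c)" for k c
  proof -
    have "Poly_Mapping.single k c = Const c * Poly_Mapping.single k 1" by (simp add: Const_def mult_single)
    then show ?thesis using mult[OF assms(1) mono] by simp
  qed
  then have "P (\<Sum>k\<in>A. Poly_Mapping.single k (g k))" for A g
    by (induction A rule: infinite_finite_induct) (auto intro: add P01)
  then show ?thesis by (metis poly_mapping_sum_single)
qed

text \<open>
  By Sylvester's theorem a general binary quintic is a sum of three fifth powers. For
  \<open>a X\<^sup>5 + b (y X + Y)\<^sup>5 + c ((1 + y) X + Y)\<^sup>5\<close> the coefficient of \<open>X\<^sup>5\<^sup>-\<^sup>i Y\<^sup>i\<close>, divided by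
  \<open>5 choose i\<close>, is \<open>syl_var a b c i\<close>, a polynomial in \<open>y\<close>. The parameter \<open>y\<close> moves the quintic
  along the one-parameter group generated by \<open>dhat\<close>; hence \<open>dhat\<close> becomes differentiation by \<open>y\<close>,
  and an element of the kernel of order \<open>w\<close> becomes a polynomial of degree at most \<open>w\<close> in \<open>y\<close>.
\<close>

definition syl_var :: "'k::field_char_0 \<Rightarrow> 'k \<Rightarrow> 'k \<Rightarrow> nat \<Rightarrow> 'k poly"
  where "syl_var a b c i = (if i \<le> 5 then
    (if i = 0 then [:a:] else 0) + smult b ([:0, 1:] ^ (5 - i)) + smult c ([:1, 1:] ^ (5 - i)) else 0)"

definition syl :: "'k::field_char_0 \<Rightarrow> 'k \<Rightarrow> 'k \<Rightarrow> 'k mpoly \<Rightarrow> 'k poly"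
  where "syl a b c = ev (\<lambda>i. smult (1 / fact i) (syl_var a b c i))"

lemma syl_add: "syl a b c (p + q) = syl a b c p + syl a b c q"
  and syl_mult: "syl a b c (p * q) = syl a b c p * syl a b c q"
  and syl_power: "syl a b c (p ^ j) = syl a b c p ^ j"
  and syl_0 [simp]: "syl a b c 0 = 0"
  and syl_1 [simp]: "syl a b c 1 = 1"
  and syl_Const [simp]: "syl a b c (Const r) = [:r:]"
  and syl_sum: "syl a b c (\<Sum>i\<in>I. f i) = (\<Sum>i\<in>I. syl a b c (f i))"
  and syl_Var: "syl a b c (Var i) = smult (1 / fact i) (syl_var a b c i)"
  by (simp_all only: syl_def ev_add ev_mult ev_power ev_0 ev_1 ev_Const ev_sum ev_Var)

lemma syl_Const_mult: "syl a b c (Const r * p) = smult r (syl a b c p)"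
  by (simp add: syl_def ev_Const_mult)

lemma smult_sum_right: "smult r (\<Sum>i\<in>I. f i) = (\<Sum>i\<in>I. smult r (f i))"
  by (induction I rule: infinite_finite_induct) (simp_all add: smult_add_right)

lemma pderiv_syl_var: "pderiv (syl_var a b c i) = of_nat (5 - i) * syl_var a b c (Suc i)"
proof -
  consider "i < 5" | "i = 5" | "i > 5" by linarith
  then show ?thesis
  proof cases
    case 1
    then have e: "5 - i = Suc (5 - Suc i)" by simp
    have "pderiv (syl_var a b c i)
        = smult b (smult (of_nat (5 - i)) ([:0, 1:] ^ (5 - Suc i))) + smult c (smult (of_nat (5 -
            i)) ([:1, 1:] ^ (5 - Suc i)))"
      using 1 unfolding syl_var_def e
      by (simp add: pderiv_add pderiv_smult pderiv_power_Suc pderiv_pCons del: power_Suc of_nat_Suc)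
    also have "\<dots> = smult (of_nat (5 - i)) (syl_var a b c (Suc i))"
      using 1 by (simp add: syl_var_def smult_add_right mult.commute)
    finally show ?thesis by (simp add: of_nat_poly)
  qed (auto simp: syl_var_def pderiv_add pderiv_smult)
qed

lemma syl_dhat: "syl a b c (dhat 5 p) = pderiv (syl a b c p)"
proof (induction p rule: mpoly_induct)
  case (Var i)
  have "syl a b c (dhat 5 (Var i)) = smult (of_nat ((i + 1) * (5 -
      i)) / fact (Suc i)) (syl_var a b c (Suc i))"
    unfolding dhat_Var of_nat_eq_Const syl_Const_mult syl_Var by simp
  also have "of_nat ((i + 1) * (5 - i)) / fact (Suc i) = (of_nat (5 - i) / fact i :: 'a)"
  proof -
    have "of_nat (Suc i) \<noteq> (0 :: 'a)" by (rule of_nat_neq_0)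
    then show ?thesis
      by (simp only: of_nat_mult fact_Suc Suc_eq_plus1[symmetric] mult_divide_mult_cancel_left
          not_False_eq_True)
  qed
  also have "smult (of_nat (5 - i) / fact i) (syl_var a b c (Suc i)) = pderiv (syl a b c (Var i))"
    unfolding syl_Var pderiv_smult pderiv_syl_var by (simp add: of_nat_poly)
  finally show ?case .
qed (simp_all add: syl_add syl_mult dhat_add dhat_mult pderiv_add pderiv_mult pderiv_pCons algebra_simps)

lemma syl_dhat_pow: "syl a b c ((dhat 5 ^^ j) p) = (pderiv ^^ j) (syl a b c p)"
  by (induction j) (simp_all add: syl_dhat)

lemma pderiv_pow_smult: "(pderiv ^^ j) (smult l Z) = smult l ((pderiv ^^ j) Z)"
  by (induction j) (simp_all add: pderiv_smult)

text \<open>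
  \<open>L\<close>, \<open>M\<close> and \<open>l\<close> are scalars that keep the polynomials \<open>Z\<close> and \<open>Z'\<close> free of denominators and of
  powers of \<open>a b c\<close>.
\<close>

lemma syl_tau:
  assumes z: "z \<in> hwv 5 m w" and Z: "syl a b c z = smult l Z" and L: "L \<noteq> 0"
    and I: "\<And>k. k \<le> i \<Longrightarrow> L * tau_coeff w (i - k) = fact k * I k"
    and eq: "(\<Sum>k\<le>i. smult (I k) (syl_var a b c k * (pderiv ^^ (i - k)) Z)) = smult M Z'"
    and l': "l' * L = l * M"
  shows "syl a b c (tau 5 i z) = smult l' Z'"
proof -
  have "z \<in> bihom 5 m w" using z by (simp add: hwv_def)
  then have "smult L (syl a b c (tau 5 i z))
      = (\<Sum>k\<le>i. smult L (syl a b c (Var k * (Const (tau_coeff w (i - k)) * (dhat 5 ^^ (i - k)) z))))"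
    by (simp add: tau_bihom syl_sum smult_sum_right)
  also have "\<dots> = (\<Sum>k\<le>i. smult l (smult (I k) (syl_var a b c k * (pderiv ^^ (i - k)) Z)))"
  proof (intro sum.cong refl)
    fix k assume "k \<in> {..i}"
    then have "I k = L * tau_coeff w (i - k) / fact k" using I[of k] by simp
    then show "smult L (syl a b c (Var k * (Const (tau_coeff w (i - k)) * (dhat 5 ^^ (i - k)) z)))
        = smult l (smult (I k) (syl_var a b c k * (pderiv ^^ (i - k)) Z))"
      by (simp add: syl_mult syl_Var syl_Const_mult syl_dhat_pow Z pderiv_pow_smult mult_ac)
  qed
  also have "\<dots> = smult (l * M) Z'" unfolding smult_sum_right[symmetric] eq by simp
  also have "\<dots> = smult L (smult l' Z')" using l' by (simp add: mult.commute)
  finally have "smult (1 / L) (smult L (syl a b c (tau 5 i z))) =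
      smult (1 / L) (smult L (smult l' Z'))" by simp
  then show ?thesis using L by simp
qed

lemma syl_var_simps:
  "syl_var a b c 0 = [:a + c, 5 * c, 10 * c, 10 * c, 5 * c, b + c:]"
  "syl_var a b c 1 = [:c, 4 * c, 6 * c, 4 * c, b + c:]"
  "syl_var a b c 2 = [:c, 3 * c, 3 * c, b + c:]"
  "syl_var a b c 3 = [:c, 2 * c, b + c:]"
  "syl_var a b c 4 = [:c, b + c:]"
  "syl_var a b c 5 = [:b + c:]"
  by (simp_all add: syl_var_def eval_nat_numeral)

lemma pderiv_lists:
  fixes a0 :: "'a::idom"
  shows
  "pderiv [:a0:] = 0"
  "pderiv [:a0, a1:] = [:a1:]"
  "pderiv [:a0, a1, a2:] = [:a1, 2 * a2:]"
  "pderiv [:a0, a1, a2, a3:] = [:a1, 2 * a2, 3 * a3:]"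
  "pderiv [:a0, a1, a2, a3, a4:] = [:a1, 2 * a2, 3 * a3, 4 * a4:]"
  "pderiv [:a0, a1, a2, a3, a4, a5:] = [:a1, 2 * a2, 3 * a3, 4 * a4, 5 * a5:]"
  "pderiv [:a0, a1, a2, a3, a4, a5, a6:] = [:a1, 2 * a2, 3 * a3, 4 * a4, 5 * a5, 6 * a6:]"
  "pderiv [:a0, a1, a2, a3, a4, a5, a6, a7:] = [:a1, 2 * a2, 3 * a3, 4 * a4, 5 * a5, 6 * a6, 7 * a7:]"
  "pderiv [:a0, a1, a2, a3, a4, a5, a6, a7, a8:] = [:a1, 2 * a2, 3 * a3, 4 * a4, 5 * a5, 6 * a6,
      7 * a7, 8 * a8:]"
  "pderiv [:a0, a1, a2, a3, a4, a5, a6, a7, a8, a9:] = [:a1, 2 * a2, 3 * a3, 4 * a4, 5 * a5, 6 * a6,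
      7 * a7, 8 * a8, 9 * a9:]"
  by (simp_all add: pderiv_pCons algebra_simps)

lemma zero_eq_pCons_iff: "0 = pCons x p \<longleftrightarrow> x = 0 \<and> p = 0"
  by (metis pCons_eq_0_iff)

lemmas list_arith = mult_pCons_left mult_zero_left mult_zero_right smult_pCons smult_0_right add_pCons
  add_0_left add_0_right pderiv_lists pderiv_0 pCons_eq_iff pCons_eq_0_iff zero_eq_pCons_iff simp_thms

text \<open>
  \<open>transvect\<close> is the image of \<open>\<tau>\<^sub>s\<close> up to a scalar: the \<open>j\<close>-th entry of the list, the coefficient
  of the \<open>j\<close>-th derivative of \<open>P\<close>, goes with the variable of index \<open>s - j\<close>.
\<close>

fun transvect :: "'k::field_char_0 \<Rightarrow> 'k \<Rightarrow> 'k \<Rightarrow> 'k list \<Rightarrow> 'k poly \<Rightarrow> 'k poly"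
  where
    "transvect a b c [] P = 0"
  | "transvect a b c (r # rs) P = smult r (syl_var a b c (length rs) * P) + transvect a b c rs (pderiv P)"

lemma transvect_eq_sum:
  "transvect a b c rs P =
    (\<Sum>k<length rs. smult (rs ! (length rs - 1 - k)) (syl_var a b c k * (pderiv ^^ (length rs - 1 - k)) P))"
proof (induction rs arbitrary: P)
  case (Cons r rs)
  have "(\<Sum>k<length rs. smult (rs ! (length rs - 1 - k)) (syl_var a b c k * (pderiv ^^ (length rs -
      1 - k)) (pderiv P)))
      = (\<Sum>k<length rs. smult ((r # rs) ! (length rs - k)) (syl_var a b c k * (pderiv ^^ (length rs -
          k)) P))"
  proof (intro sum.cong refl)
    fix k assume "k \<in> {..<length rs}"
    then have "length rs - k = Suc (length rs - 1 - k)" by auto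
    then show "smult (rs ! (length rs - 1 - k)) (syl_var a b c k * (pderiv ^^ (length rs - 1 -
        k)) (pderiv P))
        = smult ((r # rs) ! (length rs - k)) (syl_var a b c k * (pderiv ^^ (length rs - k)) P)"
      by (simp add: funpow_swap1)
  qed
  then show ?case by (simp add: Cons.IH)
qed simp

lemma transvect_simps:
  "transvect a b c [r1, r0] P = smult r1 (syl_var a b c 1 * P) + smult r0 (syl_var a b c 0 * pderiv P)"
  "transvect a b c [r2, r1, r0] P = smult r2 (syl_var a b c 2 * P) + transvect a b c [r1, r0] (pderiv P)"
  "transvect a b c [r3, r2, r1, r0] P = smult r3 (syl_var a b c 3 * P) + transvect a b c [r2, r1,
      r0] (pderiv P)"
  "transvect a b c [r4, r3, r2, r1, r0] P = smult r4 (syl_var a b c 4 * P) + transvect a b c [r3,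
      r2, r1, r0] (pderiv P)"
  "transvect a b c [r5, r4, r3, r2, r1, r0] P
    = smult r5 (syl_var a b c 5 * P) + transvect a b c [r4, r3, r2, r1, r0] (pderiv P)"
  by (simp_all add: eval_nat_numeral)

lemma syl_tau_transvect:
  assumes "z \<in> hwv 5 m w" "syl a b c z = smult l Z" "L \<noteq> 0"
    and r: "map (\<lambda>j. L * tau_coeff w j / fact (i - j)) [0..<Suc i] = r"
    and eq: "transvect a b c r Z = smult M Z'"
    and "l' * L = l * M"
  shows "syl a b c (tau 5 i z) = smult l' Z'"
proof (rule syl_tau[OF assms(1-3), where I = "\<lambda>k. r ! (i - k)"])
  have nth: "r ! j = L * tau_coeff w j / fact (i - j)" if "j \<le> i" for j
    using that by (simp flip: r del: upt_Suc)
  show "L * tau_coeff w (i - k) = fact k * r ! (i - k)" if "k \<le> i" for k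
    using that by (simp add: nth)
  have "length r = Suc i" by (simp flip: r)
  then show "(\<Sum>k\<le>i. smult (r ! (i - k)) (syl_var a b c k * (pderiv ^^ (i - k)) Z)) = smult M Z'"
    unfolding eq[symmetric] transvect_eq_sum by (simp add: lessThan_Suc_atMost)
qed (rule assms(6))

text \<open>
  The 23 generators, and the polynomials \<open>Z\<close> in \<open>y\<close> to which they are mapped up to a rational
  factor and a power of \<open>a b c\<close>.
\<close>

definition cov_t :: "'k::field_char_0 mpoly" where "cov_t = Var 0"
definition cov_d1 :: "'k::field_char_0 mpoly" where "cov_d1 = tau 5 2 (cov_t)"
definition cov_d2 :: "'k::field_char_0 mpoly" where "cov_d2 = tau 5 4 (cov_t)"
definition cov_tr1 :: "'k::field_char_0 mpoly" where "cov_tr1 = tau 5 4 (cov_d1)"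
definition cov_tr2 :: "'k::field_char_0 mpoly" where "cov_tr2 = tau 5 3 (cov_d1)"
definition cov_tr3 :: "'k::field_char_0 mpoly" where "cov_tr3 = tau 5 1 (cov_d1)"
definition cov_c1 :: "'k::field_char_0 mpoly" where "cov_c1 = tau 5 5 (cov_tr2)"
definition cov_c2 :: "'k::field_char_0 mpoly" where "cov_c2 = tau 5 5 (cov_tr3)"
definition cov_c3 :: "'k::field_char_0 mpoly" where "cov_c3 = tau 5 4 (cov_tr3)"
definition cov_p1 :: "'k::field_char_0 mpoly" where "cov_p1 = tau 5 4 (cov_d2^2)"
definition cov_p2 :: "'k::field_char_0 mpoly" where "cov_p2 = tau 5 3 (cov_d2^2)"
definition cov_p3 :: "'k::field_char_0 mpoly" where "cov_p3 = tau 5 2 (cov_c3)"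
definition cov_s1 :: "'k::field_char_0 mpoly" where "cov_s1 = tau 5 4 (cov_d2 * cov_tr1)"
definition cov_s2 :: "'k::field_char_0 mpoly" where "cov_s2 = tau 5 1 (cov_p1)"
definition cov_si1 :: "'k::field_char_0 mpoly" where "cov_si1 = tau 5 5 (cov_d2^3)"
definition cov_si2 :: "'k::field_char_0 mpoly" where "cov_si2 = tau 5 1 (cov_s1)"
definition cov_v1 :: "'k::field_char_0 mpoly" where "cov_v1 = tau 5 5 (cov_d2 * cov_p2)"
definition cov_v2 :: "'k::field_char_0 mpoly" where "cov_v2 = tau 5 5 (cov_d2^2 * cov_tr1)"
definition cov_dev :: "'k::field_char_0 mpoly" where "cov_dev = tau 5 2 (cov_v2)"
definition cov_od :: "'k::field_char_0 mpoly" where "cov_od = tau 5 5 (cov_s1 * cov_d2^2)"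
definition cov_dv :: "'k::field_char_0 mpoly" where "cov_dv = tau 5 5 (cov_d2^2 * cov_si1)"
definition cov_trn :: "'k::field_char_0 mpoly" where "cov_trn = tau 5 5 (cov_v2 * cov_d2^2)"
definition cov_vis :: "'k::field_char_0 mpoly" where "cov_vis = tau 5 5 (cov_p1 * cov_p2 * cov_si1)"

definition Z_t :: "'k::field_char_0 \<Rightarrow> 'k \<Rightarrow> 'k \<Rightarrow> 'k poly"
  where "Z_t a b c = [:a + c, 5*c, 10*c, 10*c, 5*c, b + c:]"
definition Z_d1 :: "'k::field_char_0 \<Rightarrow> 'k \<Rightarrow> 'k \<Rightarrow> 'k poly"
  where "Z_d1 a b c = [:a*c, 3*a*c, 3*a*c, a*b + a*c + b*c, 3*b*c, 3*b*c, b*c:]"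
definition Z_d2 :: "'k::field_char_0 \<Rightarrow> 'k \<Rightarrow> 'k \<Rightarrow> 'k poly"
  where "Z_d2 a b c = [:a*c, a*b + a*c + b*c, b*c:]"
definition Z_tr1 :: "'k::field_char_0 \<Rightarrow> 'k \<Rightarrow> 'k \<Rightarrow> 'k poly"
  where "Z_tr1 a b c = [:0, 1, 1:]"
definition Z_tr2 :: "'k::field_char_0 \<Rightarrow> 'k \<Rightarrow> 'k \<Rightarrow> 'k poly"
  where "Z_tr2 a b c = [:a^2*b + a^2*c + 2*a*b*c + b*c^2 - a*c^2, 5*a*b*c + 5*b*c^2 - 5*a*c^2,
      2*a*b*c + 10*b*c^2 - 10*a*c^2, 10*b*c^2 - 2*a*b*c - 10*a*c^2, 5*b*c^2 - 5*a*b*c - 5*a*c^2,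
      b*c^2 - a*b^2 - 2*a*b*c - a*c^2 - b^2*c:]"
definition Z_tr3 :: "'k::field_char_0 \<Rightarrow> 'k \<Rightarrow> 'k \<Rightarrow> 'k poly"
  where "Z_tr3 a b c = [:a^2*c - a*c^2, 2*a^2*c - 7*a*c^2, a^2*b + a^2*c + 2*a*b*c + b*c^2 -
      21*a*c^2, 7*a*b*c + 7*b*c^2 - 35*a*c^2, 5*a*b*c + 21*b*c^2 - 35*a*c^2, 35*b*c^2 - 5*a*b*c -
      21*a*c^2, 35*b*c^2 - 7*a*b*c - 7*a*c^2, 21*b*c^2 - a*b^2 - 2*a*b*c - a*c^2 - b^2*c, 7*b*c^2 -
      2*b^2*c, b*c^2 - b^2*c:]"
definition Z_c1 :: "'k::field_char_0 \<Rightarrow> 'k \<Rightarrow> 'k \<Rightarrow> 'k poly"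
  where "Z_c1 a b c = [:a^2*b^2 + 2*a^2*b*c + a^2*c^2 + 2*a*b^2*c + b^2*c^2 - 2*a*b*c^2:]"
definition Z_c2 :: "'k::field_char_0 \<Rightarrow> 'k \<Rightarrow> 'k \<Rightarrow> 'k poly"
  where "Z_c2 a b c = [:83*a^2*b*c + 21*a^2*c^2 - 83*a*b*c^2, 42*a^2*b*c + 42*a^2*c^2 - 290*a*b*c^2,
      21*a^2*b^2 + 42*a^2*b*c + 21*a^2*c^2 + 42*a*b^2*c + 21*b^2*c^2 - 414*a*b*c^2, 42*a*b^2*c +
      42*b^2*c^2 - 290*a*b*c^2, 83*a*b^2*c + 21*b^2*c^2 - 83*a*b*c^2:]"
definition Z_c3 :: "'k::field_char_0 \<Rightarrow> 'k \<Rightarrow> 'k \<Rightarrow> 'k poly"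
  where "Z_c3 a b c = [:a + c, 2*a + 4*c, 5*c, 0, -(5*c), -(2*b) - 4*c, -(b) - c:]"
definition Z_p1 :: "'k::field_char_0 \<Rightarrow> 'k \<Rightarrow> 'k \<Rightarrow> 'k poly"
  where "Z_p1 a b c = [:a*b + b*c, a*b + a*c:]"
definition Z_p2 :: "'k::field_char_0 \<Rightarrow> 'k \<Rightarrow> 'k \<Rightarrow> 'k poly"
  where "Z_p2 a b c = [:2*a*c, 3*a*c - a*b - b*c, a*b + a*c - 3*b*c, -(2*b*c):]"
definition Z_p3 :: "'k::field_char_0 \<Rightarrow> 'k \<Rightarrow> 'k \<Rightarrow> 'k poly"
  where "Z_p3 a b c = [:2*a*c, 7*a*c, 9*a*c, 5*a*c - a*b - b*c, a*b + a*c - 5*b*c, -(9*b*c),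
      -(7*b*c), -(2*b*c):]"
definition Z_s1 :: "'k::field_char_0 \<Rightarrow> 'k \<Rightarrow> 'k \<Rightarrow> 'k poly"
  where "Z_s1 a b c = [:1, 1, 1:]"
definition Z_s2 :: "'k::field_char_0 \<Rightarrow> 'k \<Rightarrow> 'k \<Rightarrow> 'k poly"
  where "Z_s2 a b c = [:a^2*b + a^2*c + a*c^2 - b*c^2, 4*a*c^2 - 4*b*c^2, 6*a*c^2 - 6*b*c^2,
      4*a*c^2 - 4*b*c^2, a*c^2 - a*b^2 - b^2*c - b*c^2:]"
definition Z_si1 :: "'k::field_char_0 \<Rightarrow> 'k \<Rightarrow> 'k \<Rightarrow> 'k poly"
  where "Z_si1 a b c = [:a^2*b^2 + 2*a*b^2*c + a*b*c^2 + b^2*c^2 - a^2*b*c - 2*a^2*c^2, a*b^2*c +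
      2*b^2*c^2 - a^2*b^2 - 2*a^2*b*c - a^2*c^2 - a*b*c^2:]"
definition Z_si2 :: "'k::field_char_0 \<Rightarrow> 'k \<Rightarrow> 'k \<Rightarrow> 'k poly"
  where "Z_si2 a b c = [:a - c, 2*a - 3*c, -(2*c), 2*c, 3*c - 2*b, c - b:]"
definition Z_v1 :: "'k::field_char_0 \<Rightarrow> 'k \<Rightarrow> 'k \<Rightarrow> 'k poly"
  where "Z_v1 a b c = [:a*b - a*c - b*c:]"
definition Z_v2 :: "'k::field_char_0 \<Rightarrow> 'k \<Rightarrow> 'k \<Rightarrow> 'k poly"
  where "Z_v2 a b c = [:a*b + b*c, 2*b*c - 2*a*c, -(a*b) - a*c:]"
definition Z_dev :: "'k::field_char_0 \<Rightarrow> 'k \<Rightarrow> 'k \<Rightarrow> 'k poly"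
  where "Z_dev a b c = [:a^2*b + a^2*c + b*c^2 - a*c^2, 3*b*c^2 - 3*a*c^2, 3*b*c^2 - 3*a*c^2,
      b*c^2 - a*b^2 - a*c^2 - b^2*c:]"
definition Z_od :: "'k::field_char_0 \<Rightarrow> 'k \<Rightarrow> 'k \<Rightarrow> 'k poly"
  where "Z_od a b c = [:a*b + 2*a*c - b*c, a*c - a*b - 2*b*c:]"
definition Z_dv :: "'k::field_char_0 \<Rightarrow> 'k \<Rightarrow> 'k \<Rightarrow> 'k poly"
  where "Z_dv a b c = [:a^3*b^3 + a^3*b^2*c + a^2*b^3*c + 3*a^2*b^2*c^2 + a^2*b*c^3 + a*b^2*c^3 -
      a^3*b*c^2 - a^3*c^3 - a*b^3*c^2 - b^3*c^3:]"
definition Z_trn :: "'k::field_char_0 \<Rightarrow> 'k \<Rightarrow> 'k \<Rightarrow> 'k poly"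
  where "Z_trn a b c = [:2*a^2*b^2 + 7*a^2*b*c + 7*a*b*c^2 - 2*b^2*c^2, 2*a^2*b^2 + 7*a*b^2*c +
      7*a*b*c^2 - 2*a^2*c^2:]"
definition Z_vis :: "'k::field_char_0 \<Rightarrow> 'k \<Rightarrow> 'k \<Rightarrow> 'k poly"
  where "Z_vis a b c = [:a^2*b + a^2*c + a*c^2 - a*b^2 - b^2*c - b*c^2:]"

lemma hwv_Var0: "Var 0 \<in> hwv 5 1 5"
  using bihom_Var[of 0 5] by (simp add: hwv_def weitzenboeck_Var)

lemma hwv_power: "p \<in> hwv n m w \<Longrightarrow> p ^ j \<in> hwv n (j * m) (int j * w)"
proof (induction j)
  case 0
  show ?case using weitzenboeck_Const[of 1] by (simp add: hwv_def bihom_1)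
next
  case (Suc j)
  then show ?case using hwv_mult[of p n m w "p ^ j" "j * m" "int j * w"] by (simp add: algebra_simps)
qed

lemma cov_t_hwv: "cov_t \<in> hwv 5 1 5"
  unfolding cov_t_def by (rule hwv_Var0)
lemma cov_d1_hwv: "cov_d1 \<in> hwv 5 2 6"
  unfolding cov_d1_def using tau_hwv[OF cov_t_hwv, of 2] by (simp add: numeral_eq_Suc)
lemma cov_d2_hwv: "cov_d2 \<in> hwv 5 2 2"
  unfolding cov_d2_def using tau_hwv[OF cov_t_hwv, of 4] by (simp add: numeral_eq_Suc)
lemma cov_tr1_hwv: "cov_tr1 \<in> hwv 5 3 3"
  unfolding cov_tr1_def using tau_hwv[OF cov_d1_hwv, of 4] by (simp add: numeral_eq_Suc)
lemma cov_tr2_hwv: "cov_tr2 \<in> hwv 5 3 5"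
  unfolding cov_tr2_def using tau_hwv[OF cov_d1_hwv, of 3] by (simp add: numeral_eq_Suc)
lemma cov_tr3_hwv: "cov_tr3 \<in> hwv 5 3 9"
  unfolding cov_tr3_def using tau_hwv[OF cov_d1_hwv, of 1] by (simp add: numeral_eq_Suc)
lemma cov_c1_hwv: "cov_c1 \<in> hwv 5 4 0"
  unfolding cov_c1_def using tau_hwv[OF cov_tr2_hwv, of 5] by (simp add: numeral_eq_Suc)
lemma cov_c2_hwv: "cov_c2 \<in> hwv 5 4 4"
  unfolding cov_c2_def using tau_hwv[OF cov_tr3_hwv, of 5] by (simp add: numeral_eq_Suc)
lemma cov_c3_hwv: "cov_c3 \<in> hwv 5 4 6"
  unfolding cov_c3_def using tau_hwv[OF cov_tr3_hwv, of 4] by (simp add: numeral_eq_Suc)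
lemma cov_p1_hwv: "cov_p1 \<in> hwv 5 5 1"
  unfolding cov_p1_def using tau_hwv[OF hwv_power[OF cov_d2_hwv, of 2], of 4] by (simp add: numeral_eq_Suc)
lemma cov_p2_hwv: "cov_p2 \<in> hwv 5 5 3"
  unfolding cov_p2_def using tau_hwv[OF hwv_power[OF cov_d2_hwv, of 2], of 3] by (simp add: numeral_eq_Suc)
lemma cov_p3_hwv: "cov_p3 \<in> hwv 5 5 7"
  unfolding cov_p3_def using tau_hwv[OF cov_c3_hwv, of 2] by (simp add: numeral_eq_Suc)
lemma cov_s1_hwv: "cov_s1 \<in> hwv 5 6 2"
  unfolding cov_s1_def using tau_hwv[OF hwv_mult[OF cov_d2_hwv cov_tr1_hwv], of 4]
      by (simp add: numeral_eq_Suc)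
lemma cov_s2_hwv: "cov_s2 \<in> hwv 5 6 4"
  unfolding cov_s2_def using tau_hwv[OF cov_p1_hwv, of 1] by (simp add: numeral_eq_Suc)
lemma cov_si1_hwv: "cov_si1 \<in> hwv 5 7 1"
  unfolding cov_si1_def using tau_hwv[OF hwv_power[OF cov_d2_hwv, of 3], of 5] by (simp add: numeral_eq_Suc)
lemma cov_si2_hwv: "cov_si2 \<in> hwv 5 7 5"
  unfolding cov_si2_def using tau_hwv[OF cov_s1_hwv, of 1] by (simp add: numeral_eq_Suc)
lemma cov_v1_hwv: "cov_v1 \<in> hwv 5 8 0"
  unfolding cov_v1_def using tau_hwv[OF hwv_mult[OF cov_d2_hwv cov_p2_hwv], of 5]
      by (simp add: numeral_eq_Suc)
lemma cov_v2_hwv: "cov_v2 \<in> hwv 5 8 2"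
  unfolding cov_v2_def using tau_hwv[OF hwv_mult[OF hwv_power[OF cov_d2_hwv, of 2] cov_tr1_hwv],
      of 5] by (simp add: numeral_eq_Suc)
lemma cov_dev_hwv: "cov_dev \<in> hwv 5 9 3"
  unfolding cov_dev_def using tau_hwv[OF cov_v2_hwv, of 2] by (simp add: numeral_eq_Suc)
lemma cov_od_hwv: "cov_od \<in> hwv 5 11 1"
  unfolding cov_od_def using tau_hwv[OF hwv_mult[OF cov_s1_hwv hwv_power[OF cov_d2_hwv, of 2]],
      of 5] by (simp add: numeral_eq_Suc)
lemma cov_dv_hwv: "cov_dv \<in> hwv 5 12 0"
  unfolding cov_dv_def using tau_hwv[OF hwv_mult[OF hwv_power[OF cov_d2_hwv, of 2] cov_si1_hwv],
      of 5] by (simp add: numeral_eq_Suc)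
lemma cov_trn_hwv: "cov_trn \<in> hwv 5 13 1"
  unfolding cov_trn_def using tau_hwv[OF hwv_mult[OF cov_v2_hwv hwv_power[OF cov_d2_hwv, of 2]],
      of 5] by (simp add: numeral_eq_Suc)
lemma cov_vis_hwv: "cov_vis \<in> hwv 5 18 0"
  unfolding cov_vis_def using tau_hwv[OF hwv_mult[OF hwv_mult[OF cov_p1_hwv cov_p2_hwv]
      cov_si1_hwv], of 5] by (simp add: numeral_eq_Suc)

context
  fixes a b c :: "'k::field_char_0"
begin

lemma syl_t: "syl a b c cov_t = smult 1 (Z_t a b c)"
  by (simp add: cov_t_def Z_t_def syl_Var syl_var_simps)

lemma syl_d1: "syl a b c cov_d1 = smult (1) (Z_d1 a b c)"
proof -
  have "transvect a b c [20, - 8, 1] (Z_t a b c) = smult (40) (Z_d1 a b c)"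
    unfolding Z_t_def Z_d1_def by (simp only: transvect_simps list_arith syl_var_simps; (intro
        conjI)?; algebra)
  then show ?thesis
    unfolding cov_d1_def
    by (rule syl_tau_transvect[OF cov_t_hwv syl_t, where L = 40 and i = 2,
        rotated 2]) (simp_all add: tau_coeff_def fact_numeral eval_nat_numeral mult_ac)
qed

lemma syl_d2: "syl a b c cov_d2 = smult (1/12) (Z_d2 a b c)"
proof -
  have "transvect a b c [120, - 96, 36, - 8, 1] (Z_t a b c) = smult (240) (Z_d2 a b c)"
    unfolding Z_t_def Z_d2_def by (simp only: transvect_simps list_arith syl_var_simps; (intro
        conjI)?; algebra)
  then show ?thesis
    unfolding cov_d2_def
    by (rule syl_tau_transvect[OF cov_t_hwv syl_t, where L = 2880 and i = 4,
        rotated 2]) (simp_all add: tau_coeff_def fact_numeral eval_nat_numeral mult_ac)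
qed

lemma syl_tr1: "syl a b c cov_tr1 = smult ((1/10) * (a * b * c)) (Z_tr1 a b c)"
proof -
  have "transvect a b c [360, - 240, 72, - 12, 1] (Z_d1 a b c) = smult (864 * (a * b * c)) (Z_tr1 a b c)"
    unfolding Z_d1_def Z_tr1_def by (simp only: transvect_simps list_arith syl_var_simps; (intro
        conjI)?; algebra)
  then show ?thesis
    unfolding cov_tr1_def
    by (rule syl_tau_transvect[OF cov_d1_hwv syl_d1, where L = 8640 and i = 4,
        rotated 2]) (simp_all add: tau_coeff_def fact_numeral eval_nat_numeral mult_ac)
qed

lemma syl_tr2: "syl a b c cov_tr2 = smult (- (1/120)) (Z_tr2 a b c)"
proof -
  have "transvect a b c [120, - 60, 12, - 1] (Z_d1 a b c) = smult (- 6) (Z_tr2 a b c)"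
    unfolding Z_d1_def Z_tr2_def by (simp only: transvect_simps list_arith syl_var_simps; (intro
        conjI)?; algebra)
  then show ?thesis
    unfolding cov_tr2_def
    by (rule syl_tau_transvect[OF cov_d1_hwv syl_d1, where L = 720 and i = 3,
        rotated 2]) (simp_all add: tau_coeff_def fact_numeral eval_nat_numeral mult_ac)
qed

lemma syl_tr3: "syl a b c cov_tr3 = smult (- (1/2)) (Z_tr3 a b c)"
proof -
  have "transvect a b c [6, - 1] (Z_d1 a b c) = smult (- 3) (Z_tr3 a b c)"
    unfolding Z_d1_def Z_tr3_def by (simp only: transvect_simps list_arith syl_var_simps; (intro
        conjI)?; algebra)
  then show ?thesis
    unfolding cov_tr3_def
    by (rule syl_tau_transvect[OF cov_d1_hwv syl_d1, where L = 6 and i = 1,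
        rotated 2]) (simp_all add: tau_coeff_def fact_numeral eval_nat_numeral mult_ac)
qed

lemma syl_c1: "syl a b c cov_c1 = smult (- (1/7200)) (Z_c1 a b c)"
proof -
  have "transvect a b c [120, - 120, 60, - 20, 5, - 1] (Z_tr2 a b c) = smult (240) (Z_c1 a b c)"
    unfolding Z_tr2_def Z_c1_def by (simp only: transvect_simps list_arith syl_var_simps; (intro
        conjI)?; algebra)
  then show ?thesis
    unfolding cov_c1_def
    by (rule syl_tau_transvect[OF cov_tr2_hwv syl_tr2, where L = 14400 and i = 5,
        rotated 2]) (simp_all add: tau_coeff_def fact_numeral eval_nat_numeral mult_ac)
qed

lemma syl_c2: "syl a b c cov_c2 = smult (- (1/15120)) (Z_c2 a b c)"
proof -
  have "transvect a b c [15120, - 8400, 2100, - 300, 25, - 1] (Z_tr3 a b c) = smult (240) (Z_c2 a b c)"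
    unfolding Z_tr3_def Z_c2_def by (simp only: transvect_simps list_arith syl_var_simps; (intro
        conjI)?; algebra)
  then show ?thesis
    unfolding cov_c2_def
    by (rule syl_tau_transvect[OF cov_tr3_hwv syl_tr3, where L = 1814400 and i = 5,
        rotated 2]) (simp_all add: tau_coeff_def fact_numeral eval_nat_numeral mult_ac)
qed

lemma syl_c3: "syl a b c cov_c3 = smult ((- (13/3024)) * (a * b * c)) (Z_c3 a b c)"
proof -
  have "transvect a b c [3024, - 1344, 252, - 24, 1] (Z_tr3 a b c) = smult (624 * (a * b * c)) (Z_c3 a b c)"
    unfolding Z_tr3_def Z_c3_def by (simp only: transvect_simps list_arith syl_var_simps; (intro
        conjI)?; algebra)
  then show ?thesis
    unfolding cov_c3_def
    by (rule syl_tau_transvect[OF cov_tr3_hwv syl_tr3, where L = 72576 and i = 4,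
        rotated 2]) (simp_all add: tau_coeff_def fact_numeral eval_nat_numeral mult_ac)
qed

lemma syl_p1: "syl a b c cov_p1 = smult ((1/3456) * (a * b * c)) (Z_p1 a b c)"
proof -
  let ?P = "[:a^2*c^2, 2*a^2*b*c + 2*a^2*c^2 + 2*a*b*c^2, a^2*b^2 + 2*a^2*b*c + a^2*c^2 +
      2*a*b^2*c + 4*a*b*c^2 + b^2*c^2, 2*a*b^2*c + 2*a*b*c^2 + 2*b^2*c^2, b^2*c^2:]"
  have P: "(Z_d2 a b c * Z_d2 a b c) = ?P"
    unfolding Z_d2_def by (simp only: list_arith; (intro conjI)?; algebra)
  have prod: "syl a b c (cov_d2^2) = smult ((1/144)) ?P"
    unfolding P[symmetric]
    unfolding syl_mult syl_power syl_d2 power2_eq_square power3_eq_cube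
      mult_smult_left mult_smult_right smult_smult
    by (rule arg_cong2[where f = smult], simp add: eval_nat_numeral mult_ac, simp only: mult_ac)
  have mem: "cov_d2^2 \<in> hwv 5 4 4"
    using hwv_power[OF cov_d2_hwv, of 2] by simp
  have "transvect a b c [24, - 24, 12, - 4, 1] ?P = smult (24 * (a * b * c)) (Z_p1 a b c)"
    unfolding Z_p1_def by (simp only: transvect_simps list_arith syl_var_simps; (intro conjI)?; algebra)
  then show ?thesis
    unfolding cov_p1_def
    by (rule syl_tau_transvect[OF mem prod, where L = 576 and i = 4,
        rotated 2]) (simp_all add: tau_coeff_def fact_numeral eval_nat_numeral mult_ac)
qed

lemma syl_p2: "syl a b c cov_p2 = smult ((- (1/1728)) * (a * b * c)) (Z_p2 a b c)"
proof -
  let ?P = "[:a^2*c^2, 2*a^2*b*c + 2*a^2*c^2 + 2*a*b*c^2, a^2*b^2 + 2*a^2*b*c + a^2*c^2 +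
      2*a*b^2*c + 4*a*b*c^2 + b^2*c^2, 2*a*b^2*c + 2*a*b*c^2 + 2*b^2*c^2, b^2*c^2:]"
  have P: "(Z_d2 a b c * Z_d2 a b c) = ?P"
    unfolding Z_d2_def by (simp only: list_arith; (intro conjI)?; algebra)
  have prod: "syl a b c (cov_d2^2) = smult ((1/144)) ?P"
    unfolding P[symmetric]
    unfolding syl_mult syl_power syl_d2 power2_eq_square power3_eq_cube
      mult_smult_left mult_smult_right smult_smult
    by (rule arg_cong2[where f = smult], simp add: eval_nat_numeral mult_ac, simp only: mult_ac)
  have mem: "cov_d2^2 \<in> hwv 5 4 4"
    using hwv_power[OF cov_d2_hwv, of 2] by simp
  have "transvect a b c [24, - 18, 6, - 1] ?P = smult (- 12 * (a * b * c)) (Z_p2 a b c)"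
    unfolding Z_p2_def by (simp only: transvect_simps list_arith syl_var_simps; (intro conjI)?; algebra)
  then show ?thesis
    unfolding cov_p2_def
    by (rule syl_tau_transvect[OF mem prod, where L = 144 and i = 3,
        rotated 2]) (simp_all add: tau_coeff_def fact_numeral eval_nat_numeral mult_ac)
qed

lemma syl_p3: "syl a b c cov_p3 = smult ((- (13/18144)) * (a * b * c)) (Z_p3 a b c)"
proof -
  have "transvect a b c [30, - 10, 1] (Z_c3 a b c) = smult (10) (Z_p3 a b c)"
    unfolding Z_c3_def Z_p3_def by (simp only: transvect_simps list_arith syl_var_simps; (intro
        conjI)?; algebra)
  then show ?thesis
    unfolding cov_p3_def
    by (rule syl_tau_transvect[OF cov_c3_hwv syl_c3, where L = 60 and i = 2,
        rotated 2]) (simp_all add: tau_coeff_def fact_numeral eval_nat_numeral mult_ac)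
qed

lemma syl_s1: "syl a b c cov_s1 = smult ((1/7200) * (a * b * c)^2) (Z_s1 a b c)"
proof -
  let ?P = "[:0, a*c, a*b + 2*a*c + b*c, a*b + a*c + 2*b*c, b*c:]"
  have P: "Z_d2 a b c * Z_tr1 a b c = ?P"
    unfolding Z_d2_def Z_tr1_def by (simp only: list_arith; (intro conjI)?; algebra)
  have prod: "syl a b c (cov_d2 * cov_tr1) = smult ((1/120) * (a * b * c)) ?P"
    unfolding P[symmetric]
    unfolding syl_mult syl_power syl_d2 syl_tr1 power2_eq_square power3_eq_cube
      mult_smult_left mult_smult_right smult_smult
    by (rule arg_cong2[where f = smult], simp add: eval_nat_numeral mult_ac, simp only: mult_ac)
  have mem: "cov_d2 * cov_tr1 \<in> hwv 5 5 5"
    using hwv_mult[OF cov_d2_hwv cov_tr1_hwv] by simp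
  have "transvect a b c [120, - 96, 36, - 8, 1] ?P = smult (48 * (a * b * c)) (Z_s1 a b c)"
    unfolding Z_s1_def by (simp only: transvect_simps list_arith syl_var_simps; (intro conjI)?; algebra)
  then show ?thesis
    unfolding cov_s1_def
    by (rule syl_tau_transvect[OF mem prod, where L = 2880 and i = 4,
        rotated 2]) (simp_all add: tau_coeff_def fact_numeral eval_nat_numeral mult_ac)
qed

lemma syl_s2: "syl a b c cov_s2 = smult ((- (1/3456)) * (a * b * c)) (Z_s2 a b c)"
proof -
  have "transvect a b c [1, - 1] (Z_p1 a b c) = smult (- 1) (Z_s2 a b c)"
    unfolding Z_p1_def Z_s2_def by (simp only: transvect_simps list_arith syl_var_simps; (intro
        conjI)?; algebra)
  then show ?thesis
    unfolding cov_s2_def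
    by (rule syl_tau_transvect[OF cov_p1_hwv syl_p1, where L = 1 and i = 1,
        rotated 2]) (simp_all add: tau_coeff_def fact_numeral eval_nat_numeral mult_ac)
qed

lemma syl_si1: "syl a b c cov_si1 = smult ((- (1/414720)) * (a * b * c)) (Z_si1 a b c)"
proof -
  let ?P = "[:a^3*c^3, 3*a^3*b*c^2 + 3*a^3*c^3 + 3*a^2*b*c^3, 3*a^3*b^2*c + 6*a^3*b*c^2 +
      3*a^3*c^3 + 6*a^2*b^2*c^2 + 9*a^2*b*c^3 + 3*a*b^2*c^3, a^3*b^3 + 3*a^3*b^2*c + 3*a^3*b*c^2 +
      a^3*c^3 + 3*a^2*b^3*c + 12*a^2*b^2*c^2 + 9*a^2*b*c^3 + 3*a*b^3*c^2 + 9*a*b^2*c^3 + b^3*c^3,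
      3*a^2*b^3*c + 6*a^2*b^2*c^2 + 3*a^2*b*c^3 + 6*a*b^3*c^2 + 9*a*b^2*c^3 + 3*b^3*c^3,
      3*a*b^3*c^2 + 3*a*b^2*c^3 + 3*b^3*c^3, b^3*c^3:]"
  have P: "(Z_d2 a b c * Z_d2 a b c * Z_d2 a b c) = ?P"
    unfolding Z_d2_def by (simp only: list_arith; (intro conjI)?; algebra)
  have prod: "syl a b c (cov_d2^3) = smult ((1/1728)) ?P"
    unfolding P[symmetric]
    unfolding syl_mult syl_power syl_d2 power2_eq_square power3_eq_cube
      mult_smult_left mult_smult_right smult_smult
    by (rule arg_cong2[where f = smult], simp add: eval_nat_numeral mult_ac, simp only: mult_ac)
  have mem: "cov_d2^3 \<in> hwv 5 6 6"
    using hwv_power[OF cov_d2_hwv, of 3] by simp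
  have "transvect a b c [720, - 600, 240, - 60, 10, - 1] ?P = smult (- 360 * (a * b * c)) (Z_si1 a b c)"
    unfolding Z_si1_def by (simp only: transvect_simps list_arith syl_var_simps; (intro conjI)?; algebra)
  then show ?thesis
    unfolding cov_si1_def
    by (rule syl_tau_transvect[OF mem prod, where L = 86400 and i = 5,
        rotated 2]) (simp_all add: tau_coeff_def fact_numeral eval_nat_numeral mult_ac)
qed

lemma syl_si2: "syl a b c cov_si2 = smult ((- (1/14400)) * (a * b * c)^2) (Z_si2 a b c)"
proof -
  have "transvect a b c [2, - 1] (Z_s1 a b c) = smult (- 1) (Z_si2 a b c)"
    unfolding Z_s1_def Z_si2_def by (simp only: transvect_simps list_arith syl_var_simps; (intro
        conjI)?; algebra)
  then show ?thesis
    unfolding cov_si2_def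
    by (rule syl_tau_transvect[OF cov_s1_hwv syl_s1, where L = 2 and i = 1,
        rotated 2]) (simp_all add: tau_coeff_def fact_numeral eval_nat_numeral mult_ac)
qed

lemma syl_v1: "syl a b c cov_v1 = smult ((1/1244160) * (a * b * c)^2) (Z_v1 a b c)"
proof -
  let ?P = "[:2*a^2*c^2, a^2*b*c + 5*a^2*c^2 + a*b*c^2, 3*a^2*b*c + 4*a^2*c^2 + a*b*c^2 - a^2*b^2 -
      2*a*b^2*c - b^2*c^2, a^2*b^2 + 2*a^2*b*c + a^2*c^2 - 3*a*b^2*c - a*b*c^2 - 4*b^2*c^2,
      -(a*b^2*c) - a*b*c^2 - 5*b^2*c^2, -(2*b^2*c^2):]"
  have P: "Z_d2 a b c * Z_p2 a b c = ?P"
    unfolding Z_d2_def Z_p2_def by (simp only: list_arith; (intro conjI)?; algebra)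
  have prod: "syl a b c (cov_d2 * cov_p2) = smult ((- (1/20736)) * (a * b * c)) ?P"
    unfolding P[symmetric]
    unfolding syl_mult syl_power syl_d2 syl_p2 power2_eq_square power3_eq_cube
      mult_smult_left mult_smult_right smult_smult
    by (rule arg_cong2[where f = smult], simp add: eval_nat_numeral mult_ac, simp only: mult_ac)
  have mem: "cov_d2 * cov_p2 \<in> hwv 5 7 5"
    using hwv_mult[OF cov_d2_hwv cov_p2_hwv] by simp
  have "transvect a b c [120, - 120, 60, - 20, 5, - 1] ?P = smult (- 240 * (a * b * c)) (Z_v1 a b c)"
    unfolding Z_v1_def by (simp only: transvect_simps list_arith syl_var_simps; (intro conjI)?; algebra)
  then show ?thesis
    unfolding cov_v1_def
    by (rule syl_tau_transvect[OF mem prod, where L = 14400 and i = 5,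
        rotated 2]) (simp_all add: tau_coeff_def fact_numeral eval_nat_numeral mult_ac)
qed

lemma syl_v2: "syl a b c cov_v2 = smult ((- (1/725760)) * (a * b * c)^2) (Z_v2 a b c)"
proof -
  let ?P = "[:0, a^2*c^2, 2*a^2*b*c + 3*a^2*c^2 + 2*a*b*c^2, a^2*b^2 + 4*a^2*b*c + 3*a^2*c^2 +
      2*a*b^2*c + 6*a*b*c^2 + b^2*c^2, a^2*b^2 + 2*a^2*b*c + a^2*c^2 + 4*a*b^2*c + 6*a*b*c^2 +
      3*b^2*c^2, 2*a*b^2*c + 2*a*b*c^2 + 3*b^2*c^2, b^2*c^2:]"
  have P: "(Z_d2 a b c * Z_d2 a b c) * Z_tr1 a b c = ?P"
    unfolding Z_d2_def Z_tr1_def by (simp only: list_arith; (intro conjI)?; algebra)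
  have prod: "syl a b c (cov_d2^2 * cov_tr1) = smult ((1/1440) * (a * b * c)) ?P"
    unfolding P[symmetric]
    unfolding syl_mult syl_power syl_d2 syl_tr1 power2_eq_square power3_eq_cube
      mult_smult_left mult_smult_right smult_smult
    by (rule arg_cong2[where f = smult], simp add: eval_nat_numeral mult_ac, simp only: mult_ac)
  have mem: "cov_d2^2 * cov_tr1 \<in> hwv 5 7 7"
    using hwv_mult[OF hwv_power[OF cov_d2_hwv, of 2] cov_tr1_hwv] by simp
  have "transvect a b c [2520, - 1800, 600, - 120, 15, - 1] ?P = smult (- 600 * (a * b * c)) (Z_v2 a b c)"
    unfolding Z_v2_def by (simp only: transvect_simps list_arith syl_var_simps; (intro conjI)?; algebra)
  then show ?thesis
    unfolding cov_v2_def
    by (rule syl_tau_transvect[OF mem prod, where L = 302400 and i = 5,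
        rotated 2]) (simp_all add: tau_coeff_def fact_numeral eval_nat_numeral mult_ac)
qed

lemma syl_dev: "syl a b c cov_dev = smult ((1/1451520) * (a * b * c)^2) (Z_dev a b c)"
proof -
  have "transvect a b c [2, - 2, 1] (Z_v2 a b c) = smult (- 2) (Z_dev a b c)"
    unfolding Z_v2_def Z_dev_def by (simp only: transvect_simps list_arith syl_var_simps; (intro
        conjI)?; algebra)
  then show ?thesis
    unfolding cov_dev_def
    by (rule syl_tau_transvect[OF cov_v2_hwv syl_v2, where L = 4 and i = 2,
        rotated 2]) (simp_all add: tau_coeff_def fact_numeral eval_nat_numeral mult_ac)
qed

lemma syl_od: "syl a b c cov_od = smult ((1/746496000) * (a * b * c)^3) (Z_od a b c)"
proof -
  let ?P = "[:a^2*c^2, 2*a^2*b*c + 3*a^2*c^2 + 2*a*b*c^2, a^2*b^2 + 4*a^2*b*c + 4*a^2*c^2 +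
      2*a*b^2*c + 6*a*b*c^2 + b^2*c^2, a^2*b^2 + 4*a^2*b*c + 3*a^2*c^2 + 4*a*b^2*c + 8*a*b*c^2 +
      3*b^2*c^2, a^2*b^2 + 2*a^2*b*c + a^2*c^2 + 4*a*b^2*c + 6*a*b*c^2 + 4*b^2*c^2, 2*a*b^2*c +
      2*a*b*c^2 + 3*b^2*c^2, b^2*c^2:]"
  have P: "Z_s1 a b c * (Z_d2 a b c * Z_d2 a b c) = ?P"
    unfolding Z_s1_def Z_d2_def by (simp only: list_arith; (intro conjI)?; algebra)
  have prod: "syl a b c (cov_s1 * cov_d2^2) = smult ((1/1036800) * (a * b * c)^2) ?P"
    unfolding P[symmetric]
    unfolding syl_mult syl_power syl_s1 syl_d2 power2_eq_square power3_eq_cube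
      mult_smult_left mult_smult_right smult_smult
    by (rule arg_cong2[where f = smult], simp add: eval_nat_numeral mult_ac, simp only: mult_ac)
  have mem: "cov_s1 * cov_d2^2 \<in> hwv 5 10 6"
    using hwv_mult[OF cov_s1_hwv hwv_power[OF cov_d2_hwv, of 2]] by simp
  have "transvect a b c [720, - 600, 240, - 60, 10, - 1] ?P = smult (120 * (a * b * c)) (Z_od a b c)"
    unfolding Z_od_def by (simp only: transvect_simps list_arith syl_var_simps; (intro conjI)?; algebra)
  then show ?thesis
    unfolding cov_od_def
    by (rule syl_tau_transvect[OF mem prod, where L = 86400 and i = 5,
        rotated 2]) (simp_all add: tau_coeff_def fact_numeral eval_nat_numeral mult_ac)
qed

lemma syl_dv: "syl a b c cov_dv = smult ((- (1/3583180800)) * (a * b * c)^2) (Z_dv a b c)"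
proof -
  let ?P = "[:a^4*b^2*c^2 + 2*a^3*b^2*c^3 + a^3*b*c^4 + a^2*b^2*c^4 - a^4*b*c^3 - 2*a^4*c^4,
      2*a^4*b^3*c + 6*a^3*b^3*c^2 + 5*a^3*b^2*c^3 + 6*a^2*b^3*c^3 + 6*a^2*b^2*c^4 + 2*a*b^3*c^4 -
      a^4*b^2*c^2 - 8*a^4*b*c^3 - 5*a^4*c^4 - 3*a^3*b*c^4, a^4*b^4 + 4*a^3*b^4*c + 7*a^3*b^3*c^2 +
      6*a^2*b^4*c^2 + 17*a^2*b^3*c^3 + 5*a^2*b^2*c^4 + 4*a*b^4*c^3 + 9*a*b^3*c^4 + b^4*c^4 -
      a^4*b^3*c - 9*a^4*b^2*c^2 - 11*a^4*b*c^3 - 4*a^4*c^4 - 8*a^3*b^2*c^3 - 11*a^3*b*c^4,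
      a^3*b^4*c + 9*a^2*b^4*c^2 + 8*a^2*b^3*c^3 + 11*a*b^4*c^3 + 11*a*b^3*c^4 + 4*b^4*c^4 -
      a^4*b^4 - 4*a^4*b^3*c - 6*a^4*b^2*c^2 - 4*a^4*b*c^3 - a^4*c^4 - 7*a^3*b^3*c^2 -
      17*a^3*b^2*c^3 - 9*a^3*b*c^4 - 5*a^2*b^2*c^4, a^2*b^4*c^2 + 8*a*b^4*c^3 + 3*a*b^3*c^4 +
      5*b^4*c^4 - 2*a^3*b^4*c - 6*a^3*b^3*c^2 - 6*a^3*b^2*c^3 - 2*a^3*b*c^4 - 5*a^2*b^3*c^3 -
      6*a^2*b^2*c^4, a*b^4*c^3 + 2*b^4*c^4 - a^2*b^4*c^2 - 2*a^2*b^3*c^3 - a^2*b^2*c^4 - a*b^3*c^4:]"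
  have P: "(Z_d2 a b c * Z_d2 a b c) * Z_si1 a b c = ?P"
    unfolding Z_d2_def Z_si1_def by (simp only: list_arith; (intro conjI)?; algebra)
  have prod: "syl a b c (cov_d2^2 * cov_si1) = smult ((- (1/59719680)) * (a * b * c)) ?P"
    unfolding P[symmetric]
    unfolding syl_mult syl_power syl_d2 syl_si1 power2_eq_square power3_eq_cube
      mult_smult_left mult_smult_right smult_smult
    by (rule arg_cong2[where f = smult], simp add: eval_nat_numeral mult_ac, simp only: mult_ac)
  have mem: "cov_d2^2 * cov_si1 \<in> hwv 5 11 5"
    using hwv_mult[OF hwv_power[OF cov_d2_hwv, of 2] cov_si1_hwv] by simp
  have "transvect a b c [120, - 120, 60, - 20, 5, - 1] ?P = smult (240 * (a * b * c)) (Z_dv a b c)"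
    unfolding Z_dv_def by (simp only: transvect_simps list_arith syl_var_simps; (intro conjI)?; algebra)
  then show ?thesis
    unfolding cov_dv_def
    by (rule syl_tau_transvect[OF mem prod, where L = 14400 and i = 5,
        rotated 2]) (simp_all add: tau_coeff_def fact_numeral eval_nat_numeral mult_ac)
qed

lemma syl_trn: "syl a b c cov_trn = smult ((- (1/37623398400)) * (a * b * c)^3) (Z_trn a b c)"
proof -
  let ?P = "[:a^3*b*c^2 + a^2*b*c^3, 2*a^3*b^2*c + 2*a^3*b*c^2 + 4*a^2*b^2*c^2 + 4*a^2*b*c^3 +
      2*a*b^2*c^3 - 2*a^3*c^3, a^3*b^3 + 2*a^3*b^2*c + 3*a^2*b^3*c + 10*a^2*b^2*c^2 + a^2*b*c^3 +
      3*a*b^3*c^2 + 8*a*b^2*c^3 + b^3*c^3 - 4*a^3*b*c^2 - 5*a^3*c^3, 4*a^2*b^3*c + 8*a*b^3*c^2 +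
      8*a*b^2*c^3 + 4*b^3*c^3 - 4*a^3*b^2*c - 8*a^3*b*c^2 - 4*a^3*c^3 - 8*a^2*b*c^3, 4*a*b^3*c^2 +
      5*b^3*c^3 - a^3*b^3 - 3*a^3*b^2*c - 3*a^3*b*c^2 - a^3*c^3 - 2*a^2*b^3*c - 10*a^2*b^2*c^2 -
      8*a^2*b*c^3 - a*b^2*c^3, 2*b^3*c^3 - 2*a^2*b^3*c - 4*a^2*b^2*c^2 - 2*a^2*b*c^3 - 2*a*b^3*c^2 -
      4*a*b^2*c^3, -(a*b^3*c^2) - a*b^2*c^3:]"
  have P: "Z_v2 a b c * (Z_d2 a b c * Z_d2 a b c) = ?P"
    unfolding Z_v2_def Z_d2_def by (simp only: list_arith; (intro conjI)?; algebra)
  have prod: "syl a b c (cov_v2 * cov_d2^2) = smult ((- (1/104509440)) * (a * b * c)^2) ?P"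
    unfolding P[symmetric]
    unfolding syl_mult syl_power syl_v2 syl_d2 power2_eq_square power3_eq_cube
      mult_smult_left mult_smult_right smult_smult
    by (rule arg_cong2[where f = smult], simp add: eval_nat_numeral mult_ac, simp only: mult_ac)
  have mem: "cov_v2 * cov_d2^2 \<in> hwv 5 12 6"
    using hwv_mult[OF cov_v2_hwv hwv_power[OF cov_d2_hwv, of 2]] by simp
  have "transvect a b c [720, - 600, 240, - 60, 10, - 1] ?P = smult (240 * (a * b * c)) (Z_trn a b c)"
    unfolding Z_trn_def by (simp only: transvect_simps list_arith syl_var_simps; (intro conjI)?; algebra)
  then show ?thesis
    unfolding cov_trn_def
    by (rule syl_tau_transvect[OF mem prod, where L = 86400 and i = 5,
        rotated 2]) (simp_all add: tau_coeff_def fact_numeral eval_nat_numeral mult_ac)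
qed

lemma syl_vis: "syl a b c cov_vis = smult ((- (1/24766945689600)) * (a * b * c)^5) (Z_vis a b c)"
proof -
  let ?P = "[:2*a^4*b^3*c + 6*a^3*b^3*c^2 + 6*a^2*b^3*c^3 + 2*a^2*b^2*c^4 + 2*a*b^3*c^4 -
      2*a^4*b^2*c^2 - 4*a^4*b*c^3 - 4*a^3*b*c^4, 4*a^4*b^3*c + 14*a^3*b^3*c^2 + 4*a^3*b^2*c^3 +
      16*a^2*b^3*c^3 + 5*a^2*b^2*c^4 + 6*a*b^3*c^4 - a^4*b^4 - 5*a^4*b^2*c^2 - 14*a^4*b*c^3 -
      4*a^4*c^4 - 4*a^3*b^4*c - 6*a^3*b*c^4 - 6*a^2*b^4*c^2 - 4*a*b^4*c^3 - b^4*c^4, a^4*b^4 +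
      16*a^3*b^3*c^2 + 8*a^3*b^2*c^3 + 20*a^2*b^3*c^3 + 11*a^2*b^2*c^4 + 4*a*b^3*c^4 -
      11*a^4*b^2*c^2 - 18*a^4*b*c^3 - 8*a^4*c^4 - 2*a^3*b^4*c - 2*a^3*b*c^4 - 12*a^2*b^4*c^2 -
      14*a*b^4*c^3 - 5*b^4*c^4, a^4*b^4 + 16*a^3*b^3*c^2 + 20*a^3*b^2*c^3 + 4*a^3*b*c^4 +
      8*a^2*b^3*c^3 + 11*a^2*b^2*c^4 - 2*a^4*b^3*c - 12*a^4*b^2*c^2 - 14*a^4*b*c^3 - 5*a^4*c^4 -
      11*a^2*b^4*c^2 - 18*a*b^4*c^3 - 2*a*b^3*c^4 - 8*b^4*c^4, 4*a^3*b^4*c + 14*a^3*b^3*c^2 +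
      16*a^3*b^2*c^3 + 6*a^3*b*c^4 + 4*a^2*b^3*c^3 + 5*a^2*b^2*c^4 - a^4*b^4 - 4*a^4*b^3*c -
      6*a^4*b^2*c^2 - 4*a^4*b*c^3 - a^4*c^4 - 5*a^2*b^4*c^2 - 14*a*b^4*c^3 - 6*a*b^3*c^4 -
      4*b^4*c^4, 2*a^3*b^4*c + 6*a^3*b^3*c^2 + 6*a^3*b^2*c^3 + 2*a^3*b*c^4 + 2*a^2*b^2*c^4 -
      2*a^2*b^4*c^2 - 4*a*b^4*c^3 - 4*a*b^3*c^4:]"
  have P: "Z_p1 a b c * Z_p2 a b c * Z_si1 a b c = ?P"
    unfolding Z_p1_def Z_p2_def Z_si1_def by (simp only: list_arith; (intro conjI)?; algebra)
  have prod: "syl a b c (cov_p1 * cov_p2 * cov_si1) = smult ((1/2476694568960) * (a * b * c)^3) ?P"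
    unfolding P[symmetric]
    unfolding syl_mult syl_power syl_p1 syl_p2 syl_si1 power2_eq_square power3_eq_cube
      mult_smult_left mult_smult_right smult_smult
    by (rule arg_cong2[where f = smult], simp add: eval_nat_numeral mult_ac, simp only: mult_ac)
  have mem: "cov_p1 * cov_p2 * cov_si1 \<in> hwv 5 17 5"
    using hwv_mult[OF hwv_mult[OF cov_p1_hwv cov_p2_hwv] cov_si1_hwv] by simp
  have "transvect a b c [120, - 120, 60, - 20, 5, - 1] ?P = smult (- 1440 * (a * b * c)^2) (Z_vis a b c)"
    unfolding Z_vis_def by (simp only: transvect_simps list_arith syl_var_simps; (intro conjI)?; algebra)
  then show ?thesis
    unfolding cov_vis_def
    by (rule syl_tau_transvect[OF mem prod, where L = 14400 and i = 5,
        rotated 2]) (simp_all add: tau_coeff_def fact_numeral eval_nat_numeral mult_ac)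
qed

end

section \<open>Free modules over three invariants\<close>

text \<open>
  \<open>ext_index k A\<close> indexes the products of elements of \<open>A\<close> with powers of an invariant of degree
  \<open>k\<close>.
\<close>

definition ext_index :: "nat \<Rightarrow> (nat \<Rightarrow> 'x set) \<Rightarrow> nat \<Rightarrow> ('x \<times> nat) set"
  where "ext_index k A m = {(x, j). k * j \<le> m \<and> x \<in> A (m - k * j)}"

lemma ext_index_step:
  assumes "k > 0"
  shows "ext_index k A m = (\<lambda>x. (x, 0)) ` A m \<union>
    (if k \<le> m then (\<lambda>(x, j). (x, Suc j)) ` ext_index k A (m - k) else {})" (is "_ = ?R")
proof (intro set_eqI iffI)
  fix z assume z: "z \<in> ext_index k A m"
  obtain x j where zx: "z = (x, j)" by force
  show "z \<in> ?R"
  proof (cases j)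
    case 0
    then show ?thesis using z zx by (auto simp: ext_index_def)
  next
    case (Suc l)
    then have "k \<le> m" "(x, l) \<in> ext_index k A (m - k)" using z zx by (auto simp: ext_index_def)
    then show ?thesis using zx Suc by force
  qed
qed (use assms in \<open>auto simp: ext_index_def split: if_splits\<close>)

lemma finite_ext_index:
  assumes "k > 0" "\<And>m. finite (A m)"
  shows "finite (ext_index k A m)"
  by (induction m rule: less_induct) (subst ext_index_step, use assms in auto)

definition card_series :: "(nat \<Rightarrow> 'x set) \<Rightarrow> int fps"
  where "card_series A = Abs_fps (\<lambda>m. int (card (A m)))"

lemma card_series_ext_index:
  assumes "k > 0" "\<And>m. finite (A m)"
  shows "(1 - fps_X ^ k) * card_series (ext_index k A) = card_series A"
proof (rule fps_ext)
  fix m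
  have "card (ext_index k A m) = card (A m) + (if k \<le> m then card (ext_index k A (m - k)) else 0)"
  proof (cases "k \<le> m")
    case True
    have "card (ext_index k A m) = card ((\<lambda>x. (x, 0 :: nat)) ` A m) + card ((\<lambda>(x, j). (x,
        Suc j)) ` ext_index k A (m - k))"
      using True finite_ext_index[OF assms] assms
      by (subst ext_index_step) (auto intro!: card_Un_disjoint)
    then show ?thesis using True by (simp add: card_image inj_on_def split_def prod_eq_iff)
  next
    case False
    then show ?thesis using assms by (subst ext_index_step) (auto simp: card_image inj_on_def)
  qed
  then show "fps_nth ((1 - fps_X ^ k) * card_series (ext_index k A)) m = fps_nth (card_series A) m"
    by (simp add: card_series_def left_diff_distrib fps_X_power_mult_nth)
qed

lemma D_series_nonzero: "D_series \<noteq> 0"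
proof -
  have "fps_nth D_series 0 = 1" by (simp add: D_series_def)
  then show ?thesis by auto
qed

definition inv_index :: "nat set \<Rightarrow> (nat \<Rightarrow> nat) \<Rightarrow> nat \<Rightarrow> (((nat \<times> nat) \<times> nat) \<times> nat) set"
  where "inv_index K dg = ext_index 12 (ext_index 8 (ext_index 4 (\<lambda>m. {\<kappa> \<in> K. dg \<kappa> = m})))"

lemma finite_inv_index: "finite K \<Longrightarrow> finite (inv_index K dg m)"
  unfolding inv_index_def by (intro finite_ext_index) auto

lemma inv_index_iff: "(((\<kappa>, i), j), l) \<in> inv_index K dg m \<longleftrightarrow> \<kappa> \<in> K \<and> m = dg \<kappa> + 4 * i + 8 * j + 12 * l"
  by (auto simp: inv_index_def ext_index_def)

lemma card_inv_index:
  assumes K: "finite K" and ser: "D_series * dim_series w = (\<Sum>\<kappa>\<in>K. fps_X ^ dg \<kappa>)"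
  shows "int (card (inv_index K dg m)) = int (card (bimons 5 m w)) - int (card (bimons 5 m (w + 2)))"
proof -
  let ?A = "\<lambda>m. {\<kappa> \<in> K. dg \<kappa> = m}"
  have "D_series * card_series (inv_index K dg)
      = (1 - fps_X^4) * ((1 - fps_X^8) * ((1 - fps_X^12) * card_series (inv_index K dg)))"
    by (simp add: D_series_def mult.assoc)
  also have "\<dots> = card_series ?A"
    unfolding inv_index_def using K by (simp add: card_series_ext_index finite_ext_index)
  also have "\<dots> = (\<Sum>\<kappa>\<in>K. fps_X ^ dg \<kappa>)"
  proof (rule fps_ext)
    fix m
    have "fps_nth (\<Sum>\<kappa>\<in>K. fps_X ^ dg \<kappa>) m = (\<Sum>\<kappa>\<in>K. if dg \<kappa> = m then 1 else (0 :: int))"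
      unfolding fps_sum_nth by (intro sum.cong) auto
    also have "\<dots> = int (card {\<kappa> \<in> K. dg \<kappa> = m})" using K by (simp add: sum.If_cases Int_def)
    finally show "fps_nth (card_series ?A) m = fps_nth (\<Sum>\<kappa>\<in>K. fps_X ^ dg \<kappa>) m"
      by (simp add: card_series_def)
  qed
  finally have "card_series (inv_index K dg) = dim_series w"
    unfolding ser[symmetric] using D_series_nonzero by simp
  then show ?thesis by (simp add: card_series_def dim_series_def fps_eq_iff)
qed

text \<open>
  Compare the leading coefficients.
\<close>

lemma distinct_degrees_independent:
  fixes q :: "'i \<Rightarrow> 'k::idom poly"
  assumes X: "finite X" and q: "\<And>x. x \<in> X \<Longrightarrow> q x \<noteq> 0" and inj: "inj_on (\<lambda>x. degree (q x)) X"
    and sum: "(\<Sum>x\<in>X. smult (c x) (q x)) = 0"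
  shows "\<forall>x\<in>X. c x = 0"
proof (rule ccontr)
  assume "\<not> ?thesis"
  then have ne: "(\<lambda>x. degree (q x)) ` {x \<in> X. c x \<noteq> 0} \<noteq> {}" by auto
  have fin: "finite ((\<lambda>x. degree (q x)) ` {x \<in> X. c x \<noteq> 0})" using X by simp
  obtain x where x: "x \<in> X" "c x \<noteq> 0" "degree (q x) = Max ((\<lambda>x. degree (q x)) ` {x \<in> X. c x \<noteq> 0})"
    using Max_in[OF fin ne] by auto
  have max: "degree (q y) \<le> degree (q x)" if "y \<in> X" "c y \<noteq> 0" for y
    unfolding x(3) using that by (intro Max_ge fin) auto
  have "coeff (smult (c y) (q y)) (degree (q x)) = (if y =
      x then c x * lead_coeff (q x) else 0)" if "y \<in> X" for y
  proof (cases "y = x")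
    case False
    then have "degree (q y) \<noteq> degree (q x)" using inj that x(1) by (auto dest: inj_onD)
    then have "c y = 0 \<or> degree (q y) < degree (q x)" using max[OF that] by fastforce
    then show ?thesis using False by (auto simp: coeff_eq_0)
  qed simp
  then have "coeff (\<Sum>y\<in>X. smult (c y) (q y)) (degree (q x)) = (\<Sum>y\<in>X. if y =
      x then c x * lead_coeff (q x) else 0)"
    unfolding coeff_sum by (intro sum.cong) auto
  then show False using sum x(1,2) X q[OF x(1)] by simp
qed

text \<open>
  \<open>I4\<close>, \<open>I8\<close> and \<open>I12\<close> are the values of invariants of degrees 4, 8 and 12 on the sum of fifth
  powers; the last three factors of \<open>gen_cond\<close> are the value of the invariant of degree 18 up to a
  number and a monomial.
\<close>

definition I4 :: "'k::comm_ring_1 \<Rightarrow> 'k \<Rightarrow> 'k \<Rightarrow> 'k"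
  where "I4 a b c = a^2*b^2 + 2*a^2*b*c + a^2*c^2 + 2*a*b^2*c + b^2*c^2 - 2*a*b*c^2"

definition I8 :: "'k::comm_ring_1 \<Rightarrow> 'k \<Rightarrow> 'k \<Rightarrow> 'k"
  where "I8 a b c = (a * b * c)^2 * (a*b - a*c - b*c)"

definition I12 :: "'k::comm_ring_1 \<Rightarrow> 'k \<Rightarrow> 'k \<Rightarrow> 'k"
  where "I12 a b c = (a * b * c)^4"

definition gen_cond :: "'k::comm_ring_1 \<Rightarrow> 'k \<Rightarrow> 'k \<Rightarrow> 'k"
  where "gen_cond a b c = a * b * c * (a - b) * (a + c) * (b + c)"

text \<open>
  Substitute \<open>a = t + 1\<close>, \<open>b = t - 1\<close> and \<open>c = t\<^sup>M\<close> with \<open>M\<close> large. Then the three invariants have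
  degrees \<open>2 M\<close>, \<open>3 M + 5\<close> and \<open>4 M + 8\<close> in \<open>t\<close>, and different monomials of the same total degree
  have different degrees in \<open>t\<close>. The points with \<open>gen_cond = 0\<close> are avoided by multiplication with
  \<open>gen_cond\<close>.
\<close>

lemma invariants_independent:
  fixes X :: "(nat \<times> nat \<times> nat) set" and r :: "nat \<times> nat \<times> nat \<Rightarrow> 'k::field_char_0"
  assumes X: "finite X" "\<And>i j l. (i, j, l) \<in> X \<Longrightarrow> i + 2 * j + 3 * l = N"
    and sum: "\<And>a b c. gen_cond a b c \<noteq> 0 \<Longrightarrow>
      (\<Sum>(i, j, l)\<in>X. r (i, j, l) * (I4 a b c ^ i * I8 a b c ^ j * I12 a b c ^ l)) = 0"
  shows "\<forall>x\<in>X. r x = 0"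
proof -
  define M where "M = 3 * N + 4"
  define A B C :: "'k poly" where "A = [:1, 1:]" and "B = [:-1, 1:]" and "C = monom 1 M"
  have nz: "A \<noteq> 0" "B \<noteq> 0" "C \<noteq> 0" by (auto simp: A_def B_def C_def monom_eq_0_iff)
  have dA: "degree A = 1" "degree B = 1" "degree C = M" "degree (A * B) = 2"
    by (simp_all add: A_def B_def C_def degree_monom_eq)
  have AB: "A + B = [:0, 2:]" "A - B = [:2:]" by (simp_all add: A_def B_def)
  have dAC: "degree (A + C) = M" "degree (B + C) = M"
    using dA by (simp_all add: degree_add_eq_right M_def)
  have d1: "degree (C * (A + B)) = M + 1" unfolding AB using nz by (simp add: degree_mult_eq dA)
  have d4: "degree (I4 A B C) = 2 * M" and d4nz: "I4 A B C \<noteq> 0"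
  proof -
    have eq: "I4 A B C = C^2 * (A - B)^2 + (2 * (A * B) * (C * (A + B)) + (A * B)^2)"
      unfolding I4_def by algebra
    have "degree (C^2 * (A - B)^2) = 2 * M" unfolding AB by (simp add: degree_power_eq degree_mult_eq nz dA)
    moreover have "degree (2 * (A * B) * (C * (A + B)) + (A * B)^2) < 2 * M"
    proof (rule degree_add_less)
      have "degree (2 * (A * B) * (C * (A + B))) \<le> degree (2 :: 'k poly) + degree (A * B) +
          degree (C * (A + B))"
        by (intro order.trans[OF degree_mult_le] add_mono degree_mult_le order.refl)
      then show "degree (2 * (A * B) * (C * (A + B))) < 2 * M" using d1 dA by (simp add: M_def)
      have "degree ((A * B)^2) = 4" using dA nz by (simp add: degree_power_eq)
      then show "degree ((A * B)^2) < 2 * M" by (simp add: M_def)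
    qed
    ultimately show "degree (I4 A B C) = 2 * M" unfolding eq by (simp add: degree_add_eq_left)
    then show "I4 A B C \<noteq> 0" by (auto simp: M_def)
  qed
  have d8: "degree (I8 A B C) = 3 * M + 5" and d8nz: "I8 A B C \<noteq> 0"
  proof -
    have eq: "I8 A B C = (A * B * C)^2 * (A * B + - (C * (A + B)))" unfolding I8_def by algebra
    have d: "degree (A * B + - (C * (A + B))) = M + 1"
      using d1 dA by (subst degree_add_eq_right) (simp_all add: M_def)
    then have nz': "A * B + - (C * (A + B)) \<noteq> 0" by (auto simp: M_def)
    show "I8 A B C \<noteq> 0" unfolding eq using nz nz' by simp
    show "degree (I8 A B C) = 3 * M + 5"
      unfolding eq using nz nz' d by (simp add: degree_mult_eq degree_power_eq dA)
  qed
  have d12: "degree (I12 A B C) = 4 * M + 8" and d12nz: "I12 A B C \<noteq> 0"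
    unfolding I12_def using nz by (simp_all add: degree_mult_eq degree_power_eq dA)
  define p where "p x = (case x of (i, j, l) \<Rightarrow> I4 A B C ^ i * I8 A B C ^ j * I12 A B C ^ l)" for x
  have pnz: "p x \<noteq> 0" for x
    using d4nz d8nz d12nz by (auto simp: p_def split: prod.splits)
  have dp: "degree (p (i, j, l)) = M * (2 * i + 3 * j + 4 * l) + (5 * j + 8 * l)" for i j l
    unfolding p_def using d4nz d8nz d12nz
    by (simp add: degree_mult_eq degree_power_eq d4 d8 d12 algebra_simps)
  have inj: "inj_on (\<lambda>x. degree (p x)) X"
  proof (rule inj_onI)
    fix x y assume xy: "x \<in> X" "y \<in> X" "degree (p x) = degree (p y)"
    obtain i j l i' j' l' where x: "x = (i, j, l)" and y: "y = (i', j', l')" by (metis prod_cases3)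
    have s: "i + 2 * j + 3 * l = N" "i' + 2 * j' + 3 * l' = N" using X(2) xy x y by auto
    have small: "5 * j + 8 * l < M" "5 * j' + 8 * l' < M" using s by (auto simp: M_def)
    have e: "M * (2 * i + 3 * j + 4 * l) + (5 * j + 8 * l) = M * (2 * i' + 3 * j' + 4 * l') +
        (5 * j' + 8 * l')"
      using xy(3) unfolding x y dp .
    from arg_cong[OF e, of "\<lambda>n. n mod M"] have 1: "5 * j + 8 * l = 5 * j' + 8 * l'" using small by simp
    with e have 2: "2 * i + 3 * j + 4 * l = 2 * i' + 3 * j' + 4 * l'" using small by simp
    have "i = i' \<and> j = j' \<and> l = l'" using 1 2 s by linarith
    then show "x = y" using x y by simp
  qed
  define R where "R = gen_cond A B C"
  have R: "R \<noteq> 0"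
  proof -
    have "A + C \<noteq> 0" "B + C \<noteq> 0" using dAC by (auto simp: M_def)
    then show ?thesis unfolding R_def gen_cond_def using nz AB by simp
  qed
  define Q where "Q = (\<Sum>x\<in>X. smult (r x) (p x))"
  have ev: "poly (I4 A B C) t = I4 (t + 1) (t - 1) (t ^ M)" "poly (I8 A B C) t = I8 (t + 1) (t - 1) (t ^ M)"
    "poly (I12 A B C) t = I12 (t + 1) (t - 1) (t ^ M)" "poly (gen_cond A B C) t = gen_cond (t +
        1) (t - 1) (t ^ M)" for t
  proof -
    have ABC: "poly A t = t + 1" "poly B t = t - 1" "poly C t = t ^ M"
      by (simp_all add: A_def B_def C_def poly_monom)
    show "poly (I4 A B C) t = I4 (t + 1) (t - 1) (t ^ M)" "poly (I8 A B C) t = I8 (t + 1) (t - 1) (t ^ M)"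
      "poly (I12 A B C) t = I12 (t + 1) (t - 1) (t ^ M)" "poly (gen_cond A B C) t = gen_cond (t +
          1) (t - 1) (t ^ M)"
      by (simp_all add: I4_def I8_def I12_def gen_cond_def ABC)
  qed
  have "poly (Q * R) t = 0" for t
  proof (cases "poly R t = 0")
    case False
    then have "(\<Sum>(i, j, l)\<in>X. r (i, j,
        l) * (I4 (t+1) (t-1) (t^M) ^ i * I8 (t+1) (t-1) (t^M) ^ j * I12 (t+1) (t-1) (t^M) ^ l)) = 0"
      unfolding R_def ev by (rule sum)
    then have "poly Q t = 0"
      by (simp add: Q_def p_def poly_sum split_def ev)
    then show ?thesis by simp
  qed simp
  then have "Q * R = 0" using poly_all_0_iff_0 by blast
  then have "Q = 0" using R by simp
  then show ?thesis
    using distinct_degrees_independent[of X p r] X(1) pnz inj by (simp add: Q_def)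
qed

definition gens :: "('k::field_char_0 mpoly \<times> nat \<times> nat) set"
  where "gens = {(cov_t, 1, 5), (cov_d1, 2, 6), (cov_d2, 2, 2), (cov_tr1, 3, 3), (cov_tr2, 3, 5),
      (cov_tr3, 3, 9), (cov_c1, 4, 0), (cov_c2, 4, 4), (cov_c3, 4, 6), (cov_p1, 5, 1), (cov_p2, 5,
      3), (cov_p3, 5, 7), (cov_s1, 6, 2), (cov_s2, 6, 4), (cov_si1, 7, 1), (cov_si2, 7, 5), (cov_v1,
      8, 0), (cov_v2, 8, 2), (cov_dev, 9, 3), (cov_od, 11, 1), (cov_dv, 12, 0), (cov_trn, 13, 1),
      (cov_vis, 18, 0)}"

lemma gens_hwv: "(g, d, w) \<in> gens \<Longrightarrow> g \<in> hwv 5 d (int w) \<and> d > 0"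
  unfolding gens_def
  by (elim insertE emptyE; simp add: cov_t_hwv cov_d1_hwv cov_d2_hwv cov_tr1_hwv cov_tr2_hwv
      cov_tr3_hwv cov_c1_hwv cov_c2_hwv cov_c3_hwv cov_p1_hwv cov_p2_hwv cov_p3_hwv cov_s1_hwv
      cov_s2_hwv cov_si1_hwv cov_si2_hwv cov_v1_hwv cov_v2_hwv cov_dev_hwv cov_od_hwv cov_dv_hwv
      cov_trn_hwv cov_vis_hwv del: One_nat_def)

text \<open>
  The invariants \<open>cov_c1\<close>, \<open>cov_v1\<close> and \<open>cov_dv\<close>, normalised, the last one also by a multiple of
  the product of the other two, so that their values are \<open>I4\<close>, \<open>I8\<close> and \<open>I12\<close>.
\<close>

definition inv4 :: "'k::field_char_0 mpoly" where "inv4 = Const (- 7200) * cov_c1"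
definition inv8 :: "'k::field_char_0 mpoly" where "inv8 = Const 1244160 * cov_v1"
definition inv12 :: "'k::field_char_0 mpoly"
  where "inv12 = Const (- 3583180800 / 9) * cov_dv - Const (1 / 9) * (inv4 * inv8)"

lemma gen_span_Const: "p \<in> gen_span G m w \<Longrightarrow> Const r * p \<in> gen_span G m w"
  unfolding gen_span_def by (rule vs.span_scale)

lemma gen_span_diff: "p \<in> gen_span G m w \<Longrightarrow> q \<in> gen_span G m w \<Longrightarrow> p - q \<in> gen_span G m w"
  unfolding gen_span_def by (rule vs.span_diff)

lemma inv_gen_span: "inv4 \<in> gen_span gens 4 0" "inv8 \<in> gen_span gens 8 0" "inv12 \<in> gen_span gens 12 0"
proof -
  have c: "cov_c1 \<in> gen_span gens 4 (int 0)" "cov_v1 \<in> gen_span gens 8 (int 0)" "cov_dv \<in> gen_span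
      gens 12 (int 0)"
    by (intro gen_span_gen; simp add: gens_def)+
  show 4: "inv4 \<in> gen_span gens 4 0" and 8: "inv8 \<in> gen_span gens 8 0"
    unfolding inv4_def inv8_def using c by (auto intro: gen_span_Const simp only: of_nat_0)
  show "inv12 \<in> gen_span gens 12 0"
    unfolding inv12_def using gen_span_mult[OF 4 8] c(3) by (intro gen_span_diff gen_span_Const) auto
qed

lemma syl_inv: "syl a b c inv4 = [:I4 a b c:]" "syl a b c inv8 = [:I8 a b c:]" "syl a b c inv12 =
    [:I12 a b c:]"
proof -
  show 4: "syl a b c inv4 = [:I4 a b c:]"
    unfolding inv4_def syl_Const_mult syl_c1 Z_c1_def I4_def by (simp only: smult_smult, simp)
  show 8: "syl a b c inv8 = [:I8 a b c:]"
    unfolding inv8_def syl_Const_mult syl_v1 Z_v1_def I8_def by (simp only: smult_smult, simp)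
  have diff: "syl a b c (p - q) = syl a b c p - syl a b c q" for p q :: "'a mpoly"
    using syl_add[of a b c "p - q" q] by simp
  have comb: "[:- 3583180800 / 9:] * smult (- (1 / 3583180800) * S) [:X:] -
      [:1 / 9:] * ([:P:] * [:Q:]) = [:R:]"
    if "S * X = P * Q + 9 * R" for S X P Q R :: 'a
  proof -
    have R: "R = (S * X - P * Q) / 9" using that by simp
    show ?thesis unfolding R by (simp add: diff_divide_distrib)
  qed
  show "syl a b c inv12 = [:I12 a b c:]"
    unfolding inv12_def diff syl_mult syl_Const 4 8 syl_dv Z_dv_def
    by (rule comb) (unfold I4_def I8_def I12_def, algebra)
qed

text \<open>
  If the \<open>e \<kappa>\<close> are independent over the invariants and their degrees match the numerator of the
  Hilbert series, then they are a basis of the module of covariants of order \<open>w\<close>. For a fixed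
  total degree \<open>m\<close> the products with invariants only involve those \<open>e \<kappa>\<close> whose degree is congruent
  to \<open>m\<close> modulo 4, so independence is needed for one residue class \<open>q\<close> at a time. It is tested at
  a single point \<open>(a, b, c)\<close>: there the coefficients, which are polynomials in the invariants,
  become scalars \<open>\<rho> \<kappa>\<close>.
\<close>

theorem hwv_subset_gen_span_free:
  fixes e :: "nat \<Rightarrow> 'k::field_char_0 mpoly"
  assumes K: "finite K" and e: "\<And>\<kappa>. \<kappa> \<in> K \<Longrightarrow> e \<kappa> \<in> gen_span gens (dg \<kappa>) w" and w: "w \<ge> 0"
    and ind: "\<And>a b c \<rho> q. gen_cond a b c \<noteq> 0 \<Longrightarrow> (\<And>\<kappa>. \<kappa> \<in> K \<Longrightarrow> dg \<kappa> mod 4 \<noteq> q \<Longrightarrow> \<rho> \<kappa> = 0)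
      \<Longrightarrow> (\<Sum>\<kappa>\<in>K. smult (\<rho> \<kappa>) (syl a b c (e \<kappa>))) = 0 \<Longrightarrow> \<forall>\<kappa>\<in>K. \<rho> \<kappa> = 0"
    and ser: "D_series * dim_series w = (\<Sum>\<kappa>\<in>K. fps_X ^ dg \<kappa>)"
  shows "(hwv 5 m w :: 'k mpoly set) \<subseteq> gen_span gens m w"
proof -
  let ?J = "inv_index K dg m"
  define f where "f x = (case x of (((\<kappa>, i), j), l) \<Rightarrow> e \<kappa> * inv4 ^ i * inv8 ^ j * inv12 ^ l)" for x
  have fspan: "f x \<in> gen_span gens m w" if "x \<in> ?J" for x
  proof -
    obtain \<kappa> i j l where x: "x = (((\<kappa>, i), j), l)" by (metis prod.collapse)
    then have k: "\<kappa> \<in> K" "m = dg \<kappa> + i * 4 + j * 8 + l * 12" using that by (auto simp: inv_index_iff)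
    have "e \<kappa> * inv4 ^ i * inv8 ^ j * inv12 ^ l \<in> gen_span gens (dg \<kappa> + i * 4 + j * 8 + l * 12)
        (w + int i * 0 + int j * 0 + int l * 0)"
      by (intro gen_span_mult gen_span_power inv_gen_span e k(1))
    then show ?thesis by (simp add: f_def x k(2))
  qed
  have "hwv 5 m w \<subseteq> vs.span (f ` ?J)"
  proof (rule hwv_subset_span_family)
    show "finite ?J" using K by (rule finite_inv_index)
    show "f x \<in> hwv 5 m w" if "x \<in> ?J" for x
      using fspan[OF that] gen_span_hwv[of gens 5 m w] gens_hwv by blast
    show "w \<ge> 0" by (rule w)
    show "card (bimons 5 m w) \<le> card ?J + card (bimons 5 m (w + 2))"
      using card_inv_index[OF K ser, of m] by linarith
    fix r :: "_ \<Rightarrow> 'k" assume zero: "(\<Sum>x\<in>?J. Const (r x) * f x) = 0"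
    define Y where "Y \<kappa> = {(i, j, l). m = dg \<kappa> + 4 * i + 8 * j + 12 * l}" for \<kappa>
    have finY: "finite (Y \<kappa>)" for \<kappa>
    proof (rule finite_subset)
      show "Y \<kappa> \<subseteq> {..m} \<times> {..m} \<times> {..m}" by (auto simp: Y_def)
    qed auto
    define S where "S a b c \<kappa> = (\<Sum>(i, j, l)\<in>Y \<kappa>. r (((\<kappa>, i), j),
        l) * (I4 a b c ^ i * I8 a b c ^ j * I12 a b c ^ l))"
      for a b c \<kappa>
    have S0: "\<forall>\<kappa>\<in>K. S a b c \<kappa> = 0" if g: "gen_cond a b c \<noteq> 0" for a b c
    proof (rule ind[OF g, of "m mod 4"])
      show "S a b c \<kappa> = 0" if "dg \<kappa> mod 4 \<noteq> m mod 4" for \<kappa>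
      proof -
        have "m mod 4 = dg \<kappa> mod 4" if "m = dg \<kappa> + 4 * i + 8 * j + 12 * l" for i j l
        proof -
          have "m = dg \<kappa> + 4 * (i + 2 * j + 3 * l)" using that by simp
          then show ?thesis by (metis mod_mult_self2)
        qed
        then have "Y \<kappa> = {}" using that by (auto simp: Y_def)
        then show ?thesis by (simp add: S_def)
      qed
      have "0 = syl a b c (\<Sum>x\<in>?J. Const (r x) * f x)" unfolding zero by simp
      also have "\<dots> = (\<Sum>x\<in>?J. smult (r x) (syl a b c (f x)))" by (simp add: syl_sum syl_Const_mult)
      also have "\<dots> = (\<Sum>y\<in>(SIGMA \<kappa>:K. Y \<kappa>). case y of (\<kappa>, i, j, l) \<Rightarrow>
          smult (r (((\<kappa>, i), j), l) * (I4 a b c ^ i * I8 a b c ^ j * I12 a b c ^ l)) (syl a b c (e \<kappa>)))"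
      proof (rule sum.reindex_bij_witness[of _ "\<lambda>(\<kappa>, i, j, l). (((\<kappa>, i), j), l)" "\<lambda>(((\<kappa>, i), j),
          l). (\<kappa>, i, j, l)"],
          goal_cases)
        case (5 x)
        obtain \<kappa> i j l where x: "x = (((\<kappa>, i), j), l)" by (metis prod.collapse)
        show ?case
          unfolding x f_def by (simp add: syl_mult syl_power syl_inv poly_const_pow mult_ac)
      qed (auto simp: inv_index_iff Y_def)
      also have "\<dots> = (\<Sum>\<kappa>\<in>K. smult (S a b c \<kappa>) (syl a b c (e \<kappa>)))"
        using K finY by (subst sum.Sigma[symmetric]) (auto simp: S_def smult_sum split_def)
      finally show "(\<Sum>\<kappa>\<in>K. smult (S a b c \<kappa>) (syl a b c (e \<kappa>))) = 0" by simp
    qed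
    show "\<forall>x\<in>?J. r x = 0"
    proof
      fix x assume xJ: "x \<in> ?J"
      obtain \<kappa> i j l where x: "x = (((\<kappa>, i), j), l)" by (metis prod.collapse)
      have k: "\<kappa> \<in> K" "(i, j, l) \<in> Y \<kappa>" using xJ unfolding x by (auto simp: inv_index_iff Y_def)
      have "\<forall>y\<in>Y \<kappa>. (\<lambda>(i, j, l). r (((\<kappa>, i), j), l)) y = 0"
      proof (rule invariants_independent[where N = "(m - dg \<kappa>) div 4"])
        show "i + 2 * j + 3 * l = (m - dg \<kappa>) div 4" if "(i, j, l) \<in> Y \<kappa>" for i j l
        proof -
          have "m - dg \<kappa> = 4 * (i + 2 * j + 3 * l)" using that by (auto simp: Y_def)
          then show ?thesis by simp
        qed
        show "(\<Sum>(i, j, l)\<in>Y \<kappa>. (case (i, j, l) of (i, j, l) \<Rightarrow> r (((\<kappa>, i), j), l)) *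
            (I4 a b c ^ i * I8 a b c ^ j * I12 a b c ^ l)) = 0" if "gen_cond a b c \<noteq> 0" for a b c
          using S0[OF that] k(1) by (simp add: S_def)
      qed (rule finY)
      then show "r x = 0" using k(2) x by auto
    qed
  qed
  also have "vs.span (f ` ?J) \<subseteq> gen_span gens m w"
    unfolding gen_span_def by (intro vs.span_minimal) (use fspan in \<open>auto simp: gen_span_def\<close>)
  finally show ?thesis .
qed

section \<open>Independence of covariants of low order\<close>

text \<open>
  Each of the following lemmas solves a square homogeneous linear system: the coefficients
  \<open>E0, E1, \<dots>\<close> of the powers of \<open>y\<close> are equated to zero, and Cramer's rule expresses each unknown
  times the determinant as a combination of them. The determinant is a product of a number, a
  power of \<open>a b c\<close> and a power of \<open>gen_cond a b c\<close>. Where several covariants share a factor, their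
  other factors are first replaced by a polynomial in \<open>y\<close> with unknown coefficients \<open>l0, l1, \<dots>\<close>; a
  further lemma then separates them.
\<close>

lemma indep_p1_trn:
  fixes a b c :: "'k::field_char_0"
  assumes g: "gen_cond a b c \<noteq> 0" and eq: "smult r0 (Z_p1 a b c) + smult r1 (Z_trn a b c) = 0"
  shows "r0 = 0 \<and> r1 = 0"
proof -
  define E0 E1 where E: "E0 = r0 * (a*b + b*c) + r1 * (2*a^2*b^2 + 7*a^2*b*c + 7*a*b*c^2 - 2*b^2*c^2)"
    "E1 = r0 * (a*b + a*c) + r1 * (2*a^2*b^2 + 7*a*b^2*c + 7*a*b*c^2 - 2*a^2*c^2)"
  have "smult r0 (Z_p1 a b c) + smult r1 (Z_trn a b c) = [:E0, E1:]"
    unfolding Z_p1_def Z_trn_def E by (simp only: list_arith; (intro conjI)?; algebra)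
  with eq have E0: "E0 = 0" "E1 = 0"
    by (metis pCons_eq_0_iff)+
  have nz: "(- 9) * gen_cond a b c \<noteq> 0" using g by (simp add: gen_cond_def)
  have "(- 9) * gen_cond a b c * r0 = (2*a^2*b^2 + 7*a*b^2*c + 7*a*b*c^2 - 2*a^2*c^2) * E0 +
      (2*b^2*c^2 - 2*a^2*b^2 - 7*a^2*b*c - 7*a*b*c^2) * E1"
    unfolding E gen_cond_def by algebra
  then have r00: "r0 = 0" using nz unfolding E0 by simp
  have "(- 9) * gen_cond a b c * r1 = (-(a*b) - a*c) * E0 + (a*b + b*c) * E1"
    unfolding E gen_cond_def by algebra
  then have r10: "r1 = 0" using nz unfolding E0 by simp
  show ?thesis using r00 r10 by simp
qed

lemma indep_si1_od:
  fixes a b c :: "'k::field_char_0"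
  assumes g: "gen_cond a b c \<noteq> 0" and eq: "smult r0 (Z_si1 a b c) + smult r1 (Z_od a b c) = 0"
  shows "r0 = 0 \<and> r1 = 0"
proof -
  define E0 E1 where E: "E0 = r0 * (a^2*b^2 + 2*a*b^2*c + a*b*c^2 + b^2*c^2 - a^2*b*c - 2*a^2*c^2) +
      r1 * (a*b + 2*a*c - b*c)"
    "E1 = r0 * (a*b^2*c + 2*b^2*c^2 - a^2*b^2 - 2*a^2*b*c - a^2*c^2 - a*b*c^2) + r1 * (a*c - a*b - 2*b*c)"
  have "smult r0 (Z_si1 a b c) + smult r1 (Z_od a b c) = [:E0, E1:]"
    unfolding Z_od_def Z_si1_def E by (simp only: list_arith; (intro conjI)?; algebra)
  with eq have E0: "E0 = 0" "E1 = 0"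
    by (metis pCons_eq_0_iff)+
  have nz: "6 * gen_cond a b c \<noteq> 0" using g by (simp add: gen_cond_def)
  have "6 * gen_cond a b c * r0 = (a*c - a*b - 2*b*c) * E0 + (b*c - a*b - 2*a*c) * E1"
    unfolding E gen_cond_def by algebra
  then have r00: "r0 = 0" using nz unfolding E0 by simp
  have "6 * gen_cond a b c * r1 = (a^2*b^2 + 2*a^2*b*c + a^2*c^2 + a*b*c^2 - a*b^2*c -
      2*b^2*c^2) * E0 + (a^2*b^2 + 2*a*b^2*c + a*b*c^2 + b^2*c^2 - a^2*b*c - 2*a^2*c^2) * E1"
    unfolding E gen_cond_def by algebra
  then have r10: "r1 = 0" using nz unfolding E0 by simp
  show ?thesis using r00 r10 by simp
qed

lemma indep_d2_s1_p1p1: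
  fixes a b c :: "'k::field_char_0"
  assumes g: "gen_cond a b c \<noteq> 0" and eq: "smult r0 (Z_d2 a b c) + smult r1 (Z_s1 a b c) +
      smult r2 (Z_p1 a b c * Z_p1 a b c) = 0"
  shows "r0 = 0 \<and> r1 = 0 \<and> r2 = 0"
proof -
  define E0 E1 E2 where E: "E0 = r0 * (a*c) + r1 * (1) + r2 * (a^2*b^2 + 2*a*b^2*c + b^2*c^2)"
    "E1 = r0 * (a*b + a*c + b*c) + r1 * (1) + r2 * (2*a^2*b^2 + 2*a^2*b*c + 2*a*b^2*c + 2*a*b*c^2)"
    "E2 = r0 * (b*c) + r1 * (1) + r2 * (a^2*b^2 + 2*a^2*b*c + a^2*c^2)"
  have "smult r0 (Z_d2 a b c) + smult r1 (Z_s1 a b c) + smult r2 (Z_p1 a b c * Z_p1 a b c) = [:E0, E1, E2:]"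
    unfolding Z_d2_def Z_p1_def Z_s1_def E by (simp only: list_arith; (intro conjI)?; algebra)
  with eq have E0: "E0 = 0" "E1 = 0" "E2 = 0"
    by (metis pCons_eq_0_iff)+
  have nz: "(- 3) * gen_cond a b c \<noteq> 0" using g by (simp add: gen_cond_def)
  have "(- 3) * gen_cond a b c * r0 = (a^2*c^2 - a^2*b^2 - 2*a*b^2*c - 2*a*b*c^2) * E0 +
      (2*a*b^2*c + b^2*c^2 - 2*a^2*b*c - a^2*c^2) * E1 + (a^2*b^2 + 2*a^2*b*c + 2*a*b*c^2 - b^2*c^2) * E2"
    unfolding E gen_cond_def by algebra
  then have r00: "r0 = 0" using nz unfolding E0 by simp
  have "(- 3) * gen_cond a b c * r1 = (a^2*b^3*c + 2*a*b^3*c^2 + 2*a*b^2*c^3 - a^3*b^3 -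
      3*a^3*b^2*c - 3*a^3*b*c^2 - a^3*c^3 - a^2*b*c^3) * E0 + (a^3*b^2*c + 2*a^3*b*c^2 + a^3*c^3 -
      a^2*b^3*c - 2*a*b^3*c^2 - b^3*c^3) * E1 + (a^3*b^3 + 3*a^2*b^3*c + 3*a*b^3*c^2 + a*b^2*c^3 +
      b^3*c^3 - a^3*b^2*c - 2*a^3*b*c^2 - 2*a^2*b*c^3) * E2"
    unfolding E gen_cond_def by algebra
  then have r10: "r1 = 0" using nz unfolding E0 by simp
  have "(- 3) * gen_cond a b c * r2 = (a*b + a*c) * E0 + (b*c - a*c) * E1 + (-(a*b) - b*c) * E2"
    unfolding E gen_cond_def by algebra
  then have r20: "r2 = 0" using nz unfolding E0 by simp
  show ?thesis using r00 r10 r20 by simp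
qed

lemma indep_v2_p1:
  fixes a b c :: "'k::field_char_0"
  assumes g: "gen_cond a b c \<noteq> 0" and eq: "smult r0 (Z_v2 a b c) + Z_p1 a b c * [:l0, l1:] = 0"
  shows "r0 = 0 \<and> l0 = 0 \<and> l1 = 0"
proof -
  define E0 E1 E2 where E: "E0 = r0 * (a*b + b*c) + l0 * (a*b + b*c)"
    "E1 = r0 * (2*b*c - 2*a*c) + l0 * (a*b + a*c) + l1 * (a*b + b*c)"
    "E2 = r0 * (-(a*b) - a*c) + l1 * (a*b + a*c)"
  have "smult r0 (Z_v2 a b c) + Z_p1 a b c * [:l0, l1:] = [:E0, E1, E2:]"
    unfolding Z_p1_def Z_v2_def E by (simp only: list_arith; (intro conjI)?; algebra)
  with eq have E0: "E0 = 0" "E1 = 0" "E2 = 0"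
    by (metis pCons_eq_0_iff)+
  have nz: "3 * gen_cond a b c \<noteq> 0" using g by (simp add: gen_cond_def)
  have "3 * gen_cond a b c * r0 = (a^2*b^2 + 2*a^2*b*c + a^2*c^2) * E0 + (-(a^2*b^2) - a^2*b*c -
      a*b^2*c - a*b*c^2) * E1 + (a^2*b^2 + 2*a*b^2*c + b^2*c^2) * E2"
    unfolding E gen_cond_def by algebra
  then have r00: "r0 = 0" using nz unfolding E0 by simp
  have "3 * gen_cond a b c * l0 = (a^2*b*c + 2*a^2*c^2 - a^2*b^2 - 3*a*b^2*c - 3*a*b*c^2) * E0 +
      (a^2*b^2 + a^2*b*c + a*b^2*c + a*b*c^2) * E1 + (-(a^2*b^2) - 2*a*b^2*c - b^2*c^2) * E2"
    unfolding E gen_cond_def by algebra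
  then have l00: "l0 = 0" using nz unfolding E0 by simp
  have "3 * gen_cond a b c * l1 = (a^2*b^2 + 2*a^2*b*c + a^2*c^2) * E0 + (-(a^2*b^2) - a^2*b*c -
      a*b^2*c - a*b*c^2) * E1 + (a^2*b^2 + 3*a^2*b*c + 3*a*b*c^2 - a*b^2*c - 2*b^2*c^2) * E2"
    unfolding E gen_cond_def by algebra
  then have l10: "l1 = 0" using nz unfolding E0 by simp
  show ?thesis using r00 l00 l10 by simp
qed

lemma indep_tr1_p1:
  fixes a b c :: "'k::field_char_0"
  assumes g: "gen_cond a b c \<noteq> 0" and eq: "smult r0 (Z_tr1 a b c) + Z_p1 a b c * [:l0, l1, l2:] = 0"
  shows "r0 = 0 \<and> l0 = 0 \<and> l1 = 0 \<and> l2 = 0"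
proof -
  define E0 E1 E2 E3 where E: "E0 = l0 * (a*b + b*c)"
    "E1 = r0 * (1) + l0 * (a*b + a*c) + l1 * (a*b + b*c)"
    "E2 = r0 * (1) + l1 * (a*b + a*c) + l2 * (a*b + b*c)"
    "E3 = l2 * (a*b + a*c)"
  have "smult r0 (Z_tr1 a b c) + Z_p1 a b c * [:l0, l1, l2:] = [:E0, E1, E2, E3:]"
    unfolding Z_p1_def Z_tr1_def E by (simp only: list_arith; (intro conjI)?; algebra)
  with eq have E0: "E0 = 0" "E1 = 0" "E2 = 0" "E3 = 0"
    by (metis pCons_eq_0_iff)+
  have nz: "(- 1) * gen_cond a b c \<noteq> 0" using g by (simp add: gen_cond_def)
  have "(- 1) * gen_cond a b c * r0 = (a^3*b^3 + 3*a^3*b^2*c + 3*a^3*b*c^2 + a^3*c^3) * E0 +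
      (-(a^3*b^3) - 2*a^3*b^2*c - a^3*b*c^2 - a^2*b^3*c - 2*a^2*b^2*c^2 - a^2*b*c^3) * E1 +
      (a^3*b^3 + a^3*b^2*c + 2*a^2*b^3*c + 2*a^2*b^2*c^2 + a*b^3*c^2 + a*b^2*c^3) * E2 +
      (-(a^3*b^3) - 3*a^2*b^3*c - 3*a*b^3*c^2 - b^3*c^3) * E3"
    unfolding E gen_cond_def by algebra
  then have r00: "r0 = 0" using nz unfolding E0 by simp
  have "(- 1) * gen_cond a b c * l0 = (a*b^2*c + a*b*c^2 - a^2*b*c - a^2*c^2) * E0"
    unfolding E gen_cond_def by algebra
  then have l00: "l0 = 0" using nz unfolding E0 by simp
  have "(- 1) * gen_cond a b c * l1 = (-(a^2*b^2) - 2*a^2*b*c - a^2*c^2) * E0 + (a^2*b^2 + a^2*b*c +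
      a*b^2*c + a*b*c^2) * E1 + (-(a^2*b^2) - a^2*b*c - a*b^2*c - a*b*c^2) * E2 + (a^2*b^2 +
      2*a*b^2*c + b^2*c^2) * E3"
    unfolding E gen_cond_def by algebra
  then have l10: "l1 = 0" using nz unfolding E0 by simp
  have "(- 1) * gen_cond a b c * l2 = (a*b^2*c + b^2*c^2 - a^2*b*c - a*b*c^2) * E3"
    unfolding E gen_cond_def by algebra
  then have l20: "l2 = 0" using nz unfolding E0 by simp
  show ?thesis using r00 l00 l10 l20 by simp
qed

lemma indep_p2_dev_d2:
  fixes a b c :: "'k::field_char_0"
  assumes g: "gen_cond a b c \<noteq> 0" and eq: "smult r0 (Z_p2 a b c) + smult r1 (Z_dev a b c) +
      Z_d2 a b c * [:l0, l1:] = 0"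
  shows "r0 = 0 \<and> r1 = 0 \<and> l0 = 0 \<and> l1 = 0"
proof -
  define E0 E1 E2 E3 where E: "E0 = r0 * (2*a*c) + r1 * (a^2*b + a^2*c + b*c^2 - a*c^2) + l0 * (a*c)"
    "E1 = r0 * (3*a*c - a*b - b*c) + r1 * (3*b*c^2 - 3*a*c^2) + l0 * (a*b + a*c + b*c) + l1 * (a*c)"
    "E2 = r0 * (a*b + a*c - 3*b*c) + r1 * (3*b*c^2 - 3*a*c^2) + l0 * (b*c) + l1 * (a*b + a*c + b*c)"
    "E3 = r0 * (-(2*b*c)) + r1 * (b*c^2 - a*b^2 - a*c^2 - b^2*c) + l1 * (b*c)"
  have "smult r0 (Z_p2 a b c) + smult r1 (Z_dev a b c) + Z_d2 a b c * [:l0, l1:] = [:E0, E1, E2, E3:]"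
    unfolding Z_d2_def Z_dev_def Z_p2_def E by (simp only: list_arith; (intro conjI)?; algebra)
  with eq have E0: "E0 = 0" "E1 = 0" "E2 = 0" "E3 = 0"
    by (metis pCons_eq_0_iff)+
  have nz: "6 * (a * b * c)^1 * gen_cond a b c \<noteq> 0" using g by (simp add: gen_cond_def)
  have "6 * (a * b * c)^1 * gen_cond a b c * r0 = (2*a^2*b^2*c^3 + 3*a^2*b*c^4 + b^3*c^4 - a^3*b^4 -
      2*a^3*b^3*c - 2*a^3*b^2*c^2 - 2*a^3*b*c^3 - a^3*c^4 - 3*a^2*b^4*c - 2*a^2*b^3*c^2 -
      3*a*b^4*c^2 - 2*a*b^3*c^3 - 3*a*b^2*c^4 - b^4*c^3) * E0 + (a^3*b^3*c + a^3*b^2*c^2 +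
      a^3*b*c^3 + a^3*c^4 + a^2*b^3*c^2 + a*b^3*c^3 + 3*a*b^2*c^4 - a^2*b^2*c^3 - 3*a^2*b*c^4 -
      b^3*c^4) * E1 + (a^3*b^3*c + a^3*b^2*c^2 + a^3*b*c^3 + a^2*b^3*c^2 + 3*a^2*b*c^4 + a*b^3*c^3 +
      b^3*c^4 - a^3*c^4 - a^2*b^2*c^3 - 3*a*b^2*c^4) * E2 + (a^3*c^4 + 2*a^2*b^2*c^3 + 3*a*b^2*c^4 -
      a^4*b^3 - 3*a^4*b^2*c - 3*a^4*b*c^2 - a^4*c^3 - 2*a^3*b^3*c - 2*a^3*b^2*c^2 - 2*a^3*b*c^3 -
      2*a^2*b^3*c^2 - 3*a^2*b*c^4 - 2*a*b^3*c^3 - b^3*c^4) * E3"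
    unfolding E gen_cond_def by algebra
  then have r00: "r0 = 0" using nz unfolding E0 by simp
  have "6 * (a * b * c)^1 * gen_cond a b c * r1 = (3*a^2*b^3*c + 6*a^2*b^2*c^2 + 3*a^2*b*c^3 +
      3*a*b^3*c^2 - 3*a*b^2*c^3) * E0 + (3*a*b^2*c^3 - 3*a^2*b^2*c^2 - 3*a^2*b*c^3) * E1 +
      (3*a^2*b*c^3 - 3*a^2*b^2*c^2 - 3*a*b^2*c^3) * E2 + (3*a^3*b^2*c + 3*a^3*b*c^2 +
      6*a^2*b^2*c^2 + 3*a*b^2*c^3 - 3*a^2*b*c^3) * E3"
    unfolding E gen_cond_def by algebra
  then have r10: "r1 = 0" using nz unfolding E0 by simp
  have "6 * (a * b * c)^1 * gen_cond a b c * l0 = (a^3*b^3*c + a^3*b^2*c^2 + a^3*b*c^3 + 2*a^3*c^4 +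
      7*a^2*b^3*c^2 + 11*a^2*b^2*c^3 + b^3*c^4 - a^3*b^4 - 3*a^2*b^4*c - 3*a^2*b*c^4 - 3*a*b^4*c^2 -
      5*a*b^3*c^3 - b^4*c^3) * E0 + (a^3*b^3*c + 4*a^3*b^2*c^2 + a^3*b*c^3 + 3*a^2*b*c^4 +
      a*b^3*c^3 - 2*a^3*c^4 - 5*a^2*b^3*c^2 - 4*a^2*b^2*c^3 - b^3*c^4) * E1 + (a^3*b^3*c +
      2*a^3*c^4 + a^2*b^3*c^2 + 2*a^2*b^2*c^3 + a*b^3*c^3 + b^3*c^4 - 2*a^3*b^2*c^2 - 5*a^3*b*c^3 -
      3*a^2*b*c^4) * E2 + (3*a^4*b*c^2 + 2*a^4*c^3 + 4*a^3*b^2*c^2 + 10*a^3*b*c^3 + 3*a^2*b*c^4 -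
      a^4*b^3 - 2*a^3*b^3*c - 2*a^3*c^4 - 2*a^2*b^3*c^2 - 4*a^2*b^2*c^3 - 2*a*b^3*c^3 - b^3*c^4) * E3"
    unfolding E gen_cond_def by algebra
  then have l00: "l0 = 0" using nz unfolding E0 by simp
  have "6 * (a * b * c)^1 * gen_cond a b c * l1 = (a^3*b^4 + 2*a^3*b^3*c + 2*a^3*b^2*c^2 +
      2*a^3*b*c^3 + a^3*c^4 + 4*a^2*b^2*c^3 + 2*b^3*c^4 - 4*a^2*b^3*c^2 - 3*a*b^4*c^2 -
      10*a*b^3*c^3 - 3*a*b^2*c^4 - 2*b^4*c^3) * E0 + (2*a^2*b^3*c^2 + 5*a*b^3*c^3 + 3*a*b^2*c^4 -
      a^3*b^3*c - a^3*b^2*c^2 - a^3*b*c^3 - a^3*c^4 - 2*a^2*b^2*c^3 - 2*b^3*c^4) * E1 +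
      (5*a^3*b^2*c^2 + a^3*c^4 + 4*a^2*b^2*c^3 + 2*b^3*c^4 - a^3*b^3*c - a^3*b*c^3 - 4*a^2*b^3*c^2 -
      a*b^3*c^3 - 3*a*b^2*c^4) * E2 + (a^4*b^3 + 3*a^4*b^2*c + 3*a^4*b*c^2 + a^4*c^3 + 5*a^3*b*c^3 +
      3*a*b^2*c^4 - a^3*b^3*c - 7*a^3*b^2*c^2 - a^3*c^4 - a^2*b^3*c^2 - 11*a^2*b^2*c^3 - a*b^3*c^3 -
      2*b^3*c^4) * E3"
    unfolding E gen_cond_def by algebra
  then have l10: "l1 = 0" using nz unfolding E0 by simp
  show ?thesis using r00 r10 l00 l10 by simp
qed

lemma indep_c2_tr1p1_d2:
  fixes a b c :: "'k::field_char_0"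
  assumes g: "gen_cond a b c \<noteq> 0" and eq: "smult r0 (Z_c2 a b c) +
      smult r1 (Z_tr1 a b c * Z_p1 a b c) + Z_d2 a b c * [:l0, l1, l2:] = 0"
  shows "r0 = 0 \<and> r1 = 0 \<and> l0 = 0 \<and> l1 = 0 \<and> l2 = 0"
proof -
  define E0 E1 E2 E3 E4 where E: "E0 = r0 * (83*a^2*b*c + 21*a^2*c^2 - 83*a*b*c^2) + l0 * (a*c)"
    "E1 = r0 * (42*a^2*b*c + 42*a^2*c^2 - 290*a*b*c^2) + r1 * (a*b + b*c) + l0 * (a*b + a*c + b*c) +
        l1 * (a*c)"
    "E2 = r0 * (21*a^2*b^2 + 42*a^2*b*c + 21*a^2*c^2 + 42*a*b^2*c + 21*b^2*c^2 - 414*a*b*c^2) +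
        r1 * (2*a*b + a*c + b*c) + l0 * (b*c) + l1 * (a*b + a*c + b*c) + l2 * (a*c)"
    "E3 = r0 * (42*a*b^2*c + 42*b^2*c^2 - 290*a*b*c^2) + r1 * (a*b + a*c) + l1 * (b*c) + l2 * (a*b +
        a*c + b*c)"
    "E4 = r0 * (83*a*b^2*c + 21*b^2*c^2 - 83*a*b*c^2) + l2 * (b*c)"
  have "smult r0 (Z_c2 a b c) + smult r1 (Z_tr1 a b c * Z_p1 a b c) + Z_d2 a b c * [:l0, l1, l2:] =
      [:E0, E1, E2, E3, E4:]"
    unfolding Z_c2_def Z_d2_def Z_p1_def Z_tr1_def E by (simp only: list_arith; (intro conjI)?; algebra)
  with eq have E0: "E0 = 0" "E1 = 0" "E2 = 0" "E3 = 0" "E4 = 0"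
    by (metis pCons_eq_0_iff)+
  have nz: "332 * (a * b * c)^2 * gen_cond a b c \<noteq> 0" using g by (simp add: gen_cond_def)
  have "332 * (a * b * c)^2 * gen_cond a b c * r0 = (a^3*b^4*c + 3*a^3*b^3*c^2 + 3*a^3*b^2*c^3 +
      a^3*b*c^4 - a*b^4*c^3 - a*b^3*c^4) * E0 + (a^2*b^3*c^3 + a*b^3*c^4 - a^3*b^3*c^2 -
      2*a^3*b^2*c^3 - a^3*b*c^4) * E1 + (a^3*b^2*c^3 + a^3*b*c^4 - a^2*b^3*c^3 - a*b^3*c^4) * E2 +
      (a^3*b^3*c^2 + 2*a^2*b^3*c^3 + a*b^3*c^4 - a^3*b^2*c^3 - a^3*b*c^4) * E3 + (a^4*b*c^3 +
      a^3*b*c^4 - a^4*b^3*c - 3*a^3*b^3*c^2 - 3*a^2*b^3*c^3 - a*b^3*c^4) * E4"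
    unfolding E gen_cond_def by algebra
  then have r00: "r0 = 0" using nz unfolding E0 by simp
  have "332 * (a * b * c)^2 * gen_cond a b c * r1 = (83*a^4*b^5*c + 166*a^4*b^4*c^2 +
      249*a^3*b^5*c^2 + 415*a^3*b^4*c^3 + 415*a^3*b^3*c^4 + 249*a^3*b^2*c^5 + 249*a^2*b^5*c^3 +
      83*a*b^5*c^4 + 83*a*b^4*c^5 - 166*a^4*b^2*c^4 - 83*a^4*b*c^5 - 249*a^2*b^3*c^5) * E0 +
      (83*a^4*b^2*c^4 + 83*a^4*b*c^5 + 249*a^2*b^3*c^5 - 83*a^4*b^4*c^2 - 83*a^4*b^3*c^3 -
      166*a^3*b^4*c^3 - 249*a^3*b^3*c^4 - 249*a^3*b^2*c^5 - 83*a*b^4*c^5) * E1 + (83*a^4*b^3*c^3 +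
      249*a^3*b^2*c^5 + 83*a*b^4*c^5 - 83*a^4*b*c^5 - 83*a^3*b^4*c^3 - 249*a^2*b^3*c^5) * E2 +
      (83*a^4*b^4*c^2 + 166*a^4*b^3*c^3 + 83*a^4*b*c^5 + 83*a^3*b^4*c^3 + 249*a^3*b^3*c^4 +
      249*a^2*b^3*c^5 - 249*a^3*b^2*c^5 - 83*a^2*b^4*c^4 - 83*a*b^4*c^5) * E3 + (249*a^3*b^2*c^5 +
      166*a^2*b^4*c^4 + 83*a*b^4*c^5 - 83*a^5*b^4*c - 249*a^5*b^3*c^2 - 249*a^5*b^2*c^3 -
      83*a^5*b*c^4 - 166*a^4*b^4*c^2 - 415*a^4*b^3*c^3 - 83*a^4*b*c^5 - 415*a^3*b^3*c^4 -
      249*a^2*b^3*c^5) * E4"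
    unfolding E gen_cond_def by algebra
  then have r10: "r1 = 0" using nz unfolding E0 by simp
  have "332 * (a * b * c)^2 * gen_cond a b c * l0 = (62*a^4*b^4*c^2 + 20*a^4*b^3*c^3 +
      249*a^3*b^4*c^3 + 581*a^3*b^3*c^4 + 83*a^3*b^2*c^5 + 21*a^2*b^3*c^5 - 83*a^4*b^5*c -
      146*a^4*b^2*c^4 - 21*a^4*b*c^5 - 249*a^3*b^5*c^2 - 249*a^2*b^5*c^3 - 228*a^2*b^4*c^4 -
      83*a*b^5*c^4 - 83*a*b^4*c^5) * E0 + (83*a^4*b^4*c^2 + 187*a^4*b^3*c^3 + 125*a^4*b^2*c^4 +
      21*a^4*b*c^5 + 83*a*b^4*c^5 - 166*a^3*b^4*c^3 - 187*a^3*b^3*c^4 - 83*a^3*b^2*c^5 -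
      21*a^2*b^3*c^5) * E1 + (83*a^3*b^4*c^3 + 104*a^3*b^3*c^4 + 83*a^3*b^2*c^5 + 21*a^2*b^3*c^5 -
      83*a^4*b^3*c^3 - 104*a^4*b^2*c^4 - 21*a^4*b*c^5 - 83*a*b^4*c^5) * E2 + (62*a^4*b^3*c^3 +
      104*a^4*b^2*c^4 + 21*a^4*b*c^5 + 83*a^2*b^4*c^4 + 83*a*b^4*c^5 - 83*a^4*b^4*c^2 -
      83*a^3*b^4*c^3 - 125*a^3*b^3*c^4 - 83*a^3*b^2*c^5 - 21*a^2*b^3*c^5) * E3 + (83*a^5*b^4*c +
      21*a^5*b^3*c^2 + 166*a^4*b^4*c^2 + 63*a^4*b^3*c^3 + 63*a^3*b^3*c^4 + 83*a^3*b^2*c^5 +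
      21*a^2*b^3*c^5 - 83*a^5*b^2*c^3 - 21*a^5*b*c^4 - 21*a^4*b*c^5 - 166*a^2*b^4*c^4 - 83*a*b^4*c^5) * E4"
    unfolding E gen_cond_def by algebra
  then have l00: "l0 = 0" using nz unfolding E0 by simp
  have "332 * (a * b * c)^2 * gen_cond a b c * l1 = (40*a^4*b^3*c^3 + 82*a^4*b^2*c^4 +
      269*a^3*b^3*c^4 + 311*a^3*b^2*c^5 + 21*a*b^5*c^4 + 21*a*b^4*c^5 - 187*a^4*b^5*c -
      250*a^4*b^4*c^2 - 21*a^4*b*c^5 - 353*a^3*b^5*c^2 - 395*a^3*b^4*c^3 - 145*a^2*b^5*c^3 -
      456*a^2*b^4*c^4 - 311*a^2*b^3*c^5) * E0 + (187*a^4*b^4*c^2 + 63*a^4*b^3*c^3 + 21*a^4*b*c^5 +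
      166*a^3*b^4*c^3 + 21*a^3*b^3*c^4 + 124*a^2*b^4*c^4 + 311*a^2*b^3*c^5 - 103*a^4*b^2*c^4 -
      311*a^3*b^2*c^5 - 21*a*b^4*c^5) * E1 + (145*a^4*b^3*c^3 + 124*a^4*b^2*c^4 + 311*a^3*b^2*c^5 +
      21*a*b^4*c^5 - 21*a^4*b*c^5 - 145*a^3*b^4*c^3 - 124*a^2*b^4*c^4 - 311*a^2*b^3*c^5) * E2 +
      (21*a^4*b*c^5 + 103*a^2*b^4*c^4 + 311*a^2*b^3*c^5 - 187*a^4*b^4*c^2 - 166*a^4*b^3*c^3 -
      124*a^4*b^2*c^4 - 63*a^3*b^4*c^3 - 21*a^3*b^3*c^4 - 311*a^3*b^2*c^5 - 21*a*b^4*c^5) * E3 +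
      (187*a^5*b^4*c + 353*a^5*b^3*c^2 + 145*a^5*b^2*c^3 + 250*a^4*b^4*c^2 + 395*a^4*b^3*c^3 +
      456*a^4*b^2*c^4 + 311*a^3*b^2*c^5 + 21*a*b^4*c^5 - 21*a^5*b*c^4 - 21*a^4*b*c^5 -
      40*a^3*b^4*c^3 - 269*a^3*b^3*c^4 - 82*a^2*b^4*c^4 - 311*a^2*b^3*c^5) * E4"
    unfolding E gen_cond_def by algebra
  then have l10: "l1 = 0" using nz unfolding E0 by simp
  have "332 * (a * b * c)^2 * gen_cond a b c * l2 = (166*a^4*b^2*c^4 + 83*a^4*b*c^5 +
      83*a^2*b^5*c^3 + 21*a*b^5*c^4 + 21*a*b^4*c^5 - 83*a^4*b^5*c - 166*a^4*b^4*c^2 -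
      21*a^3*b^5*c^2 - 63*a^3*b^4*c^3 - 63*a^3*b^3*c^4 - 21*a^3*b^2*c^5 - 83*a^2*b^3*c^5) * E0 +
      (83*a^4*b^4*c^2 + 83*a^4*b^3*c^3 + 125*a^3*b^3*c^4 + 21*a^3*b^2*c^5 + 83*a^2*b^3*c^5 -
      83*a^4*b^2*c^4 - 83*a^4*b*c^5 - 62*a^3*b^4*c^3 - 104*a^2*b^4*c^4 - 21*a*b^4*c^5) * E1 +
      (83*a^4*b*c^5 + 83*a^3*b^4*c^3 + 104*a^2*b^4*c^4 + 21*a*b^4*c^5 - 83*a^4*b^3*c^3 -
      104*a^3*b^3*c^4 - 21*a^3*b^2*c^5 - 83*a^2*b^3*c^5) * E2 + (166*a^4*b^3*c^3 + 187*a^3*b^3*c^4 +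
      21*a^3*b^2*c^5 + 83*a^2*b^3*c^5 - 83*a^4*b^4*c^2 - 83*a^4*b*c^5 - 187*a^3*b^4*c^3 -
      125*a^2*b^4*c^4 - 21*a*b^4*c^5) * E3 + (83*a^5*b^4*c + 249*a^5*b^3*c^2 + 249*a^5*b^2*c^3 +
      83*a^5*b*c^4 + 228*a^4*b^2*c^4 + 83*a^4*b*c^5 + 146*a^2*b^4*c^4 + 21*a*b^4*c^5 -
      62*a^4*b^4*c^2 - 249*a^4*b^3*c^3 - 20*a^3*b^4*c^3 - 581*a^3*b^3*c^4 - 21*a^3*b^2*c^5 -
      83*a^2*b^3*c^5) * E4"
    unfolding E gen_cond_def by algebra
  then have l20: "l2 = 0" using nz unfolding E0 by simp
  show ?thesis using r00 r10 l00 l10 l20 by simp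
qed

lemma indep_s2_d2v2_s1v2_tr1:
  fixes a b c :: "'k::field_char_0"
  assumes g: "gen_cond a b c \<noteq> 0" and eq: "smult r0 (Z_s2 a b c) +
      smult r1 (Z_d2 a b c * Z_v2 a b c) + smult r2 (Z_s1 a b c * Z_v2 a b c) + Z_tr1 a b c * [:l0,
      l1:] = 0"
  shows "r0 = 0 \<and> r1 = 0 \<and> r2 = 0 \<and> l0 = 0 \<and> l1 = 0"
proof -
  define E0 E1 E2 E3 E4 where E: "E0 = r0 * (a^2*b + a^2*c + a*c^2 - b*c^2) + r1 * (a^2*b*c +
      a*b*c^2) + r2 * (a*b + b*c)"
    "E1 = r0 * (4*a*c^2 - 4*b*c^2) + r1 * (a^2*b^2 + a^2*b*c + 2*a*b^2*c + 3*a*b*c^2 + b^2*c^2 -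
        2*a^2*c^2) + r2 * (a*b + 3*b*c - 2*a*c) + l0 * (1)"
    "E2 = r0 * (6*a*c^2 - 6*b*c^2) + r1 * (3*a*b^2*c + 3*b^2*c^2 - 3*a^2*b*c - 3*a^2*c^2) +
        r2 * (3*b*c - 3*a*c) + l0 * (1) + l1 * (1)"
    "E3 = r0 * (4*a*c^2 - 4*b*c^2) + r1 * (2*b^2*c^2 - a^2*b^2 - 2*a^2*b*c - a^2*c^2 - a*b^2*c -
        3*a*b*c^2) + r2 * (2*b*c - a*b - 3*a*c) + l1 * (1)"
    "E4 = r0 * (a*c^2 - a*b^2 - b^2*c - b*c^2) + r1 * (-(a*b^2*c) - a*b*c^2) + r2 * (-(a*b) - a*c)"
  have "smult r0 (Z_s2 a b c) + smult r1 (Z_d2 a b c * Z_v2 a b c) +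
      smult r2 (Z_s1 a b c * Z_v2 a b c) + Z_tr1 a b c * [:l0, l1:] = [:E0, E1, E2, E3, E4:]"
    unfolding Z_d2_def Z_s1_def Z_s2_def Z_tr1_def Z_v2_def E
        by (simp only: list_arith; (intro conjI)?; algebra)
  with eq have E0: "E0 = 0" "E1 = 0" "E2 = 0" "E3 = 0" "E4 = 0"
    by (metis pCons_eq_0_iff)+
  have nz: "(- 2) * gen_cond a b c^2 \<noteq> 0" using g by (simp add: gen_cond_def)
  have "(- 2) * gen_cond a b c^2 * r0 = (a * b * c)^1 * ((2*a^2*b^3*c + 2*a*b^3*c^2 + 2*a*b^2*c^3 -
      2*a^3*b^2*c - 2*a^3*b*c^2 - 2*a^2*b*c^3) * E0 + (a^3*b^2*c + a^3*b*c^2 + a^2*b*c^3 -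
      a^2*b^3*c - a*b^3*c^2 - a*b^2*c^3) * E1 + (a^2*b^3*c + a*b^3*c^2 + a*b^2*c^3 - a^3*b^2*c -
      a^3*b*c^2 - a^2*b*c^3) * E2 + (a^3*b^2*c + a^3*b*c^2 + a^2*b*c^3 - a^2*b^3*c - a*b^3*c^2 -
      a*b^2*c^3) * E3 + (2*a^2*b^3*c + 2*a*b^3*c^2 + 2*a*b^2*c^3 - 2*a^3*b^2*c - 2*a^3*b*c^2 -
      2*a^2*b*c^3) * E4)"
    unfolding E gen_cond_def by algebra
  then have r00: "r0 = 0" using nz unfolding E0 by simp
  have "(- 2) * gen_cond a b c^2 * r1 = (a * b * c)^1 * ((2*a^2*b^2*c + 2*a^2*b*c^2 + 2*a*b*c^3 -
      2*a*b^3*c - 2*b^3*c^2 - 2*b^2*c^3) * E0 + (a^2*b^3 + 2*a*b^3*c + 2*a*b^2*c^2 + b^3*c^2 +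
      b^2*c^3 - a^3*b^2 - 2*a^3*b*c - a^3*c^2 - 2*a^2*b*c^2 - a^2*c^3) * E1 + (a^3*b^2 + 2*a^3*b*c +
      a^3*c^2 + 2*a^2*b*c^2 + a^2*c^3 - a^2*b^3 - 2*a*b^3*c - 2*a*b^2*c^2 - b^3*c^2 -
      b^2*c^3) * E2 + (a^2*b^3 + 2*a*b^3*c + 2*a*b^2*c^2 + b^3*c^2 + b^2*c^3 - a^3*b^2 - 2*a^3*b*c -
      a^3*c^2 - 2*a^2*b*c^2 - a^2*c^3) * E3 + (2*a^3*b*c + 2*a^3*c^2 + 2*a^2*c^3 - 2*a^2*b^2*c -
      2*a*b^2*c^2 - 2*a*b*c^3) * E4)"
    unfolding E gen_cond_def by algebra
  then have r10: "r1 = 0" using nz unfolding E0 by simp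
  have "(- 2) * gen_cond a b c^2 * r2 = (a * b * c)^1 * ((2*a^3*b^3*c + 2*a^2*b^3*c^2 +
      2*a^2*b^2*c^3 + 2*a*b^2*c^4 - 2*a^3*b*c^3 - 2*a^2*b^4*c - 2*a^2*b*c^4 - 2*a*b^4*c^2) * E0 +
      (2*a^3*b^2*c^2 + 2*a^3*b*c^3 + 2*a^2*b*c^4 - 2*a^2*b^3*c^2 - 2*a*b^3*c^3 - 2*a*b^2*c^4) * E1 +
      (2*a^2*b^3*c^2 + 2*a*b^3*c^3 + 2*a*b^2*c^4 - 2*a^3*b^2*c^2 - 2*a^3*b*c^3 - 2*a^2*b*c^4) * E2 +
      (2*a^3*b^2*c^2 + 2*a^3*b*c^3 + 2*a^2*b*c^4 - 2*a^2*b^3*c^2 - 2*a*b^3*c^3 - 2*a*b^2*c^4) * E3 +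
      (2*a^4*b^2*c + 2*a^4*b*c^2 + 2*a*b^3*c^3 + 2*a*b^2*c^4 - 2*a^3*b^3*c - 2*a^3*b^2*c^2 -
      2*a^2*b^2*c^3 - 2*a^2*b*c^4) * E4)"
    unfolding E gen_cond_def by algebra
  then have r20: "r2 = 0" using nz unfolding E0 by simp
  have "(- 2) * gen_cond a b c^2 * l0 = (a * b * c)^1 * ((12*a^4*b^2*c^3 + 8*a^4*b*c^4 +
      4*a^3*b^5*c + 8*a^3*b*c^5 + 14*a^2*b^5*c^2 + 6*a^2*b^4*c^3 + 12*a*b^5*c^3 + 18*a*b^4*c^4 +
      6*a*b^3*c^5 + 2*b^5*c^4 + 2*b^4*c^5 - 4*a^4*b^4*c - 14*a^3*b^4*c^2 - 30*a^3*b^3*c^3 -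
      4*a^3*b^2*c^4 - 24*a^2*b^3*c^4 - 16*a^2*b^2*c^5) * E0 + (a^5*b^4 + a^5*b^3*c + 5*a^4*b^4*c +
      13*a^4*b^3*c^2 + 5*a^4*b^2*c^3 + 18*a^3*b^3*c^3 + 13*a^3*b^2*c^4 + a^3*b*c^5 + 3*a^2*b^3*c^4 +
      5*a^2*b^2*c^5 - 3*a^5*b^2*c^2 - 5*a^5*b*c^3 - 2*a^5*c^4 - a^4*b^5 - 4*a^4*b*c^4 - 2*a^4*c^5 -
      6*a^3*b^5*c - 10*a^2*b^5*c^2 - 12*a^2*b^4*c^3 - 6*a*b^5*c^3 - 9*a*b^4*c^4 - 3*a*b^3*c^5 -
      b^5*c^4 - b^4*c^5) * E1 + (3*a^5*b*c^3 + 2*a^5*c^4 + a^4*b^5 + 2*a^4*c^5 + 4*a^3*b^5*c +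
      4*a^3*b^4*c^2 + 6*a^2*b^5*c^2 + 8*a^2*b^4*c^3 + a^2*b^3*c^4 + 4*a*b^5*c^3 + 5*a*b^4*c^4 +
      a*b^3*c^5 + b^5*c^4 + b^4*c^5 - a^5*b^4 - 3*a^5*b^3*c - a^5*b^2*c^2 - a^4*b^4*c -
      9*a^4*b^3*c^2 - 9*a^4*b^2*c^3 - 6*a^3*b^3*c^3 - 9*a^3*b^2*c^4 - 3*a^3*b*c^5 -
      a^2*b^2*c^5) * E2 + (a^5*b^4 + 3*a^5*b^3*c + a^5*b^2*c^2 + a^4*b^4*c + 9*a^4*b^3*c^2 +
      9*a^4*b^2*c^3 + 6*a^3*b^3*c^3 + 9*a^3*b^2*c^4 + 3*a^3*b*c^5 + a^2*b^2*c^5 - 3*a^5*b*c^3 -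
      2*a^5*c^4 - a^4*b^5 - 2*a^4*c^5 - 4*a^3*b^5*c - 4*a^3*b^4*c^2 - 6*a^2*b^5*c^2 -
      8*a^2*b^4*c^3 - a^2*b^3*c^4 - 4*a*b^5*c^3 - 5*a*b^4*c^4 - a*b^3*c^5 - b^5*c^4 -
      b^4*c^5) * E3 + (6*a^5*b*c^3 + 4*a^5*c^4 + 4*a^4*b^4*c + 4*a^4*c^5 + 12*a^3*b^4*c^2 +
      12*a^2*b^4*c^3 + 10*a^2*b^3*c^4 + 4*a*b^4*c^4 + 4*a*b^3*c^5 - 4*a^5*b^3*c - 2*a^5*b^2*c^2 -
      10*a^4*b^3*c^2 - 18*a^4*b^2*c^3 - 18*a^3*b^2*c^4 - 6*a^3*b*c^5 - 2*a^2*b^2*c^5) * E4)"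
    unfolding E gen_cond_def by algebra
  then have l00: "l0 = 0" using nz unfolding E0 by simp
  have "(- 2) * gen_cond a b c^2 * l1 = (a * b * c)^1 * ((4*a^4*b^4*c + 12*a^4*b^3*c^2 +
      12*a^4*b^2*c^3 + 4*a^4*b*c^4 + 10*a^3*b^2*c^4 + 4*a^3*b*c^5 + 6*a*b^5*c^3 + 4*b^5*c^4 +
      4*b^4*c^5 - 4*a^3*b^5*c - 10*a^3*b^4*c^2 - 2*a^2*b^5*c^2 - 18*a^2*b^4*c^3 - 18*a^2*b^3*c^4 -
      2*a^2*b^2*c^5 - 6*a*b^3*c^5) * E0 + (a^4*b^5 + a^4*b^4*c + 3*a^3*b^5*c + 9*a^3*b^4*c^2 +
      6*a^3*b^3*c^3 + a^2*b^5*c^2 + 9*a^2*b^4*c^3 + 9*a^2*b^3*c^4 + a^2*b^2*c^5 + 3*a*b^3*c^5 -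
      a^5*b^4 - 4*a^5*b^3*c - 6*a^5*b^2*c^2 - 4*a^5*b*c^3 - a^5*c^4 - 4*a^4*b^3*c^2 -
      8*a^4*b^2*c^3 - 5*a^4*b*c^4 - a^4*c^5 - a^3*b^2*c^4 - a^3*b*c^5 - 3*a*b^5*c^3 - 2*b^5*c^4 -
      2*b^4*c^5) * E1 + (a^5*b^4 + 4*a^5*b^3*c + 6*a^5*b^2*c^2 + 4*a^5*b*c^3 + a^5*c^4 +
      4*a^4*b^3*c^2 + 8*a^4*b^2*c^3 + 5*a^4*b*c^4 + a^4*c^5 + a^3*b^2*c^4 + a^3*b*c^5 +
      3*a*b^5*c^3 + 2*b^5*c^4 + 2*b^4*c^5 - a^4*b^5 - a^4*b^4*c - 3*a^3*b^5*c - 9*a^3*b^4*c^2 -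
      6*a^3*b^3*c^3 - a^2*b^5*c^2 - 9*a^2*b^4*c^3 - 9*a^2*b^3*c^4 - a^2*b^2*c^5 -
      3*a*b^3*c^5) * E2 + (a^4*b^5 + 5*a^4*b^4*c + a^3*b^5*c + 13*a^3*b^4*c^2 + 18*a^3*b^3*c^3 +
      3*a^3*b^2*c^4 + 5*a^2*b^4*c^3 + 13*a^2*b^3*c^4 + 5*a^2*b^2*c^5 + a*b^3*c^5 - a^5*b^4 -
      6*a^5*b^3*c - 10*a^5*b^2*c^2 - 6*a^5*b*c^3 - a^5*c^4 - 12*a^4*b^2*c^3 - 9*a^4*b*c^4 -
      a^4*c^5 - 3*a^3*b*c^5 - 3*a^2*b^5*c^2 - 5*a*b^5*c^3 - 4*a*b^4*c^4 - 2*b^5*c^4 -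
      2*b^4*c^5) * E3 + (4*a^5*b^3*c + 14*a^5*b^2*c^2 + 12*a^5*b*c^3 + 2*a^5*c^4 + 6*a^4*b^2*c^3 +
      18*a^4*b*c^4 + 2*a^4*c^5 + 6*a^3*b*c^5 + 12*a^2*b^4*c^3 + 8*a*b^4*c^4 + 8*a*b^3*c^5 -
      4*a^4*b^4*c - 14*a^4*b^3*c^2 - 30*a^3*b^3*c^3 - 24*a^3*b^2*c^4 - 4*a^2*b^3*c^4 -
      16*a^2*b^2*c^5) * E4)"
    unfolding E gen_cond_def by algebra
  then have l10: "l1 = 0" using nz unfolding E0 by simp
  show ?thesis using r00 r10 r20 l00 l10 by simp
qed

section \<open>Covariants of orders zero to four\<close>

lemma gens_gen_spanI: "(g, a, nat w) \<in> gens \<Longrightarrow> 0 \<le> w \<Longrightarrow> g \<in> gen_span gens a w"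
  using gen_span_gen[of g a "nat w" gens] by simp

lemma gens_gen_span:
  shows "cov_t \<in> gen_span gens 1 5"
  and "cov_d1 \<in> gen_span gens 2 6"
  and "cov_d2 \<in> gen_span gens 2 2"
  and "cov_tr1 \<in> gen_span gens 3 3"
  and "cov_tr2 \<in> gen_span gens 3 5"
  and "cov_tr3 \<in> gen_span gens 3 9"
  and "cov_c1 \<in> gen_span gens 4 0"
  and "cov_c2 \<in> gen_span gens 4 4"
  and "cov_c3 \<in> gen_span gens 4 6"
  and "cov_p1 \<in> gen_span gens 5 1"
  and "cov_p2 \<in> gen_span gens 5 3"
  and "cov_p3 \<in> gen_span gens 5 7"
  and "cov_s1 \<in> gen_span gens 6 2"
  and "cov_s2 \<in> gen_span gens 6 4"
  and "cov_si1 \<in> gen_span gens 7 1"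
  and "cov_si2 \<in> gen_span gens 7 5"
  and "cov_v1 \<in> gen_span gens 8 0"
  and "cov_v2 \<in> gen_span gens 8 2"
  and "cov_dev \<in> gen_span gens 9 3"
  and "cov_od \<in> gen_span gens 11 1"
  and "cov_dv \<in> gen_span gens 12 0"
  and "cov_trn \<in> gen_span gens 13 1"
  and "cov_vis \<in> gen_span gens 18 0"
  by (rule gens_gen_spanI; simp add: gens_def)+

lemma indep_v2_p1si1_p1od:
  fixes a b c :: "'k::field_char_0"
  assumes g: "gen_cond a b c \<noteq> 0" and eq: "smult r0 (Z_v2 a b c) +
      smult r1 (Z_p1 a b c * Z_si1 a b c) + smult r2 (Z_p1 a b c * Z_od a b c) = 0"
  shows "r0 = 0 \<and> r1 = 0 \<and> r2 = 0"
proof -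
  obtain l0 l1 where l: "smult r1 (Z_si1 a b c) + smult r2 (Z_od a b c) = [:l0, l1:]"
    unfolding Z_od_def Z_si1_def mult_pCons_left mult_zero_left smult_pCons smult_0_right add_pCons
        add_0_left add_0_right by blast
  have "smult r0 (Z_v2 a b c) + Z_p1 a b c * [:l0, l1:] = 0"
    using eq unfolding l[symmetric] by (simp only: distrib_left mult_smult_right mult.assoc add.assoc)
  from indep_v2_p1[OF g this] have z: "r0 = 0" and "smult r1 (Z_si1 a b c) + smult r2 (Z_od a b c) = 0"
    using l by simp_all
  with indep_si1_od[OF g] show ?thesis by blast
qed

lemma indep_tr1_p1d2_p1s1_p1p1p1:
  fixes a b c :: "'k::field_char_0"
  assumes g: "gen_cond a b c \<noteq> 0" and eq: "smult r0 (Z_tr1 a b c) +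
      smult r1 (Z_p1 a b c * Z_d2 a b c) + smult r2 (Z_p1 a b c * Z_s1 a b c) +
      smult r3 (Z_p1 a b c * Z_p1 a b c * Z_p1 a b c) = 0"
  shows "r0 = 0 \<and> r1 = 0 \<and> r2 = 0 \<and> r3 = 0"
proof -
  obtain l0 l1 l2 where l: "smult r1 (Z_d2 a b c) + smult r2 (Z_s1 a b c) +
      smult r3 (Z_p1 a b c * Z_p1 a b c) = [:l0, l1, l2:]"
    unfolding Z_d2_def Z_p1_def Z_s1_def mult_pCons_left mult_zero_left smult_pCons smult_0_right
        add_pCons add_0_left add_0_right by blast
  have "smult r0 (Z_tr1 a b c) + Z_p1 a b c * [:l0, l1, l2:] = 0"
    using eq unfolding l[symmetric] by (simp only: distrib_left mult_smult_right mult.assoc add.assoc)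
  from indep_tr1_p1[OF g this] have z: "r0 = 0" and "smult r1 (Z_d2 a b c) + smult r2 (Z_s1 a b c) +
      smult r3 (Z_p1 a b c * Z_p1 a b c) = 0"
    using l by simp_all
  with indep_d2_s1_p1p1[OF g] show ?thesis by blast
qed

lemma indep_p2_dev_d2si1_d2od:
  fixes a b c :: "'k::field_char_0"
  assumes g: "gen_cond a b c \<noteq> 0" and eq: "smult r0 (Z_p2 a b c) + smult r1 (Z_dev a b c) +
      smult r2 (Z_d2 a b c * Z_si1 a b c) + smult r3 (Z_d2 a b c * Z_od a b c) = 0"
  shows "r0 = 0 \<and> r1 = 0 \<and> r2 = 0 \<and> r3 = 0"
proof -
  obtain l0 l1 where l: "smult r2 (Z_si1 a b c) + smult r3 (Z_od a b c) = [:l0, l1:]"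
    unfolding Z_od_def Z_si1_def mult_pCons_left mult_zero_left smult_pCons smult_0_right add_pCons
        add_0_left add_0_right by blast
  have "smult r0 (Z_p2 a b c) + smult r1 (Z_dev a b c) + Z_d2 a b c * [:l0, l1:] = 0"
    using eq unfolding l[symmetric] by (simp only: distrib_left mult_smult_right mult.assoc add.assoc)
  from indep_p2_dev_d2[OF g this] have z: "r0 = 0" "r1 = 0" and "smult r2 (Z_si1 a b c) +
      smult r3 (Z_od a b c) = 0"
    using l by simp_all
  with indep_si1_od[OF g] show ?thesis by blast
qed

lemma indep_c2_tr1p1_d2d2_d2s1_d2p1p1:
  fixes a b c :: "'k::field_char_0"
  assumes g: "gen_cond a b c \<noteq> 0" and eq: "smult r0 (Z_c2 a b c) +
      smult r1 (Z_tr1 a b c * Z_p1 a b c) + smult r2 (Z_d2 a b c * Z_d2 a b c) +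
      smult r3 (Z_d2 a b c * Z_s1 a b c) + smult r4 (Z_d2 a b c * Z_p1 a b c * Z_p1 a b c) = 0"
  shows "r0 = 0 \<and> r1 = 0 \<and> r2 = 0 \<and> r3 = 0 \<and> r4 = 0"
proof -
  obtain l0 l1 l2 where l: "smult r2 (Z_d2 a b c) + smult r3 (Z_s1 a b c) +
      smult r4 (Z_p1 a b c * Z_p1 a b c) = [:l0, l1, l2:]"
    unfolding Z_d2_def Z_p1_def Z_s1_def mult_pCons_left mult_zero_left smult_pCons smult_0_right
        add_pCons add_0_left add_0_right by blast
  have "smult r0 (Z_c2 a b c) + smult r1 (Z_tr1 a b c * Z_p1 a b c) + Z_d2 a b c * [:l0, l1, l2:] = 0"
    using eq unfolding l[symmetric] by (simp only: distrib_left mult_smult_right mult.assoc add.assoc)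
  from indep_c2_tr1p1_d2[OF g this] have z: "r0 = 0" "r1 = 0" and "smult r2 (Z_d2 a b c) +
      smult r3 (Z_s1 a b c) + smult r4 (Z_p1 a b c * Z_p1 a b c) = 0"
    using l by simp_all
  with indep_d2_s1_p1p1[OF g] show ?thesis by blast
qed

lemma indep_s2_d2v2_s1v2_tr1si1_tr1od:
  fixes a b c :: "'k::field_char_0"
  assumes g: "gen_cond a b c \<noteq> 0" and eq: "smult r0 (Z_s2 a b c) +
      smult r1 (Z_d2 a b c * Z_v2 a b c) + smult r2 (Z_s1 a b c * Z_v2 a b c) +
      smult r3 (Z_tr1 a b c * Z_si1 a b c) + smult r4 (Z_tr1 a b c * Z_od a b c) = 0"
  shows "r0 = 0 \<and> r1 = 0 \<and> r2 = 0 \<and> r3 = 0 \<and> r4 = 0"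
proof -
  obtain l0 l1 where l: "smult r3 (Z_si1 a b c) + smult r4 (Z_od a b c) = [:l0, l1:]"
    unfolding Z_od_def Z_si1_def mult_pCons_left mult_zero_left smult_pCons smult_0_right add_pCons
        add_0_left add_0_right by blast
  have "smult r0 (Z_s2 a b c) + smult r1 (Z_d2 a b c * Z_v2 a b c) +
      smult r2 (Z_s1 a b c * Z_v2 a b c) + Z_tr1 a b c * [:l0, l1:] = 0"
    using eq unfolding l[symmetric] by (simp only: distrib_left mult_smult_right mult.assoc add.assoc)
  from indep_s2_d2v2_s1v2_tr1[OF g this] have z: "r0 = 0" "r1 = 0" "r2 =
      0" and "smult r3 (Z_si1 a b c) + smult r4 (Z_od a b c) = 0"
    using l by simp_all
  with indep_si1_od[OF g] show ?thesis by blast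
qed

text \<open>
  In each of the next five proofs the degrees of the basis elements form two classes modulo 4,
  which are treated separately.
\<close>

lemma hwv_order_0: "(hwv 5 m 0 :: 'k::field_char_0 mpoly set) \<subseteq> gen_span gens m 0"
proof (rule hwv_subset_gen_span_free)
  let ?e = "[1, cov_vis] :: 'k mpoly list"
  let ?d = "[0, 18] :: nat list"
  let ?K = "{..<2 :: nat}"
  have K: "?K = {0, 1}" by auto
  show "finite ?K" by simp
  show "(0 :: int) \<ge> 0" by simp
  have mem: "1 \<in> gen_span gens 0 0" "cov_vis \<in> gen_span gens 18 0"
    using gen_span_1 gens_gen_span(23) by simp_all
  show "?e ! \<kappa> \<in> gen_span gens (?d ! \<kappa>) 0" if "\<kappa> \<in> ?K" for \<kappa>
    using that mem unfolding K by auto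
  show "D_series * dim_series 0 = (\<Sum>\<kappa>\<in>?K. fps_X ^ (?d ! \<kappa>))"
    unfolding D_dim_series_low K by simp
  fix a b c :: 'k and \<rho> :: "nat \<Rightarrow> 'k" and q :: nat
  assume g: "gen_cond a b c \<noteq> 0"
    and supp: "\<And>\<kappa>. \<kappa> \<in> ?K \<Longrightarrow> ?d ! \<kappa> mod 4 \<noteq> q \<Longrightarrow> \<rho> \<kappa> = 0"
    and eq: "(\<Sum>\<kappa>\<in>?K. smult (\<rho> \<kappa>) (syl a b c (?e ! \<kappa>))) = 0"
  have abc: "a \<noteq> 0" "b \<noteq> 0" "c \<noteq> 0" using g by (auto simp: gen_cond_def)
  have sum: "smult (\<rho> 0) (syl a b c (1)) + smult (\<rho> 1) (syl a b c (cov_vis)) = 0"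
    using eq unfolding K by (simp add: add.assoc)
  show "\<forall>\<kappa>\<in>?K. \<rho> \<kappa> = 0"
  proof (cases "q = 0")
    case True
    then have zero: "\<rho> 1 = 0"
      using supp[of 1] by simp_all
    have "\<rho> 0 = 0" using sum unfolding zero by simp
    then show ?thesis unfolding K using zero by simp
  next
    case False
    then have zero: "\<rho> 0 = 0"
      using supp[of 0] by simp_all
    have "smult (\<rho> 1) (syl a b c cov_vis) = 0" using sum unfolding zero by simp
    moreover have "Z_vis a b c = [:(a - b) * (a + c) * (b + c):]" unfolding Z_vis_def by (simp, algebra)
    ultimately have "\<rho> 1 = 0" using g by (auto simp: syl_vis gen_cond_def)
    then show ?thesis unfolding K using zero by simp
  qed
qed

lemma hwv_order_1: "(hwv 5 m 1 :: 'k::field_char_0 mpoly set) \<subseteq> gen_span gens m 1"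
proof (rule hwv_subset_gen_span_free)
  let ?e = "[cov_p1, cov_trn, cov_si1, cov_od] :: 'k mpoly list"
  let ?d = "[5, 13, 7, 11] :: nat list"
  let ?K = "{..<4 :: nat}"
  have K: "?K = {0, 1, 2, 3}" by auto
  show "finite ?K" by simp
  show "(1 :: int) \<ge> 0" by simp
  have mem: "cov_p1 \<in> gen_span gens 5 1" "cov_trn \<in> gen_span gens 13 1" "cov_si1 \<in> gen_span gens 7
      1" "cov_od \<in> gen_span gens 11 1"
    using gens_gen_span(10) gens_gen_span(22) gens_gen_span(15) gens_gen_span(20) by simp_all
  show "?e ! \<kappa> \<in> gen_span gens (?d ! \<kappa>) 1" if "\<kappa> \<in> ?K" for \<kappa>
    using that mem unfolding K by auto
  show "D_series * dim_series 1 = (\<Sum>\<kappa>\<in>?K. fps_X ^ (?d ! \<kappa>))"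
    unfolding D_dim_series_low K by simp
  fix a b c :: 'k and \<rho> :: "nat \<Rightarrow> 'k" and q :: nat
  assume g: "gen_cond a b c \<noteq> 0"
    and supp: "\<And>\<kappa>. \<kappa> \<in> ?K \<Longrightarrow> ?d ! \<kappa> mod 4 \<noteq> q \<Longrightarrow> \<rho> \<kappa> = 0"
    and eq: "(\<Sum>\<kappa>\<in>?K. smult (\<rho> \<kappa>) (syl a b c (?e ! \<kappa>))) = 0"
  have abc: "a \<noteq> 0" "b \<noteq> 0" "c \<noteq> 0" using g by (auto simp: gen_cond_def)
  have sum: "smult (\<rho> 0) (syl a b c (cov_p1)) + smult (\<rho> 1) (syl a b c (cov_trn)) +
      smult (\<rho> 2) (syl a b c (cov_si1)) + smult (\<rho> 3) (syl a b c (cov_od)) = 0"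
    using eq unfolding K by (simp add: add.assoc)
  show "\<forall>\<kappa>\<in>?K. \<rho> \<kappa> = 0"
  proof (cases "q = 1")
    case True
    then have zero: "\<rho> 2 = 0" "\<rho> 3 = 0"
      using supp[of 2] supp[of 3] by simp_all
    have "smult (\<rho> 0) (syl a b c (cov_p1)) + smult (\<rho> 1) (syl a b c (cov_trn)) = 0"
      using sum unfolding zero by simp
    from this[unfolded syl_mult syl_od syl_p1 syl_si1 syl_trn mult_smult_left mult_smult_right smult_smult]
    have "\<rho> 0 = 0 \<and> \<rho> 1 = 0" using indep_p1_trn[OF g] abc by fastforce
    then show ?thesis unfolding K using zero by simp
  next
    case False
    then have zero: "\<rho> 0 = 0" "\<rho> 1 = 0"
      using supp[of 0] supp[of 1] by simp_all
    have "smult (\<rho> 2) (syl a b c (cov_si1)) + smult (\<rho> 3) (syl a b c (cov_od)) = 0"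
      using sum unfolding zero by simp
    from this[unfolded syl_mult syl_od syl_p1 syl_si1 syl_trn mult_smult_left mult_smult_right smult_smult]
    have "\<rho> 2 = 0 \<and> \<rho> 3 = 0" using indep_si1_od[OF g] abc by fastforce
    then show ?thesis unfolding K using zero by simp
  qed
qed

lemma hwv_order_2: "(hwv 5 m 2 :: 'k::field_char_0 mpoly set) \<subseteq> gen_span gens m 2"
proof (rule hwv_subset_gen_span_free)
  let ?e = "[cov_d2, cov_s1, cov_p1 * cov_p1, cov_v2, cov_p1 * cov_si1, cov_p1 * cov_od] :: 'k mpoly list"
  let ?d = "[2, 6, 10, 8, 12, 16] :: nat list"
  let ?K = "{..<6 :: nat}"
  have K: "?K = {0, 1, 2, 3, 4, 5}" by auto
  show "finite ?K" by simp
  show "(2 :: int) \<ge> 0" by simp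
  have mem: "cov_d2 \<in> gen_span gens 2 2" "cov_s1 \<in> gen_span gens 6 2" "cov_p1 * cov_p1 \<in> gen_span
      gens 10 2" "cov_v2 \<in> gen_span gens 8 2" "cov_p1 * cov_si1 \<in> gen_span gens 12 2" "cov_p1 *
      cov_od \<in> gen_span gens 16 2"
    using gens_gen_span(3) gens_gen_span(13) gen_span_mult[OF gens_gen_span(10) gens_gen_span(10)]
        gens_gen_span(18) gen_span_mult[OF gens_gen_span(10) gens_gen_span(15)] gen_span_mult[OF
        gens_gen_span(10) gens_gen_span(20)] by simp_all
  show "?e ! \<kappa> \<in> gen_span gens (?d ! \<kappa>) 2" if "\<kappa> \<in> ?K" for \<kappa>
    using that mem unfolding K by auto
  show "D_series * dim_series 2 = (\<Sum>\<kappa>\<in>?K. fps_X ^ (?d ! \<kappa>))"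
    unfolding D_dim_series_low K by simp
  fix a b c :: 'k and \<rho> :: "nat \<Rightarrow> 'k" and q :: nat
  assume g: "gen_cond a b c \<noteq> 0"
    and supp: "\<And>\<kappa>. \<kappa> \<in> ?K \<Longrightarrow> ?d ! \<kappa> mod 4 \<noteq> q \<Longrightarrow> \<rho> \<kappa> = 0"
    and eq: "(\<Sum>\<kappa>\<in>?K. smult (\<rho> \<kappa>) (syl a b c (?e ! \<kappa>))) = 0"
  have abc: "a \<noteq> 0" "b \<noteq> 0" "c \<noteq> 0" using g by (auto simp: gen_cond_def)
  have sum: "smult (\<rho> 0) (syl a b c (cov_d2)) + smult (\<rho> 1) (syl a b c (cov_s1)) +
      smult (\<rho> 2) (syl a b c (cov_p1 * cov_p1)) + smult (\<rho> 3) (syl a b c (cov_v2)) +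
      smult (\<rho> 4) (syl a b c (cov_p1 * cov_si1)) + smult (\<rho> 5) (syl a b c (cov_p1 * cov_od)) = 0"
    using eq unfolding K by (simp add: add.assoc)
  show "\<forall>\<kappa>\<in>?K. \<rho> \<kappa> = 0"
  proof (cases "q = 2")
    case True
    then have zero: "\<rho> 3 = 0" "\<rho> 4 = 0" "\<rho> 5 = 0"
      using supp[of 3] supp[of 4] supp[of 5] by simp_all
    have "smult (\<rho> 0) (syl a b c (cov_d2)) + smult (\<rho> 1) (syl a b c (cov_s1)) +
        smult (\<rho> 2) (syl a b c (cov_p1 * cov_p1)) = 0"
      using sum unfolding zero by simp
    from this[unfolded syl_mult syl_d2 syl_od syl_p1 syl_s1 syl_si1 syl_v2 mult_smult_left
        mult_smult_right smult_smult]
    have "\<rho> 0 = 0 \<and> \<rho> 1 = 0 \<and> \<rho> 2 = 0" using indep_d2_s1_p1p1[OF g] abc by fastforce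
    then show ?thesis unfolding K using zero by simp
  next
    case False
    then have zero: "\<rho> 0 = 0" "\<rho> 1 = 0" "\<rho> 2 = 0"
      using supp[of 0] supp[of 1] supp[of 2] by simp_all
    have "smult (\<rho> 3) (syl a b c (cov_v2)) + smult (\<rho> 4) (syl a b c (cov_p1 * cov_si1)) +
        smult (\<rho> 5) (syl a b c (cov_p1 * cov_od)) = 0"
      using sum unfolding zero by simp
    from this[unfolded syl_mult syl_d2 syl_od syl_p1 syl_s1 syl_si1 syl_v2 mult_smult_left
        mult_smult_right smult_smult]
    have "\<rho> 3 = 0 \<and> \<rho> 4 = 0 \<and> \<rho> 5 = 0" using indep_v2_p1si1_p1od[OF g] abc by fastforce
    then show ?thesis unfolding K using zero by simp
  qed
qed

lemma hwv_order_3: "(hwv 5 m 3 :: 'k::field_char_0 mpoly set) \<subseteq> gen_span gens m 3"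
proof (rule hwv_subset_gen_span_free)
  let ?e = "[cov_tr1, cov_p1 * cov_d2, cov_p1 * cov_s1, cov_p1 * cov_p1 * cov_p1, cov_p2, cov_dev,
      cov_d2 * cov_si1, cov_d2 * cov_od] :: 'k mpoly list"
  let ?d = "[3, 7, 11, 15, 5, 9, 9, 13] :: nat list"
  let ?K = "{..<8 :: nat}"
  have K: "?K = {0, 1, 2, 3, 4, 5, 6, 7}" by auto
  show "finite ?K" by simp
  show "(3 :: int) \<ge> 0" by simp
  have mem: "cov_tr1 \<in> gen_span gens 3 3" "cov_p1 * cov_d2 \<in> gen_span gens 7 3" "cov_p1 * cov_s1 \<in>
      gen_span gens 11 3" "cov_p1 * cov_p1 * cov_p1 \<in> gen_span gens 15 3" "cov_p2 \<in> gen_span gens 5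
      3" "cov_dev \<in> gen_span gens 9 3" "cov_d2 * cov_si1 \<in> gen_span gens 9 3" "cov_d2 * cov_od \<in>
      gen_span gens 13 3"
    using gens_gen_span(4) gen_span_mult[OF gens_gen_span(10) gens_gen_span(3)] gen_span_mult[OF
        gens_gen_span(10) gens_gen_span(13)] gen_span_mult[OF gen_span_mult[OF gens_gen_span(10)
        gens_gen_span(10)] gens_gen_span(10)] gens_gen_span(11) gens_gen_span(19) gen_span_mult[OF
        gens_gen_span(3) gens_gen_span(15)] gen_span_mult[OF gens_gen_span(3) gens_gen_span(20)] by simp_all
  show "?e ! \<kappa> \<in> gen_span gens (?d ! \<kappa>) 3" if "\<kappa> \<in> ?K" for \<kappa>
    using that mem unfolding K by auto
  show "D_series * dim_series 3 = (\<Sum>\<kappa>\<in>?K. fps_X ^ (?d ! \<kappa>))"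
    unfolding D_dim_series_low K by simp
  fix a b c :: 'k and \<rho> :: "nat \<Rightarrow> 'k" and q :: nat
  assume g: "gen_cond a b c \<noteq> 0"
    and supp: "\<And>\<kappa>. \<kappa> \<in> ?K \<Longrightarrow> ?d ! \<kappa> mod 4 \<noteq> q \<Longrightarrow> \<rho> \<kappa> = 0"
    and eq: "(\<Sum>\<kappa>\<in>?K. smult (\<rho> \<kappa>) (syl a b c (?e ! \<kappa>))) = 0"
  have abc: "a \<noteq> 0" "b \<noteq> 0" "c \<noteq> 0" using g by (auto simp: gen_cond_def)
  have sum: "smult (\<rho> 0) (syl a b c (cov_tr1)) + smult (\<rho> 1) (syl a b c (cov_p1 * cov_d2)) +
      smult (\<rho> 2) (syl a b c (cov_p1 * cov_s1)) +
      smult (\<rho> 3) (syl a b c (cov_p1 * cov_p1 * cov_p1)) + smult (\<rho> 4) (syl a b c (cov_p2)) +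
      smult (\<rho> 5) (syl a b c (cov_dev)) + smult (\<rho> 6) (syl a b c (cov_d2 * cov_si1)) +
      smult (\<rho> 7) (syl a b c (cov_d2 * cov_od)) = 0"
    using eq unfolding K by (simp add: add.assoc)
  show "\<forall>\<kappa>\<in>?K. \<rho> \<kappa> = 0"
  proof (cases "q = 3")
    case True
    then have zero: "\<rho> 4 = 0" "\<rho> 5 = 0" "\<rho> 6 = 0" "\<rho> 7 = 0"
      using supp[of 4] supp[of 5] supp[of 6] supp[of 7] by simp_all
    have "smult (\<rho> 0) (syl a b c (cov_tr1)) + smult (\<rho> 1) (syl a b c (cov_p1 * cov_d2)) +
        smult (\<rho> 2) (syl a b c (cov_p1 * cov_s1)) + smult (\<rho> 3) (syl a b c (cov_p1 * cov_p1 * cov_p1)) = 0"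
      using sum unfolding zero by simp
    from this[unfolded syl_mult syl_d2 syl_dev syl_od syl_p1 syl_p2 syl_s1 syl_si1 syl_tr1
        mult_smult_left mult_smult_right smult_smult]
    have "\<rho> 0 = 0 \<and> \<rho> 1 = 0 \<and> \<rho> 2 = 0 \<and> \<rho> 3 = 0" using indep_tr1_p1d2_p1s1_p1p1p1[OF g] abc by fastforce
    then show ?thesis unfolding K using zero by simp
  next
    case False
    then have zero: "\<rho> 0 = 0" "\<rho> 1 = 0" "\<rho> 2 = 0" "\<rho> 3 = 0"
      using supp[of 0] supp[of 1] supp[of 2] supp[of 3] by simp_all
    have "smult (\<rho> 4) (syl a b c (cov_p2)) + smult (\<rho> 5) (syl a b c (cov_dev)) +
        smult (\<rho> 6) (syl a b c (cov_d2 * cov_si1)) + smult (\<rho> 7) (syl a b c (cov_d2 * cov_od)) = 0"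
      using sum unfolding zero by simp
    from this[unfolded syl_mult syl_d2 syl_dev syl_od syl_p1 syl_p2 syl_s1 syl_si1 syl_tr1
        mult_smult_left mult_smult_right smult_smult]
    have "\<rho> 4 = 0 \<and> \<rho> 5 = 0 \<and> \<rho> 6 = 0 \<and> \<rho> 7 = 0" using indep_p2_dev_d2si1_d2od[OF g] abc by fastforce
    then show ?thesis unfolding K using zero by simp
  qed
qed

lemma hwv_order_4: "(hwv 5 m 4 :: 'k::field_char_0 mpoly set) \<subseteq> gen_span gens m 4"
proof (rule hwv_subset_gen_span_free)
  let ?e = "[cov_c2, cov_tr1 * cov_p1, cov_d2 * cov_d2, cov_d2 * cov_s1, cov_d2 * cov_p1 * cov_p1,
      cov_s2, cov_d2 * cov_v2, cov_s1 * cov_v2, cov_tr1 * cov_si1, cov_tr1 * cov_od] :: 'k mpoly list"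
  let ?d = "[4, 8, 4, 8, 12, 6, 10, 14, 10, 14] :: nat list"
  let ?K = "{..<10 :: nat}"
  have K: "?K = {0, 1, 2, 3, 4, 5, 6, 7, 8, 9}" by auto
  show "finite ?K" by simp
  show "(4 :: int) \<ge> 0" by simp
  have mem: "cov_c2 \<in> gen_span gens 4 4" "cov_tr1 * cov_p1 \<in> gen_span gens 8 4" "cov_d2 * cov_d2 \<in>
      gen_span gens 4 4" "cov_d2 * cov_s1 \<in> gen_span gens 8 4" "cov_d2 * cov_p1 * cov_p1 \<in> gen_span
      gens 12 4" "cov_s2 \<in> gen_span gens 6 4" "cov_d2 * cov_v2 \<in> gen_span gens 10 4" "cov_s1 *
      cov_v2 \<in> gen_span gens 14 4" "cov_tr1 * cov_si1 \<in> gen_span gens 10 4" "cov_tr1 * cov_od \<in>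
      gen_span gens 14 4"
    using gens_gen_span(8) gen_span_mult[OF gens_gen_span(4) gens_gen_span(10)] gen_span_mult[OF
        gens_gen_span(3) gens_gen_span(3)] gen_span_mult[OF gens_gen_span(3) gens_gen_span(13)]
        gen_span_mult[OF gen_span_mult[OF gens_gen_span(3) gens_gen_span(10)] gens_gen_span(10)]
        gens_gen_span(14) gen_span_mult[OF gens_gen_span(3) gens_gen_span(18)] gen_span_mult[OF
        gens_gen_span(13) gens_gen_span(18)] gen_span_mult[OF gens_gen_span(4) gens_gen_span(15)]
        gen_span_mult[OF gens_gen_span(4) gens_gen_span(20)] by simp_all
  show "?e ! \<kappa> \<in> gen_span gens (?d ! \<kappa>) 4" if "\<kappa> \<in> ?K" for \<kappa>
    using that mem unfolding K by auto
  show "D_series * dim_series 4 = (\<Sum>\<kappa>\<in>?K. fps_X ^ (?d ! \<kappa>))"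
    unfolding D_dim_series_low K by simp
  fix a b c :: 'k and \<rho> :: "nat \<Rightarrow> 'k" and q :: nat
  assume g: "gen_cond a b c \<noteq> 0"
    and supp: "\<And>\<kappa>. \<kappa> \<in> ?K \<Longrightarrow> ?d ! \<kappa> mod 4 \<noteq> q \<Longrightarrow> \<rho> \<kappa> = 0"
    and eq: "(\<Sum>\<kappa>\<in>?K. smult (\<rho> \<kappa>) (syl a b c (?e ! \<kappa>))) = 0"
  have abc: "a \<noteq> 0" "b \<noteq> 0" "c \<noteq> 0" using g by (auto simp: gen_cond_def)
  have sum: "smult (\<rho> 0) (syl a b c (cov_c2)) + smult (\<rho> 1) (syl a b c (cov_tr1 * cov_p1)) +
      smult (\<rho> 2) (syl a b c (cov_d2 * cov_d2)) + smult (\<rho> 3) (syl a b c (cov_d2 * cov_s1)) +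
      smult (\<rho> 4) (syl a b c (cov_d2 * cov_p1 * cov_p1)) + smult (\<rho> 5) (syl a b c (cov_s2)) +
      smult (\<rho> 6) (syl a b c (cov_d2 * cov_v2)) + smult (\<rho> 7) (syl a b c (cov_s1 * cov_v2)) +
      smult (\<rho> 8) (syl a b c (cov_tr1 * cov_si1)) + smult (\<rho> 9) (syl a b c (cov_tr1 * cov_od)) = 0"
    using eq unfolding K by (simp add: add.assoc)
  show "\<forall>\<kappa>\<in>?K. \<rho> \<kappa> = 0"
  proof (cases "q = 0")
    case True
    then have zero: "\<rho> 5 = 0" "\<rho> 6 = 0" "\<rho> 7 = 0" "\<rho> 8 = 0" "\<rho> 9 = 0"
      using supp[of 5] supp[of 6] supp[of 7] supp[of 8] supp[of 9] by simp_all
    have "smult (\<rho> 0) (syl a b c (cov_c2)) + smult (\<rho> 1) (syl a b c (cov_tr1 * cov_p1)) +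
        smult (\<rho> 2) (syl a b c (cov_d2 * cov_d2)) + smult (\<rho> 3) (syl a b c (cov_d2 * cov_s1)) +
        smult (\<rho> 4) (syl a b c (cov_d2 * cov_p1 * cov_p1)) = 0"
      using sum unfolding zero by simp
    from this[unfolded syl_mult syl_c2 syl_d2 syl_od syl_p1 syl_s1 syl_s2 syl_si1 syl_tr1 syl_v2
        mult_smult_left mult_smult_right smult_smult]
    have "\<rho> 0 = 0 \<and> \<rho> 1 = 0 \<and> \<rho> 2 = 0 \<and> \<rho> 3 = 0 \<and> \<rho> 4 = 0"
        using indep_c2_tr1p1_d2d2_d2s1_d2p1p1[OF g] abc by fastforce
    then show ?thesis unfolding K using zero by simp
  next
    case False
    then have zero: "\<rho> 0 = 0" "\<rho> 1 = 0" "\<rho> 2 = 0" "\<rho> 3 = 0" "\<rho> 4 = 0"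
      using supp[of 0] supp[of 1] supp[of 2] supp[of 3] supp[of 4] by simp_all
    have "smult (\<rho> 5) (syl a b c (cov_s2)) + smult (\<rho> 6) (syl a b c (cov_d2 * cov_v2)) +
        smult (\<rho> 7) (syl a b c (cov_s1 * cov_v2)) + smult (\<rho> 8) (syl a b c (cov_tr1 * cov_si1)) +
        smult (\<rho> 9) (syl a b c (cov_tr1 * cov_od)) = 0"
      using sum unfolding zero by simp
    from this[unfolded syl_mult syl_c2 syl_d2 syl_od syl_p1 syl_s1 syl_s2 syl_si1 syl_tr1 syl_v2
        mult_smult_left mult_smult_right smult_smult]
    have "\<rho> 5 = 0 \<and> \<rho> 6 = 0 \<and> \<rho> 7 = 0 \<and> \<rho> 8 = 0 \<and> \<rho> 9 = 0"
        using indep_s2_d2v2_s1v2_tr1si1_tr1od[OF g] abc by fastforce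
    then show ?thesis unfolding K using zero by simp
  qed
qed

unbundle fps_syntax

section \<open>Single bidegrees\<close>

text \<open>
  The remaining claims concern single bidegrees, where a basis is exhibited by evaluation at
  points. To make this a computation with integers, the generators are addressed by their index in
  a list and a product of generators by the list of the indices of its factors.
\<close>

definition covs :: "'k::field_char_0 mpoly list"
  where "covs = [cov_t, cov_d1, cov_d2, cov_tr1, cov_tr2, cov_tr3, cov_c1, cov_c2, cov_c3, cov_p1,
      cov_p2, cov_p3, cov_s1, cov_s2, cov_si1, cov_si2, cov_v1, cov_v2, cov_dev, cov_od, cov_dv,
      cov_trn, cov_vis]"

definition bidegs :: "(nat \<times> nat) list"
  where "bidegs = [(1, 5), (2, 6), (2, 2), (3, 3), (3, 5), (3, 9), (4, 0), (4, 4), (4, 6), (5, 1),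
      (5, 3), (5, 7), (6, 2), (6, 4), (7, 1), (7, 5), (8, 0), (8, 2), (9, 3), (11, 1), (12, 0), (13,
      1), (18, 0)]"

lemma length_covs: "length covs = 23" and length_bidegs: "length bidegs = 23"
  by (simp_all add: covs_def bidegs_def)

lemma gens_conv: "gens = set (zip covs bidegs)"
  unfolding gens_def covs_def bidegs_def by simp

lemma gens_nth: "i < 23 \<Longrightarrow> (covs ! i, bidegs ! i) \<in> gens"
  unfolding gens_conv by (auto simp: in_set_conv_nth length_covs length_bidegs intro!: exI[of _ i])

definition cov_prod :: "nat list \<Rightarrow> 'k::field_char_0 mpoly"
  where "cov_prod ks = prod_list (map ((!) covs) ks)"

definition has_bideg :: "nat list \<Rightarrow> nat \<Rightarrow> nat \<Rightarrow> bool"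
  where "has_bideg ks m w \<longleftrightarrow> (\<forall>i\<in>set ks. i < 23) \<and> sum_list (map (\<lambda>i. fst (bidegs ! i)) ks) = m
    \<and> sum_list (map (\<lambda>i. snd (bidegs ! i)) ks) = w"

lemma cov_prod_gen_product:
  assumes "has_bideg ks m w"
  shows "gen_product gens m (int w) (cov_prod ks :: 'k::field_char_0 mpoly)"
  using assms
proof (induction ks arbitrary: m w)
  case Nil
  then show ?case by (auto simp: has_bideg_def cov_prod_def gen_product.one)
next
  case (Cons i ks)
  obtain a b where ab: "bidegs ! i = (a, b)" by fastforce
  obtain m' w' where mw: "m = a + m'" "w = b + w'" "has_bideg ks m' w'"
    using Cons.prems ab by (auto simp: has_bideg_def)
  have "i < 23" using Cons.prems by (simp add: has_bideg_def)
  then have "gen_product gens (a + m') (int b + int w') (covs ! i * cov_prod ks :: 'k mpoly)"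
    using gens_nth[of i] ab Cons.IH[OF mw(3)] by (intro gen_product.mult) simp_all
  then show ?case by (simp add: mw cov_prod_def)
qed

text \<open>
  The rational factors in the images of the generators. With them split off, the value of the
  generator with index \<open>i\<close> at a point is the \<open>i\<close>-th integer in the second component of that point
  in \<open>points\<close>.
\<close>

definition lams :: "'k::field_char_0 list"
  where "lams = [1, 1, 1/12, 1/10, - 1/120, - 1/2, - 1/7200, - 1/15120, - 13/3024, 1/3456, - 1/1728,
      - 13/18144, 1/7200, - 1/3456, - 1/414720, - 1/14400, 1/1244160, - 1/725760, 1/1451520,
      1/746496000, - 1/3583180800, - 1/37623398400, - 1/24766945689600]"

text \<open>
  Seven points \<open>(a, b, c, y)\<close> in general position with respect to all bidegrees that are treated
  below.
\<close>

definition points :: "((int \<times> int \<times> int \<times> int) \<times> int list) list"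
  where "points = [((- 1, - 1, 1, 0), [0, - 1, - 1, 0, 2, 2, - 3, - 145, 0, 0, - 2, - 2, 1, 0, 0, -
      2, 3, 0, 0, 0, 0, 0, 0]),
    ((- 1, 2, 1, 1), [33, 6, 0, - 4, 99, 378, 9, 2490, 18, 6, 36, 144, 12, 90, 18, - 36, - 12, 36,
        108, 72, 36, 288, 0]),
    ((1, - 1, 2, 0), [3, 2, 2, 0, - 11, - 2, 17, 250, - 6, 6, - 8, - 8, 4, - 18, 2, - 4, - 4, - 12,
        - 28, - 40, 76, 384, - 192]),
    ((1, 2, - 1, - 1), [- 1, - 2, - 2, 0, 5, 6, - 7, - 414, - 2, 2, - 8, - 8, 4, - 2, - 2, - 12, 20,
        4, 4, - 8, 4, - 64, 0]),
    ((- 1, 2, 1, - 1), [- 3, 2, 2, 0, 7, - 2, 9, - 82, - 6, - 6, 8, 8, 4, - 6, 6, - 4, - 12, - 12,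
        12, 24, 36, - 288, 0]),
    ((2, 1, 1, 1), [35, 26, 8, 4, - 27, - 114, 17, - 814, 6, 14, 12, 48, 12, 42, - 30, 12, - 4, -
        12, - 12, 24, 76, 608, 192]),
    ((- 1, - 1, - 1, 0), [- 2, 1, 1, 0, - 4, 0, 5, 21, 2, - 2, - 2, - 2, 1, 2, - 2, 0, - 1, 2, - 2,
        - 2, 4, - 14, 0])]"

fun point_value :: "int \<times> int \<times> int \<times> int \<Rightarrow> 'k::field_char_0 mpoly \<Rightarrow> 'k"
  where "point_value (a, b, c, y) p = poly (syl (of_int a) (of_int b) (of_int c) p) (of_int y)"

lemma point_values:
  assumes "(P, row) \<in> set points"
  shows "map (point_value P) covs = map2 (\<lambda>l v. l * of_int v) (lams :: 'k::field_char_0 list) row"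
proof -
  note [simp] = covs_def lams_def syl_t syl_d1 syl_d2 syl_tr1 syl_tr2 syl_tr3 syl_c1 syl_c2 syl_c3
      syl_p1 syl_p2 syl_p3 syl_s1 syl_s2 syl_si1 syl_si2 syl_v1 syl_v2 syl_dev syl_od syl_dv syl_trn
      syl_vis Z_t_def Z_d1_def Z_d2_def Z_tr1_def Z_tr2_def Z_tr3_def Z_c1_def Z_c2_def Z_c3_def
      Z_p1_def Z_p2_def Z_p3_def Z_s1_def Z_s2_def Z_si1_def Z_si2_def Z_v1_def Z_v2_def Z_dev_def
      Z_od_def Z_dv_def Z_trn_def Z_vis_def
  have p0: "map (point_value (- 1, - 1, 1, 0)) covs = map2 (\<lambda>l v. l * of_int v) (lams :: 'k list)
      [0, - 1, - 1, 0, 2, 2, - 3, - 145, 0, 0, - 2, - 2, 1, 0, 0, - 2, 3, 0, 0, 0, 0, 0, 0]" by simp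
  have p1: "map (point_value (- 1, 2, 1, 1)) covs = map2 (\<lambda>l v. l * of_int v) (lams :: 'k list)
      [33, 6, 0, - 4, 99, 378, 9, 2490, 18, 6, 36, 144, 12, 90, 18, - 36, - 12, 36, 108, 72, 36,
          288, 0]" by simp
  have p2: "map (point_value (1, - 1, 2, 0)) covs = map2 (\<lambda>l v. l * of_int v) (lams :: 'k list)
      [3, 2, 2, 0, - 11, - 2, 17, 250, - 6, 6, - 8, - 8, 4, - 18, 2, - 4, - 4, - 12, - 28, - 40, 76,
          384, - 192]" by simp
  have p3: "map (point_value (1, 2, - 1, - 1)) covs = map2 (\<lambda>l v. l * of_int v) (lams :: 'k list)
      [- 1, - 2, - 2, 0, 5, 6, - 7, - 414, - 2, 2, - 8, - 8, 4, - 2, - 2, - 12, 20, 4, 4, - 8, 4, -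
          64, 0]" by simp
  have p4: "map (point_value (- 1, 2, 1, - 1)) covs = map2 (\<lambda>l v. l * of_int v) (lams :: 'k list)
      [- 3, 2, 2, 0, 7, - 2, 9, - 82, - 6, - 6, 8, 8, 4, - 6, 6, - 4, - 12, - 12, 12, 24, 36, - 288,
          0]" by simp
  have p5: "map (point_value (2, 1, 1, 1)) covs = map2 (\<lambda>l v. l * of_int v) (lams :: 'k list)
      [35, 26, 8, 4, - 27, - 114, 17, - 814, 6, 14, 12, 48, 12, 42, - 30, 12, - 4, - 12, - 12, 24,
          76, 608, 192]" by simp
  have p6: "map (point_value (- 1, - 1, - 1, 0)) covs = map2 (\<lambda>l v. l * of_int v) (lams :: 'k list)
      [- 2, 1, 1, 0, - 4, 0, 5, 21, 2, - 2, - 2, - 2, 1, 2, - 2, 0, - 1, 2, - 2, - 2, 4, - 14, 0]" by simp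
  show ?thesis
    using assms unfolding points_def
    by (auto simp only: list.set insert_iff empty_iff prod.inject p0 p1 p2 p3 p4 p5 p6)
qed

definition functional :: "int list \<Rightarrow> 'k::field_char_0 mpoly \<Rightarrow> 'k"
  where "functional ws p = (\<Sum>(u, P, row)\<leftarrow>zip ws points. of_int u * point_value P p)"

definition functional_value :: "int list \<Rightarrow> nat list \<Rightarrow> int"
  where "functional_value ws ks = (\<Sum>(u, P, row)\<leftarrow>zip ws points. u * prod_list (map ((!) row) ks))"

lemma point_value_add: "point_value P (p + q) = point_value P p + point_value P q"
  and point_value_mult: "point_value P (p * q) = point_value P p * point_value P q"
  and point_value_Const_mult: "point_value P (Const r * p) = r * point_value P p"
  and point_value_0: "point_value P 0 = 0"
  and point_value_1: "point_value P 1 = 1"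
  by (cases P; simp add: syl_add syl_mult syl_Const_mult syl_1)+

lemma functional_add: "functional ws (p + q) = functional ws p + functional ws q"
  by (simp add: functional_def case_prod_unfold point_value_add distrib_left sum_list_addf)

lemma functional_Const_mult: "functional ws (Const r * p) = r * functional ws p"
  by (simp add: functional_def case_prod_unfold point_value_Const_mult
      sum_list_const_mult[symmetric] mult.left_commute)

lemma functional_0: "functional ws 0 = 0"
  by (simp add: functional_def case_prod_unfold point_value_0)

lemma functional_sum: "functional ws (\<Sum>i\<in>I. f i) = (\<Sum>i\<in>I. functional ws (f i))"
  by (induction I rule: infinite_finite_induct) (simp_all add: functional_add functional_0)

lemma length_lams: "length lams = 23"
  by (simp add: lams_def)

lemma lams_nonzero: "i < 23 \<Longrightarrow> (lams ! i :: 'k::field_char_0) \<noteq> 0"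
proof -
  have "\<forall>l \<in> set (lams :: 'k list). l \<noteq> 0" by (simp add: lams_def)
  then show "i < 23 \<Longrightarrow> ?thesis" by (simp add: length_lams)
qed

lemma point_value_cov_prod:
  assumes P: "(P, row) \<in> set points" and ks: "\<forall>i\<in>set ks. i < 23"
  shows "point_value P (cov_prod ks) =
      prod_list (map ((!) lams) ks) * of_int (prod_list (map ((!) row) ks))"
proof -
  have len: "length row = 23" using P by (auto simp: points_def)
  have nth: "point_value P (covs ! i) = lams ! i * of_int (row ! i)" if "i < 23" for i
    using arg_cong[OF point_values[OF P], of "\<lambda>l. l ! i"] that by (simp add: len length_covs length_lams)
  from ks show ?thesis
    by (induction ks) (simp_all add: cov_prod_def point_value_mult point_value_1 nth mult_ac)
qed

lemma functional_cov_prod: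
  assumes ks: "\<forall>i\<in>set ks. i < 23"
  shows "functional ws (cov_prod ks) = prod_list (map ((!) lams) ks) * of_int (functional_value ws ks)"
proof -
  have "(\<Sum>(u, P, row)\<leftarrow>zip ws pts. of_int u * point_value P (cov_prod ks))
      = prod_list (map ((!) lams) ks) * of_int (\<Sum>(u, P, row)\<leftarrow>zip ws pts. u * prod_list (map ((!) row) ks))"
    if "set pts \<subseteq> set points" for pts
    using that
  proof (induction pts arbitrary: ws)
    case (Cons x pts)
    show ?case
    proof (cases ws)
      case (Cons u ws')
      obtain P row where x: "x = (P, row)" by fastforce
      show ?thesis
        using Cons.IH[of ws'] Cons.prems
        by (simp add: Cons x point_value_cov_prod[OF _ ks] algebra_simps)
    qed simp
  qed simp
  then show ?thesis unfolding functional_def functional_value_def by blast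
qed

lemma prod_lams_nonzero: "\<forall>i\<in>set ks. i < 23 \<Longrightarrow> prod_list (map ((!) lams) ks) \<noteq> (0 :: 'k::field_char_0)"
  by (induction ks) (simp_all add: lams_nonzero)

text \<open>
  The rows of \<open>Ws\<close> are, up to nonzero scalars, linear functionals dual to the products in \<open>J\<close>;
  they come from the inverse of the matrix of the values of these products at the points.
\<close>

definition dual_basis :: "nat list list \<Rightarrow> nat \<Rightarrow> nat \<Rightarrow> int list list \<Rightarrow> bool"
  where "dual_basis J m w Ws \<longleftrightarrow> length Ws = length J \<and> (\<forall>ks\<in>set J. has_bideg ks m w) \<and>
    list_all (\<lambda>i. list_all (\<lambda>j. (functional_value (Ws ! i) (J ! j) = 0) =
        (i \<noteq> j)) [0..<length J]) [0..<length J]"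

lemma hwv_subset_gen_span_dual_basis:
  assumes chk: "dual_basis J m w Ws" and dim: "dim_series (int w) $ m \<le> int (length J)"
  shows "(hwv 5 m (int w) :: 'k::field_char_0 mpoly set) \<subseteq> gen_span gens m (int w)"
proof -
  let ?f = "\<lambda>j. cov_prod (J ! j) :: 'k mpoly"
  have bi: "has_bideg (J ! j) m w" if "j < length J" for j
    using chk that by (auto simp: dual_basis_def)
  have dual: "functional_value (Ws ! i) (J ! j) = 0 \<longleftrightarrow> i \<noteq> j" if "i < length J" "j < length J" for i j
    using chk that by (auto simp: dual_basis_def list_all_iff)
  have prod: "gen_product gens m (int w) (?f j)" if "j < length J" for j
    using bi[OF that] by (rule cov_prod_gen_product)
  have "hwv 5 m (int w) \<subseteq> vs.span (?f ` {..<length J})"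
  proof (rule hwv_subset_span_family)
    show "?f j \<in> hwv 5 m (int w)" if "j \<in> {..<length J}" for j
      using gen_product_hwv[OF _ prod, of 5 j] gens_hwv that by blast
    show "card (bimons 5 m (int w)) \<le> card {..<length J} + card (bimons 5 m (int w + 2))"
      using dim by (simp add: dim_series_def)
    fix c :: "nat \<Rightarrow> 'k"
    assume zero: "(\<Sum>j<length J. Const (c j) * ?f j) = 0"
    show "\<forall>j\<in>{..<length J}. c j = 0"
    proof
      fix i assume i: "i \<in> {..<length J}"
      have "0 = functional (Ws ! i) (\<Sum>j<length J. Const (c j) * ?f j)" unfolding zero
          by (simp add: functional_0)
      also have "\<dots> = (\<Sum>j<length J. c j * functional (Ws ! i) (?f j))"
        by (simp add: functional_sum functional_Const_mult)
      also have "\<dots> = (\<Sum>j\<in>{i}. c j * functional (Ws ! i) (?f j))"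
      proof (rule sum.mono_neutral_right)
        show "\<forall>j\<in>{..<length J} - {i}. c j * functional (Ws ! i) (?f j) = 0"
          using i bi dual by (auto simp: functional_cov_prod has_bideg_def)
      qed (use i in auto)
      finally have "c i * functional (Ws ! i) (?f i) = 0" by simp
      moreover have "functional (Ws ! i) (?f i) \<noteq> 0"
        using i bi[of i] dual[of i i] prod_lams_nonzero[of "J ! i", where 'k = 'k]
        by (simp add: functional_cov_prod has_bideg_def)
      ultimately show "c i = 0" by simp
    qed
  qed auto
  also have "\<dots> \<subseteq> gen_span gens m (int w)"
    unfolding gen_span_def using prod by (intro vs.span_mono) auto
  finally show ?thesis .
qed

lemma u_series_simps2:
  "u_series 9 = fps_X^9 + fps_X^7 + 2 * fps_X^5 + 2 * fps_X^3"
  "u_series 10 = fps_X^10 + fps_X^8 + 2 * fps_X^6 + 2 * fps_X^4 + fps_X^2"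
  "u_series 11 = fps_X^11 + fps_X^9 + 2 * fps_X^7 + 2 * fps_X^5 + 2 * fps_X^3"
  "u_series 12 = fps_X^12 + fps_X^10 + 2 * fps_X^8 + 2 * fps_X^6 + 3 * fps_X^4"
proof -
  note [simp] = u_series_simps power2_eq_square
  show u9: "u_series 9 = fps_X^9 + fps_X^7 + 2 * fps_X^5 + 2 * fps_X^3"
    by (subst u_series_rec) (simp, algebra)
  show u10: "u_series 10 = fps_X^10 + fps_X^8 + 2 * fps_X^6 + 2 * fps_X^4 + fps_X^2"
    by (subst u_series_rec) (simp add: u9, algebra)
  show u11: "u_series 11 = fps_X^11 + fps_X^9 + 2 * fps_X^7 + 2 * fps_X^5 + 2 * fps_X^3"
    by (subst u_series_rec) (simp add: u9 u10, algebra)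
  show "u_series 12 = fps_X^12 + fps_X^10 + 2 * fps_X^8 + 2 * fps_X^6 + 3 * fps_X^4"
    by (subst u_series_rec) (simp add: u9 u10 u11, algebra)
qed

lemma D_dim_series_high:
  "D_series * dim_series 5 = fps_X + fps_X^3 + fps_X^5 + 2 * fps_X^7 + 2 * fps_X^9 + 2 * fps_X^11 +
      fps_X^13 + fps_X^15 + fps_X^17"
  "D_series * dim_series 6 = fps_X^2 + fps_X^4 + 3 * fps_X^6 + 2 * fps_X^8 + 2 * fps_X^10 +
      3 * fps_X^12 + fps_X^14 + fps_X^16"
  "D_series * dim_series 7 = fps_X^3 + 2 * fps_X^5 + 3 * fps_X^7 + 3 * fps_X^9 + 3 * fps_X^11 +
      3 * fps_X^13 + fps_X^15 + fps_X^17 - fps_X^21"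
  "D_series * dim_series 8 = 2 * fps_X^4 + 2 * fps_X^6 + 4 * fps_X^8 + 4 * fps_X^10 + 3 * fps_X^12 +
      3 * fps_X^14 + fps_X^16 + fps_X^18 - fps_X^20 - fps_X^22"
  "D_series * dim_series 9 = fps_X^3 + 3 * fps_X^5 + 3 * fps_X^7 + 4 * fps_X^9 + 4 * fps_X^11 +
      3 * fps_X^13 + 3 * fps_X^15 - fps_X^23"
  "D_series * dim_series 10 = fps_X^2 + fps_X^4 + 3 * fps_X^6 + 4 * fps_X^8 + 5 * fps_X^10 +
      4 * fps_X^12 + 3 * fps_X^14 + 3 * fps_X^16 - fps_X^22 - fps_X^24"
  "D_series * dim_series 12 = 2 * fps_X^4 + 3 * fps_X^6 + 5 * fps_X^8 + 5 * fps_X^10 +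
      6 * fps_X^12 + 5 * fps_X^14 + 2 * fps_X^16 + 2 * fps_X^18 - fps_X^20 - fps_X^22 - fps_X^24 - fps_X^26"
proof -
  have S: "(\<Sum>j<8. f j) = f 0 + f 1 + f 2 + f 3 + f 4 + f 5 + f 6 + f 7" for f :: "nat \<Rightarrow> int fps"
    by (simp add: eval_nat_numeral lessThan_Suc algebra_simps)
  note [simp] = D_dim_series S u_series_negative u_series_simps u_series_simps2 num_def
  show "D_series * dim_series 5 = fps_X + fps_X^3 + fps_X^5 + 2 * fps_X^7 + 2 * fps_X^9 +
      2 * fps_X^11 + fps_X^13 + fps_X^15 + fps_X^17"
    by (simp, algebra)
  show "D_series * dim_series 6 = fps_X^2 + fps_X^4 + 3 * fps_X^6 + 2 * fps_X^8 + 2 * fps_X^10 +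
      3 * fps_X^12 + fps_X^14 + fps_X^16"
    by (simp, algebra)
  show "D_series * dim_series 7 = fps_X^3 + 2 * fps_X^5 + 3 * fps_X^7 + 3 * fps_X^9 + 3 * fps_X^11 +
      3 * fps_X^13 + fps_X^15 + fps_X^17 - fps_X^21"
    by (simp, algebra)
  show "D_series * dim_series 8 = 2 * fps_X^4 + 2 * fps_X^6 + 4 * fps_X^8 + 4 * fps_X^10 +
      3 * fps_X^12 + 3 * fps_X^14 + fps_X^16 + fps_X^18 - fps_X^20 - fps_X^22"
    by (simp, algebra)
  show "D_series * dim_series 9 = fps_X^3 + 3 * fps_X^5 + 3 * fps_X^7 + 4 * fps_X^9 + 4 * fps_X^11 +
      3 * fps_X^13 + 3 * fps_X^15 - fps_X^23"
    by (simp, algebra)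
  show "D_series * dim_series 10 = fps_X^2 + fps_X^4 + 3 * fps_X^6 + 4 * fps_X^8 + 5 * fps_X^10 +
      4 * fps_X^12 + 3 * fps_X^14 + 3 * fps_X^16 - fps_X^22 - fps_X^24"
    by (simp, algebra)
  show "D_series * dim_series 12 = 2 * fps_X^4 + 3 * fps_X^6 + 5 * fps_X^8 + 5 * fps_X^10 +
      6 * fps_X^12 + 5 * fps_X^14 + 2 * fps_X^16 + 2 * fps_X^18 - fps_X^20 - fps_X^22 - fps_X^24 - fps_X^26"
    by (simp, algebra)
qed

text \<open>
  \<open>D_series = 1 - z\<^sup>4 - z\<^sup>8 + z\<^sup>1\<^sup>6 + \<dots>\<close>; the terms of degree 12 cancel.
\<close>

lemma nth_eq_D_series:
  assumes "m < 16"
  shows "F $ m = (D_series * F) $ m + (if m < 4 then 0 else F $ (m - 4)) +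
      (if m < 8 then 0 else F $ (m - 8))"
proof -
  have "D_series * F = F - fps_X^4 * F - fps_X^8 * F + fps_X^16 * ((1 + fps_X^4 - fps_X^8) * F)"
    unfolding D_series_def by algebra
  with assms show ?thesis by (simp only: fps_sub_nth fps_add_nth fps_X_power_mult_nth if_True)
qed

lemma dim_values:
  "dim_series 5 $ 1 = 1"
  "dim_series 5 $ 3 = 1"
  "dim_series 5 $ 5 = 2"
  "dim_series 5 $ 7 = 3"
  "dim_series 5 $ 9 = 5"
  "dim_series 6 $ 0 = 0"
  "dim_series 6 $ 2 = 1"
  "dim_series 6 $ 4 = 1"
  "dim_series 6 $ 6 = 4"
  "dim_series 6 $ 8 = 3"
  "dim_series 6 $ 10 = 7"
  "dim_series 7 $ 1 = 0"
  "dim_series 7 $ 3 = 1"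
  "dim_series 7 $ 5 = 2"
  "dim_series 7 $ 7 = 4"
  "dim_series 8 $ 0 = 0"
  "dim_series 8 $ 2 = 0"
  "dim_series 8 $ 4 = 2"
  "dim_series 8 $ 6 = 2"
  "dim_series 8 $ 8 = 6"
  "dim_series 9 $ 1 = 0"
  "dim_series 9 $ 3 = 1"
  "dim_series 9 $ 5 = 3"
  "dim_series 10 $ 0 = 0"
  "dim_series 10 $ 2 = 1"
  "dim_series 10 $ 4 = 1"
  "dim_series 10 $ 6 = 4"
  "dim_series 12 $ 0 = 0"
  "dim_series 12 $ 4 = 2"
proof -
  have numer: "(numeral k * F) $ n = numeral k * F $ n" for k n and F :: "int fps"
    by (simp add: numeral_fps_const)
  show d5_1: "dim_series 5 $ 1 = 1"
      by (subst nth_eq_D_series) (simp_all add: D_dim_series_high fps_X_power_nth numer)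
  show d5_3: "dim_series 5 $ 3 = 1"
      by (subst nth_eq_D_series) (simp_all add: D_dim_series_high fps_X_power_nth numer)
  show d5_5: "dim_series 5 $ 5 = 2"
      by (subst nth_eq_D_series) (simp_all add: D_dim_series_high fps_X_power_nth numer
      d5_1[unfolded One_nat_def])
  show d5_7: "dim_series 5 $ 7 = 3"
      by (subst nth_eq_D_series) (simp_all add: D_dim_series_high fps_X_power_nth numer d5_3)
  show d5_9: "dim_series 5 $ 9 = 5"
      by (subst nth_eq_D_series) (simp_all add: D_dim_series_high fps_X_power_nth numer d5_5
      d5_1[unfolded One_nat_def])
  show d6_0: "dim_series 6 $ 0 = 0"
      by (subst nth_eq_D_series) (simp_all add: D_dim_series_high fps_X_power_nth numer)
  show d6_2: "dim_series 6 $ 2 = 1"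
      by (subst nth_eq_D_series) (simp_all add: D_dim_series_high fps_X_power_nth numer)
  show d6_4: "dim_series 6 $ 4 = 1"
      by (subst nth_eq_D_series) (simp_all add: D_dim_series_high fps_X_power_nth numer d6_0)
  show d6_6: "dim_series 6 $ 6 = 4"
      by (subst nth_eq_D_series) (simp_all add: D_dim_series_high fps_X_power_nth numer d6_2)
  show d6_8: "dim_series 6 $ 8 = 3"
      by (subst nth_eq_D_series) (simp_all add: D_dim_series_high fps_X_power_nth numer d6_4 d6_0)
  show d6_10: "dim_series 6 $ 10 = 7"
      by (subst nth_eq_D_series) (simp_all add: D_dim_series_high fps_X_power_nth numer d6_6 d6_2)
  show d7_1: "dim_series 7 $ 1 = 0"
      by (subst nth_eq_D_series) (simp_all add: D_dim_series_high fps_X_power_nth numer)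
  show d7_3: "dim_series 7 $ 3 = 1"
      by (subst nth_eq_D_series) (simp_all add: D_dim_series_high fps_X_power_nth numer)
  show d7_5: "dim_series 7 $ 5 = 2"
      by (subst nth_eq_D_series) (simp_all add: D_dim_series_high fps_X_power_nth numer
      d7_1[unfolded One_nat_def])
  show d7_7: "dim_series 7 $ 7 = 4"
      by (subst nth_eq_D_series) (simp_all add: D_dim_series_high fps_X_power_nth numer d7_3)
  show d8_0: "dim_series 8 $ 0 = 0"
      by (subst nth_eq_D_series) (simp_all add: D_dim_series_high fps_X_power_nth numer)
  show d8_2: "dim_series 8 $ 2 = 0"
      by (subst nth_eq_D_series) (simp_all add: D_dim_series_high fps_X_power_nth numer)
  show d8_4: "dim_series 8 $ 4 = 2"
      by (subst nth_eq_D_series) (simp_all add: D_dim_series_high fps_X_power_nth numer d8_0)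
  show d8_6: "dim_series 8 $ 6 = 2"
      by (subst nth_eq_D_series) (simp_all add: D_dim_series_high fps_X_power_nth numer d8_2)
  show d8_8: "dim_series 8 $ 8 = 6"
      by (subst nth_eq_D_series) (simp_all add: D_dim_series_high fps_X_power_nth numer d8_4 d8_0)
  show d9_1: "dim_series 9 $ 1 = 0"
      by (subst nth_eq_D_series) (simp_all add: D_dim_series_high fps_X_power_nth numer)
  show d9_3: "dim_series 9 $ 3 = 1"
      by (subst nth_eq_D_series) (simp_all add: D_dim_series_high fps_X_power_nth numer)
  show d9_5: "dim_series 9 $ 5 = 3"
      by (subst nth_eq_D_series) (simp_all add: D_dim_series_high fps_X_power_nth numer
      d9_1[unfolded One_nat_def])
  show d10_0: "dim_series 10 $ 0 = 0"
      by (subst nth_eq_D_series) (simp_all add: D_dim_series_high fps_X_power_nth numer)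
  show d10_2: "dim_series 10 $ 2 = 1"
      by (subst nth_eq_D_series) (simp_all add: D_dim_series_high fps_X_power_nth numer)
  show d10_4: "dim_series 10 $ 4 = 1"
      by (subst nth_eq_D_series) (simp_all add: D_dim_series_high fps_X_power_nth numer d10_0)
  show d10_6: "dim_series 10 $ 6 = 4"
      by (subst nth_eq_D_series) (simp_all add: D_dim_series_high fps_X_power_nth numer d10_2)
  show d12_0: "dim_series 12 $ 0 = 0"
      by (subst nth_eq_D_series) (simp_all add: D_dim_series_high fps_X_power_nth numer)
  show d12_4: "dim_series 12 $ 4 = 2"
      by (subst nth_eq_D_series) (simp_all add: D_dim_series_high fps_X_power_nth numer d12_0)
qed

lemma hwv_3_5: "(hwv 5 3 5 :: 'k::field_char_0 mpoly set) \<subseteq> gen_span gens 3 5"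
proof -
  have "dual_basis [[4]] 3 5
    [[1, 0, 0, 0, 0, 0, 0]]"
    by code_simp
  from hwv_subset_gen_span_dual_basis[OF this] show ?thesis using dim_values by simp
qed

lemma hwv_5_5: "(hwv 5 5 5 :: 'k::field_char_0 mpoly set) \<subseteq> gen_span gens 5 5"
proof -
  have "dual_basis [[0, 6], [2, 3]] 5 5
    [[0, 1, 0, 0, 0, 0, 0],
     [0, - 595, 0, 0, 0, 297, 0]]"
    by code_simp
  from hwv_subset_gen_span_dual_basis[OF this] show ?thesis using dim_values by simp
qed

lemma hwv_7_5: "(hwv 5 7 5 :: 'k::field_char_0 mpoly set) \<subseteq> gen_span gens 7 5"
proof -
  have "dual_basis [[2, 10], [4, 6], [15]] 7 5
    [[5148, - 175, - 999, 0, 0, 0, 0],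
     [- 72, 5, - 9, 0, 0, 0, 0],
     [- 7128, - 235, - 891, 0, 0, 0, 0]]"
    by code_simp
  from hwv_subset_gen_span_dual_basis[OF this] show ?thesis using dim_values by simp
qed

lemma hwv_9_5: "(hwv 5 9 5 :: 'k::field_char_0 mpoly set) \<subseteq> gen_span gens 9 5"
proof -
  have "dual_basis [[0, 6, 6], [2, 2, 9], [2, 3, 6], [0, 16], [3, 12]] 9 5
    [[0, 0, 1, 3, 2, 0, 0],
     [0, 0, - 92, - 393, - 249, 0, 0],
     [0, 13, 523, 2882, 1969, 13, 0],
     [0, 0, - 5, - 24, - 13, 0, 0],
     [0, - 26, 1012, 4323, 2453, 0, 0]]"
    by code_simp
  from hwv_subset_gen_span_dual_basis[OF this] show ?thesis using dim_values by simp
qed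

lemma hwv_2_6: "(hwv 5 2 6 :: 'k::field_char_0 mpoly set) \<subseteq> gen_span gens 2 6"
proof -
  have "dual_basis [[1]] 2 6
    [[- 1, 0, 0, 0, 0, 0, 0]]"
    by code_simp
  from hwv_subset_gen_span_dual_basis[OF this] show ?thesis using dim_values by simp
qed

lemma hwv_4_6: "(hwv 5 4 6 :: 'k::field_char_0 mpoly set) \<subseteq> gen_span gens 4 6"
proof -
  have "dual_basis [[8]] 4 6
    [[0, 1, 0, 0, 0, 0, 0]]"
    by code_simp
  from hwv_subset_gen_span_dual_basis[OF this] show ?thesis using dim_values by simp
qed

lemma hwv_6_6: "(hwv 5 6 6 :: 'k::field_char_0 mpoly set) \<subseteq> gen_span gens 6 6"
proof -
  have "dual_basis [[2, 2, 2], [0, 9], [1, 6], [2, 7]] 6 6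
    [[416160, 164, - 9279, - 67275, 0, 0, 0],
     [864, 4, - 27, - 135, 0, 0, 0],
     [- 3168, - 4, 99, 495, 0, 0, 0],
     [4320, 4, - 117, - 657, 0, 0, 0]]"
    by code_simp
  from hwv_subset_gen_span_dual_basis[OF this] show ?thesis using dim_values by simp
qed

lemma hwv_8_6: "(hwv 5 8 6 :: 'k::field_char_0 mpoly set) \<subseteq> gen_span gens 8 6"
proof -
  have "dual_basis [[0, 14], [2, 13], [3, 10]] 8 6
    [[0, 0, 1, 9, 0, 0, 0],
     [0, 0, - 1, 3, 0, 0, 0],
     [0, - 4, 99, 891, 0, 0, 0]]"
    by code_simp
  from hwv_subset_gen_span_dual_basis[OF this] show ?thesis using dim_values by simp
qed

lemma hwv_10_6: "(hwv 5 10 6 :: 'k::field_char_0 mpoly set) \<subseteq> gen_span gens 10 6"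
proof -
  have "dual_basis [[2, 2, 2, 6], [0, 6, 9], [1, 6, 6], [2, 2, 12], [2, 3, 9], [2, 6, 7], [1, 16]] 10 6
    [[- 1353624, 82, 4359, 160016, - 138021, 0, 931960],
     [312, 2, - 3, - 62, 87, 0, - 664],
     [- 2040, - 2, 3, 278, - 303, 0, 2392],
     [924, 0, - 3, - 116, 111, 0, - 772],
     [343704, - 17, - 762, - 39271, 32025, 9, - 222488],
     [8088, 2, - 3, - 980, 897, 0, - 6712],
     [- 336, 0, - 3, 19, 6, 0, - 16]]"
    by code_simp
  from hwv_subset_gen_span_dual_basis[OF this] show ?thesis using dim_values by simp
qed

lemma hwv_3_7: "(hwv 5 3 7 :: 'k::field_char_0 mpoly set) \<subseteq> gen_span gens 3 7"
proof -
  have "dual_basis [[0, 2]] 3 7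
    [[0, 0, 1, 0, 0, 0, 0]]"
    by code_simp
  from hwv_subset_gen_span_dual_basis[OF this] show ?thesis using dim_values by simp
qed

lemma hwv_5_7: "(hwv 5 5 7 :: 'k::field_char_0 mpoly set) \<subseteq> gen_span gens 5 7"
proof -
  have "dual_basis [[2, 4], [11]] 5 7
    [[- 72, - 1, 0, 0, 0, 0, 0],
     [0, 1, 0, 0, 0, 0, 0]]"
    by code_simp
  from hwv_subset_gen_span_dual_basis[OF this] show ?thesis using dim_values by simp
qed

lemma hwv_7_7: "(hwv 5 7 7 :: 'k::field_char_0 mpoly set) \<subseteq> gen_span gens 7 7"
proof -
  have "dual_basis [[0, 2, 6], [2, 2, 3], [0, 12], [1, 9]] 7 7
    [[0, 0, 1, 3, 0, 0, 0],
     [0, - 35, - 13146, - 19278, 0, 225, 0],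
     [0, 10, 21, 153, 0, 0, 0],
     [0, - 10, - 231, - 1683, 0, 0, 0]]"
    by code_simp
  from hwv_subset_gen_span_dual_basis[OF this] show ?thesis using dim_values by simp
qed

lemma hwv_2_8: "(hwv 5 2 8 :: 'k::field_char_0 mpoly set) \<subseteq> gen_span gens 2 8"
proof -
  have "dual_basis [] 2 8
    []"
    by code_simp
  from hwv_subset_gen_span_dual_basis[OF this] show ?thesis using dim_values by simp
qed

lemma hwv_4_8: "(hwv 5 4 8 :: 'k::field_char_0 mpoly set) \<subseteq> gen_span gens 4 8"
proof -
  have "dual_basis [[0, 3], [1, 2]] 4 8
    [[0, - 1, 0, 0, 0, 0, 0],
     [1, 0, 0, 0, 0, 0, 0]]"
    by code_simp
  from hwv_subset_gen_span_dual_basis[OF this] show ?thesis using dim_values by simp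
qed

lemma hwv_6_8: "(hwv 5 6 8 :: 'k::field_char_0 mpoly set) \<subseteq> gen_span gens 6 8"
proof -
  have "dual_basis [[0, 10], [2, 8]] 6 8
    [[0, 1, 0, 0, 0, 0, 0],
     [0, - 2, - 99, 0, 0, 0, 0]]"
    by code_simp
  from hwv_subset_gen_span_dual_basis[OF this] show ?thesis using dim_values by simp
qed

lemma hwv_8_8: "(hwv 5 8 8 :: 'k::field_char_0 mpoly set) \<subseteq> gen_span gens 8 8"
proof -
  have "dual_basis [[2, 2, 2, 2], [0, 2, 9], [0, 3, 6], [1, 2, 6], [2, 2, 7], [1, 12]] 8 8
    [[- 13031616, 24395, - 177867, 897723, - 1247820, 12177, 0],
     [1292736, 595, - 36675, - 150741, 30588, 297, 0],
     [- 384, - 2, - 9, 27, 6, 0, 0],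
     [- 836544, - 595, 36675, 107973, - 16332, - 297, 0],
     [836544, 595, - 25983, - 107973, 5640, 297, 0],
     [- 128, 0, - 3, 9, 2, 0, 0]]"
    by code_simp
  from hwv_subset_gen_span_dual_basis[OF this] show ?thesis using dim_values by simp
qed

lemma hwv_3_9: "(hwv 5 3 9 :: 'k::field_char_0 mpoly set) \<subseteq> gen_span gens 3 9"
proof -
  have "dual_basis [[5]] 3 9
    [[1, 0, 0, 0, 0, 0, 0]]"
    by code_simp
  from hwv_subset_gen_span_dual_basis[OF this] show ?thesis using dim_values by simp
qed

lemma hwv_5_9: "(hwv 5 5 9 :: 'k::field_char_0 mpoly set) \<subseteq> gen_span gens 5 9"
proof -
  have "dual_basis [[0, 2, 2], [0, 7], [1, 3]] 5 9
    [[0, 0, 69, - 125, 0, 0, 0],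
     [0, 0, 1, 3, 0, 0, 0],
     [0, - 4, 165, 495, 0, 0, 0]]"
    by code_simp
  from hwv_subset_gen_span_dual_basis[OF this] show ?thesis using dim_values by simp
qed

lemma hwv_4_10: "(hwv 5 4 10 :: 'k::field_char_0 mpoly set) \<subseteq> gen_span gens 4 10"
proof -
  have "dual_basis [[0, 4]] 4 10
    [[0, 1, 0, 0, 0, 0, 0]]"
    by code_simp
  from hwv_subset_gen_span_dual_basis[OF this] show ?thesis using dim_values by simp
qed

lemma hwv_6_10: "(hwv 5 6 10 :: 'k::field_char_0 mpoly set) \<subseteq> gen_span gens 6 10"
proof -
  have "dual_basis [[0, 0, 6], [0, 2, 3], [1, 2, 2], [1, 7]] 6 10
    [[- 72, 1, - 9, 0, 0, 0, 0],
     [12800088, - 1343, - 2780469, 0, 0, 21060, 0],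
     [- 58104, - 493, 31581, 0, 0, 0, 0],
     [8712, - 17, 1089, 0, 0, 0, 0]]"
    by code_simp
  from hwv_subset_gen_span_dual_basis[OF this] show ?thesis using dim_values by simp
qed

lemma hwv_4_12: "(hwv 5 4 12 :: 'k::field_char_0 mpoly set) \<subseteq> gen_span gens 4 12"
proof -
  have "dual_basis [[0, 0, 2], [1, 1]] 4 12
    [[- 4, 0, 1, 0, 0, 0, 0],
     [1, 0, 0, 0, 0, 0, 0]]"
    by code_simp
  from hwv_subset_gen_span_dual_basis[OF this] show ?thesis using dim_values by simp
qed

section \<open>Generation of all bihomogeneous elements\<close>

lemma hwv_low_order:
  assumes "w \<le> 4"
  shows "(hwv 5 m w :: 'k::field_char_0 mpoly set) \<subseteq> gen_span gens m w"
proof (cases "w < 0")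
  case True
  show ?thesis
  proof
    fix p :: "'k mpoly" assume "p \<in> hwv 5 m w"
    then have "p = 0" using True by (rule hwv_negative)
    then show "p \<in> gen_span gens m w" by (simp add: gen_span_def vs.span_zero)
  qed
next
  case False
  with assms have "w = 0 \<or> w = 1 \<or> w = 2 \<or> w = 3 \<or> w = 4" by auto
  then show ?thesis
    using hwv_order_0 hwv_order_1 hwv_order_2 hwv_order_3 hwv_order_4 by (elim disjE) simp_all
qed

text \<open>
  If the result has order at most 4, the module structure applies. Otherwise \<open>2 * s \<le> b\<close>, which
  leaves finitely many bidegrees.
\<close>

lemma tau_gens:
  assumes g: "(g, a, b) \<in> (gens :: ('k::field_char_0 mpoly \<times> nat \<times> nat) set)" and s: "1 \<le> s" "s \<le> 5" "s \<le> b"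
  shows "tau 5 s g \<in> gen_span gens (Suc a) (int b + int 5 - 2 * int s)"
proof -
  have mem: "tau 5 s g \<in> hwv 5 (Suc a) (int b + int 5 - 2 * int s)"
    using gens_hwv[OF g] s by (intro tau_hwv) auto
  have "hwv 5 (Suc a) (int b + int 5 - 2 * int s) \<subseteq> (gen_span gens (Suc a) (int b + int 5 -
      2 * int s) :: 'k mpoly set)"
  proof (cases "int b + int 5 - 2 * int s \<le> 4")
    case True
    then show ?thesis by (rule hwv_low_order)
  next
    case False
    note small = hwv_3_5 hwv_5_5 hwv_7_5 hwv_9_5 hwv_2_6 hwv_4_6 hwv_6_6 hwv_8_6 hwv_10_6 hwv_3_7
        hwv_5_7 hwv_7_7 hwv_4_8 hwv_6_8 hwv_8_8 hwv_3_9 hwv_5_9 hwv_4_10 hwv_6_10 hwv_4_12 hwv_2_8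
    have all: "\<forall>(a, b)\<in>set bidegs. \<forall>s\<in>{1, 2, 3, 4 :: nat}. 2 * s \<le> b \<longrightarrow>
        (hwv 5 (Suc a) (int b + int 5 - 2 * int s) :: 'k mpoly set) \<subseteq> gen_span gens (Suc a) (int b +
            int 5 - 2 * int s)"
      using small[where 'k = 'k] hwv_2_6[where 'k = 'k, unfolded numeral_2_eq_2] hwv_2_8[where 'k =
          'k, unfolded numeral_2_eq_2]
      by (simp add: bidegs_def)
    from False have b: "2 * s \<le> b" by simp
    have ab: "(a, b) \<in> set bidegs"
      using g by (auto simp: gens_conv dest: set_zip_rightD)
    then have "b \<le> 9" by (auto simp: bidegs_def)
    then have "s \<in> {1, 2, 3, 4}" using s b by auto
    with all ab b show ?thesis by blast
  qed
  with mem show ?thesis by blast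
qed

theorem hwv_eq_gen_span: "(hwv 5 m w :: 'k::field_char_0 mpoly set) = gen_span gens m w"
proof (rule subset_antisym)
  show "hwv 5 m w \<subseteq> (gen_span gens m w :: 'k mpoly set)"
  proof (rule hwv_subset_gen_span)
    show "(Var 0, 1, 5) \<in> (gens :: ('k mpoly \<times> nat \<times> nat) set)" by (simp add: gens_def cov_t_def)
  qed (use gens_hwv[where 'a = 'k] hwv_low_order[where 'k = 'k] tau_gens[where 'k = 'k] in auto)
  show "gen_span gens m w \<subseteq> (hwv 5 m w :: 'k mpoly set)"
    using gens_hwv by (intro gen_span_hwv) blast
qed

section \<open>From bihomogeneous elements to the whole kernel\<close>

definition component :: "nat \<Rightarrow> nat \<Rightarrow> int \<Rightarrow> 'k::comm_ring_1 mpoly \<Rightarrow> 'k mpoly"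
  where "component n m w p = (\<Sum>k\<in>bimons n m w. Poly_Mapping.single k (Poly_Mapping.lookup p k))"

lemma lookup_component:
  "Poly_Mapping.lookup (component n m w p) k = (if k \<in> bimons n m w then Poly_Mapping.lookup p k else 0)"
  by (simp add: component_def Poly_Mapping.lookup_sum lookup_single when_def)

lemma component_add: "component n m w (p + q) = component n m w p + component n m w q"
  by (rule poly_mapping_eqI) (simp add: lookup_component lookup_add)

lemma component_Const_mult: "component n m w (Const c * p) = Const c * component n m w p"
  by (rule poly_mapping_eqI) (simp add: lookup_component lookup_Const_mult)

lemma component_0: "component n m w 0 = 0"
  by (simp add: component_def)

lemma component_sum: "component n m w (\<Sum>i\<in>I. f i) = (\<Sum>i\<in>I. component n m w (f i))"
  by (induction I rule: infinite_finite_induct) (simp_all add: component_add component_0)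

lemma component_bihom: "component n m w p \<in> bihom n m w"
  by (auto simp: bihom_def in_keys_iff lookup_component split: if_splits)

lemma component_of_bihom:
  assumes "p \<in> bihom n m' w'"
  shows "component n m w p = (if m = m' \<and> w = w' then p else 0)"
proof (rule poly_mapping_eqI)
  fix k
  have "Poly_Mapping.lookup p k = 0" if "k \<notin> bimons n m' w'"
    using assms that by (auto simp: bihom_def in_keys_iff)
  moreover have "m = m' \<and> w = w'" if "k \<in> bimons n m w" "k \<in> bimons n m' w'"
    using that by (simp add: bimons_def)
  ultimately show "Poly_Mapping.lookup (component n m w p) k
      = Poly_Mapping.lookup (if m = m' \<and> w = w' then p else 0) k"
    by (auto simp: lookup_component)
qed

lemma polys_upto_components:
  assumes "p \<in> polys_upto n"
  obtains X where "finite X" "p = (\<Sum>(m, w)\<in>X. component n m w p)"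
proof
  let ?X = "(\<lambda>k. (mon_degree n k, monomial_weight n k)) ` Poly_Mapping.keys p"
  show "finite ?X" by simp
  show "p = (\<Sum>(m, w)\<in>?X. component n m w p)"
  proof (rule poly_mapping_eqI)
    fix k
    show "Poly_Mapping.lookup p k = Poly_Mapping.lookup (\<Sum>(m, w)\<in>?X. component n m w p) k"
    proof (cases "k \<in> Poly_Mapping.keys p")
      case True
      have k: "k \<in> bimons n m w \<longleftrightarrow> (m, w) = (mon_degree n k, monomial_weight n k)" for m w
        using True assms by (auto simp: bimons_def polys_upto_def)
      have "Poly_Mapping.lookup (\<Sum>(m, w)\<in>?X. component n m w p) k
          = (\<Sum>x\<in>?X. if x = (mon_degree n k, monomial_weight n k) then Poly_Mapping.lookup p k else 0)"
        by (simp add: Poly_Mapping.lookup_sum case_prod_unfold lookup_component k)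
      also have "\<dots> = Poly_Mapping.lookup p k" using True by simp
      finally show ?thesis by simp
    next
      case False
      then show ?thesis
        by (simp add: Poly_Mapping.lookup_sum case_prod_unfold lookup_component in_keys_iff cong: if_cong)
    qed
  qed
qed

lemma component_weitzenboeck:
  assumes "p \<in> polys_upto n"
  shows "component n m (w + 2) (weitzenboeck p) = weitzenboeck (component n m w p)"
proof -
  obtain X where X: "finite X" "p = (\<Sum>(m, w)\<in>X. component n m w p)"
    using assms by (rule polys_upto_components)
  have w: "component n m (w + 2) (weitzenboeck (component n m' w' p))
      = weitzenboeck (component n m w (component n m' w' p))" for m' w'
    unfolding component_of_bihom[OF component_bihom]
      component_of_bihom[OF weitzenboeck_bihom[OF component_bihom]] by simp
  show ?thesis
    by (subst (1 2) X(2)) (simp add: component_sum weitzenboeck_sum case_prod_unfold w)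
qed

text \<open>
  The subalgebra generated by \<open>G\<close>, described as a linear span so that its components can be
  computed.
\<close>

definition alg_span :: "('k::field_char_0 mpoly \<times> nat \<times> nat) set \<Rightarrow> 'k mpoly set"
  where "alg_span G = vs.span {z. \<exists>m w. gen_product G m w z}"

lemma gen_span_subset_alg_span: "gen_span G m w \<subseteq> alg_span G"
  unfolding gen_span_def alg_span_def by (intro vs.span_mono) auto

lemma is_subalgebra_alg_span: "is_subalgebra (alg_span G)"
proof -
  have one: "1 \<in> alg_span G" using gen_span_1 gen_span_subset_alg_span by blast
  have "Const c \<in> alg_span G" for c
    using vs.span_scale[OF one[unfolded alg_span_def], of c] by (simp add: alg_span_def)
  moreover have "p * q \<in> alg_span G" if p: "p \<in> alg_span G" and q: "q \<in> alg_span G" for p q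
  proof -
    have 1: "z * q \<in> alg_span G" if z: "gen_product G m w z" for z m w
      using q unfolding alg_span_def
    proof (induction rule: vs.span_induct_alt)
      case (step c x y)
      have "z * x \<in> vs.span {z. \<exists>m w. gen_product G m w z}"
        using gen_product_mult[OF z] step by (intro vs.span_base) blast
      then have "Const c * (z * x) + z * y \<in> vs.span {z. \<exists>m w. gen_product G m w z}"
        using step by (intro vs.span_add vs.span_scale) auto
      then show ?case by (simp add: algebra_simps)
    qed (simp add: vs.span_zero)
    show ?thesis
      using p unfolding alg_span_def
    proof (induction rule: vs.span_induct_alt)
      case (step c x y)
      have "Const c * (x * q) + y * q \<in> vs.span {z. \<exists>m w. gen_product G m w z}"
        using step 1[of _ _ x] by (intro vs.span_add vs.span_scale) (auto simp: alg_span_def)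
      then show ?case by (simp add: algebra_simps)
    qed (simp add: vs.span_zero)
  qed
  ultimately show ?thesis
    unfolding is_subalgebra_def by (auto simp: alg_span_def intro: vs.span_add)
qed

lemma subset_alg_span: "fst ` G \<subseteq> alg_span G"
  using gen_span_gen gen_span_subset_alg_span by fastforce

lemma is_subalgebra_hull: "is_subalgebra (is_subalgebra hull S)"
  by (rule hull_in) (auto simp: is_subalgebra_def)

lemma hull_eq_alg_span: "is_subalgebra hull (fst ` G) = alg_span G"
proof (rule subset_antisym)
  show "is_subalgebra hull (fst ` G) \<subseteq> alg_span G"
    by (intro hull_minimal subset_alg_span is_subalgebra_alg_span)
  let ?H = "is_subalgebra hull (fst ` G)"
  have H: "Const c \<in> ?H" "p \<in> ?H \<Longrightarrow> q \<in> ?H \<Longrightarrow> p + q \<in> ?H" "p \<in> ?H \<Longrightarrow> q \<in> ?H \<Longrightarrow> p * q \<in> ?H" for c p q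
    using is_subalgebra_hull[of "fst ` G"] by (auto simp: is_subalgebra_def)
  have "z \<in> ?H" if "gen_product G m w z" for m w z
    using that
  proof induction
    case one
    show ?case using H(1)[of 1] by simp
  next
    case (mult g a b m w z)
    have "g \<in> ?H" using mult(1) hull_subset[of "fst ` G" is_subalgebra] by force
    then show ?case using mult by (intro H(3))
  qed
  moreover have "vs.subspace ?H"
    using H(1)[of 0] by (auto simp: vs.subspace_def intro: H)
  ultimately show "alg_span G \<subseteq> ?H"
    unfolding alg_span_def by (intro vs.span_minimal) auto
qed

lemma component_alg_span:
  assumes G: "\<And>g a b. (g, a, b) \<in> G \<Longrightarrow> g \<in> hwv n a (int b)"
    and p: "p \<in> alg_span G"
  shows "component n m w p \<in> gen_span G m w"
  using p unfolding alg_span_def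
proof (induction rule: vs.span_induct_alt)
  case base
  then show ?case by (simp add: component_0 gen_span_def vs.span_zero)
next
  case (step c x y)
  then obtain m' w' where x: "gen_product G m' w' x" by blast
  then have "x \<in> bihom n m' w'" using gen_product_hwv[OF G] by (auto simp: hwv_def)
  then have "component n m w x \<in> gen_span G m w"
    using x by (auto simp: component_of_bihom gen_span_def intro: vs.span_base vs.span_zero)
  with step show ?case
    unfolding component_add component_Const_mult gen_span_def by (intro vs.span_add vs.span_scale)
qed

theorem alg_span_gens: "alg_span gens = (weitzenboeck_kernel 5 :: 'k::field_char_0 mpoly set)"
proof (intro subset_antisym subsetI)
  fix p :: "'k mpoly" assume "p \<in> weitzenboeck_kernel 5"
  then have p: "p \<in> polys_upto 5" "weitzenboeck p = 0" by (auto simp: weitzenboeck_kernel_def)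
  obtain X where X: "finite X" "p = (\<Sum>(m, w)\<in>X. component 5 m w p)"
    using p(1) by (rule polys_upto_components)
  have "component 5 m w p \<in> alg_span gens" for m w
  proof -
    have "weitzenboeck (component 5 m w p) = 0"
      using component_weitzenboeck[OF p(1), of m w] p(2) by (simp add: component_0)
    then have "component 5 m w p \<in> hwv 5 m w" by (simp add: hwv_def component_bihom)
    then show ?thesis using hwv_eq_gen_span gen_span_subset_alg_span by blast
  qed
  then have "(\<Sum>(m, w)\<in>X. component 5 m w p) \<in> alg_span gens"
    unfolding alg_span_def by (intro vs.span_sum) auto
  then show "p \<in> alg_span gens" using X(2) by simp
next
  fix p :: "'k mpoly" assume "p \<in> alg_span gens"
  then show "p \<in> weitzenboeck_kernel 5"
    unfolding alg_span_def
  proof (induction rule: vs.span_induct_alt)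
    case (step c x y)
    then obtain m w where "gen_product gens m w x" by blast
    then have "x \<in> hwv 5 m w" using gen_product_hwv[of gens 5] gens_hwv by blast
    then have "Const c * x \<in> weitzenboeck_kernel 5"
      using hwv_Const_mult[of x 5 m w c]
          by (auto simp: hwv_def weitzenboeck_kernel_def bihom_subset_polys_upto)
    then show ?case
      using step(2) keys_add[of "Const c * x" y]
          by (auto simp: weitzenboeck_kernel_def polys_upto_def weitzenboeck_add)
  qed (simp add: weitzenboeck_kernel_def polys_upto_def weitzenboeck_def)
qed

section \<open>Minimality\<close>

text \<open>
  All products of given degree and order of the generators with indices in a list, each one
  represented by the list of the indices of its factors. Recursion either discards the first
  generator or uses it once more; the condition on the degree of the generator makes it terminate.
\<close>

fun products :: "nat list \<Rightarrow> nat \<Rightarrow> nat \<Rightarrow> nat list list"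
  where
    "products [] m w = (if m = 0 \<and> w = 0 then [[]] else [])"
  | "products (i # is) m w = products is m w @
      (if 0 < fst (bidegs ! i) \<and> fst (bidegs ! i) \<le> m \<and> snd (bidegs ! i) \<le> w
       then map ((#) i) (products (i # is) (m - fst (bidegs ! i)) (w - snd (bidegs ! i))) else [])"

(* As a rewrite rule this equation unfolds the recursive call in its own right-hand side again. *)
declare products.simps(2) [simp del]

lemma products_Cons_iff:
  "ks \<in> set (products (i # is) m w) \<longleftrightarrow> ks \<in> set (products is m w) \<or>
    (\<exists>ks'. 0 < fst (bidegs ! i) \<and> fst (bidegs ! i) \<le> m \<and> snd (bidegs ! i) \<le> w \<and> ks = i # ks' \<and>
      ks' \<in> set (products (i # is) (m - fst (bidegs ! i)) (w - snd (bidegs ! i))))"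
  by (subst products.simps(2)) auto

lemma products_ConsI: "ks \<in> set (products is m w) \<Longrightarrow> ks \<in> set (products (i # is) m w)"
  by (subst products_Cons_iff) blast

lemma set_products: "ks \<in> set (products is m w) \<Longrightarrow> set ks \<subseteq> set is"
proof (induction "is" m w arbitrary: ks rule: products.induct)
  case (2 i "is" m w)
  from "2.prems" show ?case
    unfolding products_Cons_iff[of ks] using "2.IH" by fastforce
qed (auto split: if_splits)

lemma products_insert:
  assumes "ks \<in> set (products is m w)" "j \<in> set is" "bidegs ! j = (a, b)" "0 < a"
  shows "\<exists>ks'\<in>set (products is (a + m) (b + w)). cov_prod ks' = covs ! j * cov_prod ks"
  using assms
proof (induction "is" m w arbitrary: ks rule: products.induct)
  case (2 i "is" m w)
  show ?case
  proof (cases "j = i")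
    case True
    then have "i # ks \<in> set (products (i # is) (a + m) (b + w))"
      using 2 unfolding products_Cons_iff[of "i # ks"] by simp
    then show ?thesis using True by (intro bexI[of _ "i # ks"]) (simp_all add: cov_prod_def)
  next
    case False
    then have j: "j \<in> set is" using 2 by simp
    let ?c = "0 < fst (bidegs ! i) \<and> fst (bidegs ! i) \<le> m \<and> snd (bidegs ! i) \<le> w"
    let ?m = "m - fst (bidegs ! i)" and ?w = "w - snd (bidegs ! i)"
    consider "ks \<in> set (products is m w)"
      | ks' where ?c "ks = i # ks'" "ks' \<in> set (products (i # is) ?m ?w)"
      using "2.prems"(1) unfolding products_Cons_iff[of ks] by blast
    then show ?thesis
    proof cases
      case 1
      then show ?thesis
        using "2.IH"(1)[OF 1 j "2.prems"(3,4)] products_ConsI by blast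
    next
      case 2
      from "2.IH"(2)[OF 2(1,3) "2.prems"(2-4)]
      obtain l where l: "l \<in> set (products (i # is) (a + ?m) (b + ?w))" "cov_prod l =
          covs ! j * (cov_prod ks' :: 'a mpoly)"
        by blast
      have "a + m - fst (bidegs ! i) = a + ?m" "b + w - snd (bidegs ! i) = b + ?w" using 2(1) by auto
      then have "i # l \<in> set (products (i # is) (a + m) (b + w))"
        using l(1) 2(1) unfolding products_Cons_iff[of "i # l"] by simp
      then show ?thesis
        using l(2) by (intro bexI[of _ "i # l"]) (simp_all add: cov_prod_def 2(2) mult_ac)
    qed
  qed
qed simp

definition indexed_gens :: "nat list \<Rightarrow> ('k::field_char_0 mpoly \<times> nat \<times> nat) set"
  where "indexed_gens is = (\<lambda>i. (covs ! i, bidegs ! i)) ` set is"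

lemma indexed_gens_subset: "\<forall>i\<in>set is. i < 23 \<Longrightarrow> indexed_gens is \<subseteq> gens"
  unfolding indexed_gens_def by (intro image_subsetI gens_nth) auto

lemma gen_product_products:
  assumes "\<forall>i\<in>set is. i < 23"
    and "gen_product (indexed_gens is) m w (z :: 'k::field_char_0 mpoly)"
  shows "\<exists>ks\<in>set (products is m (nat w)). 0 \<le> w \<and> z = cov_prod ks"
  using assms(2)
proof induction
  case one
  have "[] \<in> set (products is 0 0)" by (induction "is") (auto intro: products_ConsI)
  then show ?case by (intro bexI[of _ "[]"]) (simp_all add: cov_prod_def)
next
  case (mult g a b m w z)
  then obtain ks where ks: "ks \<in> set (products is m (nat w))" "0 \<le> w" "z = cov_prod ks" by blast
  obtain j where j: "j \<in> set is" "g = covs ! j" "bidegs ! j = (a, b)"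
    using mult(1) by (auto simp: indexed_gens_def)
  have "0 < a" using gens_hwv indexed_gens_subset[OF assms(1)] mult(1) by blast
  from products_insert[OF ks(1) j(1,3) this, where 'a = 'k]
  obtain ks' where "ks' \<in> set (products is (a + m) (b + nat w))" "cov_prod ks' = g * z"
    unfolding ks(3) j(2) by blast
  with ks(2) show ?case by (intro bexI[of _ ks']) (simp_all add: nat_add_distrib)
qed

text \<open>
  The products of the other generators that have the same degree and order as the generator with
  index \<open>i\<close>. There are at most two of them, so a combination of a few point evaluations separates
  the generator from them.
\<close>

definition decomposables :: "nat \<Rightarrow> nat list list"
  where "decomposables i = products (filter (\<lambda>j. j \<noteq> i) [0..<23]) (fst (bidegs ! i)) (snd (bidegs ! i))"

definition decomposables_table :: "nat list list list"
  where "decomposables_table = [[], [], [], [], [], [], [], [[2, 2]], [], [], [], [[2, 4]], [[2,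
      6]], [], [], [[4, 6], [2, 10]], [[6, 6]], [], [[6, 10], [2, 14]], [[6, 14]], [[6, 16], [6, 6,
      6]], [[9, 16], [6, 6, 9]], []]"

definition separating_weights :: "int list list"
  where "separating_weights = [[0, 1, 0, 0, 0, 0, 0],
    [- 1, 0, 0, 0, 0, 0, 0],
    [- 1, 0, 0, 0, 0, 0, 0],
    [0, - 1, 0, 0, 0, 0, 0],
    [1, 0, 0, 0, 0, 0, 0],
    [1, 0, 0, 0, 0, 0, 0],
    [- 1, 0, 0, 0, 0, 0, 0],
    [0, 1, 0, 0, 0, 0, 0],
    [0, 1, 0, 0, 0, 0, 0],
    [0, 1, 0, 0, 0, 0, 0],
    [- 1, 0, 0, 0, 0, 0, 0],
    [0, 1, 0, 0, 0, 0, 0],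
    [0, 1, 0, 0, 0, 0, 0],
    [0, 1, 0, 0, 0, 0, 0],
    [0, 1, 0, 0, 0, 0, 0],
    [- 7128, - 235, - 891, 0, 0, 0, 0],
    [9, - 1, 0, 0, 0, 0, 0],
    [0, 1, 0, 0, 0, 0, 0],
    [- 54, 1, 0, 0, 0, 0, 0],
    [0, 17, - 81, 0, 0, 0, 0],
    [- 53448, 5117, - 1053, 0, 0, 0, 0],
    [0, 249, - 92, 393, 0, 0, 0],
    [0, 0, - 1, 0, 0, 0, 0]]"

lemma decomposables_eq: "map decomposables [0..<23] = decomposables_table"
proof -
  have "[0..<23] = [0, 1, 2, 3, 4, 5, 6, 7, 8, 9, 10, 11, 12, 13, 14, 15, 16, 17, 18, 19, 20, 21,
      22]" by code_simp
  then show ?thesis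
    unfolding decomposables_table_def by (simp add: decomposables_def products.simps(2) bidegs_def)
qed

lemma separating_functionals:
  "list_all (\<lambda>i. functional_value (separating_weights ! i) [i] \<noteq> 0 \<and>
    list_all (\<lambda>ks. functional_value (separating_weights ! i) ks = 0) (decomposables_table ! i)) [0..<23]"
  by code_simp

lemma separating_functional:
  assumes "i < 23"
  obtains ws where "functional_value ws [i] \<noteq> 0" "\<And>ks. ks \<in> set (decomposables i) \<Longrightarrow>
      functional_value ws ks = 0"
proof -
  have "decomposables_table ! i = decomposables i"
    using assms by (simp flip: decomposables_eq)
  then show ?thesis
    using separating_functionals assms
        by (intro that[of "separating_weights ! i"]) (auto simp: list_all_iff)
qed

text \<open>
  Taking components reduces membership in the subalgebra to membership in the span of the
  decomposable products of the same bidegree.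
\<close>

lemma cov_notin_alg_span_others:
  assumes i: "i < 23"
  shows "(covs ! i :: 'k::field_char_0 mpoly) \<notin> alg_span (indexed_gens (filter (\<lambda>j. j \<noteq> i) [0..<23]))"
proof
  let ?is = "filter (\<lambda>j. j \<noteq> i) [0..<23]"
  let ?m = "fst (bidegs ! i)" and ?w = "snd (bidegs ! i)"
  obtain ws where ws: "functional_value ws [i] \<noteq> 0" "\<And>ks. ks \<in> set (decomposables i) \<Longrightarrow>
      functional_value ws ks = 0"
    using separating_functional[OF i] by blast
  have lt: "\<forall>j\<in>set ?is. j < 23" by simp
  have hw: "g \<in> hwv 5 a (int b)" if "(g, a, b) \<in> indexed_gens ?is" for g :: "'k mpoly" and a b
    using that indexed_gens_subset[OF lt] gens_hwv by blast
  assume "(covs ! i :: 'k mpoly) \<in> alg_span (indexed_gens ?is)"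
  then have "component 5 ?m (int ?w) (covs ! i :: 'k mpoly) \<in> gen_span (indexed_gens ?is) ?m (int ?w)"
    using component_alg_span[of "indexed_gens ?is" 5 "covs ! i" ?m "int ?w"] hw by blast
  moreover have "(covs ! i :: 'k mpoly) \<in> bihom 5 ?m (int ?w)"
    using gens_nth[OF i, where 'a = 'k] gens_hwv[of "covs ! i :: 'k mpoly" ?m ?w] by (simp add: hwv_def)
  ultimately have "(covs ! i :: 'k mpoly) \<in> gen_span (indexed_gens ?is) ?m (int ?w)"
    by (simp add: component_of_bihom)
  then have "functional ws (covs ! i :: 'k mpoly) = 0"
    unfolding gen_span_def
  proof (induction rule: vs.span_induct_alt)
    case base
    show ?case by (rule functional_0)
  next
    case (step c x y)
    then obtain ks where ks: "ks \<in> set (products ?is ?m ?w)" "x = cov_prod ks"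
      using gen_product_products[OF lt, of ?m "int ?w" x] by auto
    then have "functional_value ws ks = 0" "\<forall>j\<in>set ks. j < 23"
      using ws(2) ks(1) set_products[OF ks(1)] by (auto simp: decomposables_def)
    then show ?case using step by (simp add: functional_add functional_Const_mult ks(2) functional_cov_prod)
  qed
  moreover have "functional ws (cov_prod [i] :: 'k mpoly) \<noteq> 0"
    using i ws(1) by (simp add: functional_cov_prod lams_nonzero)
  ultimately show False by (simp add: cov_prod_def)
qed

lemma distinct_covs: "distinct (covs :: 'k::field_char_0 mpoly list)"
  unfolding distinct_conv_nth length_covs
proof (intro allI impI)
  fix i j :: nat assume ij: "i < 23" "j < 23" "i \<noteq> j"
  have "(covs ! j :: 'k mpoly) \<in> fst ` indexed_gens (filter (\<lambda>j. j \<noteq> i) [0..<23])"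
    using ij by (force simp: indexed_gens_def)
  then have "(covs ! j :: 'k mpoly) \<in> alg_span (indexed_gens (filter (\<lambda>j. j \<noteq> i) [0..<23]))"
    by (rule subsetD[OF subset_alg_span])
  with cov_notin_alg_span_others[OF ij(1), where 'k = 'k]
  show "(covs ! i :: 'k mpoly) \<noteq> covs ! j" by (metis (no_types))
qed

theorem minimal_generating_set_covs:
  "minimal_generating_set (set covs) (weitzenboeck_kernel 5 :: 'k::field_char_0 mpoly set)"
  unfolding minimal_generating_set_def
proof (intro conjI allI impI)
  have "set covs = fst ` (gens :: ('k mpoly \<times> nat \<times> nat) set)"
    unfolding gens_def covs_def by simp
  then show hull: "is_subalgebra hull set covs = (weitzenboeck_kernel 5 :: 'k mpoly set)"
    by (simp add: hull_eq_alg_span alg_span_gens)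
  fix T :: "'k mpoly set" assume T: "T \<subset> set covs"
  then obtain i where i: "i < 23" "covs ! i \<notin> T"
      by (metis psubset_imp_ex_mem DiffE in_set_conv_nth length_covs)
  let ?G = "indexed_gens (filter (\<lambda>j. j \<noteq> i) [0..<23]) :: ('k mpoly \<times> nat \<times> nat) set"
  have "T \<subseteq> fst ` ?G"
  proof
    fix x assume "x \<in> T"
    then obtain j where "j < 23" "x = covs ! j" using T by (metis psubsetD in_set_conv_nth length_covs)
    moreover from this \<open>x \<in> T\<close> i have "j \<noteq> i" by auto
    ultimately show "x \<in> fst ` ?G" by (force simp: indexed_gens_def)
  qed
  then have "is_subalgebra hull T \<subseteq> alg_span ?G"
    using hull_mono[of T "fst ` ?G" is_subalgebra] by (simp add: hull_eq_alg_span)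
  moreover have "covs ! i \<in> is_subalgebra hull set (covs :: 'k mpoly list)"
    using i(1) by (intro hull_inc) (simp add: length_covs)
  ultimately show "is_subalgebra hull T \<noteq> weitzenboeck_kernel 5"
    using cov_notin_alg_span_others[OF i(1), where 'k = 'k] hull by blast
qed

theorem mainTheorem11:
  fixes t d1 d2 tr1 tr2 tr3 c1 c2 c3 p1 p2 p3 s1 s2 si1 si2 v1 v2 dev od dv trn vis
    :: "'k::field_char_0 mpoly"
  assumes "t = Var 0"
    and "d1 = tau 5 2 t" and "d2 = tau 5 4 t"
    and "tr1 = tau 5 4 d1" and "tr2 = tau 5 3 d1" and "tr3 = tau 5 1 d1"
    and "c1 = tau 5 5 tr2" and "c2 = tau 5 5 tr3" and "c3 = tau 5 4 tr3"
    and "p1 = tau 5 4 (d2 ^ 2)" and "p2 = tau 5 3 (d2 ^ 2)" and "p3 = tau 5 2 c3"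
    and "s1 = tau 5 4 (d2 * tr1)" and "s2 = tau 5 1 p1"
    and "si1 = tau 5 5 (d2 ^ 3)" and "si2 = tau 5 1 s1"
    and "v1 = tau 5 5 (d2 * p2)" and "v2 = tau 5 5 (d2 ^ 2 * tr1)"
    and "dev = tau 5 2 v2" and "od = tau 5 5 (s1 * d2 ^ 2)" and "dv = tau 5 5 (d2 ^ 2 * si1)"
    and "trn = tau 5 5 (v2 * d2 ^ 2)" and "vis = tau 5 5 (p1 * p2 * si1)"
  shows "distinct [t, d1, d2, tr1, tr2, tr3, c1, c2, c3, p1, p2, p3, s1, s2, si1, si2,
           v1, v2, dev, od, dv, trn, vis] \<and>
         minimal_generating_set
           {t, d1, d2, tr1, tr2, tr3, c1, c2, c3, p1, p2, p3, s1, s2, si1, si2,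
            v1, v2, dev, od, dv, trn, vis}
           (weitzenboeck_kernel 5)"
proof -
  note cov_defs = cov_t_def cov_d1_def cov_d2_def cov_tr1_def cov_tr2_def cov_tr3_def cov_c1_def cov_c2_def
    cov_c3_def cov_p1_def cov_p2_def cov_p3_def cov_s1_def cov_s2_def cov_si1_def cov_si2_def cov_v1_def
    cov_v2_def cov_dev_def cov_od_def cov_dv_def cov_trn_def cov_vis_def
  have covs: "[t, d1, d2, tr1, tr2, tr3, c1, c2, c3, p1, p2, p3, s1, s2, si1, si2,
      v1, v2, dev, od, dv, trn, vis] = covs"
    unfolding covs_def assms cov_defs by (rule refl)
  have set: "{t, d1, d2, tr1, tr2, tr3, c1, c2, c3, p1, p2, p3, s1, s2, si1, si2,
      v1, v2, dev, od, dv, trn, vis} = set covs"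
    unfolding covs[symmetric] list.set by (rule refl)
  show ?thesis
    unfolding covs set by (intro conjI distinct_covs minimal_generating_set_covs)
qed

end
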